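(* Let $\phi,\overline\phi$, $v_n$, $\mathcal{F}$, $\mathcal{F}_0$, $\mathcal{M}(\mathcal{F})$ and $\Omega_{\mathcal{F}}$ be as in the context. For $x\ge1$ let $N$ be a uniformly random element of $\mathcal{M}(\mathcal{F})\cap[1,x]$. Let $\gamma$ be the Euler–Mascheroni constant and \[ a_1=\frac{1}{\pi}\sqrt{\frac{6}{\log\phi}},\qquad b_2=\frac{\sqrt{6\log\phi}}{\pi}, \] \[ b_1=\frac{\sqrt{6\log\phi}}{\pi}\biggl(\frac{2\gamma-\log(\pi^2\log\phi/6)}{2\log\phi}+\sum_{m\in\mathcal{F}_0}\frac{1}{\log m}+\frac{1}{\log v_{13}}+\sum_{k\ge1}\Bigl(\frac{1}{\log v_{k+13}}-\frac{1}{k\log\phi}\Bigr)\biggr). \] Then, as $x\to\infty$, \[ \frac{\Omega_{\mathcal{F}}(N)-\frac{a_1}{2}(\log x)^{1/2}\log\log x-b_1(\log x)^{1/2}}{b_2(\log x)^{1/2}}\xrightarrow{(d)}\sum_{m\in\mathcal{F}}\Bigl(X_m-\frac{1}{\log m}\Bigr), \] where the $X_m$ ($m\in\mathcal{F}$) are independent random variables and $X_m$ is exponentially distributed with rate $\log m$ (i.e. $\mathbb{P}(X_m>y)=e^{-y\log m}$ for $y\ge0$).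
   Context: Let $\phi$ and $\overline\phi$ be real algebraic integers such that $\phi+\overline\phi$ and $\phi\overline\phi$ are non-zero coprime rational integers and $\phi>\lvert\overline\phi\rvert$. For $n\ge 1$ put $v_n=v_n(\phi,\overline\phi)=(\phi^n-\overline\phi^n)/(\phi-\overline\phi)$ (positive integers). A prime $p$ is a primitive divisor of $v_n$ if $p\mid v_n$ but $p\nmid v_1\cdots v_{n-1}$. Let $\mathcal{F}=\{v_n: v_n\text{ has a primitive divisor}\}$ and $\mathcal{F}_0=\{v_n:n\le12,\ v_n\text{ has a primitive divisor}\}$; every $v_n$ with $n\ge13$ lies in $\mathcal{F}$. Let $\mathcal{M}(\mathcal{F})$ be the multiplicative monoid of all finite products (including $1$) of elements of $\mathcal{F}$. Every element of $\mathcal{M}(\mathcal{F})$ has a unique factorisation into elements of $\mathcal{F}$; $\Omega_{\mathcal{F}}(n)$ denotes the number of factors in this factorisation of $n$, counted with multiplicity. *)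

theory Defs
  imports "HOL-Probability.Probability" "HOL-Computational_Algebra.Computational_Algebra"
begin

text \<open>
  The quotient is a positive integer under the hypotheses of interest (lemma \<open>real_lucas\<close> below),
  so the floor is then exact; it only serves to obtain a natural number.
\<close>

definition lucas :: "real \<Rightarrow> real \<Rightarrow> nat \<Rightarrow> nat" where
  "lucas \<phi> \<psi> n = nat \<lfloor>(\<phi> ^ n - \<psi> ^ n) / (\<phi> - \<psi>)\<rfloor>"

lemma lucas_quotient_rec:
  fixes \<phi> \<psi> :: real
  shows "(\<phi> ^ Suc (Suc n) - \<psi> ^ Suc (Suc n)) / (\<phi> - \<psi>) =
    (\<phi> + \<psi>) * ((\<phi> ^ Suc n - \<psi> ^ Suc n) / (\<phi> - \<psi>)) - \<phi> * \<psi> * ((\<phi> ^ n - \<psi> ^ n) / (\<phi> - \<psi>))"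
proof -
  have "\<phi> ^ Suc (Suc n) - \<psi> ^ Suc (Suc n) =
      (\<phi> + \<psi>) * (\<phi> ^ Suc n - \<psi> ^ Suc n) - \<phi> * \<psi> * (\<phi> ^ n - \<psi> ^ n)"
    by (simp add: algebra_simps)
  then show ?thesis
    by (metis diff_divide_distrib times_divide_eq_right)
qed

lemma lucas_quotient_Ints:
  fixes \<phi> \<psi> :: real
  assumes "\<phi> \<noteq> \<psi>" "\<phi> + \<psi> \<in> \<int>" "\<phi> * \<psi> \<in> \<int>"
  shows "(\<phi> ^ n - \<psi> ^ n) / (\<phi> - \<psi>) \<in> \<int>"
proof (induction n rule: less_induct)
  case (less n)
  consider "n = 0" | "n = 1" | m where "n = Suc (Suc m)"
    by (metis One_nat_def not0_implies_Suc)
  then show ?case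
  proof cases
    case (3 m)
    then have "(\<phi> ^ Suc m - \<psi> ^ Suc m) / (\<phi> - \<psi>) \<in> \<int>" "(\<phi> ^ m - \<psi> ^ m) / (\<phi> - \<psi>) \<in> \<int>"
      using less by (metis lessI, metis lessI less_SucI)
    then show ?thesis
      unfolding 3 lucas_quotient_rec using assms by (metis Ints_diff Ints_mult)
  qed (use assms in auto)
qed

lemma real_lucas:
  assumes "\<phi> > \<bar>\<psi>\<bar>" "\<phi> + \<psi> \<in> \<int>" "\<phi> * \<psi> \<in> \<int>"
  shows "real (lucas \<phi> \<psi> n) = (\<phi> ^ n - \<psi> ^ n) / (\<phi> - \<psi>)" (is "_ = ?q")
    and "n \<ge> 1 \<Longrightarrow> lucas \<phi> \<psi> n > 0"
proof -
  have "\<psi> ^ n \<le> \<bar>\<psi>\<bar> ^ n"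
    by (metis abs_ge_self power_abs)
  also have "\<dots> \<le> \<phi> ^ n"
    using assms(1) by (intro power_mono) auto
  finally have "?q \<ge> 0"
    using assms(1) by simp
  moreover have "?q \<in> \<int>"
    using assms by (intro lucas_quotient_Ints) auto
  ultimately show eq: "real (lucas \<phi> \<psi> n) = ?q"
    unfolding lucas_def by (auto elim!: Ints_cases)
  assume "n \<ge> 1"
  have "\<psi> ^ n \<le> \<bar>\<psi>\<bar> ^ n"
    by (metis abs_ge_self power_abs)
  also have "\<dots> < \<phi> ^ n"
    using assms(1) \<open>n \<ge> 1\<close> by (intro power_strict_mono) auto
  finally have "?q > 0"
    using assms(1) by simp
  then show "lucas \<phi> \<psi> n > 0"
    using eq by (metis of_nat_0_less_iff)
qed

definition primitive_divisor :: "(nat \<Rightarrow> nat) \<Rightarrow> nat \<Rightarrow> nat \<Rightarrow> bool" where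
  "primitive_divisor v n p \<longleftrightarrow> prime p \<and> p dvd v n \<and> \<not> p dvd (\<Prod>k = 1..<n. v k)"

definition \<F> :: "real \<Rightarrow> real \<Rightarrow> nat set" where
  "\<F> \<phi> \<psi> = {lucas \<phi> \<psi> n | n. n \<ge> 1 \<and> (\<exists>p. primitive_divisor (lucas \<phi> \<psi>) n p)}"

definition \<F>\<^sub>0 :: "real \<Rightarrow> real \<Rightarrow> nat set" where
  "\<F>\<^sub>0 \<phi> \<psi> = {lucas \<phi> \<psi> n | n. n \<ge> 1 \<and> n \<le> 12 \<and> (\<exists>p. primitive_divisor (lucas \<phi> \<psi>) n p)}"

definition mult_monoid :: "nat set \<Rightarrow> nat set" where
  "mult_monoid S = {prod_mset A | A. set_mset A \<subseteq> S}"

text \<open>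
  Meaningful for elements of \<^term>\<open>mult_monoid S\<close> when factorisation into elements of \<open>S\<close> is unique.
\<close>

definition factorisation :: "nat set \<Rightarrow> nat \<Rightarrow> nat multiset" where
  "factorisation S n = (THE A. set_mset A \<subseteq> S \<and> prod_mset A = n)"

definition Omega :: "nat set \<Rightarrow> nat \<Rightarrow> nat" where
  "Omega S n = size (factorisation S n)"

definition a\<^sub>1 :: "real \<Rightarrow> real" where
  "a\<^sub>1 \<phi> = 1 / pi * sqrt (6 / ln \<phi>)"

definition b\<^sub>2 :: "real \<Rightarrow> real" where
  "b\<^sub>2 \<phi> = sqrt (6 * ln \<phi>) / pi"

text \<open>The series over \<open>k \<ge> 1\<close> is written with \<open>Suc k\<close> for \<open>k\<close>.\<close>

definition b\<^sub>1 :: "real \<Rightarrow> real \<Rightarrow> real" where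
  "b\<^sub>1 \<phi> \<psi> = sqrt (6 * ln \<phi>) / pi *
     ((2 * euler_mascheroni - ln (pi\<^sup>2 * ln \<phi> / 6)) / (2 * ln \<phi>)
      + (\<Sum>m\<in>\<F>\<^sub>0 \<phi> \<psi>. 1 / ln (real m))
      + 1 / ln (real (lucas \<phi> \<psi> 13))
      + (\<Sum>k. 1 / ln (real (lucas \<phi> \<psi> (Suc k + 13))) - 1 / (real (Suc k) * ln \<phi>)))"

text \<open>Weak convergence of laws on the real line along an arbitrary filter.\<close>

definition weak_conv_along :: "('i \<Rightarrow> real measure) \<Rightarrow> real measure \<Rightarrow> 'i filter \<Rightarrow> bool" where
  "weak_conv_along \<mu> \<nu> G \<longleftrightarrow>
     (\<forall>y. isCont (cdf \<nu>) y \<longrightarrow> ((\<lambda>i. cdf (\<mu> i) y) \<longlongrightarrow> cdf \<nu> y) G)"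

lemma weak_conv_along_sequentially: "weak_conv_along \<mu> \<nu> sequentially \<longleftrightarrow> weak_conv_m \<mu> \<nu>"
  by (simp add: weak_conv_along_def weak_conv_m_def weak_conv_def)

definition uniform_upto :: "nat set \<Rightarrow> real \<Rightarrow> nat pmf" where
  "uniform_upto S x = pmf_of_set {n \<in> mult_monoid S. 1 \<le> n \<and> real n \<le> x}"

definition normalised_Omega :: "real \<Rightarrow> real \<Rightarrow> real \<Rightarrow> nat \<Rightarrow> real" where
  "normalised_Omega \<phi> \<psi> x n =
     (real (Omega (\<F> \<phi> \<psi>) n) - a\<^sub>1 \<phi> / 2 * sqrt (ln x) * ln (ln x) - b\<^sub>1 \<phi> \<psi> * sqrt (ln x))
       / (b\<^sub>2 \<phi> * sqrt (ln x))"

text \<open>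
  The random series \<open>\<Sum>m. X m - 1 / ln m\<close> over \<open>m \<in> S\<close> does not converge absolutely, so the
  unordered \<^const>\<open>infsum\<close> would not do: the terms are summed in increasing order of \<open>m\<close>.
\<close>

definition centred_partial_sum :: "nat set \<Rightarrow> (nat \<Rightarrow> 'a \<Rightarrow> real) \<Rightarrow> nat \<Rightarrow> 'a \<Rightarrow> real" where
  "centred_partial_sum S X K \<omega> = (\<Sum>m \<in> {m \<in> S. m \<le> K}. X m \<omega> - 1 / ln (real m))"

definition centred_sum :: "nat set \<Rightarrow> (nat \<Rightarrow> 'a \<Rightarrow> real) \<Rightarrow> 'a \<Rightarrow> real" where
  "centred_sum S X \<omega> = lim (\<lambda>K. centred_partial_sum S X K \<omega>)"

end

theory Submission
  imports Defs "HOL-Number_Theory.Totient" "HOL-Real_Asymp.Real_Asymp"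
begin

text \<open>
  Exponent vectors \<open>a\<close> turn the elements of the monoid up to \<open>x\<close> into the vectors with
  \<open>Y a = (\<Sum>n. a n * ln (v n)) \<le> ln x\<close>, so that \<open>\<Omega>\<close> becomes \<open>\<Sum>n. a n\<close>. Draw the \<open>a n\<close>
  independently from geometric laws with ratio \<open>exp (- s * ln (v n))\<close>, where \<open>s\<close> is tuned to make
  the mean of \<open>Y\<close> equal to \<open>ln x\<close> up to \<open>O(1 / s)\<close>. Each vector then has probability proportional to
  \<open>exp (- s * Y)\<close>, hence the uniform law on \<open>{Y \<le> ln x}\<close> is the Boltzmann law weighted by
  \<open>exp t * 1{t \<le> 0}\<close>, where \<open>t = s * (Y - ln x)\<close>. Under the Boltzmann law
  \<open>s * (\<Sum>n. a n - mean)\<close> converges to the centred exponential series, while \<open>t\<close> fluctuates on the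
  larger scale \<open>sqrt V\<close>, asymptotically independently. To integrate the discontinuous weight, use first
  the smooth weight \<open>exp (- \<bar>t\<bar>)\<close>, whose Fourier transform is a Cauchy density and for which a local
  limit theorem follows from the decay of the characteristic function of \<open>(\<Omega>, Y)\<close>; under that weight \<open>t\<close>
  is asymptotically Laplace distributed and independent of \<open>\<Omega>\<close>, and half of the Laplace mass lies in \<open>t \<le> 0\<close>.

  That \<open>v n\<close> has a primitive divisor for \<open>n \<ge> 13\<close> is the theorem of Carmichael: otherwise the
  homogeneous cyclotomic value \<open>\<Phi>_n(\<phi>, \<psi>)\<close> would be at most \<open>totient n + 1\<close>, whereas it is at
  least \<open>5 powr ((totient n - 1) / 4)\<close>.
\<close>

section \<open>Primitive roots of unity\<close>

text \<open>The count and the size decouple because they live on different indices. The scaled term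
  \<open>s * a n\<close> has variance at most \<open>1 / lam n ^ 2\<close>, a summable sequence, so
  \<open>\<Omega>\<close> is decided by small \<open>n\<close>; \<open>s * lam n * a n\<close> has
  variance of order one for all \<open>n\<close> up to about \<open>1 / s\<close>, so
  \<open>V\<close> has order \<open>1 / s\<close>. Hence the mean of \<open>Y\<close> is needed only
  up to \<open>O(1 / s)\<close>, an error \<open>O(1)\<close> in \<open>t\<close> being lost against
  \<open>sqrt V\<close>, whereas the mean of \<open>\<Omega>\<close> is needed up to
  \<open>o(1 / s)\<close>, and this is what fixes \<open>b\<^sub>1\<close>. The one-sided weight
  resists a direct treatment because its Fourier transform decays only like \<open>1 / u\<close> and
  is not integrable. The two-sided weight agrees with it on \<open>t <= 0\<close>, so the one-sided
  mass can be read off from a limit law. For Levy's theorem the weighted measures must be positive;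
  the factor \<open>iexp (\<eta> * Z)\<close> is therefore carried by the positive weights
  \<open>2 + Re (d * iexp (\<eta> * Z))\<close> with \<open>norm d <= 1\<close>. On the arithmetic
  side, 13 is the point from which \<open>totient n >= 6\<close> always holds, and for
  \<open>t >= 6\<close> the power \<open>5 ^ (t - 1)\<close> exceeds
  \<open>(t + 1) ^ 4\<close>.\<close>

lemma divisor_sum_unique:
  fixes f g :: "nat \<Rightarrow> 'b :: ab_group_add"
  assumes "\<And>n. n > 0 \<Longrightarrow> (\<Sum>d | d dvd n. f d) = (\<Sum>d | d dvd n. g d)" "n > 0"
  shows "f n = g n"
  using assms(2)
proof (induction n rule: less_induct)
  case (less n)
  have split: "(\<Sum>d | d dvd n. h d) = h n + (\<Sum>d | d dvd n \<and> d \<noteq> n. h d)" for h :: "nat \<Rightarrow> 'b"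
  proof -
    have "{d. d dvd n} = insert n {d. d dvd n \<and> d \<noteq> n}" by auto
    moreover have "finite {d. d dvd n \<and> d \<noteq> n}"
      by (rule finite_subset[of _ "{d. d dvd n}"]) (use less.prems in auto)
    ultimately show ?thesis by simp
  qed
  have "(\<Sum>d | d dvd n \<and> d \<noteq> n. f d) = (\<Sum>d | d dvd n \<and> d \<noteq> n. g d)"
    using less by (intro sum.cong refl less.IH) (auto dest: dvd_imp_le intro!: Nat.gr0I)
  then show ?case
    using assms(1)[OF less.prems] by (simp add: split)
qed

definition prim_roots :: "nat \<Rightarrow> complex set" where
  "prim_roots n = {z. z ^ n = 1 \<and> (\<forall>d. 0 < d \<and> d < n \<longrightarrow> z ^ d \<noteq> 1)}"

lemma finite_prim_roots: "n > 0 \<Longrightarrow> finite (prim_roots n)"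
  by (rule finite_subset[of _ "{z. z ^ n = 1}"]) (auto simp: prim_roots_def intro: finite_nth_roots)

lemma prim_roots_dvd:
  assumes "z \<in> prim_roots d" "z ^ n = 1" "d > 0"
  shows "d dvd n"
proof -
  have "z ^ n = (z ^ d) ^ (n div d) * z ^ (n mod d)"
    by (simp flip: power_mult power_add)
  then have "z ^ (n mod d) = 1"
    using assms by (simp add: prim_roots_def)
  moreover have "n mod d < d" using assms by simp
  ultimately have "n mod d = 0"
    using assms by (auto simp: prim_roots_def)
  then show ?thesis by auto
qed

text \<open>Every n-th root of unity has exactly one order, and that order divides n. This turns
  sums over all roots into divisor sums, to which \<open>divisor_sum_unique\<close> applies.\<close>

lemma sum_roots_unity_prim_roots:
  fixes h :: "complex \<Rightarrow> real"
  assumes "n > 0"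
  shows "(\<Sum>z | z ^ n = 1. h z) = (\<Sum>d | d dvd n. \<Sum>z\<in>prim_roots d. h z)"
proof -
  have dpos: "d > 0" if "d dvd n" for d using that assms by (auto intro!: Nat.gr0I)
  have "{z. z ^ n = 1} = (\<Union>d\<in>{d. d dvd n}. prim_roots d)"
  proof (intro equalityI subsetI)
    fix z :: complex assume z: "z \<in> {z. z ^ n = 1}"
    define d where "d = (LEAST d. d > 0 \<and> z ^ d = 1)"
    have "d > 0 \<and> z ^ d = 1" unfolding d_def by (rule LeastI[of _ n]) (use z assms in auto)
    moreover have "z ^ e \<noteq> 1" if "0 < e" "e < d" for e
      using that not_less_Least[of e "\<lambda>d. d > 0 \<and> z ^ d = 1"] unfolding d_def by auto
    ultimately have "z \<in> prim_roots d" "d > 0" by (auto simp: prim_roots_def)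
    then show "z \<in> (\<Union>d\<in>{d. d dvd n}. prim_roots d)" using prim_roots_dvd z by auto
  qed (auto simp: prim_roots_def elim!: dvdE simp: power_mult)
  also have "sum h \<dots> = (\<Sum>d | d dvd n. \<Sum>z\<in>prim_roots d. h z)"
  proof (rule sum.UNION_disjoint)
    show "\<forall>i\<in>{d. d dvd n}. \<forall>j\<in>{d. d dvd n}. i \<noteq> j \<longrightarrow> prim_roots i \<inter> prim_roots j = {}"
    proof (safe, goal_cases)
      case (1 i j z)
      then have "i dvd j" "j dvd i"
        using prim_roots_dvd dpos unfolding prim_roots_def by blast+
      then show ?case using 1 by (auto dest: dvd_antisym)
    qed
  qed (use assms dpos finite_prim_roots in auto)
  finally show ?thesis .
qed

text \<open>Both sides have divisor sum n, and divisor sums determine a function.\<close>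

lemma card_prim_roots:
  assumes "n > 0"
  shows "card (prim_roots n) = totient n"
proof -
  have "real (card (prim_roots n)) = real (totient n)"
  proof (rule divisor_sum_unique[OF _ assms])
    fix n :: nat assume n: "n > 0"
    have "real (\<Sum>d | d dvd n. card (prim_roots d)) = real n"
      using sum_roots_unity_prim_roots[OF n, of "\<lambda>_. 1"] card_roots_unity_eq[OF n] by simp
    then show "(\<Sum>d | d dvd n. real (card (prim_roots d))) = (\<Sum>d | d dvd n. real (totient d))"
      unfolding of_nat_sum[symmetric] totient_divisor_sum by simp
  qed
  then show ?thesis by simp
qed

text \<open>The hypothesis is that \<open>m\<close> is the Moebius function.\<close>

lemma abs_moebius_le_1:
  fixes m :: "nat \<Rightarrow> real"
  assumes m: "\<And>n. n > 0 \<Longrightarrow> (\<Sum>d | d dvd n. m d) = (if n = 1 then 1 else 0)"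
    and "n > 0"
  shows "\<bar>m n\<bar> \<le> 1"
  using assms(2)
proof (induction n rule: less_induct)
  case (less n)
  show ?case
  proof (cases "n = 1")
    case True
    then show ?thesis using m[of 1] by simp
  next
    case False
    then obtain p where p: "prime p" "p dvd n" using prime_factor_nat by blast
    define a where "a = multiplicity p n"
    obtain k where k: "n = p ^ a * k" "\<not> p dvd k"
      using multiplicity_decompose'[of n p] p less.prems unfolding a_def
      by (metis less_irrefl not_prime_unit)
    have "a > 0" using p less.prems unfolding a_def
      by (simp add: prime_multiplicity_gt_zero_iff prime_imp_prime_elem)
    then obtain b where b: "a = Suc b" by (cases a) auto
    have kpos: "k > 0" using k less.prems by (auto intro!: Nat.gr0I)
    \<comment> \<open>The divisors of \<open>p ^ a * l\<close> are those of \<open>p ^ b * l\<close>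
      together with \<open>p ^ a\<close> times those of \<open>l\<close>. For \<open>b > 0\<close>
      both complete sums vanish; for \<open>b = 0\<close> the first one is the divisor sum of
      \<open>l\<close> itself and has to be kept.\<close>
    have rec: "(\<Sum>d | d dvd l. if b = 0 then m d + m (p * d) else m (p ^ a * d)) = 0" if l: "l > 0" "\<not> p dvd l" for l
    proof -
      have cop: "coprime (p ^ i) l" for i using p(1) l(2) by (simp add: prime_imp_coprime)
      have un: "{d. d dvd p ^ a * l} = {d. d dvd p ^ b * l} \<union> (\<lambda>d. p ^ a * d) ` {d. d dvd l}"
      proof (intro equalityI subsetI)
        fix d assume "d \<in> {d. d dvd p ^ a * l}"
        then obtain x y where xy: "d = x * y" "x dvd p ^ a" "y dvd l" using division_decomp by blast
        then obtain i where i: "x = p ^ i" "i \<le> a" using p(1) by (auto simp: divides_primepow_nat)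
        show "d \<in> {d. d dvd p ^ b * l} \<union> (\<lambda>d. p ^ a * d) ` {d. d dvd l}"
        proof (cases "i = a")
          case False
          then have "i \<le> b" using i b by auto
          then show ?thesis using xy i by (auto intro!: mult_dvd_mono le_imp_power_dvd)
        qed (use xy i in auto)
      qed (auto simp: b intro: dvd_trans)
      have dj: "{d. d dvd p ^ b * l} \<inter> (\<lambda>d. p ^ a * d) ` {d. d dvd l} = {}"
      proof (safe, goal_cases)
        case (1 _ d)
        then have "p ^ b * (p * d) dvd p ^ b * l" by (simp add: b mult.assoc mult.left_commute)
        then have "p * d dvd l" using p(1) by (simp add: prime_gt_0_nat)
        then show ?case using l(2) by (auto dest: dvd_mult_left)
      qed
      have fin: "finite {d. d dvd p ^ i * l}" for i using l p(1) by (simp add: prime_gt_0_nat)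
      have "(\<Sum>d | d dvd p ^ a * l. m d) = (\<Sum>d | d dvd p ^ b * l. m d) + (\<Sum>d | d dvd l. m (p ^ a * d))"
        unfolding un using fin[of b] fin[of 0] p(1) dj
        by (subst sum.union_disjoint) (auto simp: sum.reindex inj_on_def prime_gt_0_nat)
      moreover have "(\<Sum>d | d dvd p ^ a * l. m d) = 0"
        using l p(1) b by (subst m) (auto simp: prime_gt_0_nat)
      moreover have "(\<Sum>d | d dvd p ^ b * l. m d) = 0" if "b > 0"
        using that l p(1) by (subst m) (auto simp: prime_gt_0_nat)
      ultimately show ?thesis by (cases "b = 0") (auto simp: b sum.distrib)
    qed
    \<comment> \<open>Induction over the divisors of \<open>l\<close> removes the sum. So a simple
      prime factor flips the sign of \<open>m\<close>, and a repeated one makes it vanish.\<close>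
    have *: "(if b = 0 then m l + m (p * l) else m (p ^ a * l)) = 0" if "l > 0" "\<not> p dvd l" for l
      using that
    proof (induction l rule: less_induct)
      case (less l)
      have eq: "{d. d dvd l} = insert l {d. d dvd l \<and> d \<noteq> l}" by auto
      have fin: "finite {d. d dvd l \<and> d \<noteq> l}"
        by (rule finite_subset[OF _ finite_divisors_nat[OF less.prems(1)]]) blast
      have "(\<Sum>d | d dvd l \<and> d \<noteq> l. if b = 0 then m d + m (p * d) else m (p ^ a * d)) = 0"
      proof (rule sum.neutral, safe)
        fix d assume d: "d dvd l" "d \<noteq> l"
        show "(if b = 0 then m d + m (p * d) else m (p ^ a * d)) = 0"
        proof (rule less.IH)
          have "d \<le> l" using d less.prems by (intro dvd_imp_le) auto
          then show "d < l" using d by simp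
          show "0 < d" using d less.prems by (auto intro!: Nat.gr0I)
          show "\<not> p dvd d" using d less.prems dvd_trans by blast
        qed
      qed
      then show ?case using rec[OF less.prems] fin unfolding eq by simp
    qed
    show ?thesis
    proof (cases "b = 0")
      case True
      have "k < n" using k kpos p(1) b by (simp add: prime_gt_Suc_0_nat True)
      then have "\<bar>m k\<bar> \<le> 1" using less.IH kpos by blast
      moreover have "m n = - m k" using *[OF kpos k(2)] True k(1) b by simp
      ultimately show ?thesis by simp
    next
      case False
      then show ?thesis using *[OF kpos k(2)] k(1) by simp
    qed
  qed
qed

text \<open>The sum of the primitive roots is the Moebius function: its divisor sums are the sums of
  all n-th roots of unity, which vanish unless \<open>n = 1\<close>.\<close>

lemma abs_sum_Re_prim_roots_le_1:
  assumes "n > 0"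
  shows "\<bar>\<Sum>z\<in>prim_roots n. Re z\<bar> \<le> 1"
proof (rule abs_moebius_le_1[OF _ assms])
  fix n :: nat assume n: "n > 0"
  have "(\<Sum>d | d dvd n. \<Sum>z\<in>prim_roots d. Re z) = Re (\<Sum>z | z ^ n = 1. z)"
    using sum_roots_unity_prim_roots[OF n, of Re] by simp
  also have "\<dots> = (if n = 1 then 1 else 0)"
  proof (cases "n = 1")
    case False
    then have "\<Sum>{z::complex. z ^ n = 1} = 0" using n by (intro sum_roots_unity) auto
    then show ?thesis using False by (simp del: Re_sum)
  qed simp
  finally show "(\<Sum>d | d dvd n. \<Sum>z\<in>prim_roots d. Re z) = (if n = 1 then 1 else 0)" .
qed

text \<open>The derivative of \<open>X ^ n - 1\<close> vanishes at most at 0, which is not a root,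
  so the polynomial is the product of its distinct linear factors; evaluating at
  \<open>a / b\<close> and scaling by \<open>b ^ n\<close> makes this homogeneous.\<close>

lemma prod_roots_unity:
  fixes a b :: complex
  assumes "n > 0" "b \<noteq> 0"
  shows "(\<Prod>z | z ^ n = 1. a - b * z) = a ^ n - b ^ n"
proof -
  define p :: "complex poly" where "p = monom 1 n - 1"
  have rt: "poly p z = 0 \<longleftrightarrow> z ^ n = 1" for z by (simp add: p_def poly_monom)
  have deg: "degree p = n" 
  proof -
    have "degree (monom (1::complex) n + (- 1)) = degree (monom (1::complex) n)"
      using assms by (intro degree_add_eq_left) (simp add: degree_monom_eq)
    then show ?thesis by (simp add: p_def degree_monom_eq)
  qed
  have lc: "lead_coeff p = 1" unfolding deg using assms by (simp add: p_def)
  have pd: "pderiv p = monom (of_nat n) (n - 1)"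
    by (simp add: p_def pderiv_diff pderiv_monom)
  have "rsquarefree p"
    unfolding rsquarefree_roots
  proof safe
    fix z assume "poly p z = 0" "poly (pderiv p) z = 0"
    then show False using assms by (auto simp: rt pd poly_monom power_0_left split: if_splits)
  qed
  then have dec: "(\<Prod>z | z ^ n = 1. [:-z, 1:]) = p"
    using complex_poly_decompose_rsquarefree[of p] lc unfolding rt by simp
  have "(\<Prod>z | z ^ n = 1. a - b * z) = (\<Prod>z | z ^ n = 1. b * (a / b - z))"
    using assms by (intro prod.cong) (auto simp: field_simps)
  also have "\<dots> = b ^ n * poly p (a / b)"
    by (simp add: prod.distrib card_roots_unity_eq[OF assms(1)] dec[symmetric] poly_prod)
  also have "\<dots> = a ^ n - b ^ n"
    using assms by (simp add: p_def poly_monom field_simps)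
  finally show ?thesis .
qed

section \<open>Lucas sequences and ranks of apparition\<close>

fun lucas_U :: "int \<Rightarrow> int \<Rightarrow> nat \<Rightarrow> int" where
  "lucas_U A B 0 = 0"
| "lucas_U A B (Suc 0) = 1"
| "lucas_U A B (Suc (Suc n)) = A * lucas_U A B (Suc n) - B * lucas_U A B n"

fun lucas_V :: "int \<Rightarrow> int \<Rightarrow> nat \<Rightarrow> int" where
  "lucas_V A B 0 = 2"
| "lucas_V A B (Suc 0) = A"
| "lucas_V A B (Suc (Suc n)) = A * lucas_V A B (Suc n) - B * lucas_V A B n"

text \<open>Modulo the discriminant the characteristic polynomial has the double root \<open>A / 2\<close>.\<close>

lemma lucas_U_cong_discriminant:
  assumes "[A ^ 2 = 4 * B] (mod M)"
  shows "[2 ^ n * lucas_U A B (Suc n) = int (Suc n) * A ^ n] (mod M)"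
proof (induction n rule: induct_nat_012)
  case (ge2 n)
  have "2 ^ Suc (Suc n) * lucas_U A B (Suc (Suc (Suc n)))
      = 2 * A * (2 ^ Suc n * lucas_U A B (Suc (Suc n))) - 4 * B * (2 ^ n * lucas_U A B (Suc n))"
    by (simp add: algebra_simps)
  also have "[\<dots> = 2 * A * (int (Suc (Suc n)) * A ^ Suc n) - A ^ 2 * (int (Suc n) * A ^ n)] (mod M)"
    using ge2 assms
    by (intro cong_diff cong_scalar_left[of _ _ _ "2 * A"] cong_mult[of "4 * B" "A ^ 2"]) (auto intro: cong_sym)
  also have "2 * A * (int (Suc (Suc n)) * A ^ Suc n) - A ^ 2 * (int (Suc n) * A ^ n)
      = int (Suc (Suc (Suc n))) * A ^ Suc (Suc n)"
    by (simp add: algebra_simps power2_eq_square)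
  finally show ?case .
qed auto

text \<open>Modulo 2 the recurrence has period 2. This replaces the congruence modulo the
  discriminant at the prime 2, where the factor \<open>2 ^ n\<close> makes that congruence
  empty.\<close>

lemma odd_lucas_U_odd:
  assumes "even A" "odd B"
  shows "odd (lucas_U A B (Suc (2 * n)))"
  by (induction n) (use assms in auto)

locale real_lucas_pair =
  fixes \<phi> \<psi> :: real and P Q :: int
  assumes sum_eq: "\<phi> + \<psi> = of_int P" and prod_eq: "\<phi> * \<psi> = of_int Q"
    and P_nz: "P \<noteq> 0" and Q_nz: "Q \<noteq> 0" and coprime_PQ: "coprime P Q"
    and dominant: "\<phi> > \<bar>\<psi>\<bar>"
begin

abbreviation U where "U \<equiv> lucas_U P Q"
abbreviation V where "V \<equiv> lucas_V P Q"
abbreviation v where "v \<equiv> lucas \<phi> \<psi>"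

lemma diff_pos: "\<phi> - \<psi> > 0" using dominant by linarith

lemma roots: "\<phi> ^ 2 = of_int P * \<phi> - of_int Q" "\<psi> ^ 2 = of_int P * \<psi> - of_int Q"
  unfolding sum_eq[symmetric] prod_eq[symmetric] by (simp_all add: algebra_simps power2_eq_square)

lemma U_closed: "of_int (U n) * (\<phi> - \<psi>) = \<phi> ^ n - \<psi> ^ n"
proof (induction n rule: induct_nat_012)
  case (ge2 n)
  have "of_int (U (Suc (Suc n))) * (\<phi> - \<psi>) =
      of_int P * (of_int (U (Suc n)) * (\<phi> - \<psi>)) - of_int Q * (of_int (U n) * (\<phi> - \<psi>))"
    by (simp add: algebra_simps)
  also have "\<dots> = \<phi> ^ n * (of_int P * \<phi> - of_int Q) - \<psi> ^ n * (of_int P * \<psi> - of_int Q)"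
    unfolding ge2 by (simp add: algebra_simps)
  finally show ?case unfolding roots[symmetric] by (simp add: power2_eq_square mult_ac)
qed auto

lemma V_closed: "of_int (V n) = \<phi> ^ n + \<psi> ^ n"
proof (induction n rule: induct_nat_012)
  case (ge2 n)
  have "of_int (V (Suc (Suc n))) = of_int P * real_of_int (V (Suc n)) - of_int Q * of_int (V n)"
    by simp
  also have "\<dots> = \<phi> ^ n * (of_int P * \<phi> - of_int Q) + \<psi> ^ n * (of_int P * \<psi> - of_int Q)"
    unfolding ge2 by (simp add: algebra_simps)
  finally show ?case unfolding roots[symmetric] by (simp add: power2_eq_square mult_ac)
qed (auto simp: sum_eq)

lemma Ints: "\<phi> + \<psi> \<in> \<int>" "\<phi> * \<psi> \<in> \<int>"
  by (auto simp: sum_eq prod_eq)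

lemma real_v: "real (v n) = (\<phi> ^ n - \<psi> ^ n) / (\<phi> - \<psi>)"
  by (intro real_lucas(1) dominant Ints)

lemma v_pos: "n \<ge> 1 \<Longrightarrow> v n > 0"
  by (intro real_lucas(2)[OF dominant] Ints)

lemma int_v: "int (v n) = U n"
proof -
  have "real_of_int (int (v n)) = of_int (U n)"
    using U_closed[of n] diff_pos by (simp add: real_v field_simps)
  then show ?thesis by linarith
qed

lemma Q_power: "of_int Q ^ n = \<phi> ^ n * \<psi> ^ n"
  by (simp add: prod_eq[symmetric] power_mult_distrib)

lemma U_mult_closed: "of_int (U m) * of_int (U n) * (\<phi> - \<psi>) ^ 2 = (\<phi> ^ m - \<psi> ^ m) * (\<phi> ^ n - \<psi> ^ n)"
  unfolding U_closed[symmetric] by (simp add: power2_eq_square)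

lemma U_step: "U (n + 2 * m) = V m * U (n + m) - Q ^ m * U n"
proof -
  have "of_int (V m * U (n + m) - Q ^ m * U n) * (\<phi> - \<psi>)
      = of_int (V m) * (of_int (U (n + m)) * (\<phi> - \<psi>)) - of_int Q ^ m * (of_int (U n) * (\<phi> - \<psi>))"
    by (simp add: algebra_simps)
  also have "\<dots> = (\<phi> ^ m + \<psi> ^ m) * (\<phi> ^ (n + m) - \<psi> ^ (n + m)) - \<phi> ^ m * \<psi> ^ m * (\<phi> ^ n - \<psi> ^ n)"
    unfolding U_closed V_closed Q_power ..
  also have "\<dots> = \<phi> ^ (n + 2 * m) - \<psi> ^ (n + 2 * m)"
  proof -
    have eq: "x ^ (n + 2 * m) = x ^ n * x ^ m * x ^ m" for x :: real by (simp only: power_add mult_2 mult.assoc)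
    show ?thesis unfolding eq by (simp add: algebra_simps power_add)
  qed
  also have "\<dots> = of_int (U (n + 2 * m)) * (\<phi> - \<psi>)"
    unfolding U_closed ..
  finally show ?thesis using diff_pos by (simp flip: of_int_mult of_int_power of_int_diff)
qed

text \<open>The powers \<open>\<phi> ^ m\<close> and \<open>\<psi> ^ m\<close> form a pair with sum
  \<open>V m\<close> and product \<open>Q ^ m\<close>. The quotient of \<open>U (r * m)\<close> by
  \<open>U m\<close> is thus itself a Lucas term, whose residues are accessible through its own
  discriminant.\<close>

lemma U_mult: "U (r * m) = U m * lucas_U (V m) (Q ^ m) r"
proof (induction r rule: induct_nat_012)
  case (ge2 n)
  have "Suc (Suc n) * m = n * m + 2 * m" by simp
  then have "U (Suc (Suc n) * m) = U (n * m + 2 * m)" by (simp only:)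
  also have "\<dots> = V m * U (Suc n * m) - Q ^ m * U (n * m)"
    unfolding U_step by (simp add: algebra_simps)
  finally show ?case unfolding ge2 by (simp add: algebra_simps)
qed auto

lemma V_double: "V (2 * m) = V m ^ 2 - 2 * Q ^ m"
proof -
  have "real_of_int (V (2 * m)) = of_int (V m ^ 2 - 2 * Q ^ m)"
    unfolding of_int_diff of_int_mult of_int_power of_int_numeral V_closed Q_power power_even_eq
    by (simp add: algebra_simps power2_eq_square)
  then show ?thesis by linarith
qed

text \<open>The left side is the discriminant of the pair \<open>\<phi> ^ m\<close>,
  \<open>\<psi> ^ m\<close>. Its factor \<open>U m ^ 2\<close> gives congruences not only modulo a
  prime divisor of \<open>U m\<close>, but modulo its square.\<close>

lemma V_square: "V m ^ 2 - 4 * Q ^ m = (P ^ 2 - 4 * Q) * U m ^ 2"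
proof -
  have D: "real_of_int (P ^ 2 - 4 * Q) = (\<phi> - \<psi>) ^ 2"
    by (simp add: sum_eq[symmetric] prod_eq[symmetric] algebra_simps power2_eq_square)
  have "real_of_int (V m ^ 2 - 4 * Q ^ m) = (\<phi> ^ m - \<psi> ^ m) ^ 2"
    by (simp add: V_closed Q_power algebra_simps power2_eq_square)
  also have "\<dots> = (of_int (U m) * (\<phi> - \<psi>)) ^ 2" unfolding U_closed ..
  also have "\<dots> = (\<phi> - \<psi>) ^ 2 * of_int (U m) ^ 2" by (simp add: power_mult_distrib)
  also have "\<dots> = real_of_int ((P ^ 2 - 4 * Q) * U m ^ 2)"
    unfolding D[symmetric] by simp
  finally show ?thesis by linarith
qed

text \<open>In closed form the cross products cancel and leave the factor
  \<open>(\<phi> * \<psi>) ^ i\<close>. This controls common divisors of consecutive terms and,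
  below, the equality of two ratios of such terms.\<close>

lemma U_docagne: "U (i + 1) * U (i + k) - U (i + k + 1) * U i = Q ^ i * U k"
proof -
  have "(of_int (U (i + 1) * U (i + k) - U (i + k + 1) * U i)) * (\<phi> - \<psi>) ^ 2 =
    of_int (U (i + 1)) * of_int (U (i + k)) * (\<phi> - \<psi>) ^ 2 - of_int (U (i + k + 1)) * of_int (U i) * (\<phi> - \<psi>) ^ 2"
    by (simp add: algebra_simps)
  also have "\<dots> = (\<phi> ^ i * \<psi> ^ i) * (\<phi> ^ k - \<psi> ^ k) * (\<phi> - \<psi>)"
    unfolding U_mult_closed by (simp add: algebra_simps power_add)
  also have "\<dots> = of_int Q ^ i * (of_int (U k) * (\<phi> - \<psi>)) * (\<phi> - \<psi>)"
    unfolding U_closed Q_power ..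
  also have "\<dots> = of_int (Q ^ i * U k) * (\<phi> - \<psi>) ^ 2" by (simp add: power2_eq_square)
  finally show ?thesis using diff_pos by (simp flip: of_int_mult of_int_power of_int_diff)
qed

lemma U_add: "U (m + Suc n) = U (Suc m) * U (Suc n) - Q * U m * U n"
proof (induction n rule: induct_nat_012)
  case (ge2 n)
  have "U (m + Suc (Suc (Suc n))) = P * U (m + Suc (Suc n)) - Q * U (m + Suc n)" by simp
  then show ?case unfolding ge2 by (simp add: algebra_simps)
qed simp_all

text \<open>If \<open>p\<close> divided \<open>Q\<close>, the recurrence modulo \<open>p\<close>
  would collapse to powers of \<open>P\<close>, so \<open>p\<close> would divide both coprime
  parameters.\<close>

lemma prime_dvd_U_not_dvd_Q:
  assumes "prime p" "p dvd U n" "n \<ge> 1"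
  shows "\<not> p dvd Q"
proof
  assume Q: "p dvd Q"
  have "[U (Suc n) = P ^ n] (mod p)" for n
  proof (induction n rule: induct_nat_012)
    case (ge2 n)
    have "[P * U (Suc (Suc n)) - Q * U (Suc n) = P * P ^ Suc n - 0 * U (Suc n)] (mod p)"
      using ge2 Q by (intro cong_diff cong_scalar_left[of _ _ _ P] cong_scalar_right[of Q 0]) (auto simp: cong_0_iff)
    then show ?case by simp
  qed auto
  from this[of "n - 1"] have "p dvd P ^ (n - 1)"
    using assms by (simp add: cong_dvd_iff)
  then have "p dvd P" using assms(1) prime_dvd_power by blast
  then have "is_unit p" using coprime_common_divisor[OF coprime_PQ] Q by blast
  then show False using assms(1) not_prime_unit by blast
qed

lemma prime_dvd_U_not_dvd_U_Suc:
  assumes "prime p" "p dvd U n" "n \<ge> 1"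
  shows "\<not> p dvd U (Suc n)"
proof
  assume "p dvd U (Suc n)"
  then have "p dvd Q ^ n"
    using U_docagne[of n 1] assms(2) by (metis dvd_diff dvd_mult2 dvd_mult Suc_eq_plus1 lucas_U.simps(2) One_nat_def mult.right_neutral)
  then show False using prime_dvd_U_not_dvd_Q[OF assms] assms(1) prime_dvd_power by blast
qed

section \<open>Ranks of apparition of primes and prime powers\<close>

definition rank :: "int \<Rightarrow> nat" where
  "rank q = (LEAST d. d > 0 \<and> q dvd U d)"

lemma rank_props:
  assumes "q dvd U n" "n \<ge> 1"
  shows "rank q > 0" "q dvd U (rank q)" "\<And>e. e > 0 \<Longrightarrow> q dvd U e \<Longrightarrow> rank q \<le> e"
proof -
  have "rank q > 0 \<and> q dvd U (rank q)" unfolding rank_def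
    by (rule LeastI[of _ n]) (use assms in auto)
  then show "rank q > 0" "q dvd U (rank q)" by auto
  show "rank q \<le> e" if "e > 0" "q dvd U e" for e
    unfolding rank_def by (rule Least_le) (use that in auto)
qed

text \<open>The addition formula reduces the index modulo the rank: with \<open>a\<close> a multiple
  of the rank, \<open>U (Suc a)\<close> is invertible modulo \<open>q\<close>, since no prime
  divides two consecutive terms. A remainder below the rank must then be 0. Prime powers are covered
  because multiplicities are counted later.\<close>

lemma dvd_U_iff_rank_dvd:
  assumes "prime p" "j \<ge> 1" "q = p ^ j" "q dvd U n" "n \<ge> 1"
  shows "q dvd U e \<longleftrightarrow> rank q dvd e"
proof
  note r = rank_props[OF assms(4,5)]
  let ?d = "rank q"
  have mult: "q dvd U (?d * k)" for k
    using U_mult[of k ?d] r(2) by (simp add: mult.commute)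
  show "q dvd U e" if "?d dvd e" using that mult by auto
  assume e: "q dvd U e"
  define a where "a = ?d * (e div ?d)"
  define k where "k = e mod ?d"
  have ak: "e = a + k" unfolding a_def k_def by simp
  have "q dvd U k"
  proof (cases "a = 0 \<or> k = 0")
    case False
    then obtain k' where k': "k = Suc k'" by (cases k) auto
    have qa: "q dvd U a" unfolding a_def by (rule mult)
    have "p dvd q" using assms by (simp add: dvd_power)
    then have "\<not> p dvd U (Suc a)"
      using prime_dvd_U_not_dvd_U_Suc[OF assms(1), of a] qa False dvd_trans by fastforce
    then have "coprime q (U (Suc a))"
      unfolding assms(3) using assms(1) by (simp add: prime_imp_coprime)
    moreover have "q dvd U (Suc a) * U k"
    proof -
      have "U (Suc a) * U k = U e + Q * U a * U k'"
        using U_add[of a k'] ak k' by simp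
      then show ?thesis using e qa by simp
    qed
    ultimately show ?thesis using coprime_dvd_mult_right_iff by blast
  qed (use ak e in auto)
  moreover have "k < ?d" unfolding k_def using r(1) by simp
  ultimately have "k = 0" using r(3)[of k] by (cases "k = 0") auto
  then show "?d dvd e" by (simp add: k_def mod_eq_0_iff_dvd)
qed

text \<open>
  Pigeonhole: below the rank, the ratios of consecutive terms are distinct elements of the field
  with \<open>p\<close> elements.
\<close>

lemma rank_le_Suc_prime:
  assumes "prime p" "int p dvd U n" "n \<ge> 1"
  shows "rank (int p) \<le> p + 1"
proof -
  let ?p = "int p" and ?d = "rank (int p)"
  note r = rank_props[OF assms(2,3)]
  have nd: "\<not> ?p dvd U i" if "i \<in> {1..<?d}" for i using that r(3)[of i] by auto
  have "\<exists>y. [U i * y = 1] (mod ?p)" if "i \<in> {1..<?d}" for i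
    using nd[OF that] assms(1) by (intro cong_solve_coprime_int) (simp add: prime_imp_coprime coprime_commute)
  then obtain y where y: "\<And>i. i \<in> {1..<?d} \<Longrightarrow> [U i * y i = 1] (mod ?p)" by metis
  define g where "g i = (U (i + 1) * y i) mod ?p" for i
  have inj: "i = k" if "i \<in> {1..<?d}" "k \<in> {1..<?d}" "g i = g k" for i k
    using that
  proof (induction i k rule: linorder_wlog)
    case (le i k)
    show ?case
    proof (rule ccontr)
      assume "i \<noteq> k"
      then obtain l where l: "k = i + l" "l > 0" using le(1) le_imp_less_or_eq less_imp_add_positive by blast
      have "[U (i + 1) * y i = U (k + 1) * y k] (mod ?p)"
        using le(4) by (simp add: g_def cong_def)
      then have c: "[(U (i + 1) * y i) * (U i * U k) = (U (k + 1) * y k) * (U i * U k)] (mod ?p)"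
        by (rule cong_scalar_right)
      have "[U (i + 1) * U k * 1 = U (i + 1) * U k * (U i * y i)] (mod ?p)"
        using y[OF le(2)] by (intro cong_scalar_left) (simp add: cong_sym)
      also have "U (i + 1) * U k * (U i * y i) = (U (i + 1) * y i) * (U i * U k)" by (simp add: mult_ac)
      also note c
      also have "(U (k + 1) * y k) * (U i * U k) = U (k + 1) * U i * (U k * y k)" by (simp add: mult_ac)
      also have "[U (k + 1) * U i * (U k * y k) = U (k + 1) * U i * 1] (mod ?p)"
        using y[OF le(3)] by (intro cong_scalar_left)
      finally have "?p dvd U (i + 1) * U k - U (k + 1) * U i" by (simp add: cong_iff_dvd_diff)
      \<comment> \<open>Equal ratios at \<open>i\<close> and \<open>k\<close> make the cross
        difference divisible by \<open>p\<close>; d'Ocagne's identity passes this on to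
        \<open>U l\<close> with \<open>l = k - i\<close>, an index below the rank.\<close>
      then have "?p dvd Q ^ i * U l" using U_docagne[of i l] unfolding l(1) by simp
      moreover have "\<not> ?p dvd Q ^ i"
        using prime_dvd_U_not_dvd_Q[of ?p n] assms prime_dvd_power[of ?p Q i] by auto
      ultimately have "?p dvd U l" using assms(1) by (simp add: prime_dvd_mult_iff)
      then show False using nd[of l] l le by auto
    qed
  next
    case (sym i k)
    then show ?case by metis
  qed
  have "card {1..<?d} \<le> card {0..<?p}"
    by (rule card_inj_on_le[of g]) (use inj in \<open>auto simp: inj_on_def g_def prime_gt_0_nat[OF assms(1)]\<close>)
  then show ?thesis by simp
qed

text \<open>For odd \<open>p\<close> dividing \<open>U m\<close> the quotient is
  \<open>r * (V m / 2) ^ (r - 1)\<close> modulo \<open>p\<close>, and neither \<open>r\<close> nor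
  \<open>V m\<close> is divisible by \<open>p\<close>. For \<open>p = 2\<close> the prime
  \<open>r\<close> is odd, \<open>V m\<close> is even and \<open>Q\<close> is odd, so parity
  decides.\<close>

lemma quotient_not_dvd:
  assumes "prime p" "prime r" "r \<noteq> p" "int p dvd U m" "m \<ge> 1"
  shows "\<not> int p dvd lucas_U (V m) (Q ^ m) r"
proof -
  have nQ: "\<not> int p dvd Q ^ m" using prime_dvd_U_not_dvd_Q[of "int p" m] assms prime_dvd_power[of "int p" Q m] by auto
  have disc: "[V m ^ 2 = 4 * Q ^ m] (mod int p)"
    unfolding cong_iff_dvd_diff V_square using assms(4) by (simp add: power2_eq_square)
  obtain r' where r': "r = Suc r'" using assms(2) by (cases r) auto
  show ?thesis
  proof (cases "p = 2")
    case True
    have "odd r" using assms True by (metis primes_dvd_imp_eq two_is_prime_nat)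
    then obtain k where "r = Suc (2 * k)" by (auto elim!: oddE)
    moreover have "even (V m)"
      using disc True by (metis cong_dvd_iff dvd_mult2 even_numeral even_power of_nat_numeral)
    ultimately show ?thesis using odd_lucas_U_odd[of "V m" "Q ^ m" k] nQ True by auto
  next
    case False
    have np2: "\<not> int p dvd 2" using False assms(1)
      by (metis int_dvd_int_iff of_nat_numeral primes_dvd_imp_eq two_is_prime_nat)
    have nV: "\<not> int p dvd V m"
    proof
      assume "int p dvd V m"
      then have "int p dvd 4 * Q ^ m" using disc by (metis cong_dvd_iff dvd_mult2 power2_eq_square)
      then have "int p dvd 2 * (2 * Q ^ m)" by simp
      then show False using np2 nQ assms(1) by (metis prime_dvd_mult_iff prime_nat_int_transfer)
    qed
    have nr: "\<not> int p dvd int r" using assms by (metis int_dvd_int_iff primes_dvd_imp_eq)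
    have "\<not> int p dvd int (Suc r') * V m ^ r'"
      using nr nV assms(1) r' by (metis prime_dvd_mult_iff prime_nat_int_transfer prime_dvd_power)
    then have "\<not> int p dvd 2 ^ r' * lucas_U (V m) (Q ^ m) (Suc r')"
      using lucas_U_cong_discriminant[OF disc, of r'] cong_dvd_iff by blast
    then show ?thesis using r' by auto
  qed
qed

text \<open>The discriminant of the derived pair is divisible by \<open>p ^ 2\<close>, so for odd
  \<open>p\<close> the quotient times \<open>2 ^ (p - 1)\<close> is \<open>p * V m ^ (p - 1)\<close>
  modulo \<open>p ^ 2\<close>, with \<open>V m\<close> prime to \<open>p\<close>. At
  \<open>p = 2\<close> the extra hypothesis makes \<open>V m\<close> the value
  \<open>V k ^ 2 - 2 * Q ^ k\<close> with \<open>V k\<close> even and \<open>Q\<close> odd, hence 2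
  modulo 4.\<close>

lemma quotient_not_dvd_square:
  assumes "prime p" "int p dvd U m" "m \<ge> 1" "p = 2 \<Longrightarrow> even m \<and> even (U (m div 2)) \<and> m \<ge> 2"
  shows "\<not> int p ^ 2 dvd lucas_U (V m) (Q ^ m) p"
proof (cases "p = 2")
  case True
  then obtain k where k: "m = 2 * k" "even (U k)" "k \<ge> 1" using assms(4) by auto
  have oQ: "odd Q" using prime_dvd_U_not_dvd_Q[of 2 k] k by auto
  have "even (V k ^ 2 - 4 * Q ^ k)" unfolding V_square using k by simp
  then have "even (V k)" by simp
  then obtain w where w: "V k = 2 * w" by auto
  have "\<not> 4 dvd V m"
  proof
    assume "4 dvd V m"
    then obtain u where "V m = 4 * u" by auto
    then have "2 * Q ^ k = 4 * (w ^ 2 - u)" unfolding k V_double w by (simp add: algebra_simps power2_eq_square)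
    then have "Q ^ k = 2 * (w ^ 2 - u)" by linarith
    then have "even (Q ^ k)" by simp
    then show False using oQ by simp
  qed
  \<comment> \<open>For \<open>p = 2\<close> the quotient is \<open>V m\<close> itself.\<close>
  then show ?thesis using True by (simp add: numeral_2_eq_2)
next
  case False
  let ?p = "int p"
  have nQ: "\<not> int p dvd Q ^ m" using prime_dvd_U_not_dvd_Q[of "int p" m] assms prime_dvd_power[of "int p" Q m] by auto
  have disc: "[V m ^ 2 = 4 * Q ^ m] (mod ?p ^ 2)"
    unfolding cong_iff_dvd_diff V_square using assms(2) by (intro dvd_mult dvd_power_same)
  have np2: "\<not> int p dvd 2" using False assms(1)
    by (metis int_dvd_int_iff of_nat_numeral primes_dvd_imp_eq two_is_prime_nat)
  have nV: "\<not> int p dvd V m"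
  proof
    assume "int p dvd V m"
    moreover have "[V m ^ 2 = 4 * Q ^ m] (mod ?p)" using disc by (rule cong_dvd_modulus) simp
    ultimately have "int p dvd 4 * Q ^ m" by (metis cong_dvd_iff dvd_mult2 power2_eq_square)
    then have "int p dvd 2 * (2 * Q ^ m)" by simp
    then show False using np2 nQ assms(1) by (metis prime_dvd_mult_iff prime_nat_int_transfer)
  qed
  obtain r where r: "p = Suc r" using assms(1) by (cases p) auto
  have "\<not> ?p ^ 2 dvd ?p * V m ^ r"
  proof
    assume "?p ^ 2 dvd ?p * V m ^ r"
    then have "?p dvd V m ^ r" using assms(1) by (simp add: power2_eq_square prime_gt_0_nat)
    then show False using nV assms(1) prime_dvd_power[of ?p "V m" r] by simp
  qed
  then have "\<not> ?p ^ 2 dvd 2 ^ r * lucas_U (V m) (Q ^ m) p"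
    using lucas_U_cong_discriminant[OF disc, of r] r cong_dvd_iff by metis
  then show ?thesis by auto
qed

end

section \<open>Existence of primitive divisors\<close>

text \<open>The totient is monotone along divisibility, so a prime factor at least 7 or a factor 9,
  16 or 25 settles the claim. The bound 13 is sharp, since 12 has totient 4.\<close>

lemma six_le_totient:
  assumes "n \<ge> 13"
  shows "6 \<le> totient n"
proof -
  have mono: "totient d \<le> totient n" if "d dvd n" for d
    using totient_dvd_mono[OF that] assms by simp
  show ?thesis
  proof (cases "\<exists>p. prime p \<and> p dvd n \<and> p \<ge> 7")
    case True
    then obtain p where "prime p" "p dvd n" "p \<ge> 7" by blast
    then show ?thesis using mono[of p] by (simp add: totient_prime)
  next
    case False
    have ps: "p = 2 \<or> p = 3 \<or> p = 5" if "prime p" "p dvd n" for p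
    proof -
      have "p < 7" using False that not_less by blast
      moreover have "p = 2" if "even p"
        using that \<open>prime p\<close> primes_dvd_imp_eq two_is_prime_nat by blast
      then have "p \<noteq> 0" "p \<noteq> 1" "p \<noteq> 4" "p \<noteq> 6"
        using that by auto
      ultimately show ?thesis by linarith
    qed
    have n0: "n \<noteq> 0" using assms by simp
    obtain k where k: "n = 2 ^ multiplicity 2 n * k" "\<not> 2 dvd k"
      using multiplicity_decompose'[of n 2] n0 by auto
    have k0: "k \<noteq> 0" using k(2) by (intro notI) simp
    obtain l where l: "k = 3 ^ multiplicity 3 k * l" "\<not> 3 dvd l"
      using multiplicity_decompose'[of k 3] k0 by auto
    have tot: "totient 25 = 20" "totient 16 = 8" "totient 9 = 6" "totient 24 = 8"
      using totient_prime_power[of 5 2] totient_prime_power[of 2 4] totient_prime_power[of 3 2]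
        totient_mult_coprime[of 8 3] totient_prime_power[of 2 3] prime_imp_coprime[of "3::nat" 8]
      by (simp_all add: totient_prime coprime_commute)
    show ?thesis
    proof (cases "5 dvd n")
      case True
      then obtain m where m: "n = 5 * m" by auto
      show ?thesis
      proof (cases "5 dvd m")
        case True
        then have "25 dvd n" using m by auto
        then show ?thesis using mono[of 25] tot by simp
      next
        case False
        then have "coprime 5 m" by (intro prime_imp_coprime) auto
        then have "totient n = 4 * totient m" unfolding m by (simp add: totient_mult_coprime totient_prime)
        \<comment> \<open>Here \<open>n >= 13\<close> forces \<open>m >= 3\<close>, so the totient
          of \<open>n\<close> is at least 8.\<close>
        moreover have "totient m > 1" using m assms by (intro totient_gt_1) auto
        ultimately show ?thesis by simp
      qed
    next
      case n5: False
      show ?thesis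
      proof (cases "16 dvd n \<or> 9 dvd n")
        case True
        then show ?thesis using mono[of 16] mono[of 9] tot by auto
      next
        case False
        have a: "multiplicity 2 n < 4"
          proof (rule ccontr)
          assume "\<not> multiplicity 2 n < 4"
          then have "2 ^ 4 dvd n" by (intro multiplicity_dvd') auto
          then show False using False by simp
        qed
        have b: "multiplicity 3 k < 2"
          proof (rule ccontr)
          assume "\<not> multiplicity 3 k < 2"
          then have "3 ^ 2 dvd k" by (intro multiplicity_dvd') auto
          then have "9 dvd k" by simp
          then show False using False k(1) by (metis dvd_mult)
        qed
        have "l = 1"
        proof (rule ccontr)
          assume "l \<noteq> 1"
          then obtain r where r: "prime r" "r dvd l" using prime_factor_nat by blast
          then have "r dvd k" using l(1) by (metis dvd_mult)
          then have "r dvd n" using k(1) by (metis dvd_mult)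
          then show False using ps[OF r(1)] r \<open>r dvd k\<close> l(2) k(2) n5 by auto
        qed
        then have n: "n = 2 ^ multiplicity 2 n * 3 ^ multiplicity 3 k" using k(1) l(1) by simp
        have "multiplicity 2 n \<in> {0,1,2,3}" "multiplicity 3 k \<in> {0,1}" using a b by auto
        \<comment> \<open>Of the divisors of 24, only 24 itself reaches 13.\<close>
        then have "n = 24" using n assms by (auto simp: eval_nat_numeral)
        then show ?thesis using tot by simp
      qed
    qed
  qed
qed

text \<open>The start is \<open>2401 < 3125\<close>. From \<open>t >= 6\<close> on, the left side
  grows per step by at most the factor \<open>(8 / 7) ^ 4\<close>, which is below 5.\<close>

lemma power_exceeds_fourth_power:
  assumes "t \<ge> 6"
  shows "(t + 1) ^ 4 < (5::nat) ^ (t - 1)"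
  using assms
proof (induction t rule: dec_induct)
  case (step t)
  have "(t + 2) ^ 4 \<le> 5 * (t + 1) ^ 4"
  proof -
    have "(7 * (t + 2)) ^ 4 \<le> (8 * (t + 1)) ^ 4" using step(1) by (intro power_mono) auto
    then have "2401 * (t + 2) ^ 4 \<le> 4096 * (t + 1) ^ 4" unfolding power_mult_distrib by simp
    then have "2401 * x \<le> 4096 * y \<Longrightarrow> x \<le> 5 * y" for x y :: nat by linarith
    with \<open>2401 * (t + 2) ^ 4 \<le> 4096 * (t + 1) ^ 4\<close> show ?thesis by blast
  qed
  also have "\<dots> < 5 * 5 ^ (t - 1)" using step by simp
  also have "\<dots> = 5 ^ t" using step(1) by (cases t) auto
  finally show ?case by simp
qed simp

context real_lucas_pair
begin

section \<open>Size of the homogeneous cyclotomic values\<close>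

lemma P_pos: "P > 0"
  using sum_eq dominant by linarith

lemma discriminant: "real_of_int (P ^ 2 - 4 * Q) = (\<phi> - \<psi>) ^ 2"
  by (simp add: sum_eq[symmetric] prod_eq[symmetric] algebra_simps power2_eq_square)

text \<open>For \<open>P = 1\<close> or \<open>P = 2\<close> a positive discriminant together with
  \<open>Q\<close> nonzero forces \<open>Q < 0\<close>. So of the two end values
  \<open>P ^ 2\<close> and \<open>P ^ 2 - 4 * Q\<close> of the chord, one is at least 5 and the
  other at least 1.\<close>

lemma discriminant_cases: "5 \<le> P ^ 2 - 4 * Q \<or> 3 \<le> P \<and> 1 \<le> P ^ 2 - 4 * Q"
proof -
  have D: "P ^ 2 - 4 * Q > 0" using diff_pos discriminant
    by (metis of_int_0_less_iff zero_less_power)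
  consider "P = 1" | "P = 2" | "P \<ge> 3" using P_pos by linarith
  then show ?thesis
  proof cases
    case 1 then show ?thesis using D Q_nz by simp
  next
    case 2 then show ?thesis using D Q_nz by simp
  qed (use D in auto)
qed

text \<open>
  By concavity of the logarithm, \<open>2 ln \<bar>\<phi> - \<psi> z\<bar>\<close> lies above the chord between its values at
  \<open>Re z = -1\<close> and \<open>Re z = 1\<close>, so that summing over primitive roots of unity only involves a
  Moebius function.
\<close>

lemma ln_norm_ge:
  fixes z :: complex
  assumes "norm z = 1"
  shows "2 * ln (norm (\<phi> - \<psi> * z)) \<ge>
    (1 - Re z) / 2 * ln (real_of_int (P ^ 2)) + (1 + Re z) / 2 * ln (real_of_int (P ^ 2 - 4 * Q))"
proof -
  have sq: "Re z ^ 2 + Im z ^ 2 = 1" using assms by (simp add: cmod_power2[symmetric])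
  let ?c = "Re z" and ?p = "real_of_int (P ^ 2)" and ?D = "real_of_int (P ^ 2 - 4 * Q)"
  have c: "\<bar>?c\<bar> \<le> 1" using abs_Re_le_cmod[of z] assms by simp
  have p: "?p > 0" using P_pos by simp
  have D: "?D > 0" using discriminant_cases by linarith
  have "norm (\<phi> - \<psi> * z) ^ 2 = (\<phi> - \<psi> * ?c) ^ 2 + (\<psi> * Im z) ^ 2"
    by (simp add: cmod_power2)
  also have "\<dots> = \<phi> ^ 2 - 2 * \<phi> * \<psi> * ?c + \<psi> ^ 2 * (?c ^ 2 + Im z ^ 2)"
    by (simp add: power2_eq_square algebra_simps)
  also have "\<dots> = (1 - ?c) / 2 * (\<phi> + \<psi>) ^ 2 + (1 + ?c) / 2 * (\<phi> - \<psi>) ^ 2"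
    unfolding sq by (simp add: power2_eq_square field_simps)
  also have "\<dots> = (1 - ?c) / 2 * ?p + (1 + ?c) / 2 * ?D"
    unfolding discriminant sum_eq by simp
  finally have eq: "norm (\<phi> - \<psi> * z) ^ 2 = (1 - ?c) / 2 * ?p + (1 + ?c) / 2 * ?D" .
  have "- ln ((1 - ?c) / 2 * ?p + (1 + ?c) / 2 * ?D) \<le> (1 - ?c) / 2 * (- ln ?p) + (1 + ?c) / 2 * (- ln ?D)"
    using convex_onD[OF minus_log_convex[of "exp 1"], of "(1 + ?c) / 2" ?p ?D] c p D
    by (simp add: log_def field_simps)
  then have "ln (norm (\<phi> - \<psi> * z) ^ 2) \<ge> (1 - ?c) / 2 * ln ?p + (1 + ?c) / 2 * ln ?D"
    unfolding eq by simp
  moreover have "norm (\<phi> - \<psi> * z) > 0"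
  proof -
    have "norm (complex_of_real \<psi> * z) = \<bar>\<psi>\<bar>" using assms by (simp add: norm_mult)
    then have "complex_of_real \<phi> - \<psi> * z \<noteq> 0"
      using dominant norm_of_real[of \<phi>, where 'a = complex] by (auto simp del: norm_of_real)
    then show ?thesis by simp
  qed
  ultimately show ?thesis by (simp add: ln_realpow)
qed

text \<open>The logarithm of the absolute value of the homogeneous cyclotomic polynomial at
  \<open>\<phi>\<close>, \<open>\<psi>\<close>. The correction at \<open>n = 1\<close> divides out
  \<open>\<phi> - \<psi>\<close>, so that the divisor sums give \<open>v n\<close> and not
  \<open>\<phi> ^ n - \<psi> ^ n\<close>.\<close>

definition ln_cyclotomic :: "nat \<Rightarrow> real" where
  "ln_cyclotomic n = (\<Sum>z\<in>prim_roots n. ln (norm (\<phi> - \<psi> * z))) - (if n = 1 then ln (\<phi> - \<psi>) else 0)"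

lemma norm_prim_roots: "n > 0 \<Longrightarrow> z \<in> prim_roots n \<Longrightarrow> norm z = 1"
  using power_eq_1_iff[of z n] by (auto simp: prim_roots_def)

text \<open>Summing the chord bound weights the two end values by \<open>(t - m) / 2\<close> and
  \<open>(t + m) / 2\<close>, where \<open>m\<close> is a Moebius value. Both weights are at least
  \<open>(t - 1) / 2\<close>, whichever end value is the one that reaches 5.\<close>

lemma ln_cyclotomic_ge:
  assumes "n \<ge> 2"
  shows "ln_cyclotomic n \<ge> (real (totient n) - 1) / 4 * ln 5"
proof -
  define t where "t = real (totient n)"
  define m where "m = (\<Sum>z\<in>prim_roots n. Re z)"
  let ?p = "ln (real_of_int (P ^ 2))" and ?D = "ln (real_of_int (P ^ 2 - 4 * Q))"
  have m: "\<bar>m\<bar> \<le> 1" unfolding m_def using assms by (intro abs_sum_Re_prim_roots_le_1) auto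
  have t: "t \<ge> 1" using assms totient_gt_0_iff[of n] unfolding t_def by linarith
  have "(t - m) / 2 * ?p + (t + m) / 2 * ?D = (\<Sum>z\<in>prim_roots n. (1 - Re z) / 2 * ?p + (1 + Re z) / 2 * ?D)"
    using card_prim_roots[of n] assms
    by (simp add: sum.distrib m_def t_def sum_subtractf flip: sum_distrib_right sum_divide_distrib)
  also have "\<dots> \<le> (\<Sum>z\<in>prim_roots n. 2 * ln (norm (\<phi> - \<psi> * z)))"
    using assms norm_prim_roots[of n] by (intro sum_mono ln_norm_ge) auto
  finally have le: "(t - m) / 2 * ?p + (t + m) / 2 * ?D \<le> 2 * ln_cyclotomic n"
    using assms by (simp add: ln_cyclotomic_def sum_distrib_left)
  have p0: "?p \<ge> 0" using P_pos by (intro ln_ge_zero) (simp add: one_le_power)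
  have D0: "?D \<ge> 0" using discriminant_cases by (intro ln_ge_zero) linarith
  have "(t - 1) / 2 * ln 5 \<le> (t - m) / 2 * ?p + (t + m) / 2 * ?D"
    using discriminant_cases
  proof
    assume "5 \<le> P ^ 2 - 4 * Q"
    then have "5 \<le> real_of_int (P ^ 2 - 4 * Q)" by linarith
    then have "ln 5 \<le> ?D" by (subst ln_le_cancel_iff) auto
    then have "(t - 1) / 2 * ln 5 \<le> (t + m) / 2 * ?D" using m t by (intro mult_mono) auto
    moreover have "0 \<le> (t - m) / 2 * ?p" using m t p0 by (intro mult_nonneg_nonneg) auto
    ultimately show ?thesis by linarith
  next
    assume "3 \<le> P \<and> 1 \<le> P ^ 2 - 4 * Q"
    then have "3 ^ 2 \<le> P ^ 2" by (intro power_mono) auto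
    then have "5 \<le> P ^ 2" by simp
    then have "5 \<le> real_of_int (P ^ 2)" by linarith
    then have "ln 5 \<le> ?p" by (subst ln_le_cancel_iff) auto
    then have "(t - 1) / 2 * ln 5 \<le> (t - m) / 2 * ?p" using m t by (intro mult_mono) auto
    moreover have "0 \<le> (t + m) / 2 * ?D" using m t D0 by (intro mult_nonneg_nonneg) auto
    ultimately show ?thesis by linarith
  qed
  then show ?thesis using le unfolding t_def by linarith
qed

lemma psi_nz: "\<psi> \<noteq> 0" using prod_eq Q_nz by auto

lemma sum_ln_cyclotomic:
  assumes "n > 0"
  shows "(\<Sum>d | d dvd n. ln_cyclotomic d) = ln (real (v n))"
proof -
  have nz: "norm (complex_of_real \<phi> - complex_of_real \<psi> * z) > 0" if "z ^ n = 1" for z :: complex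
  proof -
    have "norm z = 1" using that assms power_eq_1_iff by blast
    then have "norm (complex_of_real \<psi> * z) = \<bar>\<psi>\<bar>" by (simp add: norm_mult)
    then have "complex_of_real \<phi> - \<psi> * z \<noteq> 0"
      using dominant norm_of_real[of \<phi>, where 'a = complex] by (auto simp del: norm_of_real)
    then show ?thesis by simp
  qed
  have "(\<Sum>d | d dvd n. ln_cyclotomic d) = (\<Sum>z\<in>{z::complex. z ^ n = 1}. ln (norm (complex_of_real \<phi> - complex_of_real \<psi> * z))) - ln (\<phi> - \<psi>)"
    unfolding ln_cyclotomic_def sum_subtractf
    using assms by (subst sum_roots_unity_prim_roots) (auto simp: sum.delta)
  also have "(\<Sum>z\<in>{z::complex. z ^ n = 1}. ln (norm (complex_of_real \<phi> - complex_of_real \<psi> * z))) = ln (\<Prod>z\<in>{z::complex. z ^ n = 1}. norm (complex_of_real \<phi> - complex_of_real \<psi> * z))"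
    using nz assms by (intro ln_prod[symmetric]) (auto intro: finite_nth_roots)
  also have "(\<Prod>z\<in>{z::complex. z ^ n = 1}. norm (complex_of_real \<phi> - complex_of_real \<psi> * z)) = norm (of_real (\<phi> ^ n - \<psi> ^ n) :: complex)"
    using prod_roots_unity[OF assms, of \<psi> \<phi>] psi_nz by (simp add: prod_norm)
  also have "\<dots> = \<bar>\<phi> ^ n - \<psi> ^ n\<bar>" by (simp only: norm_of_real)
  also have "\<bar>\<phi> ^ n - \<psi> ^ n\<bar> = real (v n) * (\<phi> - \<psi>)"
  proof -
    have "\<phi> ^ n - \<psi> ^ n = real (v n) * (\<phi> - \<psi>)"
      using diff_pos real_v[of n] by (simp add: field_simps)
    then show ?thesis using diff_pos by simp
  qed
  also have "ln (real (v n) * (\<phi> - \<psi>)) - ln (\<phi> - \<psi>) = ln (real (v n))"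
    using diff_pos v_pos[of n] assms by (simp add: ln_mult)
  finally show ?thesis .
qed

section \<open>Prime powers sorted by rank of apparition\<close>

definition prime_power_divisors :: "nat \<Rightarrow> (nat \<times> nat) set" where
  "prime_power_divisors n = {(p, j). prime p \<and> j \<ge> 1 \<and> p ^ j dvd n}"

lemma prime_power_divisors_eq:
  assumes "n > 0"
  shows "prime_power_divisors n = (SIGMA p:prime_factors n. {1..multiplicity p n})"
proof -
  have "p ^ j dvd n \<longleftrightarrow> p dvd n \<and> j \<le> multiplicity p n" if "prime p" "j \<ge> 1" for p j
  proof -
    have "p ^ j dvd n \<longleftrightarrow> j \<le> multiplicity p n"
      using that assms by (intro power_dvd_iff_le_multiplicity) (auto simp: prime_gt_Suc_0_nat)
    moreover have "p dvd n" if "p ^ j dvd n"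
      using that \<open>j \<ge> 1\<close> by (metis dvd_power dvd_trans less_le_trans zero_less_one)
    ultimately show ?thesis by blast
  qed
  then show ?thesis using assms by (auto simp: prime_power_divisors_def prime_factors_dvd)
qed

text \<open>A prime of multiplicity \<open>k\<close> occurs in \<open>k\<close> pairs, each of
  weight \<open>ln p\<close>; multiplicities thus become cardinalities, which can be distributed
  over ranks.\<close>

lemma sum_prime_power_divisors:
  assumes "n > 0"
  shows "finite (prime_power_divisors n)" "(\<Sum>(p, j)\<in>prime_power_divisors n. ln (real p)) = ln (real n)"
proof -
  show "finite (prime_power_divisors n)" unfolding prime_power_divisors_eq[OF assms] by auto
  have "(\<Sum>(p, j)\<in>prime_power_divisors n. ln (real p)) = (\<Sum>p\<in>prime_factors n. real (multiplicity p n) * ln (real p))"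
    unfolding prime_power_divisors_eq[OF assms] by (simp add: sum.Sigma[symmetric])
  also have "\<dots> = ln (\<Prod>p\<in>prime_factors n. real p ^ multiplicity p n)"
    by (subst ln_prod) (auto simp: ln_realpow intro!: prime_gt_0_nat)
  also have "(\<Prod>p\<in>prime_factors n. real p ^ multiplicity p n) = real (\<Prod>p\<in>prime_factors n. p ^ multiplicity p n)"
    by simp
  also have "(\<Prod>p\<in>prime_factors n. p ^ multiplicity p n) = n"
    using prime_factorization_nat[OF assms] by simp
  finally show "(\<Sum>(p, j)\<in>prime_power_divisors n. ln (real p)) = ln (real n)" .
qed

text \<open>For \<open>n > 0\<close>, the prime powers whose rank of apparition is \<open>n\<close>.
  A primitive divisor contributes its pair with \<open>j = 1\<close>; an old prime can still
  contribute a higher power.\<close>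

definition new_prime_powers :: "nat \<Rightarrow> (nat \<times> nat) set" where
  "new_prime_powers n = {(p, j) \<in> prime_power_divisors (v n). \<forall>e. 1 \<le> e \<and> e < n \<longrightarrow> \<not> p ^ j dvd v e}"

lemma int_dvd_U: "int (p ^ j) dvd U n \<longleftrightarrow> p ^ j dvd v n"
  unfolding int_v[symmetric] by (simp only: int_dvd_int_iff)

lemma new_prime_powers_rank:
  assumes "(p, j) \<in> new_prime_powers n" "n > 0"
  shows "rank (int p ^ j) = n"
proof -
  have d: "int p ^ j dvd U n" using assms int_dvd_U[of p j n] by (auto simp: new_prime_powers_def prime_power_divisors_def)
  have "rank (int p ^ j) \<le> n" "rank (int p ^ j) > 0" "int p ^ j dvd U (rank (int p ^ j))"
    using rank_props[OF d] assms d by auto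
  moreover have "\<not> rank (int p ^ j) < n"
    using calculation assms int_dvd_U[of p j "rank (int p ^ j)"] by (auto simp: new_prime_powers_def Suc_le_eq)
  ultimately show ?thesis by simp
qed

text \<open>A prime power divides \<open>v n\<close> exactly when its rank divides \<open>n\<close>,
  and at its rank it is new.\<close>

lemma prime_power_divisors_v:
  assumes "n > 0"
  shows "prime_power_divisors (v n) = (\<Union>d\<in>{d. d dvd n}. new_prime_powers d)"
proof (intro equalityI subsetI; clarify)
  fix p j assume pj: "(p, j) \<in> prime_power_divisors (v n)"
  then have p: "prime (int p)" "j \<ge> 1" and d: "int p ^ j dvd U n"
    using int_dvd_U[of p j n] by (auto simp: prime_power_divisors_def)
  let ?d = "rank (int p ^ j)"
  have r: "?d > 0" "p ^ j dvd v ?d" "\<And>e. e > 0 \<Longrightarrow> p ^ j dvd v e \<Longrightarrow> ?d \<le> e"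
    using rank_props[OF d] assms int_dvd_U[of p j] by auto
  have "?d dvd n" using dvd_U_iff_rank_dvd[OF p refl d, of n] d assms by simp
  moreover have "(p, j) \<in> new_prime_powers ?d"
    unfolding new_prime_powers_def prime_power_divisors_def
  proof (safe, goal_cases)
    case (4 e)
    then show ?case using r(3)[of e] by simp
  qed (use r p in auto)
  ultimately show "(p, j) \<in> (\<Union>d\<in>{d. d dvd n}. new_prime_powers d)" by blast
next
  fix p j d assume d: "d dvd n" and "(p, j) \<in> new_prime_powers d"
  then have p: "prime p" "j \<ge> 1" "int p ^ j dvd U d"
    using int_dvd_U[of p j d] by (auto simp: new_prime_powers_def prime_power_divisors_def)
  obtain k where "n = k * d" using d by (metis dvd_def mult.commute)
  then have "int p ^ j dvd U n" using U_mult[of k d] p by simp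
  then show "(p, j) \<in> prime_power_divisors (v n)"
    using p int_dvd_U[of p j n] by (auto simp: prime_power_divisors_def)
qed

text \<open>Both sides have divisor sums \<open>ln (v n)\<close>, on the left through roots of
  unity, on the right through ranks. The analytic size is thereby tied to the new prime
  powers.\<close>

lemma ln_cyclotomic_eq:
  assumes "n > 0"
  shows "ln_cyclotomic n = (\<Sum>(p, j)\<in>new_prime_powers n. ln (real p))"
proof (rule divisor_sum_unique[OF _ assms])
  fix n :: nat assume n: "n > 0"
  have pos: "d > 0" if "d dvd n" for d using that n by (auto intro!: Nat.gr0I)
  have "(\<Sum>(p, j)\<in>prime_power_divisors (v n). ln (real p)) = (\<Sum>d | d dvd n. \<Sum>(p, j)\<in>new_prime_powers d. ln (real p))"
    unfolding prime_power_divisors_v[OF n]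
  proof (rule sum.UNION_disjoint)
    show "\<forall>d\<in>{d. d dvd n}. finite (new_prime_powers d)"
    proof
      fix d assume "d \<in> {d. d dvd n}"
      then have "finite (prime_power_divisors (v d))" using sum_prime_power_divisors(1) v_pos[of d] pos[of d] by auto
      then show "finite (new_prime_powers d)"
        by (rule finite_subset[rotated]) (auto simp: new_prime_powers_def)
    qed
    show "\<forall>i\<in>{d. d dvd n}. \<forall>j\<in>{d. d dvd n}. i \<noteq> j \<longrightarrow> new_prime_powers i \<inter> new_prime_powers j = {}"
    proof (intro ballI impI equals0I)
      fix i j x assume ij: "i \<in> {d. d dvd n}" "j \<in> {d. d dvd n}" "i \<noteq> j"
        and "x \<in> new_prime_powers i \<inter> new_prime_powers j"
      then obtain p k where "(p, k) \<in> new_prime_powers i" "(p, k) \<in> new_prime_powers j" by (cases x) auto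
      then show False using new_prime_powers_rank[of p k] pos ij by (metis mem_Collect_eq)
    qed
  qed (use n in auto)
  then show "(\<Sum>d | d dvd n. ln_cyclotomic d) = (\<Sum>d | d dvd n. \<Sum>(p, j)\<in>new_prime_powers d. ln (real p))"
    using sum_ln_cyclotomic[OF n] sum_prime_power_divisors(2)[of "v n"] v_pos[of n] n by simp
qed

text \<open>If \<open>p\<close> is old, its rank is a proper divisor of \<open>n\<close>.
  Multiplying the index by a prime other than \<open>p\<close> adds no factor \<open>p\<close>, so
  the cofactor of the rank is a power of \<open>p\<close>; the last multiplication by
  \<open>p\<close> adds exactly one factor, which determines \<open>j\<close>.\<close>

lemma new_prime_powers_nonprimitive:
  assumes n: "n \<ge> 13" and nonprim: "\<nexists>p. primitive_divisor v n p"
    and pj: "(p, j) \<in> new_prime_powers n"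
  shows "prime p" "\<exists>k\<ge>1. n = rank (int p) * p ^ k" "rank (int p) \<le> p + 1"
    "j = Suc (multiplicity p (v (n div p)))"
proof -
  have p: "prime p" "j \<ge> 1" "p ^ j dvd v n" and new: "\<And>e. 1 \<le> e \<Longrightarrow> e < n \<Longrightarrow> \<not> p ^ j dvd v e"
    using pj by (auto simp: new_prime_powers_def prime_power_divisors_def)
  show "prime p" by fact
  have pn: "p dvd v n" using p dvd_power[of j p] by (auto intro: dvd_trans)
  define d where "d = rank (int p)"
  have dU: "int p dvd U n" using pn int_dvd_U[of p 1 n] by simp
  have p': "prime (int p)" using p by simp
  have iff: "int p dvd U e \<longleftrightarrow> d dvd e" for e
    unfolding d_def using dvd_U_iff_rank_dvd[OF p', of 1 "int p" n e] dU n by simp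
  have dpos: "d > 0" unfolding d_def using rank_props(1)[OF dU] n by simp
  have "\<not> primitive_divisor v n p" using nonprim by blast
  then obtain e where e: "1 \<le> e" "e < n" "p dvd v e"
    unfolding primitive_divisor_def using p pn by (auto simp: prime_dvd_prod_iff)
  have "d dvd e" using e iff[of e] int_dvd_U[of p 1 e] by simp
  then have "d < n" using e dvd_imp_le[of d e] by linarith
  obtain x where x: "n = d * x" using dU iff by auto
  have x1: "x > 1" using x n \<open>d < n\<close> by (cases "x = 0 \<or> x = 1") auto
  \<comment> \<open>Otherwise \<open>p ^ j\<close> would already divide the term at index
    \<open>n / r\<close>, since the quotient is prime to \<open>p\<close>.\<close>
  have only: "r = p" if r: "prime r" "r dvd x" for r
  proof (rule ccontr)
    assume rp: "r \<noteq> p"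
    obtain y where y: "x = r * y" using r by auto
    have y0: "y > 0" using y x1 by (cases y) auto
    define m where "m = d * y"
    have m: "n = r * m" "m \<ge> 1" using x y y0 dpos by (auto simp: m_def)
    have "m < n" using m r prime_gt_1_nat[of r] by simp
    have "int p dvd U m" using iff by (simp add: m_def)
    then have "\<not> int p dvd lucas_U (V m) (Q ^ m) r" using quotient_not_dvd[OF p(1) r(1) rp] m by blast
    then have "coprime (int p ^ j) (lucas_U (V m) (Q ^ m) r)" using p' by (simp add: prime_imp_coprime)
    moreover have "int p ^ j dvd U m * lucas_U (V m) (Q ^ m) r"
      using p(3) int_dvd_U[of p j n] U_mult[of r m] m by simp
    ultimately have "int p ^ j dvd U m" using coprime_dvd_mult_left_iff by blast
    then have "p ^ j dvd v m" using int_dvd_U[of p j m] by simp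
    then show False using new[of m] m \<open>m < n\<close> by blast
  qed
  define k where "k = multiplicity p x"
  obtain y where y: "x = p ^ k * y" "\<not> p dvd y"
    unfolding k_def using multiplicity_decompose'[of x p] x1 p by (metis not_prime_unit not_one_less_zero)
  have "y = 1"
  proof (rule ccontr)
    assume "y \<noteq> 1"
    then obtain r where "prime r" "r dvd y" using prime_factor_nat by blast
    then have "r = p" using only y by simp
    then show False using \<open>r dvd y\<close> y by simp
  qed
  then have xk: "x = p ^ k" using y by simp
  have k1: "k \<ge> 1" using x1 xk by (cases k) auto
  then show "\<exists>k\<ge>1. n = rank (int p) * p ^ k" using x xk d_def by blast
  show dle: "rank (int p) \<le> p + 1" using rank_le_Suc_prime[OF p(1) dU] n by simp
  define m where "m = d * p ^ (k - 1)"
  have m: "n = p * m" "m \<ge> 1" using x xk k1 dpos prime_gt_0_nat[OF p(1)] by (cases k; auto simp: m_def)+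
  have mn: "m < n" using m p prime_gt_1_nat[of p] by simp
  have pm: "int p dvd U m" using iff by (simp add: m_def)
  have ndv: "\<not> int p ^ 2 dvd lucas_U (V m) (Q ^ m) p"
  proof (rule quotient_not_dvd_square[OF p(1) pm m(2)])
    \<comment> \<open>The rank of 2 is at most 3, so \<open>n >= 13\<close> leaves at least three
      factors 2 in the cofactor and \<open>m div 2\<close> is still a multiple of the rank.\<close>
    assume p2: "p = 2"
    have "d \<le> 3" using dle p2 d_def by simp
    have "k \<ge> 3"
    proof (rule ccontr)
      assume "\<not> k \<ge> 3"
      then have "(2::nat) ^ k \<le> 2 ^ 2" by (intro power_increasing) auto
      then have "n \<le> 3 * 2 ^ 2" using x xk p2 \<open>d \<le> 3\<close> by (metis mult_le_mono)
      then show False using n by simp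
    qed
    then have "k = Suc (Suc (k - 2))" by simp
    then obtain i where "k = Suc (Suc i)" by blast
    then have m2: "m = 2 * (d * 2 ^ i)" using p2 by (simp add: m_def)
    then have "int p dvd U (m div 2)" using iff by simp
    then show "even m \<and> even (U (m div 2)) \<and> m \<ge> 2" using m2 p2 dpos by (auto simp: Suc_le_eq)
  qed
  have n_div: "n div p = m" using m prime_gt_0_nat[OF p(1)] by simp
  have vm: "v m > 0" using v_pos m by simp
  define a where "a = multiplicity p (v m)"
  have "a < j"
  proof (rule ccontr)
    assume "\<not> a < j"
    then have "p ^ j dvd v m" unfolding a_def by (intro multiplicity_dvd') auto
    then show False using new[of m] m mn by blast
  qed
  moreover have "j < Suc (Suc a)"
  proof (rule ccontr)
    assume "\<not> j < Suc (Suc a)"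
    then have "p ^ Suc (Suc a) dvd v n" using p(3) by (meson dvd_trans le_imp_power_dvd not_less)
    then have c: "int p ^ Suc (Suc a) dvd U m * lucas_U (V m) (Q ^ m) p"
      using int_dvd_U[of p "Suc (Suc a)" n] U_mult[of p m] m by simp
    obtain w where w: "v m = p ^ a * w" "\<not> p dvd w"
      unfolding a_def using multiplicity_decompose'[of "v m" p] vm p by (metis not_prime_unit less_irrefl)
    have "U m = int p ^ a * int w" using w int_v[of m] by simp
    then have "int p ^ a * int p ^ 2 dvd int p ^ a * (int w * lucas_U (V m) (Q ^ m) p)"
      using c by (simp add: power2_eq_square mult_ac)
    then have "int p ^ 2 dvd int w * lucas_U (V m) (Q ^ m) p"
      using prime_gt_0_nat[OF p(1)] by simp
    moreover have "coprime (int p ^ 2) (int w)" using w p' by (simp add: prime_imp_coprime)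
    ultimately show False using ndv coprime_dvd_mult_right_iff by blast
  qed
  ultimately show "j = Suc (multiplicity p (v (n div p)))" using n_div a_def by simp
qed

theorem primitive_divisor_exists:
  assumes n: "n \<ge> 13"
  shows "\<exists>p. primitive_divisor v n p"
proof (rule ccontr)
  assume nonprim: "\<not> ?thesis"
  note np = new_prime_powers_nonprimitive[OF n nonprim]
  \<comment> \<open>The larger prime divides the rank of the smaller one, which is at most
    \<open>p + 1\<close>, so the two are 2 and 3. Then \<open>n = 3 * 2 ^ k\<close> contains 3 only
    once, and the rank of 3 is at most 4, whence \<open>n <= 12\<close>.\<close>
  have lt: False if pj: "(p, j) \<in> new_prime_powers n" "(p', j') \<in> new_prime_powers n" "p < p'" for p j p' j'
  proof -
    obtain k where k: "n = rank (int p) * p ^ k" using np(2)[OF pj(1)] by blast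
    obtain k' where k': "n = rank (int p') * p' ^ k'" "k' \<ge> 1" using np(2)[OF pj(2)] by blast
    have pr: "prime p" "prime p'" using np(1) pj by blast+
    have "p' dvd n" using k' by (simp add: dvd_power)
    moreover have "\<not> p' dvd p ^ k" using pr pj(3) primes_dvd_imp_eq prime_dvd_power by blast
    ultimately have d: "p' dvd rank (int p)" using k pr(2) by (simp add: prime_dvd_mult_iff)
    have rpos: "rank (int p) > 0" using k n by (intro Nat.gr0I) auto
    have "p' \<le> rank (int p)" using d rpos by (rule dvd_imp_le)
    moreover have le: "rank (int p) \<le> p + 1" using np(3)[OF pj(1)] .
    ultimately have p': "p' = p + 1" "rank (int p) = p + 1" using pj(3) by auto
    have "p = 2"
    proof (rule ccontr)
      assume "p \<noteq> 2"
      then have "odd p" using pr primes_dvd_imp_eq two_is_prime_nat by blast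
      then have "even p'" using p' by simp
      then have "p' = 2" using pr primes_dvd_imp_eq two_is_prime_nat by blast
      then show False using p' prime_gt_1_nat[OF pr(1)] by simp
    qed
    then have eq: "3 * 2 ^ k = rank (int p') * 3 ^ k'" and p3: "p' = 3" using k k' p' by auto
    have "k' = 1"
    proof (rule ccontr)
      assume "k' \<noteq> 1"
      then have "k' = Suc (Suc (k' - 2))" using k'(2) by simp
      then obtain i where "k' = Suc (Suc i)" by blast
      then have "3 * 2 ^ k = 3 * (3 * (rank (int p') * 3 ^ i))" using eq by simp
      then have "(2::nat) ^ k = 3 * (rank (int p') * 3 ^ i)" by linarith
      then have "3 dvd (2::nat) ^ k" by simp
      moreover have "prime (3::nat)" using pr(2) p3 by simp
      ultimately have "3 dvd (2::nat)" by (rule prime_dvd_power[rotated])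
      then show False by simp
    qed
    then show False using k' np(3)[OF pj(2)] p3 n by simp
  qed
  have uniq: "x = y" if "x \<in> new_prime_powers n" "y \<in> new_prime_powers n" for x y
  proof -
    obtain p j p' j' where xy: "x = (p, j)" "y = (p', j')" by (metis surj_pair)
    have "p = p'" using lt[of p j p' j'] lt[of p' j' p j] that xy by (metis linorder_neqE_nat)
    then show ?thesis using np(4) that xy by metis
  qed
  \<comment> \<open>At most one pair is left, and its prime divides \<open>n\<close>, so
    \<open>p - 1 = totient p\<close> is at most \<open>totient n\<close>.\<close>
  have "ln_cyclotomic n \<le> ln (real (totient n + 1))"
  proof (cases "new_prime_powers n = {}")
    case True
    then show ?thesis using ln_cyclotomic_eq[of n] n by simp
  next
    case False
    then obtain p j where pj: "(p, j) \<in> new_prime_powers n" by auto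
    then have "new_prime_powers n = {(p, j)}" using uniq by blast
    then have "ln_cyclotomic n = ln (real p)" using ln_cyclotomic_eq[of n] n by simp
    moreover have "p dvd n"
    proof -
      obtain k where "n = rank (int p) * p ^ k" "k \<ge> 1" using np(2)[OF pj] by blast
      then show ?thesis by (simp add: dvd_power)
    qed
    then have "totient p \<le> totient n" using totient_dvd_mono[of p n] n by simp
    then have "p \<le> totient n + 1" using np(1)[OF pj] by (simp add: totient_prime)
    moreover have "p > 0" using np(1)[OF pj] by (rule prime_gt_0_nat)
    ultimately show ?thesis by (simp add: ln_mono)
  qed
  moreover have "ln_cyclotomic n \<ge> (real (totient n) - 1) / 4 * ln 5" using n by (intro ln_cyclotomic_ge) auto
  ultimately have "(real (totient n) - 1) * ln 5 \<le> 4 * ln (real (totient n + 1))" by simp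
  moreover have "(real (totient n) - 1) * ln 5 = ln (real (5 ^ (totient n - 1)))"
    using six_le_totient[OF n] by (simp add: ln_realpow of_nat_diff)
  moreover have "4 * ln (real (totient n + 1)) = ln (real ((totient n + 1) ^ 4))"
    by (simp add: ln_realpow)
  ultimately have "ln (real (5 ^ (totient n - 1))) \<le> ln (real ((totient n + 1) ^ 4))" by linarith
  then have "real (5 ^ (totient n - 1)) \<le> real ((totient n + 1) ^ 4)"
    by (subst (asm) ln_le_cancel_iff) auto
  then show False using power_exceeds_fourth_power[OF six_le_totient[OF n]] by linarith
qed

end

section \<open>Geometric, exponential, Laplace and Cauchy laws\<close>

lemma geometric_pmf_integral:
  fixes f :: "nat \<Rightarrow> 'b :: {banach, second_countable_topology}"
  assumes q: "0 < q" "q < 1" and sm: "summable (\<lambda>n. q ^ n * norm (f n))"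
  shows "integrable (measure_pmf (geometric_pmf (1 - q))) f"
    and "(\<lambda>n. ((1 - q) * q ^ n) *\<^sub>R f n) sums measure_pmf.expectation (geometric_pmf (1 - q)) f"
proof -
  have pmf: "pmf (geometric_pmf (1 - q)) n = (1 - q) * q ^ n" for n
    using q by (simp add: pmf_geometric)
  have "summable (\<lambda>n. norm (((1 - q) * q ^ n) *\<^sub>R f n))"
    using summable_mult[OF sm, of "1 - q"] q by (simp add: mult.assoc)
  then have int: "integrable (count_space UNIV) (\<lambda>n. pmf (geometric_pmf (1 - q)) n *\<^sub>R f n)"
    unfolding pmf integrable_count_space_nat_iff .
  show "integrable (measure_pmf (geometric_pmf (1 - q))) f"
    unfolding measure_pmf_eq_density using int by (subst integrable_density) auto
  have "measure_pmf.expectation (geometric_pmf (1 - q)) f = integral\<^sup>L (count_space UNIV) (\<lambda>n. pmf (geometric_pmf (1 - q)) n *\<^sub>R f n)"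
    unfolding measure_pmf_eq_density by (subst integral_density) auto
  then show "(\<lambda>n. ((1 - q) * q ^ n) *\<^sub>R f n) sums measure_pmf.expectation (geometric_pmf (1 - q)) f"
    using sums_integral_count_space_nat[OF int] by (simp add: pmf)
qed

text \<open>Differentiating the geometric series three times termwise gives a convergent series that
  dominates the cubes.\<close>

lemma summable_cube_power:
  fixes q :: real
  assumes "0 \<le> q" "q < 1"
  shows "summable (\<lambda>n. q ^ n * (real n + 1) ^ 3)"
proof -
  have *: "summable (\<lambda>n. diffs c n * x ^ n)" if "\<And>x. \<bar>x\<bar> < 1 \<Longrightarrow> summable (\<lambda>n. c n * x ^ n)" "\<bar>x\<bar> < 1"
    for c :: "nat \<Rightarrow> real" and x
    using termdiff_converges[of x 1 c] that by simp
  have "summable (\<lambda>n. (\<lambda>_. 1) n * x ^ n)" if "\<bar>x\<bar> < 1" for x :: real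
    using that by (simp add: summable_geometric)
  then have "summable (\<lambda>n. diffs (diffs (diffs (\<lambda>_. 1))) n * q ^ n)"
    using assms by (intro *) auto
  then have "summable (\<lambda>n. (real n + 1) * ((real n + 2) * (real n + 3)) * q ^ n)"
    by (simp add: diffs_def algebra_simps)
  then show ?thesis
  proof (rule summable_comparison_test'[where N = 0])
    fix n :: nat
    have "(real n + 1) ^ 3 \<le> (real n + 1) * ((real n + 2) * (real n + 3))"
      unfolding power3_eq_cube mult.assoc by (intro mult_mono) auto
    then show "norm (q ^ n * (real n + 1) ^ 3) \<le> (real n + 1) * ((real n + 2) * (real n + 3)) * q ^ n"
      using assms by (simp add: mult.commute mult_left_mono)
  qed
qed

lemma summable_power_moments:
  fixes q :: real
  assumes "0 \<le> q" "q < 1" "k \<le> 3"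
  shows "summable (\<lambda>n. q ^ n * (real n + 1) ^ k)" "summable (\<lambda>n. q ^ n * real n ^ k)"
proof -
  show "summable (\<lambda>n. q ^ n * (real n + 1) ^ k)"
    using summable_cube_power[OF assms(1,2)]
    by (rule summable_comparison_test'[where N = 0])
       (use assms in \<open>auto intro!: mult_left_mono power_increasing\<close>)
  then show "summable (\<lambda>n. q ^ n * real n ^ k)"
    by (rule summable_comparison_test'[where N = 0])
       (use assms in \<open>auto intro!: mult_left_mono power_mono\<close>)
qed

lemma geometric_pmf_moments:
  assumes q: "0 < q" "q < 1" and r: "r = q / (1 - q)"
  shows "k \<le> 3 \<Longrightarrow> integrable (measure_pmf (geometric_pmf (1 - q))) (\<lambda>a. real a ^ k)"
    and "measure_pmf.expectation (geometric_pmf (1 - q)) (\<lambda>a. real a) = r"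
    and "measure_pmf.expectation (geometric_pmf (1 - q)) (\<lambda>a. real a ^ 2) = 2 * r ^ 2 + r"
    and "measure_pmf.expectation (geometric_pmf (1 - q)) (\<lambda>a. real a ^ 3) = 6 * r ^ 3 + 6 * r ^ 2 + r"
proof -
  let ?G = "geometric_pmf (1 - q)"
  have sm: "summable (\<lambda>n. q ^ n * norm (real n ^ k))" "summable (\<lambda>n. q ^ n * norm (real (Suc n) ^ k))" if "k \<le> 3" for k
    using summable_power_moments[of q k] q that by (simp_all add: add.commute)
  show int: "integrable (measure_pmf ?G) (\<lambda>a. real a ^ k)" if "k \<le> 3" for k
    using geometric_pmf_integral(1)[OF q sm(1)[OF that]] .
  have intS: "integrable (measure_pmf ?G) (\<lambda>a. real (Suc a) ^ k)" if "k \<le> 3" for k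
    using geometric_pmf_integral(1)[OF q sm(2)[OF that]] .
  define E where "E k = measure_pmf.expectation ?G (\<lambda>a. real a ^ k)" for k :: nat
  \<comment> \<open>The term at 0 vanishes for \<open>k >= 1\<close>; shifting the index then
    extracts a factor \<open>q\<close>. Expanding \<open>(a + 1) ^ k\<close> gives a linear equation
    for each moment in terms of lower ones.\<close>
  have rec: "E k = q * measure_pmf.expectation ?G (\<lambda>a. real (Suc a) ^ k)" if k: "k \<le> 3" "k \<ge> 1" for k
  proof -
    have "(\<lambda>n. (1 - q) * q ^ n * real n ^ k) sums E k"
      using geometric_pmf_integral(2)[OF q sm(1)[OF k(1)]] by (simp add: E_def)
    then have "(\<lambda>n. (1 - q) * q ^ Suc n * real (Suc n) ^ k) sums E k"
      using k(2) by (subst sums_Suc_iff) (simp add: zero_power)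
    moreover have "(\<lambda>n. q * ((1 - q) * q ^ n * real (Suc n) ^ k)) sums (q * measure_pmf.expectation ?G (\<lambda>a. real (Suc a) ^ k))"
      using geometric_pmf_integral(2)[OF q sm(2)[OF k(1)]] by (intro sums_mult) simp
    ultimately show ?thesis
      by (simp add: mult_ac sums_unique2)
  qed
  have E0: "E 0 = 1" by (simp add: E_def)
  have i: "integrable (measure_pmf ?G) (\<lambda>a. real a)" "integrable (measure_pmf ?G) (\<lambda>a. real a ^ 2)"
    "integrable (measure_pmf ?G) (\<lambda>a. real a ^ 3)"
    using int[of 1] int[of 2] int[of 3] by simp_all
  have "E 1 = q * (E 1 + 1)"
    using rec[of 1] i by (simp add: E_def add.commute)
  then have "(1 - q) * E 1 = q" by (simp add: algebra_simps)
  then have E1: "E 1 = r" using q unfolding r by (simp add: eq_divide_eq mult.commute)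
  have "E 2 = q * measure_pmf.expectation ?G (\<lambda>a. 1 + 2 * real a + real a ^ 2)"
    using rec[of 2] by (simp add: power2_eq_square algebra_simps)
  also have "measure_pmf.expectation ?G (\<lambda>a. 1 + 2 * real a + real a ^ 2) = 1 + 2 * E 1 + E 2"
    using i by (simp add: E_def)
  finally have "E 2 = q * (1 + 2 * r + E 2)" using E1 by simp
  then have "(1 - q) * E 2 = q * (1 + 2 * r)" by (simp add: algebra_simps)
  also have "q * (1 + 2 * r) = (1 - q) * (r * (1 + 2 * r))" using q unfolding r by simp
  finally have "E 2 = r * (1 + 2 * r)" using q by simp
  then have E2: "E 2 = 2 * r ^ 2 + r" by (simp add: algebra_simps power2_eq_square)
  have "E 3 = q * measure_pmf.expectation ?G (\<lambda>a. 1 + 3 * real a + 3 * real a ^ 2 + real a ^ 3)"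
    using rec[of 3] by (simp add: power2_eq_square power3_eq_cube algebra_simps)
  also have "measure_pmf.expectation ?G (\<lambda>a. 1 + 3 * real a + 3 * real a ^ 2 + real a ^ 3) = 1 + 3 * E 1 + 3 * E 2 + E 3"
    using i by (simp add: E_def)
  finally have "(1 - q) * E 3 = q * (1 + 3 * r + 3 * (2 * r ^ 2 + r))" using E1 E2 by (simp add: algebra_simps)
  also have "q * (1 + 3 * r + 3 * (2 * r ^ 2 + r)) = (1 - q) * (r * (1 + 3 * r + 3 * (2 * r ^ 2 + r)))" using q unfolding r by simp
  finally have "E 3 = r * (1 + 3 * r + 3 * (2 * r ^ 2 + r))" using q by simp
  then have E3: "E 3 = 6 * r ^ 3 + 6 * r ^ 2 + r" by (simp add: algebra_simps power2_eq_square power3_eq_cube)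
  show "measure_pmf.expectation ?G (\<lambda>a. real a) = r"
    "measure_pmf.expectation ?G (\<lambda>a. real a ^ 2) = 2 * r ^ 2 + r"
    "measure_pmf.expectation ?G (\<lambda>a. real a ^ 3) = 6 * r ^ 3 + 6 * r ^ 2 + r"
    using E1 E2 E3 by (simp_all add: E_def)
qed

lemma geometric_pmf_central_moments:
  assumes q: "0 < q" "q < 1" and r: "r = q / (1 - q)"
  defines "G \<equiv> measure_pmf (geometric_pmf (1 - q))"
  shows "integrable G (\<lambda>a. real a - r)" "integral\<^sup>L G (\<lambda>a. real a - r) = 0"
    "integrable G (\<lambda>a. (real a - r) ^ 2)" "integral\<^sup>L G (\<lambda>a. (real a - r) ^ 2) = r * (1 + r)"
    "integrable G (\<lambda>a. \<bar>real a - r\<bar> ^ 3)" "integral\<^sup>L G (\<lambda>a. \<bar>real a - r\<bar> ^ 3) \<le> 28 * (r * (1 + r) ^ 2)"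
proof -
  note m = geometric_pmf_moments[OF q r]
  have i: "integrable G (\<lambda>a. real a)" "integrable G (\<lambda>a. real a ^ 2)" "integrable G (\<lambda>a. real a ^ 3)"
    unfolding G_def using m(1)[of 1] m(1)[of 2] m(1)[of 3] by simp_all
  have e: "integral\<^sup>L G (\<lambda>a. real a) = r" "integral\<^sup>L G (\<lambda>a. real a ^ 2) = 2 * r ^ 2 + r"
    "integral\<^sup>L G (\<lambda>a. real a ^ 3) = 6 * r ^ 3 + 6 * r ^ 2 + r" unfolding G_def by (rule m)+
  have [simp]: "integrable G (\<lambda>_. c)" "integral\<^sup>L G (\<lambda>_. c) = c" for c :: real
    unfolding G_def by simp_all
  have [simp]: "measure G (space G) = 1" unfolding G_def by simp
  have r0: "r \<ge> 0" using q r by simp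
  show "integrable G (\<lambda>a. real a - r)" using i by simp
  show "integral\<^sup>L G (\<lambda>a. real a - r) = 0" using i e by simp
  have sq: "(real a - r) ^ 2 = real a ^ 2 - 2 * r * real a + r ^ 2" for a
    by (simp add: power2_eq_square algebra_simps)
  show "integrable G (\<lambda>a. (real a - r) ^ 2)" unfolding sq using i by simp
  show "integral\<^sup>L G (\<lambda>a. (real a - r) ^ 2) = r * (1 + r)" unfolding sq using i e
    by (simp add: power2_eq_square algebra_simps)
  \<comment> \<open>Convexity of the cube on the half-line. Inserting the third moment gives
    \<open>28 * r ^ 3 + 24 * r ^ 2 + 4 * r\<close>, which explains the constant 28.\<close>
  have le: "\<bar>real a - r\<bar> ^ 3 \<le> 4 * real a ^ 3 + 4 * r ^ 3" for a
  proof -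
    let ?x = "real a"
    have "\<bar>?x - r\<bar> ^ 3 \<le> (?x + r) ^ 3" using r0 by (intro power_mono) auto
    also have "(?x + r) ^ 3 \<le> 4 * ?x ^ 3 + 4 * r ^ 3"
    proof -
      have "4 * ?x ^ 3 + 4 * r ^ 3 - (?x + r) ^ 3 = 3 * ((?x + r) * (?x - r) ^ 2)"
        by (simp add: power2_eq_square power3_eq_cube algebra_simps)
      moreover have "\<dots> \<ge> 0" using r0 by simp
      ultimately show ?thesis by linarith
    qed
    finally show ?thesis .
  qed
  show i3: "integrable G (\<lambda>a. \<bar>real a - r\<bar> ^ 3)"
    by (rule Bochner_Integration.integrable_bound[where f = "\<lambda>a. 4 * real a ^ 3 + 4 * r ^ 3"])
       (use i le r0 in \<open>auto simp: G_def\<close>)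
  have "integral\<^sup>L G (\<lambda>a. \<bar>real a - r\<bar> ^ 3) \<le> integral\<^sup>L G (\<lambda>a. 4 * real a ^ 3 + 4 * r ^ 3)"
    using i i3 le by (intro integral_mono) auto
  also have "\<dots> = 4 * (7 * r ^ 3 + 6 * r ^ 2 + r)" using i e by simp
  also have "\<dots> \<le> 28 * (r * (1 + r) ^ 2)"
    using r0 by (simp add: power2_eq_square power3_eq_cube algebra_simps)
  finally show "integral\<^sup>L G (\<lambda>a. \<bar>real a - r\<bar> ^ 3) \<le> 28 * (r * (1 + r) ^ 2)" .
qed

lemma geometric_pmf_char:
  assumes q: "0 < q" "q < 1"
  shows "measure_pmf.expectation (geometric_pmf (1 - q)) (\<lambda>a. iexp (\<alpha> * real a)) = (1 - q) / (1 - q * iexp \<alpha>)"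
proof -
  have "(\<lambda>n. ((1 - q) * q ^ n) *\<^sub>R iexp (\<alpha> * real n)) sums measure_pmf.expectation (geometric_pmf (1 - q)) (\<lambda>a. iexp (\<alpha> * real a))"
    using q by (intro geometric_pmf_integral(2)) (auto simp: summable_geometric)
  moreover have "((1 - q) * q ^ n) *\<^sub>R iexp (\<alpha> * real n) = complex_of_real (1 - q) * (q * iexp \<alpha>) ^ n" for n
    by (simp add: scaleR_conv_of_real power_mult_distrib exp_of_nat_mult[symmetric] mult_ac)
  moreover have "(\<lambda>n. complex_of_real (1 - q) * (q * iexp \<alpha>) ^ n) sums (complex_of_real (1 - q) * (1 / (1 - q * iexp \<alpha>)))"
    using q by (intro sums_mult geometric_sums) (simp add: norm_mult)
  ultimately show ?thesis by (simp add: sums_unique2)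
qed

text \<open>Mean and variance of the geometric law with ratio \<open>exp (- z)\<close>.\<close>

definition geo_mean :: "real \<Rightarrow> real" where "geo_mean z = 1 / (exp z - 1)"

definition geo_var :: "real \<Rightarrow> real" where "geo_var z = exp (- z) / (1 - exp (- z)) ^ 2"

lemma geo_mean_eq:
  assumes "z > 0"
  shows "geo_mean z = exp (- z) / (1 - exp (- z))" "1 + geo_mean z = 1 / (1 - exp (- z))"
    "geo_mean z * (1 + geo_mean z) = geo_var z" "geo_mean z > 0" "geo_var z > 0"
proof -
  have e: "exp z > 1" using assms by simp
  show 1: "geo_mean z = exp (- z) / (1 - exp (- z))"
    using e by (simp add: geo_mean_def exp_minus field_simps)
  show 2: "1 + geo_mean z = 1 / (1 - exp (- z))"
    using e by (simp add: geo_mean_def exp_minus field_simps)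
  show "geo_mean z * (1 + geo_mean z) = geo_var z"
    unfolding 2 by (simp add: 1 geo_var_def power2_eq_square)
  show "geo_mean z > 0" using e by (simp add: geo_mean_def)
  show "geo_var z > 0" using assms by (simp add: geo_var_def)
qed

lemma one_minus_exp_bounds:
  fixes z :: real
  assumes "z > 0"
  shows "1 - exp (- z) \<le> z" "z \<le> (1 + z) * (1 - exp (- z))" "1 - exp (- z) > 0"
proof -
  show "1 - exp (- z) \<le> z" using exp_ge_add_one_self[of "- z"] by linarith
  have "(1 + z) * exp (- z) \<le> 1" using exp_ge_add_one_self[of z] by (simp add: exp_minus field_simps)
  then show "z \<le> (1 + z) * (1 - exp (- z))" by (simp add: algebra_simps)
qed (use assms in auto)

lemma geo_var_ge:
  assumes "z > 0"
  shows "exp (- z) / z ^ 2 \<le> geo_var z"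
  unfolding geo_var_def using one_minus_exp_bounds[OF assms] assms
  by (intro divide_left_mono power_mono) auto

text \<open>Since \<open>geo_var z\<close> is the inverse square of \<open>2 * sinh (z / 2)\<close>,
  this is the inequality \<open>z / 2 <= sinh (z / 2)\<close>.\<close>

lemma geo_var_le:
  assumes "z > 0"
  shows "geo_var z \<le> 1 / z ^ 2"
proof -
  have "z ^ 2 \<le> exp z * (1 - exp (- z)) ^ 2"
  proof -
    define y where "y = z / 2"
    have "z \<le> exp y - exp (- y)"
    proof -
      have "(\<lambda>y. exp y - exp (- y) - 2 * y) 0 \<le> (\<lambda>y. exp y - exp (- y) - 2 * y) y"
      proof (rule DERIV_nonneg_imp_nondecreasing[where f = "\<lambda>y. exp y - exp (- y) - 2 * y"])
        fix x :: real
        have "exp x + exp (- x) - 2 \<ge> 0"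
          using sum_squares_ge_zero[of "exp (x/2) - exp (-x/2)" 0]
          by (simp add: algebra_simps flip: exp_add)
        then show "\<exists>d. ((\<lambda>y. exp y - exp (- y) - 2 * y) has_real_derivative d) (at x) \<and> d \<ge> 0"
          by (intro exI[of _ "exp x + exp (- x) - 2"]) (auto intro!: derivative_eq_intros)
      qed (use assms y_def in auto)
      then show ?thesis by (simp add: y_def)
    qed
    then have "z ^ 2 \<le> (exp y - exp (- y)) ^ 2" using assms by (intro power_mono) auto
    also have "\<dots> = (exp y * (1 - exp (- z))) ^ 2" by (simp add: y_def algebra_simps flip: exp_add)
    also have "\<dots> = exp z * (1 - exp (- z)) ^ 2"
      unfolding power_mult_distrib by (simp add: y_def power2_eq_square flip: exp_add)
    finally show ?thesis .
  qed
  then show ?thesis using assms one_minus_exp_bounds(3)[OF assms]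
    by (simp add: geo_var_def exp_minus field_simps)
qed

text \<open>From \<open>1 + z <= 6 * exp (z / 6)\<close>; the constant is 6 cubed.\<close>

lemma one_plus_power_le:
  fixes z :: real
  assumes "z \<ge> 0"
  shows "(1 + z) ^ 3 * exp (- z) \<le> 216 * exp (- z / 2)"
proof -
  have "1 + z \<le> 6 * exp (z / 6)" using exp_ge_add_one_self[of "z / 6"] assms by linarith
  then have "(1 + z) ^ 3 \<le> (6 * exp (z / 6)) ^ 3" using assms by (intro power_mono) auto
  also have "\<dots> = 216 * exp (z / 2)" by (simp add: power_mult_distrib exp_of_nat_mult[symmetric])
  finally have "(1 + z) ^ 3 * exp (- z) \<le> 216 * exp (z / 2) * exp (- z)" by (intro mult_right_mono) auto
  also have "\<dots> = 216 * exp (- z / 2)" by (simp flip: exp_add)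
  finally show ?thesis .
qed

text \<open>As \<open>z / (1 - exp (- z)) <= 1 + z\<close>, the singularities at 0 cancel against
  the powers of \<open>z\<close>. What remains decays exponentially, so sums over \<open>n\<close>
  with \<open>z = s * lam n\<close> are \<open>O(1 / s)\<close>.\<close>

lemma geo_scaled_third_le:
  assumes "z > 0"
  shows "z ^ 3 * (geo_mean z * (1 + geo_mean z) ^ 2) \<le> 216 * exp (- z / 2)"
    and "z ^ 2 * geo_var z \<le> 216 * exp (- z / 2)"
proof -
  let ?d = "1 - exp (- z)"
  note b = one_minus_exp_bounds[OF assms]
  have zd: "z / ?d \<le> 1 + z" using b by (simp add: field_simps)
  have 3: "(z / ?d) ^ 3 \<le> (1 + z) ^ 3" using zd b assms by (intro power_mono) auto
  have "z ^ 3 * (geo_mean z * (1 + geo_mean z) ^ 2) = (z / ?d) ^ 3 * exp (- z)"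
    unfolding geo_mean_eq(2)[OF assms] unfolding geo_mean_eq(1)[OF assms] by (simp add: power_divide power2_eq_square power3_eq_cube)
  also have "\<dots> \<le> (1 + z) ^ 3 * exp (- z)" using 3 by (intro mult_right_mono) auto
  finally show "z ^ 3 * (geo_mean z * (1 + geo_mean z) ^ 2) \<le> 216 * exp (- z / 2)"
    using one_plus_power_le[of z] assms by linarith
  have "z ^ 2 * geo_var z = (z / ?d) ^ 2 * exp (- z)"
    by (simp add: geo_var_def power_divide)
  also have "\<dots> \<le> (1 + z) ^ 2 * exp (- z)" using zd b assms by (intro mult_right_mono power_mono) auto
  also have "\<dots> \<le> (1 + z) ^ 3 * exp (- z)" using assms by (intro mult_right_mono power_increasing) auto
  finally show "z ^ 2 * geo_var z \<le> 216 * exp (- z / 2)"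
    using one_plus_power_le[of z] assms by linarith
qed

text \<open>Centred, so that the first-order term vanishes and the distance from 1 is governed by
  the variance.\<close>

definition geo_char :: "real \<Rightarrow> real \<Rightarrow> complex" where
  "geo_char z \<alpha> = measure_pmf.expectation (geometric_pmf (1 - exp (- z))) (\<lambda>a. iexp (\<alpha> * (real a - geo_mean z)))"

lemma geo_char_eq:
  assumes "z > 0"
  shows "geo_char z \<alpha> =
    iexp (- \<alpha> * geo_mean z) * (1 - complex_of_real (exp (- z))) / (1 - complex_of_real (exp (- z)) * iexp \<alpha>)"
proof -
  have "geo_char z \<alpha> = measure_pmf.expectation (geometric_pmf (1 - exp (- z))) (\<lambda>a. iexp (- \<alpha> * geo_mean z) * iexp (\<alpha> * real a))"
    unfolding geo_char_def by (intro Bochner_Integration.integral_cong refl) (simp add: algebra_simps flip: exp_add)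
  also have "\<dots> = iexp (- \<alpha> * geo_mean z) * measure_pmf.expectation (geometric_pmf (1 - exp (- z))) (\<lambda>a. iexp (\<alpha> * real a))"
    by (rule integral_mult_right_zero)
  finally show ?thesis using geometric_pmf_char[of "exp (- z)" \<alpha>] assms by simp
qed

lemma norm_geo_char_le_1: "norm (geo_char z \<alpha>) \<le> 1"
proof -
  have "norm (geo_char z \<alpha>) \<le> measure_pmf.expectation (geometric_pmf (1 - exp (- z))) (\<lambda>a. norm (iexp (\<alpha> * (real a - geo_mean z))))"
    unfolding geo_char_def by (rule integral_norm_bound)
  then show ?thesis by simp
qed

text \<open>An exact formula for the modulus: decay at frequencies beyond the range of the Taylor
  expansion depends only on the variance and on \<open>1 - cos \<alpha>\<close>.\<close>

lemma norm_geo_char_square: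
  assumes "z > 0"
  shows "norm (geo_char z \<alpha>) ^ 2 = 1 / (1 + 2 * geo_var z * (1 - cos \<alpha>))"
proof -
  let ?q = "exp (- z)"
  have d: "1 - ?q > 0" using assms by simp
  have "norm (1 - ?q * iexp \<alpha>) ^ 2 = (1 - ?q * cos \<alpha>) ^ 2 + (?q * sin \<alpha>) ^ 2"
    by (simp add: cmod_power2 Re_exp Im_exp)
  also have "\<dots> = 1 - 2 * ?q * cos \<alpha> + ?q ^ 2 * (sin \<alpha> ^ 2 + cos \<alpha> ^ 2)"
  proof -
    have "(1 - q * c) ^ 2 + (q * s) ^ 2 = 1 - 2 * q * c + q ^ 2 * (s ^ 2 + c ^ 2)" for q c s :: real
      by (simp add: power2_eq_square algebra_simps)
    then show ?thesis by blast
  qed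
  also have "\<dots> = (1 - ?q) ^ 2 + 2 * ?q * (1 - cos \<alpha>)"
    unfolding sin_cos_squared_add by (simp add: power2_eq_square algebra_simps)
  finally have n: "norm (1 - ?q * iexp \<alpha>) ^ 2 = (1 - ?q) ^ 2 + 2 * ?q * (1 - cos \<alpha>)" .
  have "norm (geo_char z \<alpha>) ^ 2 = (1 - ?q) ^ 2 / norm (1 - ?q * iexp \<alpha>) ^ 2"
  proof -
    have "norm (complex_of_real 1 - complex_of_real ?q) = 1 - ?q"
      using d by (metis abs_of_pos norm_of_real of_real_diff)
    then show ?thesis
      unfolding geo_char_eq[OF assms] norm_mult norm_divide power_divide power_mult_distrib by simp
  qed
  also have "\<dots> = 1 / (1 + 2 * geo_var z * (1 - cos \<alpha>))"
    unfolding n geo_var_def using d by (simp add: add_divide_distrib[symmetric] divide_simps)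
  finally show ?thesis .
qed

section \<open>Fourier transforms of the exponential, Laplace and Cauchy laws\<close>

lemma integral_exp_half_line:
  fixes l t :: real
  assumes l: "l > 0"
  shows "integrable lborel (\<lambda>x. indicator {0..} x *\<^sub>R exp (complex_of_real x * (\<i> * t - l)))"
    and "integral\<^sup>L lborel (\<lambda>x. indicator {0..} x *\<^sub>R exp (complex_of_real x * (\<i> * t - l))) = 1 / (l - \<i> * t)"
proof -
  let ?w = "\<i> * t - l"
  have w0: "?w \<noteq> 0" using l by (simp add: complex_eq_iff)
  define f where "f x = exp (complex_of_real x * ?w)" for x
  have nrm: "norm (f x) = exp (- (l * x))" for x
    by (simp add: f_def norm_exp_eq_Re)
  interpret E: prob_space "density lborel (exponential_density l)"
    by (rule prob_space_exponential_density[OF l])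
  have "integrable (density lborel (exponential_density l)) (\<lambda>_. 1 :: real)" by simp
  then have e: "integrable lborel (exponential_density l)"
    using l by (subst (asm) integrable_density) (auto simp: exponential_density_nonneg)
  show int: "integrable lborel (\<lambda>x. indicator {0..} x *\<^sub>R exp (complex_of_real x * ?w))"
    unfolding f_def[symmetric]
    by (rule Bochner_Integration.integrable_bound[OF integrable_mult_right[OF e, of "1 / l"]])
       (use l in \<open>auto simp: f_def nrm[unfolded f_def] exponential_density_def indicator_def mult.commute intro!: AE_I2\<close>)
  have lim: "((\<lambda>b. LINT x:{0..b}|lborel. f x) \<longlongrightarrow> (LINT x:{0..}|lborel. f x)) at_top"
    by (rule tendsto_set_lebesgue_integral_at_top) (use int in \<open>auto simp: set_integrable_def f_def\<close>)
  have val: "(LINT x:{0..b}|lborel. f x) = f b / ?w - 1 / ?w" if "b \<ge> 0" for b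
  proof -
    have "(LINT x|lborel. indicator {0..b} x *\<^sub>R f x) = f b / ?w - f 0 / ?w"
    proof (rule integral_FTC_Icc[OF that])
      fix x
      have "((\<lambda>x. exp (complex_of_real x * ?w) / ?w) has_vector_derivative (f x)) (at x within {0..b})"
        unfolding f_def using w0
        by (intro has_vector_derivative_real_field[of "\<lambda>z. exp (z * ?w) / ?w"]) (auto intro!: derivative_eq_intros)
      then show "((\<lambda>x. f x / ?w) has_vector_derivative (f x)) (at x within {0..b})" by (simp add: f_def)
    qed (auto simp: f_def intro!: continuous_intros)
    then show ?thesis by (simp add: set_lebesgue_integral_def f_def)
  qed
  have f0: "(f \<longlongrightarrow> 0) at_top"
  proof (rule tendsto_norm_zero_cancel)
    show "((\<lambda>x. norm (f x)) \<longlongrightarrow> 0) at_top" unfolding nrm using l by real_asymp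
  qed
  have "((\<lambda>b. f b / ?w - 1 / ?w) \<longlongrightarrow> 0 / ?w - 1 / ?w) at_top"
    by (intro tendsto_intros f0 w0)
  then have "((\<lambda>b. LINT x:{0..b}|lborel. f x) \<longlongrightarrow> 0 / ?w - 1 / ?w) at_top"
    by (rule Lim_transform_eventually) (auto intro!: eventually_mono[OF eventually_ge_at_top[of 0]] simp: val)
  then have "(LINT x:{0..}|lborel. f x) = 0 / ?w - 1 / ?w"
    using lim by (intro tendsto_unique[OF _ lim]) auto
  also have "\<dots> = 1 / (l - \<i> * t)" by (simp add: minus_divide_right)
  finally show "integral\<^sup>L lborel (\<lambda>x. indicator {0..} x *\<^sub>R exp (complex_of_real x * ?w)) = 1 / (l - \<i> * t)"
    by (simp add: set_lebesgue_integral_def f_def)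
qed

lemma char_exponential:
  assumes l: "l > 0"
  shows "char (density lborel (exponential_density l)) t = l / (l - \<i> * t)"
proof -
  have "char (density lborel (exponential_density l)) t = (CLINT x|lborel. exponential_density l x *\<^sub>R iexp (t * x))"
    unfolding char_def using l
    by (subst integral_density) (auto simp: exponential_density_nonneg)
  also have "\<dots> = (CLINT x|lborel. l *\<^sub>R (indicator {0..} x *\<^sub>R exp (complex_of_real x * (\<i> * t - l))))"
    by (intro Bochner_Integration.integral_cong refl)
       (auto simp: exponential_density_def indicator_def scaleR_conv_of_real algebra_simps exp_diff exp_minus
          divide_inverse simp flip: exp_of_real)
  also have "\<dots> = l *\<^sub>R (1 / (l - \<i> * t))"
    unfolding integral_scaleR_right using integral_exp_half_line[OF l] by simp
  finally show ?thesis by (simp add: scaleR_conv_of_real)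
qed

definition laplace_density :: "real \<Rightarrow> real" where "laplace_density x = exp (- \<bar>x\<bar>) / 2"

abbreviation laplace_distribution :: "real measure" where
  "laplace_distribution \<equiv> density lborel laplace_density"

lemma laplace_density_measurable [measurable]: "laplace_density \<in> borel_measurable borel"
  unfolding laplace_density_def by measurable

lemma laplace_char_integral:
  "integrable lborel (\<lambda>x. laplace_density x *\<^sub>R iexp (t * x))"
  "integral\<^sup>L lborel (\<lambda>x. laplace_density x *\<^sub>R iexp (t * x)) = 1 / (1 + t ^ 2)"
proof -
  define g where "g t x = indicator {0..} x *\<^sub>R exp (complex_of_real x * (\<i> * t - 1))" for t x :: real
  have g: "integrable lborel (g t)" "integral\<^sup>L lborel (g t) = 1 / (1 - \<i> * t)" for t
    unfolding g_def using integral_exp_half_line[of 1 t] by auto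
  have g': "integrable lborel (\<lambda>x. g (- t) (- x))" "integral\<^sup>L lborel (\<lambda>x. g (- t) (- x)) = 1 / (1 + \<i> * t)" for t
    using g[of "- t"] lborel_integrable_real_affine_iff[of "-1" "g (- t)" 0]
      lborel_integral_real_affine[of "-1" "g (- t)" 0] by auto
  \<comment> \<open>The two half-lines share the point 0, where the sum counts the density twice;
    hence the exceptional null set.\<close>
  have eq: "AE x in lborel. laplace_density x *\<^sub>R iexp (t * x) = (1/2) *\<^sub>R (g t x + g (- t) (- x))"
    using AE_lborel_singleton[of 0]
  proof eventually_elim
    case (elim x)
    have pos: "complex_of_real (exp (- x)) * iexp (t * x) = exp (complex_of_real x * (\<i> * t - 1))"
      unfolding exp_of_real[symmetric] exp_add[symmetric] by (simp add: algebra_simps)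
    have neg: "complex_of_real (exp x) * iexp (t * x) = exp (complex_of_real (- x) * (\<i> * complex_of_real (- t) - 1))"
      unfolding exp_of_real[symmetric] exp_add[symmetric] by (simp add: algebra_simps)
    show ?case
    proof (cases "x > 0")
      case True
      then have "laplace_density x *\<^sub>R iexp (t * x) = (1/2) *\<^sub>R (complex_of_real (exp (- x)) * iexp (t * x))"
        by (simp add: laplace_density_def scaleR_conv_of_real)
      then show ?thesis unfolding pos using True by (simp add: g_def)
    next
      case False
      then have "laplace_density x *\<^sub>R iexp (t * x) = (1/2) *\<^sub>R (complex_of_real (exp x) * iexp (t * x))"
        by (simp add: laplace_density_def scaleR_conv_of_real)
      then show ?thesis unfolding neg using False elim by (simp add: g_def)
    qed
  qed
  have i: "integrable lborel (\<lambda>x. (1/2) *\<^sub>R (g t x + g (- t) (- x)))"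
    using g(1)[of t] g'(1)[of t] by (intro integrable_scaleR_right Bochner_Integration.integrable_add)
  have m: "(\<lambda>x. laplace_density x *\<^sub>R iexp (t * x)) \<in> borel_measurable lborel" by simp
  show "integrable lborel (\<lambda>x. laplace_density x *\<^sub>R iexp (t * x))"
    using i m by (subst integrable_cong_AE[OF _ _ eq]) (auto dest: borel_measurable_integrable)
  have "integral\<^sup>L lborel (\<lambda>x. laplace_density x *\<^sub>R iexp (t * x)) = integral\<^sup>L lborel (\<lambda>x. (1/2) *\<^sub>R (g t x + g (- t) (- x)))"
    using i m eq by (intro integral_cong_AE) (auto dest: borel_measurable_integrable)
  also have "\<dots> = (1/2) *\<^sub>R (1 / (1 - \<i> * t) + 1 / (1 + \<i> * t))"
    using g[of t] g'[of t] by (simp del: of_real_minus)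
  also have "\<dots> = 1 / (1 + t ^ 2)"
  proof -
    have nz: "1 - \<i> * t \<noteq> 0" "1 + \<i> * t \<noteq> 0" by (auto simp: complex_eq_iff)
    have "(1 - \<i> * t) * (1 + \<i> * t) = complex_of_real (1 + t ^ 2)"
      by (simp add: algebra_simps power2_eq_square complex_eq_iff)
    then have "complex_of_real (1 / (1 + t ^ 2)) = 1 / ((1 - \<i> * t) * (1 + \<i> * t))" by simp
    then show ?thesis using nz by (simp add: scaleR_conv_of_real add_frac_eq)
  qed
  finally show "integral\<^sup>L lborel (\<lambda>x. laplace_density x *\<^sub>R iexp (t * x)) = 1 / (1 + t ^ 2)" by simp
qed

lemma real_distribution_laplace: "real_distribution laplace_distribution"
proof -
  have i: "integrable lborel (\<lambda>x. complex_of_real (laplace_density x))"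
    and v: "integral\<^sup>L lborel (\<lambda>x. complex_of_real (laplace_density x)) = 1"
    using laplace_char_integral[of 0] by (simp_all add: scaleR_conv_of_real)
  have i': "integrable lborel laplace_density" using i by (simp add: complex_of_real_integrable_eq)
  have v': "integral\<^sup>L lborel laplace_density = 1" using v by (simp add: integral_complex_of_real)
  have "emeasure laplace_distribution UNIV = (\<integral>\<^sup>+x. ennreal (laplace_density x) \<partial>lborel)"
    by (simp add: emeasure_density)
  also have "\<dots> = 1" using i' v' by (subst nn_integral_eq_integral) (auto simp: laplace_density_def)
  finally have "prob_space laplace_distribution" by (intro prob_spaceI) simp
  then show ?thesis by (simp add: real_distribution_def real_distribution_axioms_def)
qed

lemma char_laplace: "char laplace_distribution t = 1 / (1 + t ^ 2)"
  unfolding char_def using laplace_char_integral(2)[of t]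
  by (subst integral_density) (auto simp: laplace_density_def)

lemma cdf_laplace_0: "cdf laplace_distribution 0 = 1 / 2" "isCont (cdf laplace_distribution) 0"
proof -
  interpret L: real_distribution laplace_distribution by (rule real_distribution_laplace)
  have sing: "measure laplace_distribution {x} = 0" for x
    by (simp add: measure_def emeasure_density nn_integral_0_iff_AE)
  then show "isCont (cdf laplace_distribution) 0" using L.isCont_cdf by simp
  have neg: "emeasure laplace_distribution {..0} = emeasure laplace_distribution {0..}"
  proof -
    have "emeasure laplace_distribution {..0} = (\<integral>\<^sup>+x. ennreal (laplace_density x) * indicator {..0} x \<partial>lborel)"
      by (simp add: emeasure_density)
    also have "\<dots> = (\<integral>\<^sup>+x. ennreal (laplace_density x) * indicator {0..} x \<partial>lborel)"
      by (subst nn_integral_real_affine[where c = "-1" and t = 0]) (auto simp: laplace_density_def indicator_def)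
    finally show ?thesis by (simp add: emeasure_density)
  qed
  have "measure laplace_distribution UNIV = measure laplace_distribution {..0} + measure laplace_distribution {0<..}"
    by (subst L.finite_measure_Union[symmetric]) (auto intro: arg_cong[where f = "measure _"])
  moreover have "measure laplace_distribution {0..} = measure laplace_distribution {0} + measure laplace_distribution {0<..}"
    by (subst L.finite_measure_Union[symmetric]) (auto intro: arg_cong[where f = "measure _"])
  ultimately have "1 = 2 * measure laplace_distribution {..0}"
    using neg sing[of 0] L.prob_space by (simp add: measure_def)
  then show "cdf laplace_distribution 0 = 1 / 2" by (simp add: cdf_def)
qed

definition cauchy_density :: "real \<Rightarrow> real" where "cauchy_density u = 1 / (pi * (1 + u ^ 2))"

lemma cauchy_density_measurable [measurable]: "cauchy_density \<in> borel_measurable borel"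
  unfolding cauchy_density_def by measurable

lemma cauchy_density_pos: "cauchy_density u > 0"
  by (simp add: cauchy_density_def add_pos_nonneg)

lemma cauchy_tail:
  assumes "R > 0"
  shows "(\<integral>\<^sup>+u. ennreal (cauchy_density u) * indicator {R..} u \<partial>lborel) \<le> ennreal (1 / (pi * R))"
proof -
  have "(\<integral>\<^sup>+u. ennreal (cauchy_density u) * indicator {R..} u \<partial>lborel) \<le> (\<integral>\<^sup>+u. ennreal (1 / (pi * u ^ 2)) * indicator {R..} u \<partial>lborel)"
    using assms by (intro nn_integral_mono) (auto simp: cauchy_density_def indicator_def intro!: ennreal_leI divide_left_mono mult_left_mono mult_pos_pos add_pos_nonneg)
  also have "\<dots> = ennreal (0 - (- 1 / (pi * R)))"
  proof (rule nn_integral_FTC_atLeast)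
    fix x assume "R \<le> x"
    then show "DERIV (\<lambda>x. - 1 / (pi * x)) x :> 1 / (pi * x ^ 2)"
      using assms by (auto intro!: derivative_eq_intros simp: power2_eq_square field_simps)
    show "0 \<le> 1 / (pi * x ^ 2)" by simp
  next
    show "((\<lambda>x. - 1 / (pi * x)) \<longlongrightarrow> 0) at_top" by real_asymp
  qed simp
  finally show ?thesis by simp
qed

lemma integrable_cauchy: "integrable lborel cauchy_density"
proof (rule integrableI_nonneg)
  have "(\<integral>\<^sup>+u. ennreal (cauchy_density u) \<partial>lborel) \<le>
    (\<integral>\<^sup>+u. ennreal (cauchy_density u) * indicator {1..} u + ennreal (cauchy_density (- u)) * indicator {1..} (- u) + indicator {-1..1} u \<partial>lborel)"
  proof (rule nn_integral_mono)
    fix u :: real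
    have "cauchy_density u \<le> 1"
      using pi_ge_two mult_mono[of 1 pi 1 "1 + u ^ 2"] by (simp add: cauchy_density_def field_simps)
    moreover have "cauchy_density (- u) = cauchy_density u" by (simp add: cauchy_density_def)
    ultimately show "ennreal (cauchy_density u) \<le> ennreal (cauchy_density u) * indicator {1..} u + ennreal (cauchy_density (- u)) * indicator {1..} (- u) + indicator {-1..1} u"
      by (auto simp: indicator_def)
  qed
  also have "\<dots> = (\<integral>\<^sup>+u. ennreal (cauchy_density u) * indicator {1..} u \<partial>lborel) + (\<integral>\<^sup>+u. ennreal (cauchy_density (- u)) * indicator {1..} (- u) \<partial>lborel) + 2"
    by (subst nn_integral_add; simp)+
  also have "(\<integral>\<^sup>+u. ennreal (cauchy_density (- u)) * indicator {1..} (- u) \<partial>lborel) = (\<integral>\<^sup>+u. ennreal (cauchy_density u) * indicator {1..} u \<partial>lborel)"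
    by (subst nn_integral_real_affine[where c = "-1" and t = 0 and f = "\<lambda>u. ennreal (cauchy_density u) * indicator {1..} u"]) auto
  also have "\<dots> + \<dots> + 2 < \<infinity>"
  proof -
    have "(\<integral>\<^sup>+u. ennreal (cauchy_density u) * indicator {1..} u \<partial>lborel) < \<infinity>"
      using cauchy_tail[of 1] by (rule le_less_trans) auto
    then show ?thesis by (simp add: ennreal_add_eq_top less_top[symmetric])
  qed
  finally show "(\<integral>\<^sup>+u. ennreal (cauchy_density u) \<partial>lborel) < \<infinity>" .
qed (auto simp: cauchy_density_pos less_imp_le)

text \<open>
  Fourier inversion for the Laplace density, by convolution with a Gaussian of standard
  deviation \<open>\<epsilon>\<close>.
\<close>

lemma gaussian_smoothing_laplace:
  assumes e: "\<epsilon> > 0"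
  shows "(CLINT x|std_normal_distribution. complex_of_real (exp (- \<bar>a + \<epsilon> * x\<bar>))) =
    (CLINT u|lborel. cauchy_density u *\<^sub>R (iexp (- a * u) * exp (- ((\<epsilon> * u) ^ 2) / 2)))"
proof -
  interpret N: real_distribution std_normal_distribution by (rule real_dist_normal_dist)
  interpret L: real_distribution laplace_distribution by (rule real_distribution_laplace)
  interpret LN: pair_sigma_finite laplace_distribution std_normal_distribution ..
  interpret NL: pair_prob_space laplace_distribution std_normal_distribution ..
  \<comment> \<open>The Gaussian is, up to scaling, its own Fourier transform. Writing it as a
    characteristic function turns the smoothed Laplace integral into a double integral in which the
    order can be exchanged.\<close>
  have gauss: "(CLINT v|std_normal_distribution. iexp (v * ((y - a) / \<epsilon>))) = complex_of_real (exp (- (((y - a) / \<epsilon>) ^ 2) / 2))" for y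
  proof -
    have "(CLINT v|std_normal_distribution. iexp (v * ((y - a) / \<epsilon>))) = char std_normal_distribution ((y - a) / \<epsilon>)"
      unfolding char_def by (simp only: mult.commute)
    then show ?thesis unfolding char_std_normal_distribution by simp
  qed
  have int: "integrable (laplace_distribution \<Otimes>\<^sub>M std_normal_distribution) (\<lambda>(y, v). iexp (v * ((y - a) / \<epsilon>)))"
    by (rule NL.P.integrable_const_bound[where B = 1]) (auto simp: case_prod_beta)
  have "(CLINT y|laplace_distribution. complex_of_real (exp (- (((y - a) / \<epsilon>) ^ 2) / 2))) =
     (CLINT y|laplace_distribution. CLINT v|std_normal_distribution. iexp (v * ((y - a) / \<epsilon>)))"
    unfolding gauss ..
  also have "\<dots> = (CLINT v|std_normal_distribution. CLINT y|laplace_distribution. iexp (v * ((y - a) / \<epsilon>)))"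
    using LN.Fubini_integral[OF int] by simp
  also have "\<dots> = (CLINT v|std_normal_distribution. iexp (- v * a / \<epsilon>) * (1 / (1 + (v / \<epsilon>) ^ 2)))"
  proof (intro Bochner_Integration.integral_cong refl)
    fix v :: real
    have "(CLINT y|laplace_distribution. iexp (v * ((y - a) / \<epsilon>))) = (CLINT y|laplace_distribution. iexp (- v * a / \<epsilon>) * iexp (v / \<epsilon> * y))"
      using e by (intro Bochner_Integration.integral_cong refl) (simp add: field_simps flip: exp_add)
    also have "\<dots> = iexp (- v * a / \<epsilon>) * char laplace_distribution (v / \<epsilon>)"
      unfolding char_def by (rule integral_mult_right_zero)
    finally show "(CLINT y|laplace_distribution. iexp (v * ((y - a) / \<epsilon>))) = iexp (- v * a / \<epsilon>) * (1 / (1 + (v / \<epsilon>) ^ 2))"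
      unfolding char_laplace by simp
  qed
  finally have eq: "(CLINT y|laplace_distribution. complex_of_real (exp (- (((y - a) / \<epsilon>) ^ 2) / 2))) =
    (CLINT v|std_normal_distribution. iexp (- v * a / \<epsilon>) * (1 / (1 + (v / \<epsilon>) ^ 2)))" .
  have "(CLINT y|laplace_distribution. complex_of_real (exp (- (((y - a) / \<epsilon>) ^ 2) / 2))) =
      (CLINT y|lborel. laplace_density y *\<^sub>R complex_of_real (exp (- (((y - a) / \<epsilon>) ^ 2) / 2)))"
    by (subst integral_density) (auto simp: laplace_density_def)
  also have "\<dots> = \<epsilon> *\<^sub>R (CLINT x|lborel. laplace_density (a + \<epsilon> * x) *\<^sub>R complex_of_real (exp (- (x ^ 2) / 2)))"
    using e by (subst lborel_integral_real_affine[where c = \<epsilon> and t = a]) auto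
  also have "(CLINT x|lborel. laplace_density (a + \<epsilon> * x) *\<^sub>R complex_of_real (exp (- (x ^ 2) / 2))) =
      (CLINT x|lborel. (sqrt (2 * pi) / 2) *\<^sub>R (std_normal_density x *\<^sub>R complex_of_real (exp (- \<bar>a + \<epsilon> * x\<bar>))))"
    by (intro Bochner_Integration.integral_cong refl) (simp add: laplace_density_def std_normal_density_def scaleR_conv_of_real)
  also have "\<dots> = (sqrt (2 * pi) / 2) *\<^sub>R (CLINT x|std_normal_distribution. complex_of_real (exp (- \<bar>a + \<epsilon> * x\<bar>)))"
    unfolding integral_scaleR_right by (subst integral_density) auto
  finally have lhs: "(CLINT y|laplace_distribution. complex_of_real (exp (- (((y - a) / \<epsilon>) ^ 2) / 2))) =
    \<epsilon> *\<^sub>R (sqrt (2 * pi) / 2) *\<^sub>R (CLINT x|std_normal_distribution. complex_of_real (exp (- \<bar>a + \<epsilon> * x\<bar>)))" .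
  have "(CLINT v|std_normal_distribution. iexp (- v * a / \<epsilon>) * (1 / (1 + (v / \<epsilon>) ^ 2))) =
     (CLINT v|lborel. std_normal_density v *\<^sub>R (iexp (- v * a / \<epsilon>) * (1 / (1 + (v / \<epsilon>) ^ 2))))"
    by (subst integral_density) auto
  also have "\<dots> = \<epsilon> *\<^sub>R (CLINT u|lborel. std_normal_density (\<epsilon> * u) *\<^sub>R (iexp (- u * a) * (1 / (1 + u ^ 2))))"
    using e by (subst lborel_integral_real_affine[where c = \<epsilon> and t = 0]) auto
  also have "(CLINT u|lborel. std_normal_density (\<epsilon> * u) *\<^sub>R (iexp (- u * a) * (1 / (1 + u ^ 2)))) =
     (CLINT u|lborel. (sqrt (2 * pi) / 2) *\<^sub>R (cauchy_density u *\<^sub>R (iexp (- a * u) * exp (- ((\<epsilon> * u) ^ 2) / 2))))"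
  proof (intro Bochner_Integration.integral_cong refl)
    fix u :: real
    have "1 / sqrt (2 * pi) = sqrt (2 * pi) / 2 * (1 / pi)"
      by (simp add: field_simps)
    then have "std_normal_density (\<epsilon> * u) * (1 / (1 + u ^ 2)) = sqrt (2 * pi) / 2 * cauchy_density u * exp (- ((\<epsilon> * u) ^ 2) / 2)"
      by (simp add: std_normal_density_def cauchy_density_def)
    then have "complex_of_real (std_normal_density (\<epsilon> * u) * (1 / (1 + u ^ 2))) * iexp (- u * a) = complex_of_real (sqrt (2 * pi) / 2 * cauchy_density u * exp (- ((\<epsilon> * u) ^ 2) / 2)) * iexp (- u * a)"
      by (simp only:)
    then show "std_normal_density (\<epsilon> * u) *\<^sub>R (iexp (- u * a) * (1 / (1 + u ^ 2))) = (sqrt (2 * pi) / 2) *\<^sub>R (cauchy_density u *\<^sub>R (iexp (- a * u) * exp (- ((\<epsilon> * u) ^ 2) / 2)))"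
      by (simp add: scaleR_conv_of_real mult_ac exp_of_real)
  qed
  also have "\<dots> = (sqrt (2 * pi) / 2) *\<^sub>R (CLINT u|lborel. cauchy_density u *\<^sub>R (iexp (- a * u) * exp (- ((\<epsilon> * u) ^ 2) / 2)))"
    by (rule integral_scaleR_right)
  finally show ?thesis using eq lhs e by simp
qed

text \<open>The width of the smoothing tends to 0. Dominated convergence applies on both sides, with
  the constant 1 against the Gaussian law and with the Cauchy density against Lebesgue
  measure.\<close>

lemma cauchy_char:
  "integrable lborel (\<lambda>u. cauchy_density u *\<^sub>R iexp (a * u))"
  "(CLINT u|lborel. cauchy_density u *\<^sub>R iexp (a * u)) = exp (- \<bar>a\<bar>)"
proof -
  interpret N: real_distribution std_normal_distribution by (rule real_dist_normal_dist)
  have int: "integrable lborel (\<lambda>u. cauchy_density u *\<^sub>R iexp (a * u))" for a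
    by (rule Bochner_Integration.integrable_bound[OF integrable_cauchy]) auto
  then show "integrable lborel (\<lambda>u. cauchy_density u *\<^sub>R iexp (a * u))" .
  define e where "e n = 1 / real (Suc n)" for n
  have e: "e n > 0" "e \<longlonglongrightarrow> 0" for n unfolding e_def using LIMSEQ_inverse_real_of_nat by (auto simp: inverse_eq_divide)
  have "(\<lambda>n. CLINT x|std_normal_distribution. complex_of_real (exp (- \<bar>- a + e n * x\<bar>))) \<longlonglongrightarrow> (CLINT x|std_normal_distribution. complex_of_real (exp (- \<bar>- a + 0 * x\<bar>)))"
  proof (rule integral_dominated_convergence[where w = "\<lambda>_. 1"])
    show "AE x in std_normal_distribution. (\<lambda>n. complex_of_real (exp (- \<bar>- a + e n * x\<bar>))) \<longlonglongrightarrow> complex_of_real (exp (- \<bar>- a + 0 * x\<bar>))"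
      by (intro AE_I2 tendsto_intros e)
  qed auto
  moreover have "(\<lambda>n. CLINT u|lborel. cauchy_density u *\<^sub>R (iexp (- (- a) * u) * exp (- ((e n * u) ^ 2) / 2))) \<longlonglongrightarrow>
     (CLINT u|lborel. cauchy_density u *\<^sub>R (iexp (- (- a) * u) * exp (- ((0 * u) ^ 2) / 2)))"
  proof (rule integral_dominated_convergence[where w = cauchy_density])
    show "AE u in lborel. (\<lambda>n. cauchy_density u *\<^sub>R (iexp (- (- a) * u) * exp (- ((e n * u) ^ 2) / 2))) \<longlonglongrightarrow>
        cauchy_density u *\<^sub>R (iexp (- (- a) * u) * exp (- ((0 * u) ^ 2) / 2))"
      by (intro AE_I2 tendsto_intros e) auto
  qed (auto intro!: integrable_cauchy mult_left_le simp: norm_mult cauchy_density_pos less_imp_le)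
  ultimately have "(CLINT x|std_normal_distribution. complex_of_real (exp (- \<bar>- a + 0 * x\<bar>))) = (CLINT u|lborel. cauchy_density u *\<^sub>R (iexp (- (- a) * u) * exp (- ((0 * u) ^ 2) / 2)))"
    unfolding gaussian_smoothing_laplace[OF e(1)] by (rule LIMSEQ_unique)
  then show "(CLINT u|lborel. cauchy_density u *\<^sub>R iexp (a * u)) = exp (- \<bar>a\<bar>)"
    using N.prob_space by simp
qed

section \<open>Convergence of the centred exponential series\<close>

text \<open>By Tonelli the expected sum of absolute values is finite, so the sum is finite almost
  surely.\<close>

lemma (in prob_space) AE_convergent_of_summable_L1:
  fixes Y :: "nat \<Rightarrow> 'a \<Rightarrow> real"
  assumes int: "\<And>i. integrable M (Y i)" and sm: "summable (\<lambda>i. expectation (\<lambda>\<omega>. \<bar>Y i \<omega>\<bar>))"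
  shows "AE \<omega> in M. summable (\<lambda>i. Y i \<omega>)"
proof -
  have "(\<integral>\<^sup>+\<omega>. (\<Sum>i. ennreal \<bar>Y i \<omega>\<bar>) \<partial>M) = (\<Sum>i. \<integral>\<^sup>+\<omega>. ennreal \<bar>Y i \<omega>\<bar> \<partial>M)"
    using int by (intro nn_integral_suminf) (auto dest: borel_measurable_integrable)
  also have "\<dots> = (\<Sum>i. ennreal (expectation (\<lambda>\<omega>. \<bar>Y i \<omega>\<bar>)))"
    using int by (intro suminf_cong nn_integral_eq_integral) auto
  also have "\<dots> = ennreal (\<Sum>i. expectation (\<lambda>\<omega>. \<bar>Y i \<omega>\<bar>))"
    using sm by (intro suminf_ennreal2) auto
  finally have "(\<integral>\<^sup>+\<omega>. (\<Sum>i. ennreal \<bar>Y i \<omega>\<bar>) \<partial>M) \<noteq> \<infinity>" by simp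
  then have "AE \<omega> in M. (\<Sum>i. ennreal \<bar>Y i \<omega>\<bar>) \<noteq> \<infinity>"
    using int by (intro nn_integral_PInf_AE) (auto dest: borel_measurable_integrable)
  then show ?thesis
  proof eventually_elim
    case (elim \<omega>)
    then have "summable (\<lambda>i. \<bar>Y i \<omega>\<bar>)" by (intro summable_suminf_not_top) auto
    then show ?case by (rule summable_rabs_cancel)
  qed
qed

lemma (in prob_space) expectation_abs_sum_indep_le:
  assumes fin: "finite J" and ind: "indep_vars (\<lambda>_. borel) Z J"
    and int: "\<And>i. i \<in> J \<Longrightarrow> integrable M (\<lambda>\<omega>. Z i \<omega> ^ 2)"
    and mean: "\<And>i. i \<in> J \<Longrightarrow> expectation (Z i) = 0"
    and var: "\<And>i. i \<in> J \<Longrightarrow> expectation (\<lambda>\<omega>. Z i \<omega> ^ 2) \<le> s i"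
  shows "integrable M (\<lambda>\<omega>. \<Sum>i\<in>J. Z i \<omega>)" "expectation (\<lambda>\<omega>. \<bar>\<Sum>i\<in>J. Z i \<omega>\<bar>) \<le> sqrt (\<Sum>i\<in>J. s i)"
proof -
  have m [measurable]: "\<And>i. i \<in> J \<Longrightarrow> Z i \<in> borel_measurable M"
    using ind by (auto simp: indep_vars_def)
  have iZ: "integrable M (Z i)" if "i \<in> J" for i
    using square_integrable_imp_integrable[OF m[OF that] int[OF that]] .
  show iS: "integrable M (\<lambda>\<omega>. \<Sum>i\<in>J. Z i \<omega>)" using iZ by auto
  have sq: "(\<Sum>i\<in>J. Z i \<omega>) ^ 2 = (\<Sum>i\<in>J. \<Sum>k\<in>J. Z i \<omega> * Z k \<omega>)" for \<omega>
    by (simp add: power2_eq_square sum_product)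
  have prod: "integrable M (\<lambda>\<omega>. Z i \<omega> * Z k \<omega>) \<and>
      expectation (\<lambda>\<omega>. Z i \<omega> * Z k \<omega>) = (if i = k then expectation (\<lambda>\<omega>. Z i \<omega> ^ 2) else 0)"
    if "i \<in> J" "k \<in> J" for i k
  proof (cases "i = k")
    case True
    then show ?thesis using int[OF that(1)] by (simp add: power2_eq_square)
  next
    case False
    have ind2: "indep_vars (\<lambda>_. borel) Z {i, k}"
      using indep_vars_subset[OF ind, of "{i, k}"] that by auto
    show ?thesis
      using indep_vars_integrable[OF _ ind2] indep_vars_lebesgue_integral[OF _ ind2] iZ that mean False by auto
  qed
  have iS2: "integrable M (\<lambda>\<omega>. (\<Sum>i\<in>J. Z i \<omega>) ^ 2)"
    unfolding sq using prod by (intro Bochner_Integration.integrable_sum) auto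
  have "expectation (\<lambda>\<omega>. (\<Sum>i\<in>J. Z i \<omega>) ^ 2) = (\<Sum>i\<in>J. \<Sum>k\<in>J. if i = k then expectation (\<lambda>\<omega>. Z i \<omega> ^ 2) else 0)"
    unfolding sq using prod by (subst Bochner_Integration.integral_sum; force intro!: sum.cong)+
  also have "\<dots> = (\<Sum>i\<in>J. expectation (\<lambda>\<omega>. Z i \<omega> ^ 2))" using fin by simp
  also have "\<dots> \<le> (\<Sum>i\<in>J. s i)" by (intro sum_mono var)
  finally have le: "expectation (\<lambda>\<omega>. (\<Sum>i\<in>J. Z i \<omega>) ^ 2) \<le> (\<Sum>i\<in>J. s i)" .
  \<comment> \<open>Nonnegativity of the variance of the absolute value is the Cauchy-Schwarz
    inequality between first and second moment.\<close>
  have "variance (\<lambda>\<omega>. \<bar>\<Sum>i\<in>J. Z i \<omega>\<bar>) \<ge> 0" by simp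
  then have "(expectation (\<lambda>\<omega>. \<bar>\<Sum>i\<in>J. Z i \<omega>\<bar>)) ^ 2 \<le> expectation (\<lambda>\<omega>. (\<Sum>i\<in>J. Z i \<omega>) ^ 2)"
    using iS iS2 by (subst (asm) variance_eq) auto
  then show "expectation (\<lambda>\<omega>. \<bar>\<Sum>i\<in>J. Z i \<omega>\<bar>) \<le> sqrt (\<Sum>i\<in>J. s i)"
    using le by (intro real_le_rsqrt) auto
qed

lemma exponential_second_moment:
  assumes "prob_space M" "0 < l" "distributed M lborel X (exponential_density l)"
  shows "integrable M (\<lambda>\<omega>. (X \<omega> - 1 / l) ^ 2)" "integral\<^sup>L M (\<lambda>\<omega>. (X \<omega> - 1 / l) ^ 2) = (1 / l) ^ 2"
    "integrable M X" "integral\<^sup>L M (\<lambda>\<omega>. X \<omega> - 1 / l) = 0" "AE \<omega> in M. X \<omega> \<ge> 0"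
    "X \<in> borel_measurable M"
proof -
  interpret prob_space M by fact
  have e: "expectation X = 1 / l" using exponential_distributed_expectation[OF assms(2,3)] .
  have X [measurable]: "X \<in> borel_measurable M" using distributed_measurable[OF assms(3)] by simp
  show "X \<in> borel_measurable M" by fact
  have v: "variance X = (1 / l) ^ 2"
    using exponential_distributed_variance[OF assms(2,3)] by (simp add: power_divide)
  show "AE \<omega> in M. X \<omega> \<ge> 0"
  proof -
    have "AE x in distr M lborel X. 0 \<le> x"
      unfolding distributed_distr_eq_density[OF assms(3)]
      using assms(2) by (subst AE_density) (auto simp: exponential_density_def)
    then show ?thesis by (subst (asm) AE_distr_iff) auto
  qed
  show "integrable M (\<lambda>\<omega>. (X \<omega> - 1 / l) ^ 2)"
  proof (rule ccontr)
    assume "\<not> ?thesis"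
    \<comment> \<open>A non-integrable function has integral 0 by convention, contradicting the
      known positive value.\<close>
    then have "variance X = 0" unfolding e by (rule not_integrable_integral_eq)
    then show False using v assms(2) by simp
  qed
  show "integral\<^sup>L M (\<lambda>\<omega>. (X \<omega> - 1 / l) ^ 2) = (1 / l) ^ 2" using v unfolding e .
  show i: "integrable M X"
  proof (rule ccontr)
    assume "\<not> ?thesis"
    then have "expectation X = 0" by (rule not_integrable_integral_eq)
    then show False using e assms(2) by simp
  qed
  then show "integral\<^sup>L M (\<lambda>\<omega>. X \<omega> - 1 / l) = 0" using e prob_space by simp
qed

text \<open>
  The partial sums converge along the squares, since the increments have summable
  \<open>L\<^sup>2\<close>-norms. Between two consecutive squares they are controlled from both ends, because
  the terms are bounded below by \<open>- 1 / l n\<close>.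
\<close>

theorem (in prob_space) AE_convergent_centred_exponentials:
  fixes X :: "nat \<Rightarrow> 'a \<Rightarrow> real" and l :: "nat \<Rightarrow> real"
  assumes c: "c > 0" and l: "\<And>n. n \<in> I \<Longrightarrow> l n \<ge> c * real n \<and> l n > 0" and I0: "0 \<notin> I"
    and ind: "indep_vars (\<lambda>_. borel) X I"
    and dist: "\<And>n. n \<in> I \<Longrightarrow> distributed M lborel (X n) (exponential_density (l n))"
  shows "AE \<omega> in M. convergent (\<lambda>N. \<Sum>n\<in>{n \<in> I. n \<le> N}. X n \<omega> - 1 / l n)"
proof -
  define T where "T N \<omega> = (\<Sum>n\<in>{n \<in> I. n \<le> N}. X n \<omega> - 1 / l n)" for N \<omega>
  define J where "J i = {n \<in> I. i ^ 2 < n \<and> n \<le> Suc i ^ 2}" for i :: nat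
  define D where "D i \<omega> = (\<Sum>n\<in>J i. X n \<omega> - 1 / l n)" for i \<omega>
  note em = exponential_second_moment[OF prob_space_axioms _ dist]
  have finJ: "finite (J i)" for i by (simp add: J_def)
  have step: "T (Suc i ^ 2) \<omega> = T (i ^ 2) \<omega> + D i \<omega>" for i \<omega>
  proof -
    have "{n \<in> I. n \<le> Suc i ^ 2} = {n \<in> I. n \<le> i ^ 2} \<union> J i"
      using power_mono[of i "Suc i" 2] by (auto simp: J_def intro: order_trans[of _ "i ^ 2"])
    then show ?thesis unfolding T_def D_def by (simp add: sum.union_disjoint finJ J_def disjoint_iff)
  qed
  have Tsum: "T (i ^ 2) \<omega> = (\<Sum>k<i. D k \<omega>)" for i \<omega>
  proof (induction i)
    case 0
    show ?case using I0 by (auto simp: T_def intro!: sum.neutral)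
  qed (simp add: step)
  have cardJ: "card (J i) \<le> 2 * i + 1" for i
  proof -
    have "card (J i) \<le> card {i ^ 2<..Suc i ^ 2}" by (intro card_mono) (auto simp: J_def)
    then show ?thesis by (simp add: power2_eq_square)
  qed
  have lJ: "1 / l n \<le> 1 / (c * real i ^ 2)" if "n \<in> J i" "i > 0" for n i
  proof -
    have "real i ^ 2 \<le> real n" using that by (simp add: J_def flip: of_nat_power)
    then have "c * real i ^ 2 \<le> c * real n" using c by (intro mult_left_mono) auto
    then have "c * real i ^ 2 \<le> l n" using l[of n] that by (simp add: J_def)
    moreover have "0 < c * real i ^ 2" using c that by simp
    ultimately show ?thesis by (intro frac_le) auto
  qed
  have block: "(\<Sum>n\<in>J i. 1 / l n) \<le> 3 / (c * real i)" if "i > 0" for i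
  proof -
    have "(\<Sum>n\<in>J i. 1 / l n) \<le> real (card (J i)) * (1 / (c * real i ^ 2))"
      using lJ[OF _ that] by (intro sum_bounded_above) auto
    also have "\<dots> \<le> (3 * real i) * (1 / (c * real i ^ 2))"
      using cardJ[of i] that c by (intro mult_right_mono) auto
    also have "\<dots> = 3 / (c * real i)" using that by (simp add: power2_eq_square)
    finally show ?thesis .
  qed
  have indJ: "indep_vars (\<lambda>_. borel) (\<lambda>n \<omega>. X n \<omega> - 1 / l n) (J i)" for i
    using indep_vars_compose2[OF indep_vars_subset[OF ind, of "J i"], of "\<lambda>n x. x - 1 / l n" "\<lambda>_. borel"]
    by (auto simp: J_def)
  have D: "integrable M (D i)" "expectation (\<lambda>\<omega>. \<bar>D i \<omega>\<bar>) \<le> sqrt (\<Sum>n\<in>J i. (1 / l n) ^ 2)" for i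
    unfolding D_def
    by (rule expectation_abs_sum_indep_le[OF finJ indJ]; use em l in \<open>force simp: J_def\<close>)+
  \<comment> \<open>A block has \<open>O(i)\<close> terms of variance \<open>O(i powr (-4))\<close>
    each, so its \<open>L2\<close> norm is \<open>O(i powr (-3/2))\<close>, a summable
    sequence.\<close>
  have Dle: "expectation (\<lambda>\<omega>. \<bar>D i \<omega>\<bar>) \<le> 2 / c * (real i powr (-3/2))" if "i > 0" for i
  proof -
    have "(\<Sum>n\<in>J i. (1 / l n) ^ 2) \<le> real (card (J i)) * (1 / (c * real i ^ 2)) ^ 2"
      using lJ[OF _ that] l by (intro sum_bounded_above power_mono) (auto simp: J_def less_imp_le)
    also have "\<dots> \<le> (4 * real i) * (1 / (c * real i ^ 2)) ^ 2"
      using cardJ[of i] that by (intro mult_right_mono) auto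
    also have "\<dots> = (2 / c) ^ 2 * (1 / real i ^ 3)"
      using that by (simp add: power2_eq_square power3_eq_cube)
    also have "1 / real i ^ 3 = (real i powr (-3/2)) ^ 2"
    proof -
      have "(real i powr (-3/2)) ^ 2 = real i powr (-3)" using that by (simp add: powr_power)
      also have "\<dots> = 1 / real i ^ 3" using that by (simp add: powr_minus divide_inverse)
      finally show ?thesis ..
    qed
    finally have "sqrt (\<Sum>n\<in>J i. (1 / l n) ^ 2) \<le> sqrt ((2 / c * (real i powr (-3/2))) ^ 2)"
      by (simp only: power_mult_distrib real_sqrt_le_mono)
    then show ?thesis using D(2)[of i] c by simp
  qed
  have "summable (\<lambda>i. 2 / c * (real i powr (-3/2)))"
    by (intro summable_mult) (simp add: summable_real_powr_iff)
  then have "summable (\<lambda>i. expectation (\<lambda>\<omega>. \<bar>D i \<omega>\<bar>))"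
    by (rule summable_comparison_test'[where N = 1]) (use Dle in auto)
  then have "AE \<omega> in M. summable (\<lambda>i. D i \<omega>)"
    using D by (intro AE_convergent_of_summable_L1) auto
  moreover have "AE \<omega> in M. \<forall>n. n \<in> I \<longrightarrow> X n \<omega> \<ge> 0"
    using em(5) l by (subst AE_all_countable) (auto simp: AE_impI)
  ultimately show ?thesis
  proof eventually_elim
    case (elim \<omega>)
    define S where "S = (\<Sum>i. D i \<omega>)"
    have sq: "(\<lambda>i. T (i ^ 2) \<omega>) \<longlonglongrightarrow> S"
      unfolding Tsum S_def using elim(1) by (rule summable_LIMSEQ)
    define i where "i N = nat \<lfloor>sqrt (real N)\<rfloor>" for N
    have iN: "i N ^ 2 \<le> N" "N < Suc (i N) ^ 2" for N
    proof -
      have a: "real (i N) \<le> sqrt (real N)" "sqrt (real N) < real (Suc (i N))"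
      proof -
        have "real (i N) = real_of_int \<lfloor>sqrt (real N)\<rfloor>" by (simp add: i_def)
        then show "real (i N) \<le> sqrt (real N)" "sqrt (real N) < real (Suc (i N))" by linarith+
      qed
      have "real (i N) ^ 2 \<le> real N" using a(1) by (metis of_nat_0_le_iff real_sqrt_pow2 power_mono)
      then show "i N ^ 2 \<le> N" by (simp flip: of_nat_power)
      have "real N < real (Suc (i N)) ^ 2" using a(2) by (metis of_nat_0_le_iff power2_less_imp_less real_sqrt_pow2 real_sqrt_less_iff real_less_lsqrt not_le real_le_rsqrt)
      then show "N < Suc (i N) ^ 2" by (simp flip: of_nat_power del: of_nat_Suc)
    qed
    have lim_i: "filterlim i at_top sequentially"
      unfolding i_def by (rule filterlim_compose[OF filterlim_nat_sequentially]) real_asymp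
    define e where "e N = 3 / (c * real (i N))" for N
    have e0: "e \<longlonglongrightarrow> 0"
    proof -
      have "(\<lambda>i. 3 / (c * real i)) \<longlonglongrightarrow> 0" using c by real_asymp
      then show ?thesis unfolding e_def by (rule filterlim_compose[OF _ lim_i])
    qed
    have bounds: "T (i N ^ 2) \<omega> - e N \<le> T N \<omega>" "T N \<omega> \<le> T (Suc (i N) ^ 2) \<omega> + e N" if "i N > 0" for N
    proof -
      define A where "A = {n \<in> J (i N). n \<le> N}"
      define B where "B = {n \<in> J (i N). n > N}"
      have AB: "finite A" "finite B" "A \<subseteq> J (i N)" "B \<subseteq> J (i N)" using finJ by (auto simp: A_def B_def)
      have "{n \<in> I. n \<le> N} = {n \<in> I. n \<le> i N ^ 2} \<union> A" using iN[of N] by (auto simp: A_def J_def)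
      then have TA: "T N \<omega> = T (i N ^ 2) \<omega> + (\<Sum>n\<in>A. X n \<omega> - 1 / l n)"
        unfolding T_def using AB by (simp add: sum.union_disjoint A_def J_def disjoint_iff)
      have "{n \<in> I. n \<le> Suc (i N) ^ 2} = {n \<in> I. n \<le> N} \<union> B" using iN[of N] by (auto simp: B_def J_def)
      then have TB: "T (Suc (i N) ^ 2) \<omega> = T N \<omega> + (\<Sum>n\<in>B. X n \<omega> - 1 / l n)"
        unfolding T_def using AB by (simp add: sum.union_disjoint B_def J_def disjoint_iff)
      have low: "(\<Sum>n\<in>C. X n \<omega> - 1 / l n) \<ge> - e N" if C: "C \<subseteq> J (i N)" for C
      proof -
        have "- (\<Sum>n\<in>J (i N). 1 / l n) \<le> - (\<Sum>n\<in>C. 1 / l n)"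
          using C finJ l by (intro le_imp_neg_le sum_mono2) (auto simp: J_def less_imp_le)
        also have "\<dots> = (\<Sum>n\<in>C. - (1 / l n))" by (simp add: sum_negf)
        also have "\<dots> \<le> (\<Sum>n\<in>C. X n \<omega> - 1 / l n)"
          using elim(2) C by (intro sum_mono) (auto simp: J_def)
        finally show ?thesis using block[OF \<open>i N > 0\<close>] by (simp add: e_def)
      qed
      show "T (i N ^ 2) \<omega> - e N \<le> T N \<omega>" using TA low[OF AB(3)] by simp
      show "T N \<omega> \<le> T (Suc (i N) ^ 2) \<omega> + e N" using TB low[OF AB(4)] by simp
    qed
    have ev: "eventually (\<lambda>N. i N > 0) sequentially"
      by (rule eventually_compose_filterlim[OF eventually_gt_at_top[of 0] lim_i])
    have l1: "(\<lambda>N. T (i N ^ 2) \<omega> - e N) \<longlonglongrightarrow> S - 0"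
      by (intro tendsto_diff e0 filterlim_compose[OF sq lim_i])
    have l2: "(\<lambda>N. T (Suc (i N) ^ 2) \<omega> + e N) \<longlonglongrightarrow> S + 0"
      by (intro tendsto_add e0 filterlim_compose[OF LIMSEQ_Suc[OF sq] lim_i])
    have "(\<lambda>N. T N \<omega>) \<longlonglongrightarrow> S"
      by (rule tendsto_sandwich[OF _ _ l1[simplified] l2[simplified]]) (use ev bounds in \<open>auto elim!: eventually_mono\<close>)
    then show ?case unfolding T_def convergent_def by blast
  qed
qed

section \<open>Boltzmann sums\<close>

lemma DERIV_geo_mean:
  assumes "z > 0"
  shows "(geo_mean has_real_derivative - geo_var z) (at z)"
proof -
  have e: "exp z > 1" using assms by simp
  have "((\<lambda>z. 1 / (exp z - 1)) has_real_derivative - (exp z / (exp z - 1) ^ 2)) (at z)"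
    using e by (auto intro!: derivative_eq_intros simp: power2_eq_square)
  moreover have "exp z / (exp z - 1) ^ 2 = geo_var z"
    using e by (simp add: geo_var_def exp_minus field_simps power2_eq_square)
  ultimately show ?thesis unfolding geo_mean_def[abs_def] by simp
qed

lemma geo_mean_antimono:
  assumes "0 < a" "a \<le> b"
  shows "geo_mean b \<le> geo_mean a"
  using assms unfolding geo_mean_def by (intro divide_left_mono mult_pos_pos) auto

text \<open>The difference \<open>geo_mean z - 1 / z\<close> has derivative
  \<open>1 / z ^ 2 - geo_var z\<close>, which is nonnegative by \<open>geo_var_le\<close>.\<close>

lemma geo_mean_diff_le:
  assumes "0 < a" "a \<le> b"
  shows "geo_mean a - geo_mean b \<le> 1 / a - 1 / b"
proof -
  have "(\<lambda>z. geo_mean z - 1 / z) a \<le> (\<lambda>z. geo_mean z - 1 / z) b"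
  proof (rule DERIV_nonneg_imp_nondecreasing[where f = "\<lambda>z. geo_mean z - 1 / z", OF assms(2)])
    fix z assume "a \<le> z" "z \<le> b"
    then have z: "z > 0" using assms by simp
    have "((\<lambda>z. geo_mean z - 1 / z) has_real_derivative (- geo_var z + 1 / z ^ 2)) (at z)"
      using z by (auto intro!: derivative_eq_intros DERIV_geo_mean simp: power2_eq_square)
    then show "\<exists>y. ((\<lambda>z. geo_mean z - 1 / z) has_real_derivative y) (at z) \<and> y \<ge> 0"
      using geo_var_le[OF z] by force
  qed
  then show ?thesis by simp
qed

text \<open>The scale cancels from the bound, so it can serve as a majorant uniform in
  \<open>s\<close>.\<close>

lemma scaled_geo_mean_diff:
  assumes "s > 0" "a > 0" "b > 0"
  shows "\<bar>s * geo_mean (s * a) - s * geo_mean (s * b)\<bar> \<le> \<bar>1 / a - 1 / b\<bar>"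
  using assms(2,3)
proof (induction a b rule: linorder_wlog)
  case (le a b)
  then have "s * a \<le> s * b" "0 < s * a" using assms(1) by auto
  then have "0 \<le> geo_mean (s * a) - geo_mean (s * b)" "geo_mean (s * a) - geo_mean (s * b) \<le> 1 / (s * a) - 1 / (s * b)"
    using geo_mean_antimono geo_mean_diff_le by auto
  then have "0 \<le> s * (geo_mean (s * a) - geo_mean (s * b))" "s * (geo_mean (s * a) - geo_mean (s * b)) \<le> s * (1 / (s * a) - 1 / (s * b))"
    using assms(1) by (auto intro!: mult_left_mono)
  moreover have "s * (1 / (s * a) - 1 / (s * b)) = 1 / a - 1 / b" using assms(1) le by (simp add: field_simps)
  ultimately show ?case by (simp add: right_diff_distrib)
qed (simp add: abs_minus_commute)

lemma tendsto_scaled_geo_mean: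
  assumes "a > 0"
  shows "((\<lambda>s. s * geo_mean (s * a)) \<longlongrightarrow> 1 / a) (at_right 0)"
proof -
  have "((\<lambda>s. s * (1 / (exp (s * a) - 1))) \<longlongrightarrow> inverse a) (at_right 0)"
    using assms by real_asymp
  then show ?thesis unfolding geo_mean_def by (simp only: inverse_eq_divide)
qed

text \<open>The function \<open>ln (1 - exp (- z))\<close> is a primitive of
  \<open>geo_mean\<close>; the mean value theorem compares a Riemann sum term with its
  integral.\<close>

lemma ln_one_minus_exp_increment:
  assumes "0 < a" "a < b"
  shows "\<bar>(b - a) * geo_mean a - (ln (1 - exp (- b)) - ln (1 - exp (- a)))\<bar> \<le> (b - a) * (1 / a - 1 / b)"
proof -
  have "\<exists>z>a. z < b \<and> ln (1 - exp (- b)) - ln (1 - exp (- a)) = (b - a) * geo_mean z"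
  proof (rule MVT2[OF assms(2)])
    fix z assume "a \<le> z" "z \<le> b"
    then have z: "z > 0" using assms by simp
    then show "((\<lambda>x. ln (1 - exp (- x))) has_real_derivative geo_mean z) (at z)"
      unfolding geo_mean_eq(1)[OF z] by (auto intro!: derivative_eq_intros)
  qed
  then obtain z where z: "a < z" "z < b" "ln (1 - exp (- b)) - ln (1 - exp (- a)) = (b - a) * geo_mean z" by blast
  have "0 \<le> geo_mean a - geo_mean z" "geo_mean a - geo_mean z \<le> 1 / a - 1 / z"
    using geo_mean_antimono[of a z] geo_mean_diff_le[of a z] assms z by auto
  moreover have "1 / b \<le> 1 / z" using z assms by (intro divide_left_mono) auto
  ultimately have "\<bar>geo_mean a - geo_mean z\<bar> \<le> 1 / a - 1 / b" by linarith
  then have "(b - a) * \<bar>geo_mean a - geo_mean z\<bar> \<le> (b - a) * (1 / a - 1 / b)" using assms by (intro mult_left_mono) auto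
  moreover have "\<bar>(b - a) * geo_mean a - (b - a) * geo_mean z\<bar> = (b - a) * \<bar>geo_mean a - geo_mean z\<bar>"
    using assms by (simp add: abs_mult flip: right_diff_distrib)
  ultimately show ?thesis unfolding z(3) by simp
qed

text \<open>The gap stays bounded at 0 and is \<open>O(1 / y ^ 2)\<close> at infinity. The form
  \<open>(1 + y) ^ 2\<close> is chosen because it lies above a telescoping difference when summed
  along an arithmetic progression.\<close>

lemma inverse_square_minus_geo_var:
  assumes "y > 0"
  shows "0 \<le> 1 / y ^ 2 - geo_var y" "1 / y ^ 2 - geo_var y \<le> 4 / (1 + y) ^ 2"
proof -
  show "0 \<le> 1 / y ^ 2 - geo_var y" using geo_var_le[OF assms] by simp
  have gv: "geo_var y > 0" by (rule geo_mean_eq[OF assms])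
  show "1 / y ^ 2 - geo_var y \<le> 4 / (1 + y) ^ 2"
  proof (cases "y \<ge> 1")
    case True
    then have "(1 + y) ^ 2 \<le> (2 * y) ^ 2" by (intro power_mono) auto
    then have "1 / y ^ 2 \<le> 4 / (1 + y) ^ 2" using assms by (simp add: field_simps)
    then show ?thesis using gv by simp
  next
    case False
    \<comment> \<open>This is the derivative of \<open>f\<close> below. Nonnegativity of
      \<open>g\<close> and then of \<open>f\<close> on \<open>[0, 1]\<close> gives
      \<open>2 * cosh y - 2 <= y ^ 2 + y ^ 4\<close>, a lower bound for \<open>geo_var y\<close>
      correct to second order.\<close>
    define g where "g x = 2 * x + 4 * x ^ 3 - (exp x - exp (- x))" for x :: real
    have expb: "exp x + exp (- x) \<le> 2 + 2 * x ^ 2" if "0 \<le> x" "x \<le> 1" for x :: real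
    proof -
      have "exp x \<le> 1 + x + x ^ 2" using exp_bound that by auto
      moreover have "exp (- x) \<le> 1 - x + x ^ 2"
      proof -
        have "1 \<le> (1 + x) * (1 - x + x ^ 2)" using that by (simp add: algebra_simps power2_eq_square)
        also have "\<dots> \<le> exp x * (1 - x + x ^ 2)"
          using exp_ge_add_one_self[of x] that by (intro mult_right_mono) auto
        finally show ?thesis by (simp add: exp_minus field_simps)
      qed
      ultimately show ?thesis by simp
    qed
    have g0: "g x \<ge> 0" if x: "0 \<le> x" "x \<le> 1" for x
    proof -
      have "g 0 \<le> g x"
      proof (rule DERIV_nonneg_imp_nondecreasing[OF x(1)])
        fix z assume z: "0 \<le> z" "z \<le> x"
        have "(g has_real_derivative (2 + 12 * z ^ 2 - (exp z + exp (- z)))) (at z)"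
          unfolding g_def[abs_def] by (auto intro!: derivative_eq_intros)
        moreover have "2 + 12 * z ^ 2 - (exp z + exp (- z)) \<ge> 0"
          using expb[of z] z x zero_le_power2[of z] by linarith
        ultimately show "\<exists>d. (g has_real_derivative d) (at z) \<and> d \<ge> 0" by blast
      qed
      then show ?thesis by (simp add: g_def)
    qed
    define f where "f x = x ^ 2 + x ^ 4 - (exp x + exp (- x) - 2)" for x :: real
    have "f 0 \<le> f y"
    proof (rule DERIV_nonneg_imp_nondecreasing[OF less_imp_le[OF assms]])
      fix z assume z: "0 \<le> z" "z \<le> y"
      have "(f has_real_derivative g z) (at z)"
        unfolding f_def[abs_def] g_def by (auto intro!: derivative_eq_intros simp: power3_eq_cube)
      then show "\<exists>d. (f has_real_derivative d) (at z) \<and> d \<ge> 0" using g0[of z] z False by auto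
    qed
    then have le: "exp y + exp (- y) - 2 \<le> y ^ 2 + y ^ 4" by (simp add: f_def)
    have eq: "geo_var y = 1 / (exp y + exp (- y) - 2)"
    proof -
      have "(1 - exp (- y)) ^ 2 = exp (- y) * (exp y + exp (- y) - 2)"
        by (simp add: power2_eq_square algebra_simps flip: exp_add)
      then show ?thesis by (simp add: geo_var_def)
    qed
    have "exp y + exp (- y) - 2 > 0" using gv unfolding eq by (simp add: zero_less_divide_iff)
    then have "1 / (y ^ 2 + y ^ 4) \<le> geo_var y" unfolding eq using le assms by (intro divide_left_mono mult_pos_pos) auto
    then have "1 / y ^ 2 - geo_var y \<le> 1 / y ^ 2 - 1 / (y ^ 2 + y ^ 4)" by simp
    also have "\<dots> = 1 / (1 + y ^ 2)"
    proof -
      have "y ^ 2 + y ^ 4 = y ^ 2 * (1 + y ^ 2)" by (simp add: algebra_simps flip: power_add)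
      moreover have "1 + y ^ 2 > 0" by (simp add: add_pos_nonneg)
      ultimately show ?thesis using assms by (simp add: divide_simps)
    qed
    also have "\<dots> \<le> 1" by (simp add: add_pos_nonneg)
    also have "1 \<le> 4 / (1 + y) ^ 2"
    proof -
      have "(1 + y) ^ 2 \<le> 2 ^ 2" using assms False by (intro power_mono) auto
      then show ?thesis using assms by (simp add: field_simps)
    qed
    finally show ?thesis .
  qed
qed

text \<open>Expanding each mean as a geometric series and summing in the other order replaces the
  means by variances \<open>\<sigma> * geo_var (\<sigma> * k)\<close>. These are close to
  \<open>1 / (\<sigma> * k ^ 2)\<close>, whose sum is the zeta value at 2 divided by
  \<open>\<sigma>\<close>.\<close>

lemma bose_sum:
  assumes \<sigma>: "\<sigma> > 0"
  shows "summable (\<lambda>k. \<sigma> * real (Suc k) * geo_mean (\<sigma> * real (Suc k)))"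
    and "\<bar>(\<Sum>k. \<sigma> * real (Suc k) * geo_mean (\<sigma> * real (Suc k))) - pi ^ 2 / 6 / \<sigma>\<bar> \<le> 4"
proof -
  define f where "f j k = \<sigma> * real (Suc j) * exp (- (\<sigma> * real (Suc j) * real (Suc k)))" for j k
  have f0: "f j k \<ge> 0" for j k using \<sigma> by (simp add: f_def)
  have e1: "0 < exp (- (\<sigma> * real (Suc j)))" "exp (- (\<sigma> * real (Suc j))) < 1" for j using \<sigma> by auto
  have inner1: "(\<lambda>k. f j k) sums (\<sigma> * real (Suc j) * geo_mean (\<sigma> * real (Suc j)))" for j
  proof -
    let ?q = "exp (- (\<sigma> * real (Suc j)))"
    have "(\<lambda>k. ?q ^ k) sums (1 / (1 - ?q))" using e1[of j] by (intro geometric_sums) auto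
    then have "(\<lambda>k. \<sigma> * real (Suc j) * ?q * ?q ^ k) sums (\<sigma> * real (Suc j) * ?q * (1 / (1 - ?q)))" by (rule sums_mult)
    moreover have "\<sigma> * real (Suc j) * ?q * ?q ^ k = f j k" for k
    proof -
      have "?q * ?q ^ k = ?q ^ Suc k" by simp
      also have "\<dots> = exp (- (\<sigma> * real (Suc j) * real (Suc k)))" unfolding exp_of_nat_mult[symmetric] by (simp add: algebra_simps)
      finally show ?thesis by (simp add: f_def mult.assoc)
    qed
    moreover have "geo_mean (\<sigma> * real (Suc j)) = ?q / (1 - ?q)" using \<sigma> by (intro geo_mean_eq) auto
    ultimately show ?thesis by simp
  qed
  have inner2: "(\<lambda>j. f j k) sums (\<sigma> * geo_var (\<sigma> * real (Suc k)))" for k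
  proof -
    let ?q = "exp (- (\<sigma> * real (Suc k)))"
    have "(\<lambda>n. of_nat (Suc n) * ?q ^ n) sums (1 / (1 - ?q) ^ 2)" using e1[of k] by (intro geometric_deriv_sums) auto
    then have "(\<lambda>n. \<sigma> * ?q * (of_nat (Suc n) * ?q ^ n)) sums (\<sigma> * ?q * (1 / (1 - ?q) ^ 2))" by (rule sums_mult)
    moreover have "\<sigma> * ?q * (of_nat (Suc n) * ?q ^ n) = f n k" for n
    proof -
      have "?q * ?q ^ n = ?q ^ Suc n" by simp
      also have "\<dots> = exp (- (\<sigma> * real (Suc n) * real (Suc k)))" unfolding exp_of_nat_mult[symmetric] by (simp add: algebra_simps)
      finally show ?thesis by (simp add: f_def mult_ac)
    qed
    ultimately show ?thesis by (simp add: geo_var_def)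
  qed
  have z2: "(\<lambda>k. 1 / (\<sigma> * real (Suc k) ^ 2)) sums (pi ^ 2 / 6 / \<sigma>)"
    using sums_mult[OF inverse_squares_sums, of "1 / \<sigma>"] by (simp add: add.commute mult.commute)
  \<comment> \<open>The deficit of the variances from the inverse squares; its bound telescopes to 4
    for every \<open>\<sigma>\<close>.\<close>
  define d where "d k = 1 / (\<sigma> * real (Suc k) ^ 2) - \<sigma> * geo_var (\<sigma> * real (Suc k))" for k
  have d: "0 \<le> d k" "d k \<le> 4 * (1 / (1 + \<sigma> * real k) - 1 / (1 + \<sigma> * real (Suc k)))" for k
  proof -
    let ?y = "\<sigma> * real (Suc k)"
    have y: "?y > 0" using \<sigma> by simp
    have "\<sigma> * (1 / ?y ^ 2) = 1 / (\<sigma> * real (Suc k) ^ 2)"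
      using \<sigma> by (simp add: power_mult_distrib power2_eq_square[of \<sigma>] del: of_nat_Suc)
    then have eq: "d k = \<sigma> * (1 / ?y ^ 2 - geo_var ?y)" unfolding d_def right_diff_distrib by simp
    show "0 \<le> d k" unfolding eq using inverse_square_minus_geo_var(1)[OF y] \<sigma> by simp
    have "d k \<le> \<sigma> * (4 / (1 + ?y) ^ 2)" unfolding eq using inverse_square_minus_geo_var(2)[OF y] \<sigma> by (intro mult_left_mono) auto
    also have "\<dots> \<le> 4 * (\<sigma> / ((1 + \<sigma> * real k) * (1 + ?y)))"
    proof -
      have "(1 + \<sigma> * real k) * (1 + ?y) \<le> (1 + ?y) * (1 + ?y)" using \<sigma> by (intro mult_right_mono) auto
      then have "1 / (1 + ?y) ^ 2 \<le> 1 / ((1 + \<sigma> * real k) * (1 + ?y))"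
        using \<sigma> unfolding power2_eq_square by (intro divide_left_mono mult_pos_pos) (auto intro: add_pos_nonneg)
      then have "4 * \<sigma> * (1 / (1 + ?y) ^ 2) \<le> 4 * \<sigma> * (1 / ((1 + \<sigma> * real k) * (1 + ?y)))" using \<sigma> by (intro mult_left_mono) auto
      then show ?thesis by (simp add: mult.commute)
    qed
    also have "\<sigma> / ((1 + \<sigma> * real k) * (1 + ?y)) = 1 / (1 + \<sigma> * real k) - 1 / (1 + ?y)"
    proof -
      have "1 + \<sigma> * real k > 0" "1 + ?y > 0" using \<sigma> by (auto intro: add_pos_nonneg)
      moreover have "\<sigma> = (1 + ?y) - (1 + \<sigma> * real k)" by (simp add: algebra_simps)
      ultimately show ?thesis by (simp add: diff_frac_eq)
    qed
    finally show "d k \<le> 4 * (1 / (1 + \<sigma> * real k) - 1 / (1 + ?y))" .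
  qed
  have "(\<lambda>k. 1 / (1 + \<sigma> * real k)) \<longlonglongrightarrow> 0" using \<sigma> by real_asymp
  from sums_mult[OF telescope_sums'[OF this], of 4]
  have tel: "(\<lambda>k. 4 * (1 / (1 + \<sigma> * real k) - 1 / (1 + \<sigma> * real (Suc k)))) sums 4" by simp
  have dsum: "summable d" by (rule summable_comparison_test'[OF sums_summable[OF tel]]) (use d in auto)
  have d4: "0 \<le> suminf d" "suminf d \<le> 4"
    using d dsum suminf_le[OF d(2) dsum sums_summable[OF tel]] sums_unique[OF tel] by (auto intro: suminf_nonneg)
  have gv: "(\<lambda>k. \<sigma> * geo_var (\<sigma> * real (Suc k))) sums (pi ^ 2 / 6 / \<sigma> - suminf d)"
    using sums_diff[OF z2 summable_sums[OF dsum]] by (simp add: d_def)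
  \<comment> \<open>All terms are nonnegative, so the exchange is done with extended reals and needs
    no prior summability.\<close>
  have swap: "(\<Sum>j. ennreal (\<sigma> * real (Suc j) * geo_mean (\<sigma> * real (Suc j)))) = (\<Sum>k. ennreal (\<sigma> * geo_var (\<sigma> * real (Suc k))))"
  proof -
    have "(\<Sum>j. ennreal (\<sigma> * real (Suc j) * geo_mean (\<sigma> * real (Suc j)))) = (\<Sum>j. \<Sum>k. ennreal (f j k))"
      using inner1 f0 by (intro suminf_cong) (metis suminf_ennreal_eq)
    also have "\<dots> = (\<integral>\<^sup>+j. (\<Sum>k. ennreal (f j k)) \<partial>count_space UNIV)" by (simp add: nn_integral_count_space_nat)
    also have "\<dots> = (\<Sum>k. \<integral>\<^sup>+j. ennreal (f j k) \<partial>count_space UNIV)" by (rule nn_integral_suminf) simp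
    also have "\<dots> = (\<Sum>k. \<Sum>j. ennreal (f j k))" by (simp add: nn_integral_count_space_nat)
    also have "\<dots> = (\<Sum>k. ennreal (\<sigma> * geo_var (\<sigma> * real (Suc k))))"
      using inner2 f0 by (intro suminf_cong) (metis suminf_ennreal_eq)
    finally show ?thesis .
  qed
  have pos: "0 \<le> \<sigma> * real (Suc j) * geo_mean (\<sigma> * real (Suc j))" "0 \<le> \<sigma> * geo_var (\<sigma> * real (Suc j))" for j
    using geo_mean_eq(4,5)[of "\<sigma> * real (Suc j)"] \<sigma> by auto
  have v: "(\<Sum>j. ennreal (\<sigma> * real (Suc j) * geo_mean (\<sigma> * real (Suc j)))) = ennreal (pi ^ 2 / 6 / \<sigma> - suminf d)"
    unfolding swap using gv pos by (intro suminf_ennreal_eq) auto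
  show sm: "summable (\<lambda>k. \<sigma> * real (Suc k) * geo_mean (\<sigma> * real (Suc k)))"
    by (rule summable_suminf_not_top) (use pos v in auto)
  have "ennreal (\<Sum>k. \<sigma> * real (Suc k) * geo_mean (\<sigma> * real (Suc k))) = ennreal (pi ^ 2 / 6 / \<sigma> - suminf d)"
    using suminf_ennreal2[OF _ sm] pos v by metis
  moreover have "0 \<le> pi ^ 2 / 6 / \<sigma> - suminf d" using sums_unique[OF gv] suminf_nonneg[OF sums_summable[OF gv]] pos by auto
  moreover have "0 \<le> (\<Sum>k. \<sigma> * real (Suc k) * geo_mean (\<sigma> * real (Suc k)))" using sm pos by (intro suminf_nonneg) auto
  ultimately have "(\<Sum>k. \<sigma> * real (Suc k) * geo_mean (\<sigma> * real (Suc k))) = pi ^ 2 / 6 / \<sigma> - suminf d" by simp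
  then show "\<bar>(\<Sum>k. \<sigma> * real (Suc k) * geo_mean (\<sigma> * real (Suc k))) - pi ^ 2 / 6 / \<sigma>\<bar> \<le> 4" using d4 by simp
qed

section \<open>Sums over a nearly linear set of logarithms\<close>

locale log_growth =
  fixes I :: "nat set" and lam :: "nat \<Rightarrow> real" and l C :: real
  assumes l_pos: "l > 0"
    and lam_pos: "\<And>n. n \<in> I \<Longrightarrow> lam n > 0"
    and lam_close: "\<And>n. n \<in> I \<Longrightarrow> \<bar>lam n - l * real n\<bar> \<le> C"
    and zero_notin: "0 \<notin> I"
    and tail_subset: "\<And>n. n \<ge> 13 \<Longrightarrow> n \<in> I"
begin

lemma C_nonneg: "C \<ge> 0"
  using lam_close[OF tail_subset[of 13]] by simp

definition upto :: "nat \<Rightarrow> nat set" where "upto N = {n \<in> I. n \<le> N}"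

lemma finite_upto [simp]: "finite (upto N)" and upto_subset: "upto N \<subseteq> I"
  by (auto simp: upto_def)

lemma lam_linear_lower: "\<exists>c>0. \<forall>n\<in>I. c * real n \<le> lam n"
proof -
  obtain m :: nat where m: "2 * C / l \<le> real m" using real_arch_simple by blast
  define A where "A = insert (l / 2) ((\<lambda>n. lam n / real n) ` (upto m))"
  define c where "c = Min A"
  have fin: "finite A" "A \<noteq> {}" by (auto simp: A_def)
  have npos: "real n > 0" if "n \<in> I" for n using that zero_notin by (cases n) auto
  have "c > 0" unfolding c_def using fin l_pos lam_pos npos by (auto simp: A_def upto_def)
  moreover have "c * real n \<le> lam n" if n: "n \<in> I" for n
  proof (cases "n \<le> m")
    case True
    then have "c \<le> lam n / real n" unfolding c_def using fin n by (intro Min_le) (auto simp: A_def upto_def)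
    then show ?thesis using npos[OF n] by (simp add: field_simps)
  next
    case False
    then have "2 * C / l \<le> real n" using m by linarith
    then have "C \<le> l * real n / 2" using l_pos by (simp add: field_simps)
    then have "l / 2 * real n \<le> lam n" using lam_close[OF n] by linarith
    moreover have "c \<le> l / 2" unfolding c_def using fin by (intro Min_le) (auto simp: A_def)
    then have "c * real n \<le> l / 2 * real n" by (intro mult_right_mono) auto
    ultimately show ?thesis by linarith
  qed
  ultimately show ?thesis by blast
qed

lemma summable_inverse_square: "summable (\<lambda>n. if n \<in> I then 1 / lam n ^ 2 else 0)"
proof -
  obtain c where c: "c > 0" "\<forall>n\<in>I. c * real n \<le> lam n" using lam_linear_lower by blast
  have "summable (\<lambda>n. 1 / c ^ 2 * inverse (real n ^ 2))"
    by (intro summable_mult inverse_power_summable) simp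
  then show ?thesis
  proof (rule summable_comparison_test'[where N = 1])
    fix n :: nat assume n: "n \<ge> 1"
    show "norm (if n \<in> I then 1 / lam n ^ 2 else 0) \<le> 1 / c ^ 2 * inverse (real n ^ 2)"
    proof (cases "n \<in> I")
      case True
      then have "(c * real n) ^ 2 \<le> lam n ^ 2" using c by (intro power_mono) auto
      then have "1 / lam n ^ 2 \<le> 1 / (c * real n) ^ 2" using c n lam_pos[OF True] by (intro frac_le) auto
      then show ?thesis using True by (simp add: power_mult_distrib field_simps)
    qed (use c in auto)
  qed
qed

text \<open>Comparison with a geometric series of ratio \<open>exp (- s * l / 2)\<close>. The
  additive error \<open>C\<close> costs only the constant \<open>exp (C / 2)\<close>, because
  \<open>s <= 1\<close>.\<close>

lemma exp_sum_bound:
  "\<exists>K>0. \<forall>s J. 0 < s \<and> s \<le> 1 \<and> finite J \<and> J \<subseteq> I \<longrightarrow> (\<Sum>n\<in>J. exp (- (s * lam n) / 2)) \<le> K / s"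
proof -
  define K where "K = exp (C / 2) * (1 + l / 2) * (2 / l)"
  have K: "K > 0" using l_pos by (simp add: K_def)
  have "(\<Sum>n\<in>J. exp (- (s * lam n) / 2)) \<le> K / s" if s: "0 < s" "s \<le> 1" and J: "finite J" "J \<subseteq> I" for s J
  proof -
    let ?q = "exp (- (s * l / 2))"
    have q: "0 < ?q" "?q < 1" using s l_pos by auto
    have "(\<Sum>n\<in>J. exp (- (s * lam n) / 2)) \<le> (\<Sum>n\<in>J. exp (C / 2) * ?q ^ n)"
    proof (rule sum_mono)
      fix n assume "n \<in> J"
      then have "l * real n - C \<le> lam n" using lam_close[of n] J by fastforce
      then have "s * (l * real n - C) \<le> s * lam n" using s by (intro mult_left_mono) auto
      moreover have "s * C \<le> C" using s C_nonneg by (intro mult_left_le_one_le) auto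
      ultimately have "- (s * lam n) / 2 \<le> C / 2 + real n * (- (s * l / 2))" by (simp add: algebra_simps)
      then have "exp (- (s * lam n) / 2) \<le> exp (C / 2 + real n * (- (s * l / 2)))" by (simp only: exp_le_cancel_iff)
      then show "exp (- (s * lam n) / 2) \<le> exp (C / 2) * ?q ^ n" by (simp only: exp_add exp_of_nat_mult)
    qed
    also have "\<dots> = exp (C / 2) * (\<Sum>n\<in>J. ?q ^ n)" by (simp add: sum_distrib_left)
    also have "\<dots> \<le> exp (C / 2) * (1 / (1 - ?q))"
      using q J sum_le_suminf[of "\<lambda>n. ?q ^ n" J] suminf_geometric[of ?q] by (intro mult_left_mono) (auto simp: summable_geometric)
    also have "exp (C / 2) * (1 / (1 - ?q)) \<le> exp (C / 2) * ((1 + l / 2) * (2 / l) / s)"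
    proof (rule mult_left_mono)
      have p: "s * l / 2 > 0" using s l_pos by simp
      have "s * l / 2 \<le> (1 + s * l / 2) * (1 - ?q)" using one_minus_exp_bounds(2)[OF p] .
      also have "\<dots> \<le> (1 + l / 2) * (1 - ?q)" using s l_pos q by (intro mult_right_mono) auto
      finally show "1 / (1 - ?q) \<le> (1 + l / 2) * (2 / l) / s" using s l_pos q by (simp add: field_simps)
    qed simp
    also have "\<dots> = K / s" by (simp add: K_def)
    finally show ?thesis .
  qed
  then show ?thesis using K by blast
qed

text \<open>About \<open>1 / (l * s * y)\<close> indices qualify, less \<open>C / l\<close> for the
  error in \<open>lam\<close> and the initial segment below 13. The threshold \<open>c\<close> makes
  these losses at most half. The parameter \<open>y\<close> will be the frequency
  \<open>max 1 \<bar>u\<bar>\<close>; \<open>y >= 1\<close> keeps the indices below the truncation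
  point.\<close>

lemma count_lower:
  "\<exists>c>0. \<forall>s y N. 0 < s \<and> 1 \<le> y \<and> s * y \<le> c \<and> 1 / (l * s) \<le> real N \<longrightarrow>
     1 / (2 * l * s * y) \<le> real (card {n \<in> upto N. s * y * lam n \<le> 1})"
proof -
  define c where "c = 1 / (2 * (C + 14 * l))"
  have c: "c > 0" using C_nonneg l_pos by (simp add: c_def add_nonneg_pos)
  have "1 / (2 * l * s * y) \<le> real (card {n \<in> upto N. s * y * lam n \<le> 1})"
    if s: "0 < s" "1 \<le> y" "s * y \<le> c" "1 / (l * s) \<le> real N" for s y N
  proof -
    let ?z = "s * y"
    have z: "?z > 0" using s by simp
    define b where "b = nat \<lfloor>(1 / ?z - C) / l\<rfloor>"
    have "C + 14 * l > 0" using C_nonneg l_pos by (simp add: add_nonneg_pos)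
    then have big: "1 / ?z \<ge> 2 * (C + 14 * l)" using s(3) z by (simp add: c_def field_simps)
    have "C \<le> 2 * (C + 14 * l)" using C_nonneg l_pos by simp
    then have "1 / ?z - C \<ge> 0" using order_trans[OF _ big] by simp
    then have b0: "(1 / ?z - C) / l \<ge> 0" using l_pos by simp
    then have b: "real b \<le> (1 / ?z - C) / l" "(1 / ?z - C) / l < real b + 1" unfolding b_def by linarith+
    have sub: "{13..b} \<subseteq> {n \<in> upto N. ?z * lam n \<le> 1}"
    proof
      fix n assume n: "n \<in> {13..b}"
      then have nI: "n \<in> I" using tail_subset by auto
      have nb: "real n \<le> (1 / ?z - C) / l" using n b by simp
      then have "l * real n + C \<le> 1 / ?z" using l_pos by (simp add: field_simps)
      then have "lam n \<le> 1 / ?z" using lam_close[OF nI] by linarith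
      then have "?z * lam n \<le> 1" using z by (simp add: field_simps)
      moreover have "n \<le> N"
      proof -
        have "(1 / ?z - C) / l \<le> 1 / ?z / l" using C_nonneg l_pos by (intro divide_right_mono) auto
        also have "\<dots> \<le> 1 / s / l" using s l_pos by (intro divide_right_mono frac_le) auto
        also have "\<dots> = 1 / (l * s)" by simp
        finally have "real n \<le> real N" using nb s(4) by linarith
        then show ?thesis by simp
      qed
      ultimately show "n \<in> {n \<in> upto N. ?z * lam n \<le> 1}" using nI by (simp add: upto_def)
    qed
    have "real (card {13..b}) \<le> real (card {n \<in> upto N. ?z * lam n \<le> 1})"
      using sub by (intro of_nat_mono card_mono) auto
    moreover have "real b - 12 \<le> real (card {13..b})" by simp
    moreover have "1 / (2 * l * s * y) \<le> real b - 12"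
    proof -
      have "1 / (2 * l * s * y) = (1 / ?z) / (2 * l)" by simp
      also have "\<dots> \<le> (1 / ?z - C) / l - 14"
      proof -
        have "(1 / ?z - C) / l - 14 - (1 / ?z) / (2 * l) = (1 / ?z - 2 * (C + 14 * l)) / (2 * l)"
          using l_pos by (simp add: field_simps)
        also have "\<dots> \<ge> 0" using big l_pos by simp
        finally show ?thesis by (simp only: diff_ge_0_iff_ge)
      qed
      also have "(1 / ?z - C) / l - 14 \<le> real b - 12" using b(2) by simp
      finally show ?thesis .
    qed
    ultimately show ?thesis by linarith
  qed
  then show ?thesis using c by blast
qed

text \<open>The contribution of one index to the mean of \<open>s * Y\<close>; extending by 0
  outside \<open>I\<close> allows ordinary series over the naturals.\<close>

definition mean_size :: "real \<Rightarrow> nat \<Rightarrow> real" where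
  "mean_size s n = (if n \<in> I then s * lam n * geo_mean (s * lam n) else 0)"

definition mean_count :: "real \<Rightarrow> nat \<Rightarrow> real" where
  "mean_count s n = (if n \<in> I then s * geo_mean (s * lam n) else 0)"

lemma bose_antimono:
  assumes "0 < a" "a \<le> b"
  shows "b * geo_mean b \<le> a * geo_mean a"
proof -
  have "(\<lambda>z. - (z * geo_mean z)) a \<le> (\<lambda>z. - (z * geo_mean z)) b"
  proof (rule DERIV_nonneg_imp_nondecreasing[where f = "\<lambda>z. - (z * geo_mean z)", OF assms(2)])
    fix z assume "a \<le> z" "z \<le> b"
    then have z: "z > 0" using assms by simp
    note g = geo_mean_eq[OF z]
    have "geo_mean z \<le> z * geo_var z"
    proof -
      have "1 \<le> z * (1 + geo_mean z)" unfolding g(2) using one_minus_exp_bounds[OF z] by (simp add: field_simps)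
      then have "geo_mean z * 1 \<le> geo_mean z * (z * (1 + geo_mean z))" using g by (intro mult_left_mono) auto
      then show ?thesis unfolding g(3)[symmetric] by (simp add: mult_ac)
    qed
    moreover have "((\<lambda>z. - (z * geo_mean z)) has_real_derivative (z * geo_var z - geo_mean z)) (at z)"
      using z by (auto intro!: derivative_eq_intros DERIV_geo_mean)
    ultimately show "\<exists>y. ((\<lambda>z. - (z * geo_mean z)) has_real_derivative y) (at z) \<and> y \<ge> 0" by force
  qed
  then show ?thesis by simp
qed

lemma bose_bounds:
  assumes "z > 0"
  shows "0 \<le> z * geo_mean z" "z * geo_mean z \<le> 1"
proof -
  show "0 \<le> z * geo_mean z" using geo_mean_eq(4)[OF assms] assms by simp
  have "exp z - 1 \<ge> z" using exp_ge_add_one_self[of z] by linarith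
  then show "z * geo_mean z \<le> 1" using assms by (simp add: geo_mean_def field_simps)
qed

text \<open>The summand decreases in \<open>lam\<close> and lies in \<open>[0, 1]\<close>. Moving
  the index by a fixed number of steps \<open>m\<close> with \<open>C <= l * m\<close> compares it
  from both sides with the exactly linear case, and only boundedly many terms of size at most 1 are
  gained or lost.\<close>

lemma mean_size_sum:
  "\<exists>K. \<forall>s>0. summable (mean_size s) \<and> \<bar>suminf (mean_size s) - pi ^ 2 / 6 / (s * l)\<bar> \<le> K"
proof -
  obtain m :: nat where m: "C / l \<le> real m" using real_arch_simple by blast
  then have Cm: "C \<le> l * real m" using l_pos by (simp add: field_simps)
  define K where "K = 4 + (14 + real m)"
  have "summable (mean_size s) \<and> \<bar>suminf (mean_size s) - pi ^ 2 / 6 / (s * l)\<bar> \<le> K" if s: "s > 0" for s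
  proof -
    define \<sigma> where "\<sigma> = s * l"
    have \<sigma>: "\<sigma> > 0" using s l_pos by (simp add: \<sigma>_def)
    define h where "h z = z * geo_mean z" for z
    define b where "b k = h (\<sigma> * real (Suc k))" for k
    have b: "summable b" "\<bar>suminf b - pi ^ 2 / 6 / \<sigma>\<bar> \<le> 4"
      unfolding b_def h_def using bose_sum[OF \<sigma>] by (simp_all add: mult.assoc)
    have b01: "0 \<le> b k" "b k \<le> 1" for k unfolding b_def h_def using bose_bounds[of "\<sigma> * real (Suc k)"] \<sigma> by auto
    have ms: "mean_size s n = h (s * lam n)" if "n \<in> I" for n using that by (simp add: mean_size_def h_def)
    have ms01: "0 \<le> mean_size s n" "mean_size s n \<le> 1" for n
      using bose_bounds[of "s * lam n"] s lam_pos[of n] by (auto simp: mean_size_def mult.assoc)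
    have up: "mean_size s (k + Suc m) \<le> b k" for k
    proof (cases "k + Suc m \<in> I")
      case True
      have "l * real (Suc k) \<le> lam (k + Suc m)" using lam_close[OF True] Cm by (simp add: algebra_simps)
      then have "\<sigma> * real (Suc k) \<le> s * lam (k + Suc m)" unfolding \<sigma>_def mult.assoc using s by (intro mult_left_mono) auto
      then show ?thesis unfolding ms[OF True] b_def h_def using \<sigma> by (intro bose_antimono) auto
    next
      case False
      then show ?thesis using b01 by (simp add: mean_size_def)
    qed
    have low: "b (k + (12 + m)) \<le> mean_size s (k + 13)" for k
    proof -
      have I: "k + 13 \<in> I" by (intro tail_subset) simp
      have "lam (k + 13) \<le> l * real (Suc (k + (12 + m)))" using lam_close[OF I] Cm by (simp add: algebra_simps)
      then have "s * lam (k + 13) \<le> \<sigma> * real (Suc (k + (12 + m)))" unfolding \<sigma>_def mult.assoc using s by (intro mult_left_mono) auto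
      then show ?thesis unfolding ms[OF I] b_def h_def using s lam_pos[OF I] by (intro bose_antimono) auto
    qed
    have sm: "summable (\<lambda>k. mean_size s (k + Suc m))"
      by (rule summable_comparison_test'[OF b(1), where N = 0]) (use up ms01 in auto)
    then have sm': "summable (mean_size s)" by (simp only: summable_iff_shift)
    have "suminf (mean_size s) = (\<Sum>k. mean_size s (k + Suc m)) + (\<Sum>k<Suc m. mean_size s k)"
      by (rule suminf_split_initial_segment[OF sm'])
    moreover have "(\<Sum>k. mean_size s (k + Suc m)) \<le> suminf b" using up sm b(1) by (rule suminf_le)
    moreover have "(\<Sum>k<Suc m. mean_size s k) \<le> real (Suc m)"
      using sum_bounded_above[of "{..<Suc m}" "mean_size s" 1] ms01 by simp
    ultimately have u: "suminf (mean_size s) \<le> suminf b + real (Suc m)" by linarith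
    have "suminf b = (\<Sum>k. b (k + (12 + m))) + (\<Sum>k<12 + m. b k)" by (rule suminf_split_initial_segment[OF b(1)])
    moreover have "(\<Sum>k. b (k + (12 + m))) \<le> (\<Sum>k. mean_size s (k + 13))"
      using low b(1) sm' by (intro suminf_le) (auto simp only: summable_iff_shift)
    moreover have "(\<Sum>k<12 + m. b k) \<le> real (12 + m)"
      using sum_bounded_above[of "{..<12 + m}" b 1] b01 by simp
    moreover have "suminf (mean_size s) = (\<Sum>k. mean_size s (k + 13)) + (\<Sum>k<13. mean_size s k)"
      by (rule suminf_split_initial_segment[OF sm'])
    moreover have "(\<Sum>k<13. mean_size s k) \<ge> 0" using ms01 by (intro sum_nonneg)
    ultimately have "suminf b - real (12 + m) \<le> suminf (mean_size s)" by linarith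
    then show ?thesis using u b(2) sm' unfolding \<sigma>_def K_def by auto
  qed
  then show ?thesis by blast
qed

lemma summable_mean_count: "s > 0 \<Longrightarrow> summable (mean_count s)"
proof -
  assume s: "s > 0"
  obtain c where c: "c > 0" "\<forall>n\<in>I. c * real n \<le> lam n" using lam_linear_lower by blast
  obtain K where K: "\<forall>s>0. summable (mean_size s) \<and> \<bar>suminf (mean_size s) - pi ^ 2 / 6 / (s * l)\<bar> \<le> K" using mean_size_sum by blast
  have "summable (\<lambda>n. 1 / c * mean_size s n)" using K s by (intro summable_mult) auto
  then show ?thesis
  proof (rule summable_comparison_test'[where N = 1])
    fix n :: nat assume n: "n \<ge> 1"
    show "norm (mean_count s n) \<le> 1 / c * mean_size s n"
    proof (cases "n \<in> I")
      case True
      then have "c * 1 \<le> c * real n" using c n by (intro mult_left_mono) auto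
      moreover have "c * real n \<le> lam n" using c True by blast
      ultimately have "c \<le> lam n" by simp
      then have "c * geo_mean (s * lam n) \<le> lam n * geo_mean (s * lam n)"
        using geo_mean_eq(4)[of "s * lam n"] s lam_pos[OF True] by (intro mult_right_mono) auto
      then have "s * (c * geo_mean (s * lam n)) \<le> s * (lam n * geo_mean (s * lam n))" using s by (intro mult_left_mono) auto
      then show ?thesis using True c s geo_mean_eq(4)[of "s * lam n"] lam_pos[OF True]
        by (simp add: mean_count_def mean_size_def field_simps)
    qed (simp add: mean_count_def mean_size_def)
  qed
qed

text \<open>
  Term by term comparison with the increments of \<open>ln (1 - exp (- s l k)) / l\<close>, whose sum telescopes.
\<close>

lemma mean_count_asymptotics:
  defines "B \<equiv> (\<Sum>n\<in>upto 12. 1 / lam n) + 1 / lam 13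
      + (\<Sum>k. 1 / lam (Suc k + 13) - 1 / (real (Suc k) * l)) + (euler_mascheroni - ln l) / l"
  shows "((\<lambda>s. suminf (mean_count s) + ln s / l) \<longlongrightarrow> B) (at_right 0)"
proof -
  define F where "F y = ln (1 - exp (- y))" for y :: real
  define a where "a s k = s * geo_mean (s * lam (Suc k + 13)) - (F (s * l * real (Suc (Suc k))) - F (s * l * real (Suc k))) / l" for s k
  define A where "A k = 1 / lam (Suc k + 13) - (ln (real (Suc (Suc k))) - ln (real (Suc k))) / l" for k
  have I: "Suc k + 13 \<in> I" for k by (intro tail_subset) simp
  have lampos: "lam (Suc k + 13) > 0" for k by (intro lam_pos I)
  obtain c where c: "c > 0" "\<forall>n\<in>I. c * real n \<le> lam n" using lam_linear_lower by blast
  \<comment> \<open>A majorant of order \<open>1 / k ^ 2\<close> free of \<open>s\<close>: one part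
    for replacing \<open>lam\<close> by a linear function, the other for replacing a term by an
    increment of the primitive.\<close>
  define d where "d k = (1 / (c * l) * (C + 13 * l) + 1 / l) * (1 / real (Suc k) ^ 2)" for k
  have dif: "\<bar>1 / lam (Suc k + 13) - 1 / (l * real (Suc k))\<bar> \<le> 1 / (c * l) * (C + 13 * l) * (1 / real (Suc k) ^ 2)" for k
  proof -
    have cl: "c * real (Suc k) \<le> lam (Suc k + 13)"
    proof -
      have "c * real (Suc k) \<le> c * real (Suc k + 13)" using c by (intro mult_left_mono) auto
      then show ?thesis using c(2) I[of k] by force
    qed
    have lk: "l * real (Suc k) > 0" using l_pos by simp
    have "\<bar>1 / lam (Suc k + 13) - 1 / (l * real (Suc k))\<bar> = \<bar>l * real (Suc k) - lam (Suc k + 13)\<bar> / (lam (Suc k + 13) * (l * real (Suc k)))"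
    proof -
      have "1 / x - 1 / y = (y - x) / (x * y)" if "x > 0" "y > 0" for x y :: real
        using that by (simp add: field_simps)
      then have "1 / lam (Suc k + 13) - 1 / (l * real (Suc k)) =
          (l * real (Suc k) - lam (Suc k + 13)) / (lam (Suc k + 13) * (l * real (Suc k)))"
        using lampos[of k] lk by blast
      moreover have "lam (Suc k + 13) * (l * real (Suc k)) > 0" using lampos[of k] lk by (rule mult_pos_pos)
      ultimately show ?thesis by (simp only: abs_divide abs_of_pos)
    qed
    also have "\<dots> \<le> (C + 13 * l) / (c * real (Suc k) * (l * real (Suc k)))"
    proof (rule frac_le)
      show "\<bar>l * real (Suc k) - lam (Suc k + 13)\<bar> \<le> C + 13 * l" using lam_close[OF I, of k] l_pos by (simp add: algebra_simps)
      show "c * real (Suc k) * (l * real (Suc k)) \<le> lam (Suc k + 13) * (l * real (Suc k))"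
        using cl lk by (intro mult_right_mono) auto
    qed (use C_nonneg l_pos c in auto)
    finally show ?thesis by (simp add: power2_eq_square mult_ac)
  qed
  have lim: "((\<lambda>s. a s k) \<longlongrightarrow> A k) (at_right 0)" for k
  proof -
    have "((\<lambda>s. F (s * l * real (Suc (Suc k))) - F (s * l * real (Suc k))) \<longlongrightarrow> ln (real (Suc (Suc k))) - ln (real (Suc k))) (at_right 0)"
    proof -
      define p q where "p = l * real (Suc (Suc k))" and "q = l * real (Suc k)"
      have pq: "p > 0" "q > 0" using l_pos by (auto simp: p_def q_def)
      \<comment> \<open>Each logarithm diverges as \<open>s\<close> tends to 0; joined into the
        logarithm of a quotient they have a finite limit.\<close>
      have "((\<lambda>s. ln ((1 - exp (- (s * p))) / (1 - exp (- (s * q))))) \<longlongrightarrow> ln (p / q)) (at_right 0)"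
      proof (rule tendsto_ln)
        show "((\<lambda>s. (1 - exp (- (s * p))) / (1 - exp (- (s * q)))) \<longlongrightarrow> p / q) (at_right 0)"
        proof -
          have "((\<lambda>s. (1 - exp (- (s * p))) / (1 - exp (- (s * q)))) \<longlongrightarrow> p * inverse q) (at_right 0)"
            using pq by real_asymp
          then show ?thesis by (simp only: divide_inverse[of p q])
        qed
      qed (use pq in auto)
      moreover have "eventually (\<lambda>s. ln ((1 - exp (- (s * p))) / (1 - exp (- (s * q)))) = F (s * l * real (Suc (Suc k))) - F (s * l * real (Suc k))) (at_right 0)"
        using eventually_at_right_less[of "0::real"]
      proof eventually_elim
        case (elim s)
        then have "s * p > 0" "s * q > 0" using pq by auto
        then show ?case by (simp add: F_def p_def q_def mult.assoc ln_div del: of_nat_Suc)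
      qed
      moreover have "ln (p / q) = ln (real (Suc (Suc k))) - ln (real (Suc k))"
        using l_pos by (simp add: p_def q_def ln_div del: of_nat_Suc)
      ultimately show ?thesis using Lim_transform_eventually by fastforce
    qed
    then have "((\<lambda>s. (F (s * l * real (Suc (Suc k))) - F (s * l * real (Suc k))) / l) \<longlongrightarrow>
        (ln (real (Suc (Suc k))) - ln (real (Suc k))) / l) (at_right 0)"
      using l_pos by (intro tendsto_divide tendsto_const) auto
    then show ?thesis unfolding a_def A_def
      by (rule tendsto_diff[OF tendsto_scaled_geo_mean[OF lampos]])
  qed
  have dom: "norm (a s k) \<le> d k" if s: "s > 0" for s k
  proof -
    let ?x = "s * l * real (Suc k)" and ?y = "s * l * real (Suc (Suc k))"
    have sl: "0 < s * l" using s l_pos by simp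
    have y_eq: "?y = ?x + s * l" by (simp add: algebra_simps)
    have xy: "0 < ?x" "?x < ?y" "?y - ?x = s * l" using sl unfolding y_eq by simp_all
    have "\<bar>s * geo_mean (s * lam (Suc k + 13)) - s * geo_mean (s * (l * real (Suc k)))\<bar> \<le> \<bar>1 / lam (Suc k + 13) - 1 / (l * real (Suc k))\<bar>"
      using s l_pos lampos by (intro scaled_geo_mean_diff) auto
    then have 1: "\<bar>s * geo_mean (s * lam (Suc k + 13)) - s * geo_mean ?x\<bar> \<le> 1 / (c * l) * (C + 13 * l) * (1 / real (Suc k) ^ 2)"
      using dif[of k] by (simp add: mult.assoc)
    have "\<bar>s * l * geo_mean ?x - (F ?y - F ?x)\<bar> \<le> s * l * (1 / ?x - 1 / ?y)"
      using ln_one_minus_exp_increment[OF xy(1,2)] unfolding xy(3) F_def .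
    also have "\<dots> = 1 / real (Suc k) - 1 / real (Suc (Suc k))" using s l_pos by (simp add: field_simps del: of_nat_Suc)
    also have "\<dots> \<le> 1 / real (Suc k) ^ 2"
      by (simp add: divide_simps power2_eq_square)
    finally have "\<bar>s * l * geo_mean ?x - (F ?y - F ?x)\<bar> / l \<le> (1 / real (Suc k) ^ 2) / l" using l_pos by (intro divide_right_mono) auto
    moreover have "\<bar>s * geo_mean ?x - (F ?y - F ?x) / l\<bar> = \<bar>s * l * geo_mean ?x - (F ?y - F ?x)\<bar> / l"
    proof -
      have "s * geo_mean ?x - (F ?y - F ?x) / l = (s * l * geo_mean ?x - (F ?y - F ?x)) / l" using l_pos by (simp add: diff_divide_distrib)
      then show ?thesis using l_pos by simp
    qed
    ultimately have 2: "\<bar>s * geo_mean ?x - (F ?y - F ?x) / l\<bar> \<le> 1 / l * (1 / real (Suc k) ^ 2)" by (simp add: mult.commute)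
    show ?thesis using 1 2 unfolding a_def d_def distrib_right real_norm_def by linarith
  qed
  have dsum: "summable d"
    unfolding d_def using inverse_squares_sums by (intro summable_mult) (auto simp: sums_iff add.commute)
  have "eventually (\<lambda>(k::nat, s::real). s > 0) (sequentially \<times>\<^sub>F at_right 0)"
    by (subst eventually_prod2) (auto simp: eventually_at_right_less)
  then have "eventually (\<lambda>(k, s). norm (a s k) \<le> d k) (sequentially \<times>\<^sub>F at_right 0)"
    by (rule eventually_mono) (use dom in auto)
  from tannerys_theorem[OF lim this dsum]
  have tan: "((\<lambda>s. \<Sum>k. a s k) \<longlongrightarrow> suminf A) (at_right 0)" by simp
  \<comment> \<open>Inserting \<open>1 / k\<close> splits the limit term into the series in the
    definition of \<open>b\<^sub>1\<close> and a series with sum Euler's constant.\<close>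
  have Aeq: "A k = (1 / lam (Suc k + 13) - 1 / (real (Suc k) * l)) + 1 / l * (inverse (real (k + 1)) + ln (real (k + 1)) - ln (real (k + 2)))" for k
  proof -
    have "p - (u - w) / l = (p - 1 / (x * l)) + 1 / l * (inverse x + w - u)" if "x > 0" for p u w x
      using l_pos that by (simp add: field_simps)
    from this[of "real (Suc k)"] show ?thesis by (simp add: A_def)
  qed
  have s1: "summable (\<lambda>k. 1 / lam (Suc k + 13) - 1 / (real (Suc k) * l))"
  proof (rule summable_comparison_test'[where N = 0])
    show "summable (\<lambda>k. 1 / (c * l) * (C + 13 * l) * (1 / real (Suc k) ^ 2))"
      using inverse_squares_sums by (intro summable_mult) (auto simp: sums_iff add.commute)
    show "norm (1 / lam (Suc k + 13) - 1 / (real (Suc k) * l)) \<le> 1 / (c * l) * (C + 13 * l) * (1 / real (Suc k) ^ 2)" for k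
      using dif[of k] by (simp add: mult.commute)
  qed
  have "A sums ((\<Sum>k. 1 / lam (Suc k + 13) - 1 / (real (Suc k) * l)) + 1 / l * euler_mascheroni)"
    unfolding Aeq by (intro sums_add sums_mult summable_sums[OF s1] euler_mascheroni_sum_real)
  then have Asum: "suminf A = (\<Sum>k. 1 / lam (Suc k + 13) - 1 / (real (Suc k) * l)) + euler_mascheroni / l"
    by (simp add: sums_iff)
  \<comment> \<open>The comparison starts at index \<open>Suc k + 13 = k + 14\<close>, so indices 0
    to 13 are kept apart. The increments telescope to \<open>- ln (1 - exp (- s * l)) / l\<close>,
    and this is the source of \<open>ln s / l\<close>.\<close>
  have eq: "suminf (mean_count s) + ln s / l = (\<Sum>n<14. mean_count s n) + (\<Sum>k. a s k) - ln ((1 - exp (- (s * l))) / s) / l" if s: "s > 0" for s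
  proof -
    have "(\<lambda>k. F (s * l * real (Suc k))) \<longlonglongrightarrow> 0" unfolding F_def using s l_pos by real_asymp
    from telescope_sums[OF this] have "(\<lambda>k. F (s * l * real (Suc (Suc k))) - F (s * l * real (Suc k))) sums (0 - F (s * l))" by simp
    then have t: "(\<lambda>k. (F (s * l * real (Suc (Suc k))) - F (s * l * real (Suc k))) / l) sums ((0 - F (s * l)) / l)" by (rule sums_divide)
    have sm: "summable (\<lambda>k. mean_count s (k + 14))" using summable_mean_count[OF s] by (simp only: summable_iff_shift)
    have "mean_count s (k + 14) = s * geo_mean (s * lam (Suc k + 13))" for k
      using I[of k] by (simp add: mean_count_def add.commute)
    then have "a s = (\<lambda>k. mean_count s (k + 14) - (F (s * l * real (Suc (Suc k))) - F (s * l * real (Suc k))) / l)"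
      unfolding a_def by (auto simp: fun_eq_iff)
    then have "a s sums ((\<Sum>k. mean_count s (k + 14)) - (0 - F (s * l)) / l)"
      using sums_diff[OF summable_sums[OF sm] t] by simp
    then have "(\<Sum>k. a s k) = (\<Sum>k. mean_count s (k + 14)) + F (s * l) / l" by (simp add: sums_iff)
    moreover have "suminf (mean_count s) = (\<Sum>k. mean_count s (k + 14)) + (\<Sum>k<14. mean_count s k)"
      by (rule suminf_split_initial_segment[OF summable_mean_count[OF s]])
    moreover have "ln ((1 - exp (- (s * l))) / s) = F (s * l) - ln s"
      using s l_pos by (simp add: F_def ln_div)
    ultimately show ?thesis by (simp add: diff_divide_distrib)
  qed
  have "((\<lambda>s. (\<Sum>n<14. mean_count s n) + (\<Sum>k. a s k) - ln ((1 - exp (- (s * l))) / s) / l) \<longlongrightarrow>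
      (\<Sum>n<14. if n \<in> I then 1 / lam n else 0) + suminf A - ln l / l) (at_right 0)"
  proof (intro tendsto_diff tendsto_add tendsto_sum tan tendsto_divide tendsto_ln tendsto_const)
    show "((\<lambda>s. mean_count s n) \<longlongrightarrow> (if n \<in> I then 1 / lam n else 0)) (at_right 0)" for n
      using tendsto_scaled_geo_mean[OF lam_pos[of n]] by (simp add: mean_count_def)
    show "((\<lambda>s. (1 - exp (- (s * l))) / s) \<longlongrightarrow> l) (at_right 0)" using l_pos by real_asymp
  qed (use l_pos in auto)
  moreover have "(\<Sum>n<14. if n \<in> I then 1 / lam n else 0) = (\<Sum>n\<in>upto 12. 1 / lam n) + 1 / lam 13"
  proof -
    have "(\<Sum>n<14. if n \<in> I then 1 / lam n else 0) = (\<Sum>n\<in>{n. n < 14 \<and> n \<in> I}. 1 / lam n)"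
      by (simp add: sum.If_cases Int_def)
    also have "{n. n < 14 \<and> n \<in> I} = insert 13 (upto 12)" using tail_subset[of 13] by (auto simp: upto_def)
    also have "sum (\<lambda>n. 1 / lam n) \<dots> = (\<Sum>n\<in>upto 12. 1 / lam n) + 1 / lam 13"
      by (subst sum.insert) (auto simp: upto_def)
    finally show ?thesis .
  qed
  ultimately have "((\<lambda>s. (\<Sum>n<14. mean_count s n) + (\<Sum>k. a s k) - ln ((1 - exp (- (s * l))) / s) / l) \<longlongrightarrow> B) (at_right 0)"
    unfolding Asum B_def by (simp add: diff_divide_distrib add_divide_distrib algebra_simps)
  then show ?thesis
    by (rule Lim_transform_eventually)
       (auto intro!: eventually_mono[OF eventually_at_right_less[of "0::real"]] simp: eq)
qed

end

section \<open>Local limit theorem for the Boltzmann model\<close>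

lemma norm_integral_le:
  fixes f :: "'a \<Rightarrow> 'b :: {banach, second_countable_topology}"
  assumes "\<And>x. norm (f x) \<le> g x" "integrable M f" "integrable M g"
  shows "norm (integral\<^sup>L M f) \<le> integral\<^sup>L M g"
proof -
  have "norm (integral\<^sup>L M f) \<le> integral\<^sup>L M (\<lambda>x. norm (f x))" by (rule integral_norm_bound)
  also have "\<dots> \<le> integral\<^sup>L M g" using assms by (intro integral_mono) auto
  finally show ?thesis .
qed

lemma exp_minus_linear_bound:
  fixes x :: real
  assumes "x \<ge> 0"
  shows "\<bar>exp (- x) - (1 - x)\<bar> \<le> x ^ 2 / 2"
proof -
  have "1 - x \<le> exp (- x)" using exp_ge_add_one_self[of "- x"] by simp
  moreover have "exp (- x) \<le> 1 - x + x ^ 2 / 2"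
  proof -
    have "1 \<le> (1 + x + x ^ 2 / 2) * (1 - x + x ^ 2 / 2)"
    proof -
      have "(1 + x + x ^ 2 / 2) * (1 - x + x ^ 2 / 2) = 1 + (x ^ 2) ^ 2 / 4"
        by (simp add: power2_eq_square algebra_simps)
      then show ?thesis by simp
    qed
    also have "\<dots> \<le> exp x * (1 - x + x ^ 2 / 2)"
    proof (rule mult_right_mono[OF exp_lower_Taylor_quadratic[OF assms]])
      have eq: "1 - x + x ^ 2 / 2 = (1 + (1 - x) ^ 2) / 2" by (simp add: power2_eq_square field_simps)
      show "0 \<le> 1 - x + x ^ 2 / 2" unfolding eq by simp
    qed
    finally show ?thesis by (simp add: exp_minus field_simps)
  qed
  ultimately show ?thesis by linarith
qed

text \<open>By \<open>1 - cos x = 2 * sin (x / 2) ^ 2\<close> and \<open>sin t >= t / 2\<close> on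
  \<open>[0, 1]\<close>, where the cosine is at least that of 60 degrees.\<close>

lemma one_minus_cos_ge:
  fixes x :: real
  assumes "\<bar>x\<bar> \<le> 2"
  shows "x ^ 2 / 8 \<le> 1 - cos x"
proof -
  define t where "t = \<bar>x\<bar> / 2"
  have t: "0 \<le> t" "t \<le> 1" using assms by (auto simp: t_def)
  have c: "cos z \<ge> 1 / 2" if "0 \<le> z" "z \<le> 1" for z :: real
  proof -
    have "cos (pi / 3) \<le> cos z" using that pi_gt3 by (intro cos_monotone_0_pi_le) auto
    then show ?thesis by (simp add: cos_60)
  qed
  have "(\<lambda>t. sin t - t / 2) 0 \<le> (\<lambda>t. sin t - t / 2) t"
  proof (rule DERIV_nonneg_imp_nondecreasing[where f = "\<lambda>t. sin t - t / 2", OF t(1)])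
    fix z assume "0 \<le> z" "z \<le> t"
    then show "\<exists>y. ((\<lambda>t. sin t - t / 2) has_real_derivative y) (at z) \<and> 0 \<le> y"
      using c[of z] t by (intro exI[of _ "cos z - 1 / 2"]) (auto intro!: derivative_eq_intros)
  qed
  then have "(t / 2) ^ 2 \<le> sin t ^ 2" using t by (intro power_mono) auto
  moreover have "1 - cos x = 2 * sin t ^ 2"
  proof -
    have "cos x = cos (2 * t)" by (simp add: t_def)
    then show ?thesis by (simp only: cos_double_sin)
  qed
  moreover have "x ^ 2 = 4 * t ^ 2" by (simp add: t_def power_divide)
  ultimately show ?thesis by (simp add: power_divide)
qed

section \<open>Characteristic function of a single geometric variable\<close>

context
  fixes z :: real
  assumes z: "z > 0"
begin

private definition "b a = real a - geo_mean z"

private lemma moments: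
  "measure_pmf.expectation (geometric_pmf (1 - exp (- z))) b = 0" "integrable (measure_pmf (geometric_pmf (1 - exp (- z)))) b"
  "integrable (measure_pmf (geometric_pmf (1 - exp (- z)))) (\<lambda>a. b a ^ 2)"
  "measure_pmf.expectation (geometric_pmf (1 - exp (- z))) (\<lambda>a. b a ^ 2) = geo_var z"
  "integrable (measure_pmf (geometric_pmf (1 - exp (- z)))) (\<lambda>a. \<bar>b a\<bar> ^ 3)"
  "measure_pmf.expectation (geometric_pmf (1 - exp (- z))) (\<lambda>a. \<bar>b a\<bar> ^ 3) \<le> 28 * (geo_mean z * (1 + geo_mean z) ^ 2)"
proof -
  have q: "0 < exp (- z)" "exp (- z) < 1" using z by auto
  note m = geometric_pmf_central_moments[OF q geo_mean_eq(1)[OF z], folded b_def[abs_def]]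
  show "measure_pmf.expectation (geometric_pmf (1 - exp (- z))) b = 0" "integrable (measure_pmf (geometric_pmf (1 - exp (- z)))) b"
    "integrable (measure_pmf (geometric_pmf (1 - exp (- z)))) (\<lambda>a. b a ^ 2)"
    "measure_pmf.expectation (geometric_pmf (1 - exp (- z))) (\<lambda>a. b a ^ 2) = geo_var z"
    "integrable (measure_pmf (geometric_pmf (1 - exp (- z)))) (\<lambda>a. \<bar>b a\<bar> ^ 3)"
    "measure_pmf.expectation (geometric_pmf (1 - exp (- z))) (\<lambda>a. \<bar>b a\<bar> ^ 3) \<le> 28 * (geo_mean z * (1 + geo_mean z) ^ 2)"
    using m geo_mean_eq(3)[OF z] unfolding b_def[abs_def] by simp_all
qed

private lemma char_b: "geo_char z \<alpha> = measure_pmf.expectation (geometric_pmf (1 - exp (- z))) (\<lambda>a. iexp (\<alpha> * b a))"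
  by (simp add: geo_char_def b_def)

private lemma int_b: "integrable (measure_pmf (geometric_pmf (1 - exp (- z)))) (\<lambda>a. iexp (\<alpha> * b a))"
  by (rule measure_pmf.integrable_const_bound[where B = 1]) auto

lemma norm_geo_char_minus_1:
  "norm (geo_char z \<alpha> - 1) \<le> \<alpha> ^ 2 * geo_var z / 2"
  "norm (geo_char z \<alpha> - 1) \<le> \<bar>\<alpha>\<bar> * sqrt (geo_var z)"
proof -
  have e: "geo_char z \<alpha> - 1 = measure_pmf.expectation (geometric_pmf (1 - exp (- z))) (\<lambda>a. iexp (\<alpha> * b a) - 1 - \<i> * (\<alpha> * b a))"
    unfolding char_b using int_b[of \<alpha>] moments(1,2) by (simp add: integral_complex_of_real)
  have bd: "norm (iexp x - 1 - \<i> * x) \<le> x ^ 2 / 2" for x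
    using iexp_approx1[of x 1] by (simp add: power2_eq_square diff_diff_eq)
  have "norm (geo_char z \<alpha> - 1) \<le> measure_pmf.expectation (geometric_pmf (1 - exp (- z))) (\<lambda>a. \<alpha> ^ 2 / 2 * b a ^ 2)"
    unfolding e
  proof (rule norm_integral_le)
    show "norm (iexp (\<alpha> * b a) - 1 - \<i> * (\<alpha> * b a)) \<le> \<alpha> ^ 2 / 2 * b a ^ 2" for a
      using bd[of "\<alpha> * b a"] by (simp add: power_mult_distrib)
  qed (use int_b moments in auto)
  then show "norm (geo_char z \<alpha> - 1) \<le> \<alpha> ^ 2 * geo_var z / 2" using moments by simp
  have e: "geo_char z \<alpha> - 1 = measure_pmf.expectation (geometric_pmf (1 - exp (- z))) (\<lambda>a. iexp (\<alpha> * b a) - 1)"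
    unfolding char_b using int_b[of \<alpha>] by simp
  have bd: "norm (iexp x - 1) \<le> \<bar>x\<bar>" for x using iexp_approx1[of x 0] by simp
  have "norm (geo_char z \<alpha> - 1) \<le> measure_pmf.expectation (geometric_pmf (1 - exp (- z))) (\<lambda>a. \<bar>\<alpha>\<bar> * \<bar>b a\<bar>)"
    unfolding e
  proof (rule norm_integral_le)
    show "norm (iexp (\<alpha> * b a) - 1) \<le> \<bar>\<alpha>\<bar> * \<bar>b a\<bar>" for a
      using bd[of "\<alpha> * b a"] by (simp add: abs_mult)
  qed (use int_b moments in auto)
  also have "\<dots> = \<bar>\<alpha>\<bar> * measure_pmf.expectation (geometric_pmf (1 - exp (- z))) (\<lambda>a. \<bar>b a\<bar>)" by simp
  also have "measure_pmf.expectation (geometric_pmf (1 - exp (- z))) (\<lambda>a. \<bar>b a\<bar>) \<le> sqrt (geo_var z)"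
  proof (rule real_le_rsqrt)
    have "measure_pmf.variance (geometric_pmf (1 - exp (- z))) (\<lambda>a. \<bar>b a\<bar>) \<ge> 0" by simp
    then show "(measure_pmf.expectation (geometric_pmf (1 - exp (- z))) (\<lambda>a. \<bar>b a\<bar>)) ^ 2 \<le> geo_var z"
      using moments by (subst (asm) measure_pmf.variance_eq) auto
  qed
  finally show "norm (geo_char z \<alpha> - 1) \<le> \<bar>\<alpha>\<bar> * sqrt (geo_var z)" by (simp add: mult_left_mono)
qed

text \<open>Measures how far one variable fails to treat two frequencies as independent. The defect
  is a covariance of two factors, each \<open>O\<close> of its frequency times the deviation; it
  will separate the count frequency from the size frequency.\<close>

lemma geo_char_add_approx:
  "norm (geo_char z (\<alpha> + \<beta>) - geo_char z \<alpha> * geo_char z \<beta>) \<le> 2 * \<bar>\<alpha> * \<beta>\<bar> * geo_var z"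
proof -
  have bd: "norm (iexp x - 1) \<le> \<bar>x\<bar>" for x using iexp_approx1[of x 0] by simp
  define E where "E = measure_pmf.expectation (geometric_pmf (1 - exp (- z))) (\<lambda>a. (iexp (\<alpha> * b a) - 1) * (iexp (\<beta> * b a) - 1))"
  have "E = measure_pmf.expectation (geometric_pmf (1 - exp (- z))) (\<lambda>a. iexp ((\<alpha> + \<beta>) * b a) - iexp (\<alpha> * b a) - iexp (\<beta> * b a) + 1)"
    unfolding E_def by (intro Bochner_Integration.integral_cong refl) (simp add: algebra_simps flip: exp_add)
  also have "\<dots> = geo_char z (\<alpha> + \<beta>) - geo_char z \<alpha> - geo_char z \<beta> + 1"
    unfolding char_b using int_b[of "\<alpha> + \<beta>"] int_b[of \<alpha>] int_b[of \<beta>] by (simp del: of_real_add)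
  finally have eq: "geo_char z (\<alpha> + \<beta>) - geo_char z \<alpha> * geo_char z \<beta> = E - (geo_char z \<alpha> - 1) * (geo_char z \<beta> - 1)"
    by (simp add: algebra_simps)
  have "norm E \<le> measure_pmf.expectation (geometric_pmf (1 - exp (- z))) (\<lambda>a. \<bar>\<alpha> * \<beta>\<bar> * b a ^ 2)"
    unfolding E_def
  proof (rule norm_integral_le)
    show "norm ((iexp (\<alpha> * b a) - 1) * (iexp (\<beta> * b a) - 1)) \<le> \<bar>\<alpha> * \<beta>\<bar> * b a ^ 2" for a
    proof -
      have "norm (iexp (\<alpha> * b a) - 1) * norm (iexp (\<beta> * b a) - 1) \<le> \<bar>\<alpha> * b a\<bar> * \<bar>\<beta> * b a\<bar>"
        by (intro mult_mono bd) auto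
      also have "\<dots> = \<bar>\<alpha> * \<beta>\<bar> * (\<bar>b a\<bar> * \<bar>b a\<bar>)" by (simp only: abs_mult mult_ac)
      also have "\<bar>b a\<bar> * \<bar>b a\<bar> = b a ^ 2" by (simp add: power2_eq_square)
      finally show ?thesis by (simp only: norm_mult)
    qed
    show "integrable (measure_pmf (geometric_pmf (1 - exp (- z)))) (\<lambda>a. (iexp (\<alpha> * b a) - 1) * (iexp (\<beta> * b a) - 1))"
    proof (rule measure_pmf.integrable_const_bound[where B = "2 * 2"])
      have n2: "norm (iexp x - 1) \<le> 2" for x using norm_triangle_ineq4[of "iexp x" 1] by simp
      have "norm ((iexp (\<alpha> * b a) - 1) * (iexp (\<beta> * b a) - 1)) \<le> 2 * 2" for a
        unfolding norm_mult by (intro mult_mono n2) auto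
      then show "AE a in measure_pmf (geometric_pmf (1 - exp (- z))). norm ((iexp (\<alpha> * b a) - 1) * (iexp (\<beta> * b a) - 1)) \<le> 2 * 2"
        by blast
    qed simp
  qed (use moments in auto)
  then have 1: "norm E \<le> \<bar>\<alpha> * \<beta>\<bar> * geo_var z" using moments by simp
  have "norm ((geo_char z \<alpha> - 1) * (geo_char z \<beta> - 1)) \<le> (\<bar>\<alpha>\<bar> * sqrt (geo_var z)) * (\<bar>\<beta>\<bar> * sqrt (geo_var z))"
    unfolding norm_mult using geo_mean_eq(5)[OF z] by (intro mult_mono norm_geo_char_minus_1) auto
  also have "\<dots> = \<bar>\<alpha> * \<beta>\<bar> * (sqrt (geo_var z) * sqrt (geo_var z))" by (simp only: abs_mult mult_ac)
  also have "\<dots> = \<bar>\<alpha> * \<beta>\<bar> * geo_var z" using geo_mean_eq(5)[OF z] by simp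
  finally show ?thesis unfolding eq using 1 norm_triangle_ineq4[of E "(geo_char z \<alpha> - 1) * (geo_char z \<beta> - 1)"] by linarith
qed

text \<open>Both functions are compared with their common second-order polynomial. The error is an
  absolute third moment on one side and the square of the exponent on the other.\<close>

lemma geo_char_gaussian_approx:
  "norm (geo_char z \<beta> - exp (- (\<beta> ^ 2 * geo_var z / 2))) \<le>
    5 * \<bar>\<beta>\<bar> ^ 3 * (geo_mean z * (1 + geo_mean z) ^ 2) + (\<beta> ^ 2 * geo_var z) ^ 2 / 8"
proof -
  have bd: "norm (iexp x - (1 + \<i> * x - x ^ 2 / 2)) \<le> \<bar>x\<bar> ^ 3 / 6" for x
  proof -
    have "(\<Sum>k\<le>2. (\<i> * x) ^ k / fact k) = 1 + \<i> * x - x ^ 2 / 2"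
      by (simp add: numeral_2_eq_2) (simp add: power_mult_distrib flip: power2_eq_square)
    then show ?thesis using iexp_approx1[of x 2] by (simp add: numeral_3_eq_3 fact_numeral)
  qed
  have taylor: "1 + \<i> * (\<beta> * b a) - (\<beta> * b a) ^ 2 / 2 =
      1 + \<i> * \<beta> * complex_of_real (b a) - \<beta> ^ 2 / 2 * complex_of_real (b a ^ 2)" for a
    by (simp add: power_mult_distrib)
  have intb: "complex_integrable (measure_pmf (geometric_pmf (1 - exp (- z)))) (\<lambda>a. complex_of_real (b a))"
    "complex_integrable (measure_pmf (geometric_pmf (1 - exp (- z)))) (\<lambda>a. complex_of_real (b a ^ 2))"
    using moments by (simp_all only: complex_of_real_integrable_eq)
  have int2: "integrable (measure_pmf (geometric_pmf (1 - exp (- z)))) (\<lambda>a. 1 + \<i> * (\<beta> * b a) - (\<beta> * b a) ^ 2 / 2)"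
    unfolding taylor using intb
    by (intro Bochner_Integration.integrable_diff Bochner_Integration.integrable_add integrable_mult_right) auto
  have "geo_char z \<beta> - (1 - \<beta> ^ 2 * geo_var z / 2) =
      measure_pmf.expectation (geometric_pmf (1 - exp (- z))) (\<lambda>a. iexp (\<beta> * b a) - (1 + \<i> * (\<beta> * b a) - (\<beta> * b a) ^ 2 / 2))"
  proof -
    have "measure_pmf.expectation (geometric_pmf (1 - exp (- z))) (\<lambda>a. 1 + \<i> * (\<beta> * b a) - (\<beta> * b a) ^ 2 / 2) =
       measure_pmf.expectation (geometric_pmf (1 - exp (- z))) (\<lambda>a. 1 + \<i> * \<beta> * complex_of_real (b a) - \<beta> ^ 2 / 2 * complex_of_real (b a ^ 2))"
      unfolding taylor ..
    also have "\<dots> = 1 + \<i> * \<beta> * complex_of_real (measure_pmf.expectation (geometric_pmf (1 - exp (- z))) b) - \<beta> ^ 2 / 2 * complex_of_real (measure_pmf.expectation (geometric_pmf (1 - exp (- z))) (\<lambda>a. b a ^ 2))"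
      using intb by (simp add: integral_complex_of_real del: of_real_power)
    also have "\<dots> = 1 - \<beta> ^ 2 * geo_var z / 2" using moments by simp
    finally show ?thesis unfolding char_b using int_b[of \<beta>] int2 by simp
  qed
  also have "norm \<dots> \<le> measure_pmf.expectation (geometric_pmf (1 - exp (- z))) (\<lambda>a. \<bar>\<beta>\<bar> ^ 3 / 6 * \<bar>b a\<bar> ^ 3)"
  proof (rule norm_integral_le)
    show "norm (iexp (\<beta> * b a) - (1 + \<i> * (\<beta> * b a) - (\<beta> * b a) ^ 2 / 2)) \<le> \<bar>\<beta>\<bar> ^ 3 / 6 * \<bar>b a\<bar> ^ 3" for a
      using bd[of "\<beta> * b a"] by (simp add: abs_mult power_mult_distrib)
  qed (use int_b int2 moments in auto)
  also have "\<dots> = \<bar>\<beta>\<bar> ^ 3 / 6 * measure_pmf.expectation (geometric_pmf (1 - exp (- z))) (\<lambda>a. \<bar>b a\<bar> ^ 3)" by simp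
  also have "\<dots> \<le> \<bar>\<beta>\<bar> ^ 3 / 6 * (28 * (geo_mean z * (1 + geo_mean z) ^ 2))" using moments(6) by (intro mult_left_mono) auto
  \<comment> \<open>Since \<open>28 / 6 <= 5\<close>.\<close>
  also have "\<dots> \<le> 5 * \<bar>\<beta>\<bar> ^ 3 * (geo_mean z * (1 + geo_mean z) ^ 2)"
  proof -
    have "0 \<le> \<bar>\<beta>\<bar> ^ 3 * (geo_mean z * (1 + geo_mean z) ^ 2)" using geo_mean_eq(4)[OF z] by simp
    then show ?thesis by (simp add: field_simps)
  qed
  finally have 1: "norm (geo_char z \<beta> - (1 - \<beta> ^ 2 * geo_var z / 2)) \<le> 5 * \<bar>\<beta>\<bar> ^ 3 * (geo_mean z * (1 + geo_mean z) ^ 2)" .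
  let ?x = "\<beta> ^ 2 * geo_var z / 2"
  have "?x \<ge> 0" using geo_mean_eq(5)[OF z] by simp
  then have "\<bar>exp (- ?x) - (1 - ?x)\<bar> \<le> (\<beta> ^ 2 * geo_var z) ^ 2 / 8" using exp_minus_linear_bound[of ?x] by (simp add: power_divide)
  then have 2: "norm (complex_of_real (exp (- ?x)) - complex_of_real (1 - ?x)) \<le> (\<beta> ^ 2 * geo_var z) ^ 2 / 8"
    by (simp only: norm_of_real flip: of_real_diff)
  have "norm (geo_char z \<beta> - complex_of_real (exp (- ?x))) \<le>
      norm (geo_char z \<beta> - complex_of_real (1 - ?x)) + norm (complex_of_real (exp (- ?x)) - complex_of_real (1 - ?x))"
    using norm_triangle_ineq4[of "geo_char z \<beta> - complex_of_real (1 - ?x)" "complex_of_real (exp (- ?x)) - complex_of_real (1 - ?x)"]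
    by simp
  then show ?thesis using 1 2 by simp
qed

text \<open>The hypotheses keep the angle within \<open>[-2, 2]\<close>, where
  \<open>1 - cos\<close> is quadratic, and the variance above \<open>1 / (3 * z ^ 2)\<close>. The
  count frequency perturbs the exponent only by a multiple of \<open>\<eta> ^ 2 / m ^ 2\<close>,
  which is summable over the indices and costs a constant factor in the product.\<close>

lemma norm_geo_char_decay:
  assumes s: "s > 0" "s * \<bar>\<eta>\<bar> \<le> 1" and m: "m > 0" "z = s * m" "z \<le> 1" "\<bar>u\<bar> * z \<le> 1"
  shows "norm (geo_char z (s * (\<eta> + u * m))) \<le> exp (- (min 1 (u ^ 2) / 96) + \<eta> ^ 2 / (48 * m ^ 2))"
proof -
  let ?\<alpha> = "s * (\<eta> + u * m)"
  \<comment> \<open>The 12 comes from the constants 3 and 8 in the bounds for the variance and for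
    \<open>1 - cos\<close>. Capping \<open>u ^ 2\<close> at 1 keeps \<open>X\<close> at most 1, so
    that \<open>1 + X >= exp (X / 2)\<close>.\<close>
  define X where "X = (min 1 (u ^ 2) / 2 - \<eta> ^ 2 / m ^ 2) / 12"
  have a2: "\<bar>?\<alpha>\<bar> \<le> 2"
  proof -
    have "\<bar>?\<alpha>\<bar> = \<bar>s * \<eta> + u * z\<bar>" using m by (simp add: algebra_simps)
    also have "\<dots> \<le> s * \<bar>\<eta>\<bar> + \<bar>u\<bar> * z" using s z by (auto intro!: order_trans[OF abs_triangle_ineq] simp: abs_mult)
    finally show ?thesis using s m by linarith
  qed
  have "exp (- z) \<ge> 1 / 3"
  proof -
    have "exp z \<le> exp 1" using m by simp
    then have "exp z \<le> 3" using exp_le by linarith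
    then show ?thesis by (simp add: exp_minus field_simps)
  qed
  then have "1 / 3 / z ^ 2 \<le> exp (- z) / z ^ 2" by (intro divide_right_mono) auto
  then have gv: "1 / (3 * z ^ 2) \<le> geo_var z" using geo_var_ge[OF z] by simp
  have "X \<le> (\<eta> / m + u) ^ 2 / 12"
  proof -
    \<comment> \<open>The defect is the square \<open>(2 * x + u) ^ 2 / 2\<close> with
      \<open>x = \<eta> / m\<close>.\<close>
    have "u ^ 2 / 2 - (\<eta> / m) ^ 2 \<le> (\<eta> / m + u) ^ 2"
    proof -
      have "(x + u) ^ 2 - (u ^ 2 / 2 - x ^ 2) = (2 * x + u) ^ 2 / 2" for x :: real
        by (simp add: power2_eq_square field_simps)
      moreover have "0 \<le> (2 * (\<eta> / m) + u) ^ 2 / 2" by simp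
      ultimately have "0 \<le> (\<eta> / m + u) ^ 2 - (u ^ 2 / 2 - (\<eta> / m) ^ 2)" by metis
      then show ?thesis by linarith
    qed
    moreover have "min 1 (u ^ 2) \<le> u ^ 2" by simp
    moreover have "(M / 2 - B) / 12 \<le> A / 12" if "W / 2 - B \<le> A" "M \<le> W" for M B A W :: real
      using that by (intro divide_right_mono) auto
    ultimately show ?thesis unfolding X_def power_divide[symmetric] by blast
  qed
  also have "(\<eta> / m + u) ^ 2 / 12 = 2 * (1 / (3 * z ^ 2)) * (?\<alpha> ^ 2 / 8)"
    using m s by (simp add: power2_eq_square field_simps)
  also have "\<dots> \<le> 2 * geo_var z * (1 - cos ?\<alpha>)"
    using gv geo_mean_eq(5)[OF z] one_minus_cos_ge[OF a2] by (intro mult_mono) auto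
  finally have X: "X \<le> 2 * geo_var z * (1 - cos ?\<alpha>)" .
  have nn: "0 \<le> 2 * geo_var z * (1 - cos ?\<alpha>)" using geo_mean_eq(5)[OF z] by simp
  have "norm (geo_char z ?\<alpha>) ^ 2 \<le> exp (- (X / 2))"
  proof (cases "X \<le> 0")
    case True
    have "norm (geo_char z ?\<alpha>) ^ 2 \<le> 1" using norm_geo_char_le_1 by (simp add: power_le_one)
    also have "1 \<le> exp (- (X / 2))" using True by simp
    finally show ?thesis .
  next
    case False
    have "min 1 (u ^ 2) \<le> 1" "0 \<le> \<eta> ^ 2 / m ^ 2" by simp_all
    moreover have "X * 12 = min 1 (u ^ 2) / 2 - \<eta> ^ 2 / m ^ 2" by (simp add: X_def)
    ultimately have "X \<le> 1" by linarith
    then have "exp (X / 2) \<le> 1 + X / 2 + (X / 2) ^ 2" using False by (intro exp_bound) auto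
    also have "(X / 2) ^ 2 \<le> X / 2 * 1" unfolding power2_eq_square using False \<open>X \<le> 1\<close> by (intro mult_left_mono) auto
    finally have e: "exp (X / 2) \<le> 1 + X" by simp
    have "norm (geo_char z ?\<alpha>) ^ 2 \<le> 1 / (1 + X)"
      unfolding norm_geo_char_square[OF z] using X False by (intro frac_le) auto
    also have "\<dots> \<le> 1 / exp (X / 2)" using e False by (intro frac_le) auto
    finally show ?thesis by (simp add: exp_minus inverse_eq_divide)
  qed
  also have "exp (- (X / 2)) = exp (- (X / 4)) ^ 2" by (simp add: power2_eq_square flip: exp_add)
  finally have "norm (geo_char z ?\<alpha>) \<le> exp (- (X / 4))" by (rule power2_le_imp_le) simp
  also have "- (X / 4) = - (min 1 (u ^ 2) / 96) + \<eta> ^ 2 / (48 * m ^ 2)" by (simp add: X_def field_simps)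
  finally show ?thesis .
qed

end

text \<open>A bounded sequence in \<open>l2\<close> that tends to 0 in each coordinate tends to 0
  weakly: finitely many coordinates vanish in the limit, and Cauchy-Schwarz makes the tail uniformly
  small.\<close>

lemma sum_mult_tail_tendsto_zero:
  fixes x :: "nat \<Rightarrow> real" and y :: "nat \<Rightarrow> nat \<Rightarrow> real"
  assumes x: "\<And>n. x n \<ge> 0" "summable (\<lambda>n. x n ^ 2)"
    and y: "\<And>j n. y j n \<ge> 0" "\<And>n. (\<lambda>j. y j n) \<longlonglongrightarrow> 0" "\<And>j. (\<Sum>n\<in>A j. y j n ^ 2) \<le> B"
    and A: "\<And>j. finite (A j)"
  shows "(\<lambda>j. \<Sum>n\<in>A j. x n * y j n) \<longlonglongrightarrow> 0"
proof (rule LIMSEQ_I)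
  fix r :: real assume r: "r > 0"
  have "B \<ge> 0" using y(3)[of 0] sum_nonneg[of "A 0" "\<lambda>n. y 0 n ^ 2"] by (auto intro: order_trans)
  define e where "e = (r / 2) ^ 2 / (B + 1)"
  have e: "e > 0" using r \<open>B \<ge> 0\<close> by (simp add: e_def)
  obtain n0 where n0: "\<And>n. n \<ge> n0 \<Longrightarrow> norm (\<Sum>i. x (i + n) ^ 2) < e"
    using suminf_exist_split[OF e x(2)] by blast
  have "(\<lambda>j. \<Sum>n<n0. x n * y j n) \<longlonglongrightarrow> (\<Sum>n<n0. x n * 0)" by (intro tendsto_intros y)
  then have "(\<lambda>j. \<Sum>n<n0. x n * y j n) \<longlonglongrightarrow> 0" by simp
  from LIMSEQ_D[OF this, of "r / 2"] r obtain j0 where j0: "\<And>j. j \<ge> j0 \<Longrightarrow> \<bar>\<Sum>n<n0. x n * y j n\<bar> < r / 2" by auto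
  have "norm ((\<Sum>n\<in>A j. x n * y j n) - 0) < r" if j: "j \<ge> j0" for j
  proof -
    have xy: "0 \<le> x n * y j n" for n using x y by simp
    have "(\<Sum>n\<in>A j. x n * y j n) \<le> (\<Sum>n\<in>{..<n0} \<union> (A j - {..<n0}). x n * y j n)"
      using A xy by (intro sum_mono2) auto
    also have "\<dots> = (\<Sum>n<n0. x n * y j n) + (\<Sum>n\<in>A j - {..<n0}. x n * y j n)"
      using A by (intro sum.union_disjoint) auto
    also have "(\<Sum>n\<in>A j - {..<n0}. x n * y j n) \<le> L2_set x (A j - {..<n0}) * L2_set (y j) (A j - {..<n0})"
      using L2_set_mult_ineq[of x "y j" "A j - {..<n0}"] x y by simp
    also have "L2_set x (A j - {..<n0}) * L2_set (y j) (A j - {..<n0}) \<le> sqrt e * sqrt B"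
    proof (intro mult_mono)
      have fin: "finite (A j - {..<n0})" using A by simp
      have "(\<Sum>n\<in>A j - {..<n0}. x n ^ 2) = (\<Sum>n\<in>(\<lambda>n. n - n0) ` (A j - {..<n0}). x (n + n0) ^ 2)"
        by (subst sum.reindex) (auto simp: inj_on_def)
      also have "\<dots> \<le> (\<Sum>i. x (i + n0) ^ 2)"
        using x(2) fin by (intro sum_le_suminf) (auto simp: summable_iff_shift[of "\<lambda>n. x n ^ 2"])
      also have "\<dots> \<le> e" using n0[of n0] by simp
      finally show "L2_set x (A j - {..<n0}) \<le> sqrt e" by (simp add: L2_set_def)
      have "(\<Sum>n\<in>A j - {..<n0}. y j n ^ 2) \<le> (\<Sum>n\<in>A j. y j n ^ 2)" using A by (intro sum_mono2) auto
      then show "L2_set (y j) (A j - {..<n0}) \<le> sqrt B" using y(3)[of j] by (simp add: L2_set_def)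
    qed (auto simp: e less_imp_le)
    also have "sqrt e * sqrt B \<le> r / 2"
    proof -
      have "e * B \<le> (r / 2) ^ 2"
      proof -
        have "e * B \<le> e * (B + 1)" using e by simp
        also have "\<dots> = (r / 2) ^ 2" using \<open>B \<ge> 0\<close> by (simp add: e_def)
        finally show ?thesis .
      qed
      then have "sqrt (e * B) \<le> sqrt ((r / 2) ^ 2)" by (rule real_sqrt_le_mono)
      also have "\<dots> = r / 2" using r by (simp only: real_sqrt_abs abs_of_pos[of "r / 2"] half_gt_zero)
      finally show ?thesis by (simp only: real_sqrt_mult)
    qed
    finally have "(\<Sum>n\<in>A j. x n * y j n) < r" using j0[OF j] by simp
    moreover have "(\<Sum>n\<in>A j. x n * y j n) \<ge> 0" using xy by (intro sum_nonneg)
    ultimately show ?thesis by simp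
  qed
  then show "\<exists>no. \<forall>j\<ge>no. norm ((\<Sum>n\<in>A j. x n * y j n) - 0) < r" by blast
qed

text \<open>The index set is truncated at \<open>N j\<close>, so that each law is a finite product.
  The truncation must reach \<open>1 / (l * s)\<close>, the range of indices that produces a
  variance of order \<open>1 / s\<close>.\<close>

locale boltzmann_seq = log_growth +
  fixes s :: "nat \<Rightarrow> real" and N :: "nat \<Rightarrow> nat"
  assumes s_pos: "\<And>j. s j > 0" and s_le: "\<And>j. s j \<le> 1" and s_lim: "s \<longlonglongrightarrow> 0"
    and N_large: "\<And>j. 1 / (l * s j) \<le> real (N j)"
begin

abbreviation J where "J j \<equiv> upto (N j)"

definition V :: "nat \<Rightarrow> real" where "V j = (\<Sum>n\<in>J j. (s j * lam n) ^ 2 * geo_var (s j * lam n))"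

lemma sl_pos: "n \<in> J j \<Longrightarrow> s j * lam n > 0"
  using s_pos lam_pos upto_subset by (meson mult_pos_pos subsetD)

lemma N_lim: "filterlim N at_top sequentially"
proof -
  have "filterlim (\<lambda>j. 1 / (l * s j)) at_top sequentially"
  proof (rule filterlim_at_top_mono)
    have "filterlim (\<lambda>j. inverse (l * s j)) at_top sequentially"
      using s_lim s_pos l_pos tendsto_mult_right[OF s_lim, of l]
      by (intro filterlim_inverse_at_top) auto
    then show "filterlim (\<lambda>j. inverse (l * s j)) at_top sequentially" .
  qed (auto simp: inverse_eq_divide)
  then have "filterlim (\<lambda>j. real (N j)) at_top sequentially"
    by (rule filterlim_at_top_mono) (use N_large in auto)
  then show ?thesis by (simp only: filterlim_sequentially_iff_filterlim_real)
qed

lemma V_upper: "\<exists>K>0. \<forall>j. V j \<le> K / s j \<and>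
   (\<Sum>n\<in>J j. (s j * lam n) ^ 3 * (geo_mean (s j * lam n) * (1 + geo_mean (s j * lam n)) ^ 2)) \<le> K / s j"
proof -
  obtain K where K: "K > 0" "\<And>s J. 0 < s \<and> s \<le> 1 \<and> finite J \<and> J \<subseteq> I \<Longrightarrow> (\<Sum>n\<in>J. exp (- (s * lam n) / 2)) \<le> K / s"
    using exp_sum_bound by blast
  have b: "(\<Sum>n\<in>J j. 216 * exp (- (s j * lam n) / 2)) \<le> 216 * K / s j" for j
    using K(2)[of "s j" "J j"] s_pos s_le upto_subset by (simp flip: sum_distrib_left)
  have "V j \<le> 216 * K / s j" for j
    unfolding V_def using sl_pos by (intro order_trans[OF sum_mono b] geo_scaled_third_le)
  moreover have "(\<Sum>n\<in>J j. (s j * lam n) ^ 3 * (geo_mean (s j * lam n) * (1 + geo_mean (s j * lam n)) ^ 2)) \<le> 216 * K / s j" for j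
    using sl_pos by (intro order_trans[OF sum_mono b] geo_scaled_third_le)
  ultimately show ?thesis using K(1) by (intro exI[of _ "216 * K"]) auto
qed

text \<open>There are at least \<open>1 / (2 * l * s)\<close> indices with
  \<open>s * lam n <= 1\<close>, and each contributes at least
  \<open>exp (-1) >= 1 / 3\<close>.\<close>

lemma V_lower: "\<exists>c>0. eventually (\<lambda>j. c / s j \<le> V j) sequentially"
proof -
  obtain c where c: "c > 0" "\<And>s y N. 0 < s \<and> 1 \<le> y \<and> s * y \<le> c \<and> 1 / (l * s) \<le> real N \<Longrightarrow>
     1 / (2 * l * s * y) \<le> real (card {n \<in> upto N. s * y * lam n \<le> 1})" using count_lower by blast
  have "eventually (\<lambda>j. s j < c) sequentially" using s_lim c(1) by (rule order_tendstoD)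
  then have "eventually (\<lambda>j. 1 / (6 * l) / s j \<le> V j) sequentially"
  proof eventually_elim
    case (elim j)
    define W where "W = {n \<in> J j. s j * 1 * lam n \<le> 1}"
    have W: "1 / (2 * l * s j * 1) \<le> real (card W)" unfolding W_def using elim s_pos N_large by (intro c(2)) auto
    have "1 / (6 * l) / s j = 1 / (2 * l * s j * 1) * (1 / 3)" by simp
    also have "\<dots> \<le> real (card W) * (1 / 3)" using W by (intro mult_right_mono) auto
    also have "\<dots> = (\<Sum>n\<in>W. 1 / 3)" by simp
    also have "\<dots> \<le> (\<Sum>n\<in>W. (s j * lam n) ^ 2 * geo_var (s j * lam n))"
    proof (rule sum_mono)
      fix n assume n: "n \<in> W"
      let ?z = "s j * lam n"
      have z: "?z > 0" "?z \<le> 1" using n sl_pos by (auto simp: W_def)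
      have "exp ?z \<le> exp 1" using z by simp
      then have "exp ?z \<le> 3" using exp_le by linarith
      then have "1 / 3 \<le> exp (- ?z)" by (simp add: exp_minus field_simps)
      also have "\<dots> = ?z ^ 2 * (exp (- ?z) / ?z ^ 2)"
      proof -
        have "e = y ^ 2 * (e / y ^ 2)" if "y > 0" for e y :: real using that by simp
        then show ?thesis using z(1) by blast
      qed
      also have "\<dots> \<le> ?z ^ 2 * geo_var ?z" using geo_var_ge[OF z(1)] by (intro mult_left_mono) auto
      finally show "1 / 3 \<le> ?z ^ 2 * geo_var ?z" .
    qed
    also have "\<dots> \<le> V j" unfolding V_def
      using geo_mean_eq(5)[OF sl_pos] by (intro sum_mono2) (auto simp: W_def less_imp_le)
    finally show ?case .
  qed
  then show ?thesis using l_pos by (intro exI[of _ "1 / (6 * l)"]) auto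
qed

lemma V_at_top: "filterlim V at_top sequentially"
proof -
  obtain c where c: "c > 0" "eventually (\<lambda>j. c / s j \<le> V j) sequentially" using V_lower by blast
  have "filterlim (\<lambda>j. c * inverse (s j)) at_top sequentially"
    using s_pos c by (intro filterlim_tendsto_pos_mult_at_top[OF tendsto_const] filterlim_inverse_at_top s_lim) auto
  then show ?thesis by (rule filterlim_at_top_mono) (use c(2) in \<open>simp add: divide_inverse\<close>)
qed

lemma V_nonneg: "V j \<ge> 0"
  unfolding V_def using geo_mean_eq(5)[OF sl_pos] by (intro sum_nonneg) (auto simp: less_imp_le)

section \<open>Joint characteristic function of count and size\<close>

definition \<Phi> :: "nat \<Rightarrow> real \<Rightarrow> real \<Rightarrow> complex" where
  "\<Phi> j \<eta> u = (\<Prod>n\<in>J j. geo_char (s j * lam n) (s j * (\<eta> + u * lam n)))"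

lemma norm_\<Phi>_le_1: "norm (\<Phi> j \<eta> u) \<le> 1"
  unfolding \<Phi>_def prod_norm[symmetric] by (intro prod_le_1) (auto simp: norm_geo_char_le_1)

text \<open>The characteristic function of an exponential variable of rate \<open>lam n\<close>
  minus its mean.\<close>

definition exp_char :: "nat \<Rightarrow> real \<Rightarrow> complex" where
  "exp_char n \<eta> = iexp (- \<eta> / lam n) / (1 - \<i> * \<eta> / lam n)"

lemma tendsto_geo_char:
  assumes n: "n \<in> I"
  shows "(\<lambda>j. geo_char (s j * lam n) (s j * \<eta>)) \<longlonglongrightarrow> exp_char n \<eta>"
proof -
  let ?m = "lam n"
  have m: "?m > 0" by (rule lam_pos[OF n])
  have sr: "filterlim s (at_right 0) sequentially"
    using s_lim s_pos less_imp_neq[OF s_pos, symmetric] by (auto simp: filterlim_at)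
  have r1: "((\<lambda>s. s * geo_mean (s * ?m)) \<longlongrightarrow> 1 / ?m) (at_right 0)" by (rule tendsto_scaled_geo_mean[OF m])
  have r2: "((\<lambda>s. geo_mean (s * ?m) * (cos (s * \<eta>) - 1)) \<longlongrightarrow> 0) (at_right 0)"
    unfolding geo_mean_def using m by real_asymp
  have r3: "((\<lambda>s. geo_mean (s * ?m) * sin (s * \<eta>)) \<longlongrightarrow> \<eta> / ?m) (at_right 0)"
  proof -
    have "((\<lambda>s. 1 / (exp (s * ?m) - 1) * sin (s * \<eta>)) \<longlongrightarrow> \<eta> * inverse ?m) (at_right 0)" using m by real_asymp
    then show ?thesis unfolding geo_mean_def by (simp only: divide_inverse[of \<eta>])
  qed
  \<comment> \<open>Dividing numerator and denominator by \<open>1 - q\<close> gives the denominator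
    \<open>1 - r * (iexp \<alpha> - 1)\<close> with \<open>r\<close> the mean, which removes the
    indeterminate form at \<open>s = 0\<close>.\<close>
  define f where "f s = iexp (- \<eta> * (s * geo_mean (s * ?m))) /
      (1 - (complex_of_real (geo_mean (s * ?m) * (cos (s * \<eta>) - 1)) + \<i> * complex_of_real (geo_mean (s * ?m) * sin (s * \<eta>))))" for s
  have "geo_char (s j * ?m) (s j * \<eta>) = f (s j)" for j
  proof -
    let ?z = "s j * ?m" and ?q = "complex_of_real (exp (- (s j * ?m)))"
    have z: "?z > 0" using s_pos m by simp
    have q: "1 - ?q \<noteq> 0" using z by (metis eq_iff_diff_eq_0 exp_eq_one_iff less_irrefl neg_equal_0_iff_equal of_real_eq_1_iff)
    have r: "complex_of_real (geo_mean ?z) = ?q / (1 - ?q)" unfolding geo_mean_eq(1)[OF z] by simp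
    have e: "iexp (s j * \<eta>) = complex_of_real (cos (s j * \<eta>)) + \<i> * complex_of_real (sin (s j * \<eta>))"
      by (simp add: complex_eq_iff Re_exp Im_exp)
    have d: "1 - (complex_of_real (geo_mean ?z * (cos (s j * \<eta>) - 1)) + \<i> * complex_of_real (geo_mean ?z * sin (s j * \<eta>)))
       = (1 - ?q * iexp (s j * \<eta>)) / (1 - ?q)"
    proof -
      have "1 - (complex_of_real (geo_mean ?z * (cos (s j * \<eta>) - 1)) + \<i> * complex_of_real (geo_mean ?z * sin (s j * \<eta>)))
         = 1 - complex_of_real (geo_mean ?z) * (iexp (s j * \<eta>) - 1)" unfolding e by (simp add: algebra_simps)
      also have "\<dots> = (1 - ?q * iexp (s j * \<eta>)) / (1 - ?q)" unfolding r using q by (simp add: field_simps)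
      finally show ?thesis .
    qed
    show ?thesis unfolding f_def d geo_char_eq[OF z] by (simp add: mult_ac)
  qed
  moreover have "(\<lambda>j. f (s j)) \<longlonglongrightarrow> exp_char n \<eta>"
  proof (rule filterlim_compose[OF _ sr])
    have "1 - \<i> * \<eta> / ?m \<noteq> 0" by (auto simp: complex_eq_iff)
    then have "(f \<longlongrightarrow> iexp (- \<eta> * (1 / ?m)) / (1 - (complex_of_real 0 + \<i> * complex_of_real (\<eta> / ?m)))) (at_right 0)"
      unfolding f_def by (intro tendsto_intros r1 r2 r3) simp
    then show "(f \<longlongrightarrow> exp_char n \<eta>) (at_right 0)" by (simp add: exp_char_def)
  qed
  ultimately show ?thesis by simp
qed

lemma geo_char_count_bound:
  assumes "n \<in> I"
  shows "norm (geo_char (s j * lam n) (s j * \<eta>) - 1) \<le> \<eta> ^ 2 / 2 * (1 / lam n ^ 2)"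
proof -
  have z: "s j * lam n > 0" using s_pos lam_pos[OF assms] by simp
  have "norm (geo_char (s j * lam n) (s j * \<eta>) - 1) \<le> (s j * \<eta>) ^ 2 * geo_var (s j * lam n) / 2"
    by (rule norm_geo_char_minus_1[OF z])
  also have "\<dots> \<le> (s j * \<eta>) ^ 2 * (1 / (s j * lam n) ^ 2) / 2"
    using geo_var_le[OF z] by (intro divide_right_mono mult_left_mono) auto
  also have "\<dots> = \<eta> ^ 2 / 2 * (1 / lam n ^ 2)" using s_pos[of j] by (simp add: power_mult_distrib)
  finally show ?thesis .
qed

lemma norm_exp_char: "norm (exp_char n \<eta>) \<le> 1"
proof -
  have "1 ^ 2 \<le> norm (1 - \<i> * \<eta> / lam n) ^ 2" by (simp add: cmod_power2)
  then have "1 \<le> norm (1 - \<i> * \<eta> / lam n)" by (rule power2_le_imp_le) simp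
  then show ?thesis unfolding exp_char_def norm_divide by simp
qed

text \<open>All factors lie in the unit disc, so products differ by at most the sum of the
  factorwise differences. These tend to 0 singly and are dominated by a multiple of
  \<open>1 / lam n ^ 2\<close>, as Tannery's theorem requires.\<close>

lemma tendsto_prod_geo_char:
  assumes lim: "(\<lambda>K. \<Prod>n\<in>upto K. exp_char n \<eta>) \<longlonglongrightarrow> \<Psi>"
  shows "(\<lambda>j. \<Phi> j \<eta> 0) \<longlonglongrightarrow> \<Psi>"
proof -
  define a where "a n j = (if n \<in> I then norm (geo_char (s j * lam n) (s j * \<eta>) - exp_char n \<eta>) else 0)" for n j
  have eb: "norm (exp_char n \<eta> - 1) \<le> \<eta> ^ 2 / 2 * (1 / lam n ^ 2)" if "n \<in> I" for n
    by (rule tendsto_upperbound[OF tendsto_norm[OF tendsto_diff[OF tendsto_geo_char[OF that] tendsto_const]]])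
       (use geo_char_count_bound[OF that] in auto)
  have bd: "norm (a n j) \<le> \<eta> ^ 2 * (if n \<in> I then 1 / lam n ^ 2 else 0)" for n j
  proof (cases "n \<in> I")
    case True
    have "norm (geo_char (s j * lam n) (s j * \<eta>) - exp_char n \<eta>) \<le>
        norm (geo_char (s j * lam n) (s j * \<eta>) - 1) + norm (exp_char n \<eta> - 1)"
      using norm_triangle_ineq4[of "geo_char (s j * lam n) (s j * \<eta>) - 1" "exp_char n \<eta> - 1"] by simp
    also have "\<dots> \<le> \<eta> ^ 2 / 2 * (1 / lam n ^ 2) + \<eta> ^ 2 / 2 * (1 / lam n ^ 2)"
      by (intro add_mono geo_char_count_bound eb True)
    finally show ?thesis using True by (simp add: a_def)
  qed (simp add: a_def)
  have "(\<lambda>j. \<Sum>n. a n j) \<longlonglongrightarrow> (\<Sum>n. 0 :: real)"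
  proof -
    have l: "(\<lambda>j. a n j) \<longlonglongrightarrow> 0" for n
    proof (cases "n \<in> I")
      case True
      then show ?thesis unfolding a_def
        using tendsto_norm[OF tendsto_diff[OF tendsto_geo_char[OF True, of \<eta>] tendsto_const[of "exp_char n \<eta>"]]] by simp
    qed (simp add: a_def)
    have "eventually (\<lambda>(n, j). norm (a n j) \<le> \<eta> ^ 2 * (if n \<in> I then 1 / lam n ^ 2 else 0)) (sequentially \<times>\<^sub>F sequentially)"
      using bd by (intro always_eventually) auto
    from tannerys_theorem[OF l this summable_mult[OF summable_inverse_square]] show ?thesis by simp
  qed
  then have z: "(\<lambda>j. \<Sum>n. a n j) \<longlonglongrightarrow> 0" by simp
  have sm: "summable (\<lambda>n. a n j)" for j
    by (rule summable_comparison_test'[OF summable_mult[OF summable_inverse_square, of "\<eta> ^ 2"], where N = 0])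
       (use bd in auto)
  have d: "norm (\<Phi> j \<eta> 0 - (\<Prod>n\<in>J j. exp_char n \<eta>)) \<le> (\<Sum>n. a n j)" for j
  proof -
    have "norm (\<Phi> j \<eta> 0 - (\<Prod>n\<in>J j. exp_char n \<eta>)) \<le> (\<Sum>n\<in>J j. norm (geo_char (s j * lam n) (s j * \<eta>) - exp_char n \<eta>))"
      unfolding \<Phi>_def using norm_prod_diff[of "J j" "\<lambda>n. geo_char (s j * lam n) (s j * \<eta>)" "\<lambda>n. exp_char n \<eta>"]
      by (simp add: norm_geo_char_le_1 norm_exp_char)
    also have "\<dots> = (\<Sum>n\<in>J j. a n j)" using upto_subset by (intro sum.cong) (auto simp: a_def)
    also have "\<dots> \<le> (\<Sum>n. a n j)" using sm by (intro sum_le_suminf) (auto simp: a_def)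
    finally show ?thesis .
  qed
  have "(\<lambda>j. \<Phi> j \<eta> 0 - (\<Prod>n\<in>J j. exp_char n \<eta>)) \<longlonglongrightarrow> 0"
    by (rule Lim_null_comparison[OF _ z]) (use d in auto)
  from tendsto_add[OF this filterlim_compose[OF lim N_lim]] show ?thesis by simp
qed

text \<open>The asymptotic independence of count and size: each factor splits into a count part and
  a size part with cross error \<open>e1\<close>, and the size parts multiply to a Gaussian with
  error \<open>e2\<close>.\<close>

lemma tendsto_\<Phi>:
  assumes lim: "(\<lambda>K. \<Prod>n\<in>upto K. exp_char n \<eta>) \<longlonglongrightarrow> \<Psi>"
  shows "(\<lambda>j. \<Phi> j \<eta> (w / sqrt (V j))) \<longlonglongrightarrow> \<Psi> * exp (- (w ^ 2) / 2)"
proof -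
  define \<beta> where "\<beta> j n = s j * (w / sqrt (V j) * lam n)" for j n
  obtain K where K: "K > 0" "\<And>j. V j \<le> K / s j"
     "\<And>j. (\<Sum>n\<in>J j. (s j * lam n) ^ 3 * (geo_mean (s j * lam n) * (1 + geo_mean (s j * lam n)) ^ 2)) \<le> K / s j"
    using V_upper by blast
  obtain c where c: "c > 0" "eventually (\<lambda>j. c / s j \<le> V j) sequentially" using V_lower by blast
  have evV: "eventually (\<lambda>j. V j > 0) sequentially" using V_at_top by (simp add: filterlim_at_top_dense)
  have invV: "(\<lambda>j. 1 / sqrt (V j)) \<longlonglongrightarrow> 0"
    using tendsto_inverse_0_at_top[OF filterlim_compose[OF sqrt_at_top V_at_top]] by (simp add: inverse_eq_divide)
  \<comment> \<open>With \<open>z = s * lam n\<close>, a cross term is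
    \<open>2 * \<bar>\<eta> * w\<bar>\<close> times \<open>1 / lam n\<close>, which is
    square-summable, times \<open>z * sqrt (geo_var z) / sqrt V\<close>, whose squares sum to 1,
    times a factor at most 1.\<close>
  define e1 where "e1 j = (\<Sum>n\<in>J j. 2 * \<bar>(s j * \<eta>) * \<beta> j n\<bar> * geo_var (s j * lam n))" for j
  have e1: "e1 \<longlonglongrightarrow> 0"
  proof -
    define x where "x n = (if n \<in> I then 1 / lam n else 0)" for n
    define y where "y j n = (if n \<in> J j \<and> V j > 0 then s j * lam n * sqrt (geo_var (s j * lam n)) / sqrt (V j) else 0)" for j n
    have "(\<lambda>j. \<Sum>n\<in>J j. x n * y j n) \<longlonglongrightarrow> 0"
    proof (rule sum_mult_tail_tendsto_zero[where B = 1])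
      show "x n \<ge> 0" for n using lam_pos[of n] by (simp add: x_def less_imp_le)
      have "(\<lambda>n. x n ^ 2) = (\<lambda>n. if n \<in> I then 1 / lam n ^ 2 else 0)" by (auto simp: x_def power_divide)
      then show "summable (\<lambda>n. x n ^ 2)" using summable_inverse_square by simp
      show y0: "y j n \<ge> 0" for j n using sl_pos[of n j] geo_mean_eq(5)[OF sl_pos, of n j] by (auto simp: y_def)
      have yle: "y j n \<le> 1 / sqrt (V j)" for j n
      proof (cases "n \<in> J j \<and> V j > 0")
        case True
        have z: "s j * lam n > 0" using True sl_pos by blast
        have "sqrt (geo_var (s j * lam n)) \<le> sqrt (1 / (s j * lam n) ^ 2)" using geo_var_le[OF z] by simp
        also have "\<dots> = 1 / (s j * lam n)" using z by (simp add: real_sqrt_divide)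
        finally have "s j * lam n * sqrt (geo_var (s j * lam n)) \<le> s j * lam n * (1 / (s j * lam n))" using z by (intro mult_left_mono) auto
        also have "\<dots> = 1"
        proof -
          have "x * (1 / x) = 1" if "x > 0" for x :: real using that by simp
          then show ?thesis using z by blast
        qed
        finally show ?thesis using True by (simp add: y_def divide_right_mono)
      qed (use V_nonneg[of j] in \<open>auto simp: y_def\<close>)
      show "(\<lambda>j. y j n) \<longlonglongrightarrow> 0" for n
        by (rule tendsto_sandwich[OF _ _ tendsto_const invV]) (use y0 yle in auto)
      show "(\<Sum>n\<in>J j. y j n ^ 2) \<le> 1" for j
      proof (cases "V j > 0")
        case True
        have "(\<Sum>n\<in>J j. y j n ^ 2) = (\<Sum>n\<in>J j. (s j * lam n) ^ 2 * geo_var (s j * lam n) / V j)"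
          using True geo_mean_eq(5)[OF sl_pos, of _ j] by (intro sum.cong) (auto simp: y_def power_divide power_mult_distrib less_imp_le)
        also have "\<dots> = 1" using True by (simp add: V_def flip: sum_divide_distrib)
        finally show ?thesis by simp
      qed (simp add: y_def)
    qed simp
    then have lim0: "(\<lambda>j. 2 * \<bar>\<eta> * w\<bar> * (\<Sum>n\<in>J j. x n * y j n)) \<longlonglongrightarrow> 2 * \<bar>\<eta> * w\<bar> * 0" by (intro tendsto_intros)
    show ?thesis
    proof (rule tendsto_sandwich[OF _ _ tendsto_const lim0[simplified]])
      show "eventually (\<lambda>j. 0 \<le> e1 j) sequentially"
        using geo_mean_eq(5)[OF sl_pos] by (intro always_eventually allI) (auto simp: e1_def less_imp_le intro!: sum_nonneg)
      show "eventually (\<lambda>j. e1 j \<le> 2 * \<bar>\<eta> * w\<bar> * (\<Sum>n\<in>J j. x n * y j n)) sequentially"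
        using evV
      proof eventually_elim
        case (elim j)
        show ?case unfolding e1_def sum_distrib_left
        proof (rule sum_mono)
          fix n assume n: "n \<in> J j"
          then have nI: "n \<in> I" using upto_subset by blast
          have z: "s j * lam n > 0" by (rule sl_pos[OF n])
          have gv: "geo_var (s j * lam n) > 0" by (rule geo_mean_eq[OF z])
          have g: "s j * lam n * sqrt (geo_var (s j * lam n)) \<le> 1"
          proof -
            have "sqrt (geo_var (s j * lam n)) \<le> sqrt (1 / (s j * lam n) ^ 2)" using geo_var_le[OF z] by simp
            also have "\<dots> = 1 / (s j * lam n)" using z by (simp add: real_sqrt_divide)
            finally show ?thesis using z by (simp add: field_simps)
          qed
          have "2 * \<bar>(s j * \<eta>) * \<beta> j n\<bar> * geo_var (s j * lam n) = 2 * \<bar>\<eta> * w\<bar> * (1 / lam n * (s j * lam n * sqrt (geo_var (s j * lam n)) / sqrt (V j))) * (s j * lam n * sqrt (geo_var (s j * lam n)))"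
            using s_pos[of j] lam_pos[OF nI] elim gv by (simp add: \<beta>_def abs_mult field_simps)
          also have "\<dots> \<le> 2 * \<bar>\<eta> * w\<bar> * (1 / lam n * (s j * lam n * sqrt (geo_var (s j * lam n)) / sqrt (V j))) * 1"
            using g s_pos[of j] lam_pos[OF nI] elim gv by (intro mult_left_mono) auto
          finally show "2 * \<bar>(s j * \<eta>) * \<beta> j n\<bar> * geo_var (s j * lam n) \<le> 2 * \<bar>\<eta> * w\<bar> * (x n * y j n)"
            using n nI elim by (simp add: x_def y_def)
        qed
      qed
    qed
  qed
  \<comment> \<open>The third-moment ratio of Lyapunov: a sum of third moments of order
    \<open>1 / s\<close>, hence of order \<open>V\<close>, against \<open>V powr (3/2)\<close>. The
    second summand comes from the squared exponents.\<close>
  define e2 where "e2 j = 5 * \<bar>w\<bar> ^ 3 * (K / s j) / sqrt (V j) ^ 3 + w ^ 4 / 8 / V j" for j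
  have e2: "e2 \<longlonglongrightarrow> 0"
  proof -
    have "(\<lambda>j. 5 * \<bar>w\<bar> ^ 3 * (K / c) * (1 / sqrt (V j)) + w ^ 4 / 8 * (1 / sqrt (V j)) ^ 2) \<longlonglongrightarrow> 5 * \<bar>w\<bar> ^ 3 * (K / c) * 0 + w ^ 4 / 8 * 0 ^ 2"
      by (intro tendsto_intros invV)
    then have l: "(\<lambda>j. 5 * \<bar>w\<bar> ^ 3 * (K / c) * (1 / sqrt (V j)) + w ^ 4 / 8 * (1 / sqrt (V j)) ^ 2) \<longlonglongrightarrow> 0" by simp
    show ?thesis
    proof (rule tendsto_sandwich[OF _ _ tendsto_const l])
      show "eventually (\<lambda>j. 0 \<le> e2 j) sequentially"
        using V_nonneg s_pos K(1) by (intro always_eventually allI) (auto simp: e2_def less_imp_le)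
      show "eventually (\<lambda>j. e2 j \<le> 5 * \<bar>w\<bar> ^ 3 * (K / c) * (1 / sqrt (V j)) + w ^ 4 / 8 * (1 / sqrt (V j)) ^ 2) sequentially"
        using evV c(2)
      proof eventually_elim
        case (elim j)
        have "K / s j = K / c * (c / s j)" using c by simp
        also have "\<dots> \<le> K / c * V j" using elim K(1) c(1) by (intro mult_left_mono) auto
        finally have "5 * \<bar>w\<bar> ^ 3 * (K / s j) / sqrt (V j) ^ 3 \<le> 5 * \<bar>w\<bar> ^ 3 * (K / c * V j) / sqrt (V j) ^ 3"
          using elim by (intro divide_right_mono mult_left_mono) auto
        also have "\<dots> = 5 * \<bar>w\<bar> ^ 3 * (K / c) * (V j / sqrt (V j) ^ 3)" by simp
        also have "V j / sqrt (V j) ^ 3 = 1 / sqrt (V j)"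
        proof -
          have "sqrt (V j) ^ 3 = V j * sqrt (V j)" using elim by (simp add: power3_eq_cube)
          then show ?thesis using elim by simp
        qed
        finally show ?case using elim by (simp add: e2_def power_divide)
      qed
    qed
  qed
  have bound: "eventually (\<lambda>j. norm (\<Phi> j \<eta> (w / sqrt (V j)) - \<Phi> j \<eta> 0 * exp (- (w ^ 2) / 2)) \<le> e1 j + e2 j) sequentially"
    using evV
  proof eventually_elim
    case (elim j)
    let ?z = "\<lambda>n. s j * lam n"
    let ?a = "s j * \<eta>"
    let ?g = "\<lambda>n. complex_of_real (exp (- (\<beta> j n ^ 2 * geo_var (?z n) / 2)))"
    have b2: "\<beta> j n ^ 2 * geo_var (?z n) = w ^ 2 / V j * (?z n ^ 2 * geo_var (?z n))" for n
      using elim by (simp add: \<beta>_def power_mult_distrib power_divide)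
    have phi: "\<Phi> j \<eta> (w / sqrt (V j)) = (\<Prod>n\<in>J j. geo_char (?z n) (?a + \<beta> j n))"
      unfolding \<Phi>_def \<beta>_def by (simp only: distrib_left)
    have 1: "norm (\<Phi> j \<eta> (w / sqrt (V j)) - (\<Prod>n\<in>J j. geo_char (?z n) ?a * geo_char (?z n) (\<beta> j n))) \<le> e1 j"
    proof -
      have "norm ((\<Prod>n\<in>J j. geo_char (?z n) (?a + \<beta> j n)) - (\<Prod>n\<in>J j. geo_char (?z n) ?a * geo_char (?z n) (\<beta> j n)))
        \<le> (\<Sum>n\<in>J j. norm (geo_char (?z n) (?a + \<beta> j n) - geo_char (?z n) ?a * geo_char (?z n) (\<beta> j n)))"
        by (intro norm_prod_diff) (auto simp: norm_geo_char_le_1 norm_mult mult_le_one)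
      also have "\<dots> \<le> e1 j" unfolding e1_def by (intro sum_mono geo_char_add_approx sl_pos)
      finally show ?thesis unfolding phi .
    qed
    have prodg: "(\<Prod>n\<in>J j. ?g n) = exp (- (w ^ 2) / 2)"
    proof -
      have "(\<Prod>n\<in>J j. exp (- (\<beta> j n ^ 2 * geo_var (?z n) / 2))) = exp (\<Sum>n\<in>J j. - (\<beta> j n ^ 2 * geo_var (?z n) / 2))"
        by (simp add: exp_sum)
      also have "(\<Sum>n\<in>J j. - (\<beta> j n ^ 2 * geo_var (?z n) / 2)) = - (w ^ 2 / V j * V j) / 2"
        unfolding b2 V_def by (simp add: sum_negf sum_distrib_left sum_divide_distrib)
      also have "\<dots> = - (w ^ 2) / 2" using elim by simp
      finally show ?thesis by (simp flip: of_real_prod)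
    qed
    have 2: "norm ((\<Prod>n\<in>J j. geo_char (?z n) (\<beta> j n)) - exp (- (w ^ 2) / 2)) \<le> e2 j"
    proof -
      have "norm ((\<Prod>n\<in>J j. geo_char (?z n) (\<beta> j n)) - (\<Prod>n\<in>J j. ?g n)) \<le> (\<Sum>n\<in>J j. norm (geo_char (?z n) (\<beta> j n) - ?g n))"
        using geo_mean_eq(5)[OF sl_pos, of _ j] by (intro norm_prod_diff) (auto simp: norm_geo_char_le_1 less_imp_le)
      also have "\<dots> \<le> (\<Sum>n\<in>J j. 5 * \<bar>\<beta> j n\<bar> ^ 3 * (geo_mean (?z n) * (1 + geo_mean (?z n)) ^ 2) + (\<beta> j n ^ 2 * geo_var (?z n)) ^ 2 / 8)"
        by (intro sum_mono geo_char_gaussian_approx sl_pos)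
      also have "\<dots> \<le> (\<Sum>n\<in>J j. 5 * \<bar>w\<bar> ^ 3 / sqrt (V j) ^ 3 * (?z n ^ 3 * (geo_mean (?z n) * (1 + geo_mean (?z n)) ^ 2)) + w ^ 4 / 8 / V j ^ 2 * (?z n ^ 2 * geo_var (?z n)))"
      proof (intro sum_mono add_mono)
        fix n assume n: "n \<in> J j"
        note z = sl_pos[OF n]
        have "\<bar>\<beta> j n\<bar> = \<bar>w\<bar> / sqrt (V j) * ?z n" using z elim s_pos[of j] lam_pos[of n] n upto_subset
          by (auto simp: \<beta>_def abs_mult zero_less_mult_iff)
        then show "5 * \<bar>\<beta> j n\<bar> ^ 3 * (geo_mean (?z n) * (1 + geo_mean (?z n)) ^ 2) \<le> 5 * \<bar>w\<bar> ^ 3 / sqrt (V j) ^ 3 * (?z n ^ 3 * (geo_mean (?z n) * (1 + geo_mean (?z n)) ^ 2))"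
          by (simp add: power_mult_distrib power_divide)
        define y where "y = ?z n ^ 2 * geo_var (?z n)"
        have "x ^ 2 * g \<le> 1" if "g \<le> 1 / x ^ 2" "x > 0" for x g :: real using that by (simp add: field_simps)
        then have y: "0 \<le> y" "y \<le> 1"
          using geo_var_le[OF z] geo_mean_eq(5)[OF z] z unfolding y_def by (blast intro: mult_nonneg_nonneg less_imp_le zero_le_power2)+
        have "(\<beta> j n ^ 2 * geo_var (?z n)) ^ 2 / 8 = w ^ 4 / 8 / V j ^ 2 * (y * y)"
          unfolding b2 y_def[symmetric] by (simp add: power_mult_distrib power_divide power2_eq_square[of y] flip: power_mult)
        also have "\<dots> \<le> w ^ 4 / 8 / V j ^ 2 * (y * 1)" using y by (intro mult_left_mono) auto
        finally show "(\<beta> j n ^ 2 * geo_var (?z n)) ^ 2 / 8 \<le> w ^ 4 / 8 / V j ^ 2 * (?z n ^ 2 * geo_var (?z n))" by (simp add: y_def)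
      qed
      also have "\<dots> = 5 * \<bar>w\<bar> ^ 3 / sqrt (V j) ^ 3 * (\<Sum>n\<in>J j. ?z n ^ 3 * (geo_mean (?z n) * (1 + geo_mean (?z n)) ^ 2)) + w ^ 4 / 8 / V j ^ 2 * V j"
        unfolding V_def sum.distrib sum_distrib_left[symmetric] ..
      also have "\<dots> \<le> 5 * \<bar>w\<bar> ^ 3 / sqrt (V j) ^ 3 * (K / s j) + w ^ 4 / 8 / V j ^ 2 * V j"
        using K(3)[of j] elim by (intro add_right_mono mult_left_mono) auto
      also have "\<dots> = e2 j" using elim by (simp add: e2_def power2_eq_square)
      finally show ?thesis unfolding prodg .
    qed
    have "norm ((\<Prod>n\<in>J j. geo_char (?z n) ?a * geo_char (?z n) (\<beta> j n)) - \<Phi> j \<eta> 0 * exp (- (w ^ 2) / 2)) =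
       norm (\<Phi> j \<eta> 0) * norm ((\<Prod>n\<in>J j. geo_char (?z n) (\<beta> j n)) - exp (- (w ^ 2) / 2))"
      by (simp add: prod.distrib \<Phi>_def right_diff_distrib flip: norm_mult)
    also have "\<dots> \<le> 1 * e2 j" using 2 by (intro mult_mono norm_\<Phi>_le_1) auto
    finally show ?case using 1 norm_triangle_ineq[of "\<Phi> j \<eta> (w / sqrt (V j)) - (\<Prod>n\<in>J j. geo_char (?z n) ?a * geo_char (?z n) (\<beta> j n))"
        "(\<Prod>n\<in>J j. geo_char (?z n) ?a * geo_char (?z n) (\<beta> j n)) - \<Phi> j \<eta> 0 * exp (- (w ^ 2) / 2)"] by simp
  qed
  have "(\<lambda>j. \<Phi> j \<eta> (w / sqrt (V j)) - \<Phi> j \<eta> 0 * exp (- (w ^ 2) / 2)) \<longlonglongrightarrow> 0"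
    by (rule Lim_null_comparison[OF bound]) (use tendsto_add[OF e1 e2] in simp)
  from tendsto_add[OF this tendsto_mult[OF tendsto_prod_geo_char[OF lim] tendsto_const[of "complex_of_real (exp (- (w ^ 2) / 2))"]]]
  show ?thesis by simp
qed

text \<open>Only factors with \<open>s * max 1 \<bar>u\<bar> * lam n <= 1\<close> are exploited, the
  others being bounded by 1. Their number is of order \<open>1 / (s * max 1 \<bar>u\<bar>)\<close>
  by \<open>count_lower\<close>, and each gains a fixed power of
  \<open>exp (- min 1 (u ^ 2))\<close>.\<close>

lemma \<Phi>_decay:
  "\<exists>K>0. \<exists>c>0. eventually (\<lambda>j. \<forall>u. s j * \<bar>u\<bar> \<le> c \<longrightarrow>
     norm (\<Phi> j \<eta> u) \<le> K * exp (- (c * min 1 (u ^ 2) / (s j * max 1 \<bar>u\<bar>)))) sequentially"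
proof -
  obtain c0 where c0: "c0 > 0" "\<And>s y N. 0 < s \<and> 1 \<le> y \<and> s * y \<le> c0 \<and> 1 / (l * s) \<le> real N \<Longrightarrow>
     1 / (2 * l * s * y) \<le> real (card {n \<in> upto N. s * y * lam n \<le> 1})" using count_lower by blast
  define S where "S = (\<Sum>n. if n \<in> I then 1 / lam n ^ 2 else 0)"
  \<comment> \<open>Here \<open>192 = 2 * 96\<close>: the 2 is from the count of indices, the 96
    from the decay of one factor.\<close>
  define c where "c = min c0 (1 / (192 * l))"
  have c: "c > 0" using c0 l_pos by (simp add: c_def)
  have "eventually (\<lambda>j. s j * \<bar>\<eta>\<bar> < 1) sequentially"
    using order_tendstoD(2)[OF tendsto_mult_left[OF s_lim, of "\<bar>\<eta>\<bar>"], of 1] by (simp add: mult.commute)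
  moreover have "eventually (\<lambda>j. s j < c) sequentially" using order_tendstoD(2)[OF s_lim c] .
  ultimately have "eventually (\<lambda>j. \<forall>u. s j * \<bar>u\<bar> \<le> c \<longrightarrow>
     norm (\<Phi> j \<eta> u) \<le> exp (\<eta> ^ 2 / 48 * S) * exp (- (c * min 1 (u ^ 2) / (s j * max 1 \<bar>u\<bar>)))) sequentially"
  proof eventually_elim
    case (elim j)
    show ?case
    proof (intro allI impI)
      fix u assume u: "s j * \<bar>u\<bar> \<le> c"
      let ?y = "max 1 \<bar>u\<bar>"
      define W where "W = {n \<in> J j. s j * ?y * lam n \<le> 1}"
      have W: "finite W" "W \<subseteq> J j" "W \<subseteq> I" using upto_subset by (auto simp: W_def)
      have "s j * ?y \<le> c0" using u elim by (auto simp: max_def c_def)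
      then have cW: "1 / (2 * l * s j * ?y) \<le> real (card W)" unfolding W_def using s_pos N_large by (intro c0(2)) auto
      have "norm (\<Phi> j \<eta> u) = (\<Prod>n\<in>J j. norm (geo_char (s j * lam n) (s j * (\<eta> + u * lam n))))"
        unfolding \<Phi>_def by (rule prod_norm[symmetric])
      also have "\<dots> \<le> (\<Prod>n\<in>J j. if n \<in> W then exp (- (min 1 (u ^ 2) / 96) + \<eta> ^ 2 / (48 * lam n ^ 2)) else 1)"
      proof (rule prod_mono)
        fix n assume n: "n \<in> J j"
        have "norm (geo_char (s j * lam n) (s j * (\<eta> + u * lam n))) \<le> exp (- (min 1 (u ^ 2) / 96) + \<eta> ^ 2 / (48 * lam n ^ 2))" if "n \<in> W"
        proof (rule norm_geo_char_decay)
          have z: "s j * lam n > 0" by (rule sl_pos[OF n])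
          have le: "s j * lam n * ?y \<le> 1" using that by (simp add: W_def mult_ac)
          have "s j * lam n * 1 \<le> s j * lam n * ?y" using z by (intro mult_left_mono) auto
          then show "s j * lam n \<le> 1" using le by simp
          have "s j * lam n * \<bar>u\<bar> \<le> s j * lam n * ?y" using z by (intro mult_left_mono) auto
          then show "\<bar>u\<bar> * (s j * lam n) \<le> 1" using le by (simp add: mult.commute)
          show "lam n > 0" using lam_pos n upto_subset by blast
        qed (use sl_pos[OF n] s_pos elim in auto)
        then show "0 \<le> norm (geo_char (s j * lam n) (s j * (\<eta> + u * lam n))) \<and>
            norm (geo_char (s j * lam n) (s j * (\<eta> + u * lam n))) \<le> (if n \<in> W then exp (- (min 1 (u ^ 2) / 96) + \<eta> ^ 2 / (48 * lam n ^ 2)) else 1)"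
          using norm_geo_char_le_1 by auto
      qed
      also have "\<dots> = (\<Prod>n\<in>W. exp (- (min 1 (u ^ 2) / 96) + \<eta> ^ 2 / (48 * lam n ^ 2)))"
        using W by (simp add: prod.If_cases Int_absorb1)
      also have "\<dots> = exp (\<Sum>n\<in>W. - (min 1 (u ^ 2) / 96) + \<eta> ^ 2 / (48 * lam n ^ 2))" using W by (simp add: exp_sum)
      also have "(\<Sum>n\<in>W. - (min 1 (u ^ 2) / 96) + \<eta> ^ 2 / (48 * lam n ^ 2)) = - (real (card W) * (min 1 (u ^ 2) / 96)) + \<eta> ^ 2 / 48 * (\<Sum>n\<in>W. 1 / lam n ^ 2)"
        by (simp add: sum.distrib sum_distrib_left sum_negf sum_subtractf)
      also have "exp \<dots> \<le> exp (- (c * min 1 (u ^ 2) / (s j * ?y)) + \<eta> ^ 2 / 48 * S)"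
      proof -
        have "(\<Sum>n\<in>W. 1 / lam n ^ 2) = (\<Sum>n\<in>W. if n \<in> I then 1 / lam n ^ 2 else 0)" using W by (intro sum.cong) auto
        also have "\<dots> \<le> S" unfolding S_def using W summable_inverse_square by (intro sum_le_suminf) auto
        finally have S: "\<eta> ^ 2 / 48 * (\<Sum>n\<in>W. 1 / lam n ^ 2) \<le> \<eta> ^ 2 / 48 * S" by (intro mult_left_mono) auto
        have "c * min 1 (u ^ 2) / (s j * ?y) \<le> 1 / (192 * l) * min 1 (u ^ 2) / (s j * ?y)"
          using s_pos[of j] by (intro divide_right_mono mult_right_mono) (auto simp: c_def)
        also have "\<dots> = 1 / (2 * l * s j * ?y) * (min 1 (u ^ 2) / 96)" by simp
        also have "\<dots> \<le> real (card W) * (min 1 (u ^ 2) / 96)" using cW by (intro mult_right_mono) auto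
        finally show ?thesis unfolding exp_le_cancel_iff using S by linarith
      qed
      also have "\<dots> = exp (\<eta> ^ 2 / 48 * S) * exp (- (c * min 1 (u ^ 2) / (s j * ?y)))"
        unfolding exp_add by (rule mult.commute)
      finally show "norm (\<Phi> j \<eta> u) \<le> exp (\<eta> ^ 2 / 48 * S) * exp (- (c * min 1 (u ^ 2) / (s j * ?y)))" .
    qed
  qed
  then show ?thesis using c by (intro exI[of _ "exp (\<eta> ^ 2 / 48 * S)"] conjI exI[of _ c]) auto
qed

end

section \<open>Cauchy averages and the local limit\<close>

lemma cauchy_integral: "integral\<^sup>L lborel cauchy_density = 1"
proof -
  have "complex_of_real (integral\<^sup>L lborel cauchy_density) = 1"
    using cauchy_char(2)[of 0] by (simp add: scaleR_conv_of_real)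
  then show ?thesis by (simp only: of_real_eq_1_iff)
qed

lemma integrable_cauchy_shift: "integrable lborel (\<lambda>u. cauchy_density (u - \<theta>))"
  and integral_cauchy_shift: "(\<integral>u. cauchy_density (u - \<theta>) \<partial>lborel) = 1"
proof -
  show "integrable lborel (\<lambda>u. cauchy_density (u - \<theta>))"
    using lborel_integrable_real_affine[OF integrable_cauchy, of 1 "- \<theta>"] by simp
  show "(\<integral>u. cauchy_density (u - \<theta>) \<partial>lborel) = 1"
    using lborel_integral_real_affine[of 1 cauchy_density "- \<theta>"] cauchy_integral by simp
qed

lemma cauchy_tail_shift:
  assumes R: "R > \<bar>\<theta>\<bar>"
  shows "integrable lborel (\<lambda>u. indicator {u. \<bar>u\<bar> > R} u * cauchy_density (u - \<theta>))"
    and "(\<integral>u. indicator {u. \<bar>u\<bar> > R} u * cauchy_density (u - \<theta>) \<partial>lborel) \<le> 2 / (pi * (R - \<bar>\<theta>\<bar>))"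
proof -
  let ?r = "R - \<bar>\<theta>\<bar>"
  have r: "?r > 0" using R by simp
  have "AE u in lborel. norm (indicator {u. \<bar>u\<bar> > R} u * cauchy_density (u - \<theta>)) \<le> norm (cauchy_density (u - \<theta>))"
    by (auto simp: indicator_def)
  moreover have [measurable]: "{u :: real. \<bar>u\<bar> > R} \<in> sets borel" by measurable
  ultimately show int: "integrable lborel (\<lambda>u. indicator {u. \<bar>u\<bar> > R} u * cauchy_density (u - \<theta>))"
    by (intro Bochner_Integration.integrable_bound[OF integrable_cauchy_shift[of \<theta>]]) auto
  define T where "T = (\<integral>\<^sup>+u. ennreal (cauchy_density u) * indicator {?r..} u \<partial>lborel)"
  have "ennreal (\<integral>u. indicator {u. \<bar>u\<bar> > R} u * cauchy_density (u - \<theta>) \<partial>lborel) =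
     (\<integral>\<^sup>+u. ennreal (indicator {u. \<bar>u\<bar> > R} u * cauchy_density (u - \<theta>)) \<partial>lborel)"
    using int by (subst nn_integral_eq_integral) (auto simp: cauchy_density_pos less_imp_le)
  also have "\<dots> = (\<integral>\<^sup>+u. ennreal (indicator {u. \<bar>u\<bar> > R} (\<theta> + u) * cauchy_density u) \<partial>lborel)"
    using nn_integral_real_affine[of "\<lambda>u. ennreal (indicator {u. \<bar>u\<bar> > R} u * cauchy_density (u - \<theta>))" 1 \<theta>] by simp
  also have "\<dots> \<le> (\<integral>\<^sup>+u. ennreal (cauchy_density u) * indicator {?r..} u + ennreal (cauchy_density (- u)) * indicator {?r..} (- u) \<partial>lborel)"
  proof (rule nn_integral_mono)
    fix u :: real
    have "cauchy_density (- u) = cauchy_density u" by (simp add: cauchy_density_def)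
    then show "ennreal (indicator {u. \<bar>u\<bar> > R} (\<theta> + u) * cauchy_density u) \<le> ennreal (cauchy_density u) * indicator {?r..} u + ennreal (cauchy_density (- u)) * indicator {?r..} (- u)"
      by (auto simp: indicator_def)
  qed
  also have "\<dots> = T + (\<integral>\<^sup>+u. ennreal (cauchy_density (- u)) * indicator {?r..} (- u) \<partial>lborel)"
    unfolding T_def by (rule nn_integral_add) auto
  also have "(\<integral>\<^sup>+u. ennreal (cauchy_density (- u)) * indicator {?r..} (- u) \<partial>lborel) = T"
    unfolding T_def by (subst nn_integral_real_affine[where c = "-1" and t = 0 and f = "\<lambda>u. ennreal (cauchy_density u) * indicator {?r..} u"]) auto
  also have "T + T \<le> ennreal (1 / (pi * ?r)) + ennreal (1 / (pi * ?r))"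
    unfolding T_def using cauchy_tail[OF r] by (intro add_mono)
  also have "\<dots> = ennreal (2 / (pi * ?r))" using r by (simp flip: ennreal_plus add: add_divide_distrib[symmetric])
  finally show "(\<integral>u. indicator {u. \<bar>u\<bar> > R} u * cauchy_density (u - \<theta>) \<partial>lborel) \<le> 2 / (pi * ?r)"
    using r by (simp add: ennreal_le_iff)
qed

text \<open>
  On \<open>\<bar>u\<bar> \<le> 1\<close> the substitution \<open>u = w / sqrt V\<close> produces a Gaussian limit; for
  \<open>1 < \<bar>u\<bar> \<le> s powr (-2/3)\<close> the integrand is exponentially small, and the remaining mass of the
  Cauchy kernel, \<open>O(s powr (2/3))\<close>, is negligible against \<open>1 / sqrt V\<close>.
\<close>

lemma cauchy_kernel_local_limit:
  fixes ch :: "nat \<Rightarrow> real \<Rightarrow> complex" and V s :: "nat \<Rightarrow> real" and \<psi> :: complex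
  assumes meas [measurable]: "\<And>j. ch j \<in> borel_measurable borel" and norm1: "\<And>j u. norm (ch j u) \<le> 1"
    and s: "\<And>j. s j > 0" "s \<longlonglongrightarrow> 0" and V: "filterlim V at_top sequentially" "\<And>j. V j \<le> D / s j"
    and K: "K > 0" "c > 0" and decay: "eventually (\<lambda>j. \<forall>u. s j * \<bar>u\<bar> \<le> c \<longrightarrow>
        norm (ch j u) \<le> K * exp (- (c * min 1 (u ^ 2) / (s j * max 1 \<bar>u\<bar>)))) sequentially"
    and lim: "\<And>w. (\<lambda>j. ch j (w / sqrt (V j))) \<longlonglongrightarrow> \<psi> * complex_of_real (exp (- (w ^ 2) / 2))"
  shows "(\<lambda>j. sqrt (V j) * (CLINT u|lborel. cauchy_density (u - \<theta>) *\<^sub>R ch j u)) \<longlonglongrightarrow> sqrt (2 * pi) * cauchy_density \<theta> * \<psi>"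
proof -
  have sr: "filterlim s (at_right 0) sequentially"
    using s less_imp_neq[OF s(1), symmetric] by (auto simp: filterlim_at)
  have evV: "eventually (\<lambda>j. V j > 0) sequentially" using V(1) by (simp add: filterlim_at_top_dense)
  have D: "D > 0"
  proof -
    obtain j where "V j > 0" using evV by (auto simp: eventually_sequentially)
    then have "D / s j > 0" using V(2)[of j] by simp
    then show ?thesis using s(1)[of j] by (simp add: zero_less_divide_iff)
  qed
  have cle: "cauchy_density u \<le> 1" for u
    using pi_ge_two mult_mono[of 1 pi 1 "1 + u ^ 2"] by (simp add: cauchy_density_def field_simps)
  have intch: "integrable lborel (\<lambda>u. cauchy_density (u - \<theta>) *\<^sub>R ch j u)" for j
    by (rule Bochner_Integration.integrable_bound[OF integrable_cauchy_shift[of \<theta>]])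
       (use norm1 in \<open>auto simp: cauchy_density_pos less_imp_le intro!: mult_left_le\<close>)
  define A where "A j = (CLINT u|lborel. indicator {-1..1} u *\<^sub>R (cauchy_density (u - \<theta>) *\<^sub>R ch j u))" for j
  define B where "B j = (CLINT u|lborel. indicator {u. \<bar>u\<bar> > 1} u *\<^sub>R (cauchy_density (u - \<theta>) *\<^sub>R ch j u))" for j
  have [measurable]: "{u :: real. \<bar>u\<bar> > r} \<in> sets borel" for r by measurable
  have intA: "integrable lborel (\<lambda>u. indicator {-1..1} u *\<^sub>R (cauchy_density (u - \<theta>) *\<^sub>R ch j u))" for j
    using intch by (intro integrable_mult_indicator) auto
  have intB: "integrable lborel (\<lambda>u. indicator {u. \<bar>u\<bar> > 1} u *\<^sub>R (cauchy_density (u - \<theta>) *\<^sub>R ch j u))" for j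
    using intch by (intro integrable_mult_indicator) auto
  have split: "(CLINT u|lborel. cauchy_density (u - \<theta>) *\<^sub>R ch j u) = A j + B j" for j
    unfolding A_def B_def Bochner_Integration.integral_add[OF intA intB, symmetric]
    by (intro Bochner_Integration.integral_cong refl) (auto simp: indicator_def)
  have limB: "(\<lambda>j. sqrt (V j) * B j) \<longlonglongrightarrow> 0"
  proof (rule Lim_null_comparison)
    \<comment> \<open>With a cutoff \<open>s powr (- a)\<close>, the tail needs
      \<open>a > 1 / 2\<close> to beat \<open>sqrt (D / s)\<close>, and the exponential needs
      \<open>a < 1\<close>; the choice is \<open>a = 2 / 3\<close>.\<close>
    define h where "h s = sqrt (D / s) * (K * exp (- (c / (s * (s powr (-2/3))))) + 2 / (pi * (s powr (-2/3) - \<bar>\<theta>\<bar>)))" for s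
    have "(h \<longlongrightarrow> 0) (at_right 0)" unfolding h_def using D K by real_asymp
    then show "(\<lambda>j. h (s j)) \<longlonglongrightarrow> 0" by (rule filterlim_compose[OF _ sr])
    have "eventually (\<lambda>s::real. s * s powr (-2/3) \<le> c \<and> s powr (-2/3) > \<bar>\<theta>\<bar> \<and> s powr (-2/3) > 1) (at_right 0)"
    proof (intro eventually_conj)
      have "((\<lambda>s::real. s * s powr (-2/3)) \<longlongrightarrow> 0) (at_right 0)" by real_asymp
      from order_tendstoD(2)[OF this K(2)] show "eventually (\<lambda>s::real. s * s powr (-2/3) \<le> c) (at_right 0)"
        by eventually_elim simp
      have "filterlim (\<lambda>s::real. s powr (-2/3)) at_top (at_right 0)" by real_asymp
      then show "eventually (\<lambda>s::real. s powr (-2/3) > \<bar>\<theta>\<bar>) (at_right 0)" "eventually (\<lambda>s::real. s powr (-2/3) > 1) (at_right 0)"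
        by (simp_all add: filterlim_at_top_dense)
    qed
    from eventually_compose_filterlim[OF this sr] decay evV
    show "eventually (\<lambda>j. norm (sqrt (V j) * B j) \<le> h (s j)) sequentially"
    proof eventually_elim
      case (elim j)
      let ?R = "s j powr (-2/3)"
      let ?e = "K * exp (- (c / (s j * ?R)))"
      have R: "?R > 1" "?R > \<bar>\<theta>\<bar>" "s j * ?R \<le> c" using elim by auto
      have "norm (B j) \<le> (\<integral>u. ?e * cauchy_density (u - \<theta>) + indicator {u. \<bar>u\<bar> > ?R} u * cauchy_density (u - \<theta>) \<partial>lborel)"
        unfolding B_def
      proof (rule norm_integral_le)
        fix u :: real
        have cd: "cauchy_density (u - \<theta>) \<ge> 0" using cauchy_density_pos less_imp_le by blast
        consider "\<bar>u\<bar> \<le> 1" | "1 < \<bar>u\<bar>" "\<bar>u\<bar> \<le> ?R" | "?R < \<bar>u\<bar>" by linarith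
        then show "norm (indicator {u. \<bar>u\<bar> > 1} u *\<^sub>R (cauchy_density (u - \<theta>) *\<^sub>R ch j u)) \<le> ?e * cauchy_density (u - \<theta>) + indicator {u. \<bar>u\<bar> > ?R} u * cauchy_density (u - \<theta>)"
        proof cases
          case 2
          have "s j * \<bar>u\<bar> \<le> s j * ?R" using 2 s by (intro mult_left_mono) (auto simp: less_imp_le)
          then have "norm (ch j u) \<le> K * exp (- (c * min 1 (u ^ 2) / (s j * max 1 \<bar>u\<bar>)))" using elim R by auto
          also have "min 1 (u ^ 2) = 1" using 2 one_less_power[of "\<bar>u\<bar>" 2] by (simp add: min_def)
          also have "max 1 \<bar>u\<bar> = \<bar>u\<bar>" using 2 by simp
          also have "K * exp (- (c * 1 / (s j * \<bar>u\<bar>))) \<le> ?e"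
          proof -
            have "c / (s j * ?R) \<le> c / (s j * \<bar>u\<bar>)"
              using 2 s(1)[of j] K R by (intro divide_left_mono mult_left_mono mult_pos_pos) auto
            then show ?thesis using K by simp
          qed
          finally have "norm (ch j u) * cauchy_density (u - \<theta>) \<le> ?e * cauchy_density (u - \<theta>)" using cd by (rule mult_right_mono)
          moreover have "norm (indicator {u. \<bar>u\<bar> > 1} u *\<^sub>R (cauchy_density (u - \<theta>) *\<^sub>R ch j u)) = norm (ch j u) * cauchy_density (u - \<theta>)"
            using 2 cd by (simp add: mult.commute)
          moreover have "indicator {u. \<bar>u\<bar> > ?R} u * cauchy_density (u - \<theta>) = 0" using 2 by simp
          ultimately show ?thesis by (simp only: add_0_right)
        next
          case 3
          then have "cauchy_density (u - \<theta>) * norm (ch j u) \<le> cauchy_density (u - \<theta>)" using norm1[of j u] cd by (intro mult_left_le) auto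
          then show ?thesis using 3 R cd K by (simp add: add_increasing)
        qed (use cd K in auto)
      qed (use intB cauchy_tail_shift[OF R(2)] integrable_cauchy_shift[of \<theta>] in auto)
      also have "\<dots> = ?e * 1 + (\<integral>u. indicator {u. \<bar>u\<bar> > ?R} u * cauchy_density (u - \<theta>) \<partial>lborel)"
        using cauchy_tail_shift[OF R(2)] integrable_cauchy_shift[of \<theta>] integral_cauchy_shift[of \<theta>] by simp
      also have "\<dots> \<le> ?e + 2 / (pi * (?R - \<bar>\<theta>\<bar>))" using cauchy_tail_shift(2)[OF R(2)] by simp
      finally have b: "norm (B j) \<le> ?e + 2 / (pi * (?R - \<bar>\<theta>\<bar>))" .
      have "norm (sqrt (V j) * B j) = sqrt (V j) * norm (B j)" using elim by (simp add: norm_mult)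
      also have "\<dots> \<le> sqrt (D / s j) * (?e + 2 / (pi * (?R - \<bar>\<theta>\<bar>)))"
        using V(2)[of j] b elim D s(1)[of j] by (intro mult_mono) auto
      finally show ?case by (simp add: h_def)
    qed
  qed
  define f where "f j w = indicator {-1..1} (w / sqrt (V j)) *\<^sub>R (cauchy_density (w / sqrt (V j) - \<theta>) *\<^sub>R ch j (w / sqrt (V j)))" for j w
  have invV: "(\<lambda>j. 1 / sqrt (V j)) \<longlonglongrightarrow> 0"
    using tendsto_inverse_0_at_top[OF filterlim_compose[OF sqrt_at_top V(1)]] by (simp add: inverse_eq_divide)
  have wV: "(\<lambda>j. w / sqrt (V j)) \<longlonglongrightarrow> 0" for w using tendsto_mult[OF tendsto_const[of w] invV] by simp
  have subst: "eventually (\<lambda>j. sqrt (V j) * A j = integral\<^sup>L lborel (f j)) sequentially"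
    using evV
  proof eventually_elim
    case (elim j)
    have "A j = (1 / sqrt (V j)) *\<^sub>R integral\<^sup>L lborel (f j)"
      unfolding A_def f_def using elim by (subst lborel_integral_real_affine[where c = "1 / sqrt (V j)" and t = 0]) auto
    then show ?case using elim by (simp add: scaleR_conv_of_real)
  qed
  \<comment> \<open>The majorant must hold for every member of the sequence, so the finitely many
    exceptional indices are cut off and restored at the end by \<open>LIMSEQ_offset\<close>.\<close>
  obtain j0 where j0: "\<And>j. j \<ge> j0 \<Longrightarrow> V j > 0" "\<And>j. j \<ge> j0 \<Longrightarrow> s j < c"
     "\<And>j u. j \<ge> j0 \<Longrightarrow> s j * \<bar>u\<bar> \<le> c \<Longrightarrow> norm (ch j u) \<le> K * exp (- (c * min 1 (u ^ 2) / (s j * max 1 \<bar>u\<bar>)))"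
  proof -
    have "eventually (\<lambda>j. s j < c) sequentially" using s(2) K(2) by (rule order_tendstoD)
    with evV decay have "eventually (\<lambda>j. V j > 0 \<and> s j < c \<and> (\<forall>u. s j * \<bar>u\<bar> \<le> c \<longrightarrow>
        norm (ch j u) \<le> K * exp (- (c * min 1 (u ^ 2) / (s j * max 1 \<bar>u\<bar>))))) sequentially" by eventually_elim blast
    then show ?thesis using that unfolding eventually_sequentially by blast
  qed
  have limf: "(\<lambda>j. integral\<^sup>L lborel (f (j + j0))) \<longlonglongrightarrow> (CLINT w|lborel. cauchy_density \<theta> *\<^sub>R (\<psi> * complex_of_real (exp (- (w ^ 2) / 2))))"
  \<comment> \<open>On the indicator the decay exponent is \<open>c * w ^ 2 / (V * s)\<close>, and
    \<open>V * s <= D\<close> makes it a fixed Gaussian.\<close>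
  proof (rule integral_dominated_convergence[where w = "\<lambda>w. K * exp (- (c / D * w ^ 2))"])
    show "integrable lborel (\<lambda>w. K * exp (- (c / D * w ^ 2)))"
    proof -
      have p: "c / D > 0" using D K by simp
      have "integrable lborel (\<lambda>x. normal_density 0 (sqrt (D / (2 * c))) x)" using D K by (intro integrable_normal_density) auto
      moreover have "normal_density 0 (sqrt (D / (2 * c))) x = 1 / sqrt (2 * pi * (D / (2 * c))) * exp (- (c / D * x ^ 2))" for x
        using D K by (simp add: normal_density_def)
      ultimately have "integrable lborel (\<lambda>x. 1 / sqrt (2 * pi * (D / (2 * c))) * exp (- (c / D * x ^ 2)))" by simp
      then have "integrable lborel (\<lambda>x. exp (- (c / D * x ^ 2)))" using D K by (subst (asm) integrable_mult_left_iff) auto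
      then show ?thesis by simp
    qed
    have fm: "(\<lambda>w. f j w) \<in> borel_measurable lborel" for j unfolding f_def by measurable
    then show "\<And>i. f (i + j0) \<in> borel_measurable lborel" by simp
    show "AE w in lborel. (\<lambda>i. f (i + j0) w) \<longlonglongrightarrow> cauchy_density \<theta> *\<^sub>R (\<psi> * complex_of_real (exp (- (w ^ 2) / 2)))"
    proof (intro AE_I2)
      fix w :: real
      have "eventually (\<lambda>j. \<bar>w / sqrt (V j)\<bar> < 1) sequentially"
        using order_tendstoD(2)[OF tendsto_rabs[OF wV[of w]], of 1] by simp
      then have "eventually (\<lambda>j. f j w = cauchy_density (w / sqrt (V j) - \<theta>) *\<^sub>R ch j (w / sqrt (V j))) sequentially"
      proof eventually_elim
        case (elim j)
        have "x \<in> {-1..1}" if "\<bar>x\<bar> < 1" for x :: real using that by auto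
        then show ?case using elim by (simp only: f_def indicator_simps scaleR_one)
      qed
      then have ev: "eventually (\<lambda>j. cauchy_density (w / sqrt (V j) - \<theta>) *\<^sub>R ch j (w / sqrt (V j)) = f j w) sequentially"
        by (auto elim: eventually_mono)
      have "(\<lambda>j. cauchy_density (w / sqrt (V j) - \<theta>)) \<longlonglongrightarrow> cauchy_density (0 - \<theta>)"
        unfolding cauchy_density_def by (intro tendsto_intros wV) (auto simp: add_nonneg_eq_0_iff)
      then have "(\<lambda>j. cauchy_density (w / sqrt (V j) - \<theta>) *\<^sub>R ch j (w / sqrt (V j))) \<longlonglongrightarrow> cauchy_density (0 - \<theta>) *\<^sub>R (\<psi> * complex_of_real (exp (- (w ^ 2) / 2)))"
        by (intro tendsto_scaleR lim)
      from Lim_transform_eventually[OF this ev] have "(\<lambda>j. f j w) \<longlonglongrightarrow> cauchy_density (0 - \<theta>) *\<^sub>R (\<psi> * complex_of_real (exp (- (w ^ 2) / 2)))" .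
      then have "(\<lambda>j. f j w) \<longlonglongrightarrow> cauchy_density \<theta> *\<^sub>R (\<psi> * complex_of_real (exp (- (w ^ 2) / 2)))"
        by (simp add: cauchy_density_def)
      then show "(\<lambda>i. f (i + j0) w) \<longlonglongrightarrow> cauchy_density \<theta> *\<^sub>R (\<psi> * complex_of_real (exp (- (w ^ 2) / 2)))"
        by (rule LIMSEQ_ignore_initial_segment)
    qed
    show "AE w in lborel. norm (f (i + j0) w) \<le> K * exp (- (c / D * w ^ 2))" for i
    proof (intro AE_I2)
      fix w :: real
      let ?j = "i + j0"
      let ?u = "w / sqrt (V ?j)"
      have Vp: "V ?j > 0" "s ?j < c" using j0 by auto
      show "norm (f ?j w) \<le> K * exp (- (c / D * w ^ 2))"
      proof (cases "\<bar>?u\<bar> \<le> 1")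
        case True
        then have "s ?j * \<bar>?u\<bar> \<le> s ?j * 1" using s by (intro mult_left_mono) (auto simp: less_imp_le)
        then have "norm (ch ?j ?u) \<le> K * exp (- (c * min 1 (?u ^ 2) / (s ?j * max 1 \<bar>?u\<bar>)))" using j0(3)[of ?j ?u] Vp by simp
        also have "min 1 (?u ^ 2) = ?u ^ 2" using abs_square_le_1[of ?u] True by (intro min_absorb2) blast
        also have "max 1 \<bar>?u\<bar> = 1" using True by simp
        also have "K * exp (- (c * ?u ^ 2 / (s ?j * 1))) \<le> K * exp (- (c / D * w ^ 2))"
        proof -
          have "V ?j * s ?j \<le> D" using V(2)[of ?j] s(1)[of ?j] by (simp add: field_simps)
          then have "c * w ^ 2 / D \<le> c * w ^ 2 / (V ?j * s ?j)" using K Vp s(1)[of ?j] D by (intro divide_left_mono mult_pos_pos) auto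
          also have "\<dots> = c * ?u ^ 2 / (s ?j * 1)" using Vp by (simp add: power_divide)
          finally show ?thesis using K by simp
        qed
        finally have *: "norm (ch ?j ?u) \<le> K * exp (- (c / D * w ^ 2))" .
        have "norm (f ?j w) \<le> cauchy_density (?u - \<theta>) * norm (ch ?j ?u)"
          using cauchy_density_pos[of "?u - \<theta>"] by (simp add: f_def indicator_def)
        also have "\<dots> \<le> 1 * (K * exp (- (c / D * w ^ 2)))" using * cle cauchy_density_pos[of "?u - \<theta>"] by (intro mult_mono) auto
        finally show ?thesis by simp
      next
        case False
        then have "?u \<notin> {-1..1}" by auto
        then show ?thesis using K by (simp add: f_def)
      qed
    qed
  qed simp
  have val: "(CLINT w|lborel. cauchy_density \<theta> *\<^sub>R (\<psi> * complex_of_real (exp (- (w ^ 2) / 2)))) = sqrt (2 * pi) * cauchy_density \<theta> * \<psi>"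
  proof -
    have "(CLINT w|lborel. cauchy_density \<theta> *\<^sub>R (\<psi> * complex_of_real (exp (- (w ^ 2) / 2)))) =
      (CLINT w|lborel. (cauchy_density \<theta> * \<psi> * sqrt (2 * pi)) * complex_of_real (std_normal_density w))"
      by (intro Bochner_Integration.integral_cong refl) (simp add: std_normal_density_def scaleR_conv_of_real)
    also have "\<dots> = (cauchy_density \<theta> * \<psi> * sqrt (2 * pi)) * complex_of_real (\<integral>w. std_normal_density w \<partial>lborel)"
      by (simp only: integral_mult_right_zero integral_complex_of_real)
    also have "(\<integral>w. std_normal_density w \<partial>lborel) = 1" using integral_normal_density[of 1 0] by simp
    finally show ?thesis by simp
  qed
  have "(\<lambda>j. integral\<^sup>L lborel (f j)) \<longlonglongrightarrow> sqrt (2 * pi) * cauchy_density \<theta> * \<psi>"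
    using limf unfolding val by (rule LIMSEQ_offset)
  then have "(\<lambda>j. sqrt (V j) * A j) \<longlonglongrightarrow> sqrt (2 * pi) * cauchy_density \<theta> * \<psi>"
    by (rule Lim_transform_eventually) (use subst in \<open>auto elim: eventually_mono\<close>)
  from tendsto_add[OF this limB] show ?thesis unfolding split by (simp add: distrib_left)
qed

lemma expectation_prod_Pi_pmf_bounded:
  fixes f :: "'i \<Rightarrow> 'b \<Rightarrow> complex"
  assumes "finite A" "\<And>x y. norm (f x y) \<le> 1"
  shows "measure_pmf.expectation (Pi_pmf A d p) (\<lambda>h. \<Prod>x\<in>A. f x (h x)) = (\<Prod>x\<in>A. measure_pmf.expectation (p x) (f x))"
proof (cases "A = {}")
  case False
  have ind: "prob_space.indep_vars (measure_pmf (Pi_pmf A d p)) (\<lambda>_. borel) (\<lambda>x h. f x (h x)) A"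
    by (rule prob_space.indep_vars_compose2[OF prob_space_measure_pmf indep_vars_Pi_pmf[OF assms(1)]]) auto
  have "measure_pmf.expectation (Pi_pmf A d p) (\<lambda>h. \<Prod>x\<in>A. f x (h x)) = (\<Prod>x\<in>A. measure_pmf.expectation (Pi_pmf A d p) (\<lambda>h. f x (h x)))"
  proof (rule prob_space.indep_vars_lebesgue_integral[OF prob_space_measure_pmf assms(1) ind])
    show "integrable (measure_pmf (Pi_pmf A d p)) (\<lambda>h. f x (h x))" for x
      by (rule measure_pmf.integrable_const_bound[where B = 1]) (use assms in auto)
  qed
  also have "\<dots> = (\<Prod>x\<in>A. measure_pmf.expectation (p x) (f x))"
  proof (rule prod.cong[OF refl])
    fix x assume x: "x \<in> A"
    have "measure_pmf.expectation (Pi_pmf A d p) (\<lambda>h. f x (h x)) = measure_pmf.expectation (map_pmf (\<lambda>h. h x) (Pi_pmf A d p)) (f x)"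
      by simp
    then show "measure_pmf.expectation (Pi_pmf A d p) (\<lambda>h. f x (h x)) = measure_pmf.expectation (p x) (f x)"
      using Pi_pmf_component[OF assms(1), of x d p] x by simp
  qed
  finally show ?thesis .
qed simp

text \<open>The two means are required at different precision: a bounded error in \<open>t\<close>
  disappears after division by \<open>sqrt V\<close>, while \<open>Z\<close> has a limit law on the
  scale 1 and its centring must be asymptotically exact.\<close>

locale boltzmann_limit = boltzmann_seq +
  fixes L c :: "nat \<Rightarrow> real" and \<Psi> :: "real \<Rightarrow> complex" and D0 :: real
  assumes size_mean: "\<And>j. \<bar>(\<Sum>n\<in>J j. s j * lam n * geo_mean (s j * lam n)) - s j * L j\<bar> \<le> D0"
    and count_mean: "(\<lambda>j. (\<Sum>n\<in>J j. s j * geo_mean (s j * lam n)) - c j) \<longlonglongrightarrow> 0"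
    and \<Psi>_lim: "\<And>\<eta>. (\<lambda>K. \<Prod>n\<in>upto K. exp_char n \<eta>) \<longlonglongrightarrow> \<Psi> \<eta>"
begin

definition Bz :: "nat \<Rightarrow> (nat \<Rightarrow> nat) pmf" where
  "Bz j = Pi_pmf (J j) 0 (\<lambda>n. geometric_pmf (1 - exp (- (s j * lam n))))"

definition Z :: "nat \<Rightarrow> (nat \<Rightarrow> nat) \<Rightarrow> real" where
  "Z j a = s j * (\<Sum>n\<in>J j. real (a n)) - c j"

definition t :: "nat \<Rightarrow> (nat \<Rightarrow> nat) \<Rightarrow> real" where
  "t j a = s j * ((\<Sum>n\<in>J j. lam n * real (a n)) - L j)"

definition ch :: "nat \<Rightarrow> real \<Rightarrow> real \<Rightarrow> complex" where
  "ch j \<eta> u = measure_pmf.expectation (Bz j) (\<lambda>a. iexp (\<eta> * Z j a + u * t j a))"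

definition \<delta>Z where "\<delta>Z j = (\<Sum>n\<in>J j. s j * geo_mean (s j * lam n)) - c j"
definition \<delta>t where "\<delta>t j = (\<Sum>n\<in>J j. s j * lam n * geo_mean (s j * lam n)) - s j * L j"

text \<open>The coordinates are independent, so centring each of them leaves a product and a
  deterministic phase from the errors of the two means.\<close>

lemma ch_eq: "ch j \<eta> u = iexp (\<eta> * \<delta>Z j + u * \<delta>t j) * \<Phi> j \<eta> u"
proof -
  have lin: "\<eta> * Z j a + u * t j a = (\<eta> * \<delta>Z j + u * \<delta>t j) +
      (\<Sum>n\<in>J j. s j * (\<eta> + u * lam n) * (real (a n) - geo_mean (s j * lam n)))" for a
    unfolding Z_def t_def \<delta>Z_def \<delta>t_def
    by (simp add: algebra_simps sum.distrib sum_subtractf sum_distrib_left)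
  have e: "iexp (\<eta> * Z j a + u * t j a) = iexp (\<eta> * \<delta>Z j + u * \<delta>t j) *
      (\<Prod>n\<in>J j. iexp (s j * (\<eta> + u * lam n) * (real (a n) - geo_mean (s j * lam n))))" for a
    unfolding lin by (simp add: distrib_left exp_add sum_distrib_left exp_sum)
  have "ch j \<eta> u = iexp (\<eta> * \<delta>Z j + u * \<delta>t j) * measure_pmf.expectation (Bz j)
      (\<lambda>a. \<Prod>n\<in>J j. iexp (s j * (\<eta> + u * lam n) * (real (a n) - geo_mean (s j * lam n))))"
    unfolding ch_def e by (rule integral_mult_right_zero)
  also have "measure_pmf.expectation (Bz j)
      (\<lambda>a. \<Prod>n\<in>J j. iexp (s j * (\<eta> + u * lam n) * (real (a n) - geo_mean (s j * lam n)))) = \<Phi> j \<eta> u"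
    unfolding Bz_def \<Phi>_def geo_char_def
    by (rule expectation_prod_Pi_pmf_bounded[where f = "\<lambda>n k. iexp (s j * (\<eta> + u * lam n) * (real k - geo_mean (s j * lam n)))"]) auto
  finally show ?thesis .
qed

lemma norm_ch_le: "norm (ch j \<eta> u) \<le> 1" "norm (ch j \<eta> u) = norm (\<Phi> j \<eta> u)"
  unfolding ch_eq norm_mult using norm_\<Phi>_le_1 by (simp_all del: of_real_add of_real_mult)

lemma ch_measurable [measurable]: "ch j \<eta> \<in> borel_measurable borel"
proof -
  have "continuous_on UNIV (ch j \<eta>)"
    unfolding continuous_on_sequentially
  proof (intro ballI allI impI, elim conjE)
    fix x :: "nat \<Rightarrow> real" and u assume x: "x \<longlonglongrightarrow> u"
    show "(ch j \<eta> \<circ> x) \<longlonglongrightarrow> ch j \<eta> u"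
      unfolding comp_def ch_def
    proof (rule integral_dominated_convergence[where w = "\<lambda>_. 1"])
      show "AE a in measure_pmf (Bz j). (\<lambda>i. iexp (\<eta> * Z j a + x i * t j a)) \<longlonglongrightarrow> iexp (\<eta> * Z j a + u * t j a)"
        by (intro AE_I2 tendsto_intros x)
    qed auto
  qed
  then show ?thesis by (rule borel_measurable_continuous_onI)
qed

lemma ch_tendsto: "(\<lambda>j. ch j \<eta> (w / sqrt (V j))) \<longlonglongrightarrow> \<Psi> \<eta> * complex_of_real (exp (- (w ^ 2) / 2))"
proof -
  have invV: "(\<lambda>j. 1 / sqrt (V j)) \<longlonglongrightarrow> 0"
    using tendsto_inverse_0_at_top[OF filterlim_compose[OF sqrt_at_top V_at_top]] by (simp add: inverse_eq_divide)
  have "(\<lambda>j. w / sqrt (V j) * \<delta>t j) \<longlonglongrightarrow> 0"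
  proof (rule Lim_null_comparison)
    show "eventually (\<lambda>j. norm (w / sqrt (V j) * \<delta>t j) \<le> \<bar>w\<bar> * D0 * (1 / sqrt (V j))) sequentially"
    proof (intro always_eventually allI)
      fix j
      have "norm (w / sqrt (V j) * \<delta>t j) = \<bar>w\<bar> * (1 / sqrt (V j)) * \<bar>\<delta>t j\<bar>"
        using V_nonneg[of j] by (simp add: abs_mult)
      also have "\<dots> \<le> \<bar>w\<bar> * (1 / sqrt (V j)) * D0"
        using size_mean[of j] V_nonneg[of j] unfolding \<delta>t_def by (intro mult_left_mono) auto
      finally show "norm (w / sqrt (V j) * \<delta>t j) \<le> \<bar>w\<bar> * D0 * (1 / sqrt (V j))" by (simp add: mult_ac)
    qed
    show "(\<lambda>j. \<bar>w\<bar> * D0 * (1 / sqrt (V j))) \<longlonglongrightarrow> 0" using tendsto_mult[OF tendsto_const invV] by simp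
  qed
  then have "(\<lambda>j. \<eta> * \<delta>Z j + w / sqrt (V j) * \<delta>t j) \<longlonglongrightarrow> \<eta> * 0 + 0"
    using count_mean unfolding \<delta>Z_def[symmetric] by (intro tendsto_add tendsto_mult tendsto_const)
  from tendsto_exp[OF tendsto_mult[OF tendsto_const[of \<i>] tendsto_of_real[OF this]]]
  have "(\<lambda>j. iexp (\<eta> * \<delta>Z j + w / sqrt (V j) * \<delta>t j)) \<longlonglongrightarrow> iexp (\<eta> * 0 + 0)" .
  from tendsto_mult[OF this tendsto_\<Phi>[OF \<Psi>_lim]] show ?thesis unfolding ch_eq by (simp add: exp_of_real[symmetric])
qed

definition Ker :: "nat \<Rightarrow> real \<Rightarrow> real \<Rightarrow> complex" where
  "Ker j \<eta> \<theta> = measure_pmf.expectation (Bz j) (\<lambda>a. iexp (\<eta> * Z j a + \<theta> * t j a) * exp (- \<bar>t j a\<bar>))"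

text \<open>Expressing \<open>exp (- \<bar>t\<bar>)\<close> as the Fourier transform of the Cauchy
  density and exchanging the integrals turns the weight into an average over the size frequency; the
  factor \<open>iexp (\<theta> * t)\<close> merely translates it.\<close>

lemma Ker_eq: "Ker j \<eta> \<theta> = (CLINT u|lborel. cauchy_density (u - \<theta>) *\<^sub>R ch j \<eta> u)"
proof -
  interpret P: prob_space "measure_pmf (Bz j)" by (rule prob_space_measure_pmf)
  interpret PL: pair_sigma_finite "measure_pmf (Bz j)" lborel ..
  define g where "g a u = cauchy_density (u - \<theta>) *\<^sub>R iexp (\<eta> * Z j a + u * t j a)" for a u
  have inner: "iexp (\<eta> * Z j a + \<theta> * t j a) * exp (- \<bar>t j a\<bar>) = (CLINT u|lborel. g a u)" for a
  proof -
    have "(CLINT u|lborel. g a u) = (CLINT u|lborel. g a (\<theta> + u))"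
      using lborel_integral_real_affine[of 1 "g a" \<theta>] by simp
    also have "\<dots> = (CLINT u|lborel. iexp (\<eta> * Z j a + \<theta> * t j a) * (cauchy_density u *\<^sub>R iexp (t j a * u)))"
      by (intro Bochner_Integration.integral_cong refl) (simp add: g_def scaleR_conv_of_real algebra_simps exp_add)
    also have "\<dots> = iexp (\<eta> * Z j a + \<theta> * t j a) * complex_of_real (exp (- \<bar>t j a\<bar>))"
      using cauchy_char(2)[of "t j a"] by (simp only: integral_mult_right_zero)
    finally show ?thesis ..
  qed
  have int: "integrable (measure_pmf (Bz j) \<Otimes>\<^sub>M lborel) (\<lambda>(a, u). g a u)"
  proof (rule PL.Fubini_integrable)
    have "(\<lambda>p. cauchy_density (snd p - \<theta>) *\<^sub>R iexp (\<eta> * Z j (fst p) + snd p * t j (fst p))) \<in> borel_measurable (measure_pmf (Bz j) \<Otimes>\<^sub>M lborel)"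
    proof -
      have [measurable]: "(\<lambda>p. Z j (fst p)) \<in> borel_measurable (measure_pmf (Bz j) \<Otimes>\<^sub>M lborel)"
        by (rule measurable_compose[OF measurable_fst]) simp
      have [measurable]: "(\<lambda>p. t j (fst p)) \<in> borel_measurable (measure_pmf (Bz j) \<Otimes>\<^sub>M lborel)"
        by (rule measurable_compose[OF measurable_fst]) simp
      show ?thesis by measurable
    qed
    then show "(\<lambda>(a, u). g a u) \<in> borel_measurable (measure_pmf (Bz j) \<Otimes>\<^sub>M lborel)"
      by (simp add: g_def case_prod_beta)
    show "integrable (measure_pmf (Bz j)) (\<lambda>a. \<integral>u. norm (case (a, u) of (a, u) \<Rightarrow> g a u) \<partial>lborel)"
      using integral_cauchy_shift[of \<theta>] by (simp add: g_def cauchy_density_pos less_imp_le)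
    show "AE a in measure_pmf (Bz j). integrable lborel (\<lambda>u. case (a, u) of (a, u) \<Rightarrow> g a u)"
      by (intro AE_I2) (auto simp: g_def intro!: Bochner_Integration.integrable_bound[OF integrable_cauchy_shift[of \<theta>]])
  qed
  have "Ker j \<eta> \<theta> = (CLINT a|measure_pmf (Bz j). CLINT u|lborel. g a u)"
    unfolding Ker_def inner ..
  also have "\<dots> = (CLINT u|lborel. CLINT a|measure_pmf (Bz j). g a u)"
    using PL.Fubini_integral[OF int] by simp
  also have "\<dots> = (CLINT u|lborel. cauchy_density (u - \<theta>) *\<^sub>R ch j \<eta> u)"
    unfolding g_def ch_def by (simp only: integral_scaleR_right)
  finally show ?thesis .
qed

lemma Ker_tendsto: "(\<lambda>j. sqrt (V j) * Ker j \<eta> \<theta>) \<longlonglongrightarrow> sqrt (2 * pi) * cauchy_density \<theta> * \<Psi> \<eta>"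
proof -
  obtain D where D: "\<And>j. V j \<le> D / s j" using V_upper by blast
  obtain K c where K: "K > 0" "c > 0" "eventually (\<lambda>j. \<forall>u. s j * \<bar>u\<bar> \<le> c \<longrightarrow>
     norm (\<Phi> j \<eta> u) \<le> K * exp (- (c * min 1 (u ^ 2) / (s j * max 1 \<bar>u\<bar>)))) sequentially" using \<Phi>_decay[of \<eta>] by blast
  show ?thesis unfolding Ker_eq
    by (rule cauchy_kernel_local_limit[OF ch_measurable norm_ch_le(1) s_pos s_lim V_at_top D K(1,2)])
       (use K(3) ch_tendsto in \<open>simp_all only: norm_ch_le(2)\<close>)
qed

lemma exp_char_uminus: "exp_char n (- \<eta>) = cnj (exp_char n \<eta>)"
  by (simp add: exp_char_def exp_cnj)

lemma \<Psi>_uminus: "\<Psi> (- \<eta>) = cnj (\<Psi> \<eta>)"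
proof (rule LIMSEQ_unique[OF \<Psi>_lim])
  show "(\<lambda>K. \<Prod>n\<in>upto K. exp_char n (- \<eta>)) \<longlonglongrightarrow> cnj (\<Psi> \<eta>)"
    unfolding exp_char_uminus using tendsto_cnj[OF \<Psi>_lim[of \<eta>]] by simp
qed

lemma \<Psi>_0: "\<Psi> 0 = 1"
  by (rule LIMSEQ_unique[OF \<Psi>_lim]) (simp add: exp_char_def)

lemma norm_\<Psi>_le_1: "norm (\<Psi> \<eta>) \<le> 1"
  by (rule tendsto_upperbound[OF tendsto_norm[OF \<Psi>_lim]])
     (auto simp: prod_norm[symmetric] norm_exp_char intro!: prod_le_1 always_eventually)

section \<open>Positive weights that carry the count\<close>

context
  fixes \<eta> :: real and d :: complex
  assumes d: "norm d \<le> 1"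
begin

text \<open>A real weight between 1 and 3 that still encodes the complex observable: it defines
  genuine probability laws for \<open>t\<close>, and varying \<open>d\<close> recovers real and
  imaginary part.\<close>

definition wt :: "nat \<Rightarrow> (nat \<Rightarrow> nat) \<Rightarrow> real" where "wt j a = 2 + Re (d * iexp (\<eta> * Z j a))"

lemma wt_bounds: "1 \<le> wt j a" "wt j a \<le> 3"
proof -
  have "\<bar>Re (d * iexp (\<eta> * Z j a))\<bar> \<le> norm (d * iexp (\<eta> * Z j a))" by (rule abs_Re_le_cmod)
  also have "\<dots> \<le> 1" using d by (simp add: norm_mult)
  finally show "1 \<le> wt j a" "wt j a \<le> 3" unfolding wt_def by linarith+
qed

lemma wt_nonneg: "0 \<le> wt j a"
  using wt_bounds(1)[of j a] by linarith

definition W where "W = 2 + Re (d * \<Psi> \<eta>)"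

lemma W_pos: "W > 0"
proof -
  have "\<bar>Re (d * \<Psi> \<eta>)\<bar> \<le> norm (d * \<Psi> \<eta>)" by (rule abs_Re_le_cmod)
  also have "\<dots> \<le> 1 * 1" unfolding norm_mult using d norm_\<Psi>_le_1 by (intro mult_mono) auto
  finally show ?thesis unfolding W_def by linarith
qed

definition A :: "nat \<Rightarrow> real \<Rightarrow> complex" where
  "A j \<theta> = measure_pmf.expectation (Bz j) (\<lambda>a. (wt j a * exp (- \<bar>t j a\<bar>)) *\<^sub>R iexp (\<theta> * t j a))"

text \<open>The weight is a combination of the count frequencies 0, \<open>\<eta>\<close> and
  \<open>- \<eta>\<close>, so the limit follows from three instances of \<open>Ker_tendsto\<close>;
  conjugate symmetry of \<open>\<Psi>\<close> makes it real.\<close>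

lemma A_tendsto: "(\<lambda>j. sqrt (V j) * A j \<theta>) \<longlonglongrightarrow> sqrt (2 * pi) * cauchy_density \<theta> * W"
proof -
  have int: "integrable (measure_pmf (Bz j)) (\<lambda>a. iexp (\<eta> * Z j a + \<theta> * t j a) * exp (- \<bar>t j a\<bar>))" for \<eta> j
    by (rule measure_pmf.integrable_const_bound[where B = 1]) (auto simp: norm_mult)
  have eq: "(wt j a * exp (- \<bar>t j a\<bar>)) *\<^sub>R iexp (\<theta> * t j a) =
      2 * (iexp (0 * Z j a + \<theta> * t j a) * exp (- \<bar>t j a\<bar>)) + d / 2 * (iexp (\<eta> * Z j a + \<theta> * t j a) * exp (- \<bar>t j a\<bar>))
      + cnj d / 2 * (iexp (- \<eta> * Z j a + \<theta> * t j a) * exp (- \<bar>t j a\<bar>))" for j a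
  proof -
    have w: "complex_of_real (wt j a) = 2 + (d * iexp (\<eta> * Z j a) + cnj d * iexp (- \<eta> * Z j a)) / 2"
      unfolding wt_def using complex_add_cnj[of "d * iexp (\<eta> * Z j a)"] by (simp add: exp_cnj)
    have sp: "iexp (x * Z j a + \<theta> * t j a) = iexp (x * Z j a) * iexp (\<theta> * t j a)" for x
      by (simp add: distrib_left exp_add)
    have alg: "((2 + (d * p + cnj d * q) / 2) * r) * T = 2 * (1 * T * r) + d / 2 * (p * T * r) + cnj d / 2 * (q * T * r)"
      for p q r T :: complex by (simp add: algebra_simps add_divide_distrib)
    have one: "iexp (0 * Z j a) = 1" by simp
    show ?thesis
      unfolding sp one scaleR_conv_of_real of_real_mult[of "wt j a"] w by (rule alg)
  qed
  have "A j \<theta> = 2 * Ker j 0 \<theta> + d / 2 * Ker j \<eta> \<theta> + cnj d / 2 * Ker j (- \<eta>) \<theta>" for j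
    unfolding A_def eq Ker_def
    by (subst Bochner_Integration.integral_add, intro Bochner_Integration.integrable_add integrable_mult_right int,
        intro integrable_mult_right int, subst Bochner_Integration.integral_add, intro integrable_mult_right int,
        intro integrable_mult_right int, simp only: integral_mult_right_zero)
  then have e: "sqrt (V j) * A j \<theta> = 2 * (sqrt (V j) * Ker j 0 \<theta>) + d / 2 * (sqrt (V j) * Ker j \<eta> \<theta>) + cnj d / 2 * (sqrt (V j) * Ker j (- \<eta>) \<theta>)" for j
    by (simp add: algebra_simps)
  have "(\<lambda>j. sqrt (V j) * A j \<theta>) \<longlonglongrightarrow> 2 * (sqrt (2 * pi) * cauchy_density \<theta> * \<Psi> 0) + d / 2 * (sqrt (2 * pi) * cauchy_density \<theta> * \<Psi> \<eta>)
       + cnj d / 2 * (sqrt (2 * pi) * cauchy_density \<theta> * \<Psi> (- \<eta>))"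
    unfolding e by (intro tendsto_add tendsto_mult tendsto_const Ker_tendsto)
  also have "2 * (sqrt (2 * pi) * cauchy_density \<theta> * \<Psi> 0) + d / 2 * (sqrt (2 * pi) * cauchy_density \<theta> * \<Psi> \<eta>)
       + cnj d / 2 * (sqrt (2 * pi) * cauchy_density \<theta> * \<Psi> (- \<eta>)) =
     sqrt (2 * pi) * cauchy_density \<theta> * (2 + (d * \<Psi> \<eta> + cnj (d * \<Psi> \<eta>)) / 2)"
    unfolding \<Psi>_0 \<Psi>_uminus by (simp add: algebra_simps add_divide_distrib)
  also have "2 + (d * \<Psi> \<eta> + cnj (d * \<Psi> \<eta>)) / 2 = complex_of_real W"
    unfolding complex_add_cnj W_def by simp
  finally show ?thesis by simp
qed

definition m :: "nat \<Rightarrow> real" where "m j = measure_pmf.expectation (Bz j) (\<lambda>a. wt j a * exp (- \<bar>t j a\<bar>))"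

lemma wt_integrable: "integrable (measure_pmf (Bz j)) (\<lambda>a. wt j a * exp (- \<bar>t j a\<bar>))"
proof (rule measure_pmf.integrable_const_bound[where B = "3 * 1"])
  show "AE a in measure_pmf (Bz j). norm (wt j a * exp (- \<bar>t j a\<bar>)) \<le> 3 * 1"
  proof (intro AE_I2)
    fix a
    have "\<bar>wt j a\<bar> * exp (- \<bar>t j a\<bar>) \<le> 3 * 1" using wt_bounds[of j a] by (intro mult_mono) auto
    then show "norm (wt j a * exp (- \<bar>t j a\<bar>)) \<le> 3 * 1" by (simp add: abs_mult)
  qed
qed simp

lemma A_0: "A j 0 = complex_of_real (m j)"
  unfolding A_def m_def by (simp add: scaleR_conv_of_real integral_complex_of_real del: of_real_mult)

lemma m_pos: "m j > 0"
proof -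
  have "m j \<ge> 0" unfolding m_def by (intro integral_nonneg_AE AE_I2) (simp add: wt_nonneg)
  moreover have "m j \<noteq> 0"
  proof
    assume "m j = 0"
    then have "AE a in measure_pmf (Bz j). wt j a * exp (- \<bar>t j a\<bar>) = 0"
      unfolding m_def using wt_integrable
      by (subst (asm) integral_nonneg_eq_0_iff_AE) (auto simp: wt_nonneg)
    moreover have "wt j a * exp (- \<bar>t j a\<bar>) \<noteq> 0" for a using wt_bounds[of j a] by auto
    ultimately have "AE a in measure_pmf (Bz j). False" by simp
    then show False by simp
  qed
  ultimately show ?thesis by simp
qed

definition Q :: "nat \<Rightarrow> real measure" where
  "Q j = distr (density (measure_pmf (Bz j)) (\<lambda>a. wt j a * exp (- \<bar>t j a\<bar>) / m j)) borel (t j)"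

lemma dens_nonneg: "0 \<le> wt j a * exp (- \<bar>t j a\<bar>) / m j"
  using wt_bounds[of j a] m_pos[of j] by auto

lemma real_distribution_Q: "real_distribution (Q j)"
proof -
  have "emeasure (density (measure_pmf (Bz j)) (\<lambda>a. wt j a * exp (- \<bar>t j a\<bar>) / m j)) (space (measure_pmf (Bz j)))
     = (\<integral>\<^sup>+a. ennreal (wt j a * exp (- \<bar>t j a\<bar>) / m j) \<partial>measure_pmf (Bz j))"
    by (subst emeasure_density) auto
  also have "\<dots> = ennreal (measure_pmf.expectation (Bz j) (\<lambda>a. wt j a * exp (- \<bar>t j a\<bar>) / m j))"
    using wt_integrable dens_nonneg by (intro nn_integral_eq_integral) auto
  also have "\<dots> = 1" using m_pos[of j] by (simp add: m_def)
  finally have "prob_space (density (measure_pmf (Bz j)) (\<lambda>a. wt j a * exp (- \<bar>t j a\<bar>) / m j))"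
    by (intro prob_spaceI) simp
  then interpret R: prob_space "density (measure_pmf (Bz j)) (\<lambda>a. wt j a * exp (- \<bar>t j a\<bar>) / m j)" .
  show ?thesis unfolding Q_def by (intro R.real_distribution_distr) simp
qed

lemma char_Q: "char (Q j) \<theta> = A j \<theta> / m j"
proof -
  have "char (Q j) \<theta> = (CLINT a|density (measure_pmf (Bz j)) (\<lambda>a. wt j a * exp (- \<bar>t j a\<bar>) / m j). iexp (\<theta> * t j a))"
    unfolding char_def Q_def by (subst integral_distr) auto
  also have "\<dots> = (CLINT a|measure_pmf (Bz j). (wt j a * exp (- \<bar>t j a\<bar>) / m j) *\<^sub>R iexp (\<theta> * t j a))"
    using dens_nonneg by (subst integral_density) auto
  also have "\<dots> = (CLINT a|measure_pmf (Bz j). (wt j a * exp (- \<bar>t j a\<bar>)) *\<^sub>R iexp (\<theta> * t j a) / m j)"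
    by (simp add: scaleR_conv_of_real)
  finally show ?thesis unfolding A_def by simp
qed

lemma cdf_Q_0: "cdf (Q j) 0 = measure_pmf.expectation (Bz j) (\<lambda>a. wt j a * (exp (t j a) * indicator {..0} (t j a))) / m j"
proof -
  have "cdf (Q j) 0 = measure (density (measure_pmf (Bz j)) (\<lambda>a. wt j a * exp (- \<bar>t j a\<bar>) / m j)) {a. t j a \<le> 0}"
    unfolding cdf_def Q_def by (subst measure_distr) (auto simp: vimage_def)
  also have "emeasure (density (measure_pmf (Bz j)) (\<lambda>a. wt j a * exp (- \<bar>t j a\<bar>) / m j)) {a. t j a \<le> 0}
     = (\<integral>\<^sup>+a. ennreal (wt j a * (exp (t j a) * indicator {..0} (t j a)) / m j) \<partial>measure_pmf (Bz j))"
    by (subst emeasure_density) (auto intro!: nn_integral_cong simp: indicator_def)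
  then have "measure (density (measure_pmf (Bz j)) (\<lambda>a. wt j a * exp (- \<bar>t j a\<bar>) / m j)) {a. t j a \<le> 0}
     = measure_pmf.expectation (Bz j) (\<lambda>a. wt j a * (exp (t j a) * indicator {..0} (t j a)) / m j)"
    using m_pos[of j] unfolding measure_def
    by (subst integral_eq_nn_integral) (auto simp: indicator_def less_imp_le wt_nonneg)
  finally show ?thesis by simp
qed

text \<open>Normalised by its value at 0, the limit of \<open>A\<close> is
  \<open>1 / (1 + \<theta> ^ 2)\<close>, so the weighted law of \<open>t\<close> tends to the
  Laplace law whatever \<open>d\<close> and \<open>\<eta>\<close> are. Its distribution function is
  continuous at 0 with value one half, and on \<open>t <= 0\<close> the smooth weight equals
  \<open>exp t\<close>.\<close>

lemma tilted_limit:
  "(\<lambda>j. sqrt (V j) * measure_pmf.expectation (Bz j) (\<lambda>a. wt j a * (exp (t j a) * indicator {..0} (t j a)))) \<longlonglongrightarrow>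
    sqrt (2 * pi) / pi * W / 2"
proof -
  have evV: "eventually (\<lambda>j. V j > 0) sequentially" using V_at_top by (simp add: filterlim_at_top_dense)
  have k0: "cauchy_density 0 = 1 / pi" by (simp add: cauchy_density_def)
  have "(\<lambda>j. char (Q j) \<theta>) \<longlonglongrightarrow> char laplace_distribution \<theta>" for \<theta>
  proof -
    have l: "(\<lambda>j. (sqrt (V j) * A j \<theta>) / (sqrt (V j) * A j 0)) \<longlonglongrightarrow>
       complex_of_real (sqrt (2 * pi) * cauchy_density \<theta> * W) / complex_of_real (sqrt (2 * pi) * cauchy_density 0 * W)"
      using W_pos cauchy_density_pos[of 0] by (intro tendsto_divide A_tendsto) auto
    have v: "complex_of_real (sqrt (2 * pi) * cauchy_density \<theta> * W) / complex_of_real (sqrt (2 * pi) * cauchy_density 0 * W) = char laplace_distribution \<theta>"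
      unfolding char_laplace k0 using W_pos by (simp add: cauchy_density_def flip: of_real_divide)
    have ev: "eventually (\<lambda>j. (sqrt (V j) * A j \<theta>) / (sqrt (V j) * A j 0) = char (Q j) \<theta>) sequentially"
      using evV by eventually_elim (simp add: char_Q A_0)
    show ?thesis using Lim_transform_eventually[OF l ev] unfolding v .
  qed
  then have "weak_conv_m Q laplace_distribution"
    by (intro levy_continuity real_distribution_Q real_distribution_laplace)
  then have half: "(\<lambda>j. cdf (Q j) 0) \<longlonglongrightarrow> 1 / 2"
    using cdf_laplace_0 unfolding weak_conv_m_def weak_conv_def by metis
  have "(\<lambda>j. Re (sqrt (V j) * A j 0)) \<longlonglongrightarrow> Re (sqrt (2 * pi) * cauchy_density 0 * W)"
    by (intro tendsto_Re A_tendsto)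
  then have "(\<lambda>j. sqrt (V j) * m j) \<longlonglongrightarrow> sqrt (2 * pi) / pi * W" unfolding A_0 k0 by simp
  from tendsto_mult[OF half this] have "(\<lambda>j. cdf (Q j) 0 * (sqrt (V j) * m j)) \<longlonglongrightarrow> sqrt (2 * pi) / pi * W / 2" by (simp add: mult.commute)
  moreover have "cdf (Q j) 0 * (sqrt (V j) * m j) =
     sqrt (V j) * measure_pmf.expectation (Bz j) (\<lambda>a. wt j a * (exp (t j a) * indicator {..0} (t j a)))" for j
    unfolding cdf_Q_0 using m_pos[of j] by simp
  ultimately show ?thesis by simp
qed

end

definition tilt :: "nat \<Rightarrow> (nat \<Rightarrow> nat) \<Rightarrow> real" where "tilt j a = exp (t j a) * indicator {..0} (t j a)"

lemma tilt_bounds: "0 \<le> tilt j a" "tilt j a \<le> 1"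
  by (auto simp: tilt_def indicator_def)

text \<open>Both expectations vanish like \<open>1 / sqrt (V j)\<close>. After this common factor is
  divided out, the weights for different \<open>d\<close> determine the complex ratio by
  linearity.\<close>

theorem tilted_char_tendsto:
  "(\<lambda>j. measure_pmf.expectation (Bz j) (\<lambda>a. tilt j a *\<^sub>R iexp (\<eta> * Z j a)) / measure_pmf.expectation (Bz j) (tilt j)) \<longlonglongrightarrow> \<Psi> \<eta>"
proof -
  have evV: "eventually (\<lambda>j. V j > 0) sequentially" using V_at_top by (simp add: filterlim_at_top_dense)
  define X where "X d j = measure_pmf.expectation (Bz j) (\<lambda>a. (2 + Re (d * iexp (\<eta> * Z j a))) * tilt j a)" for d j
  have X: "(\<lambda>j. sqrt (V j) * X d j) \<longlonglongrightarrow> sqrt (2 * pi) / pi * (2 + Re (d * \<Psi> \<eta>)) / 2" if "norm d \<le> 1" for d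
    using tilted_limit[OF that, of \<eta>] unfolding X_def wt_def[OF that] W_def[OF that] tilt_def .
  have it: "integrable (measure_pmf (Bz j)) (tilt j)" for j
    by (rule measure_pmf.integrable_const_bound[where B = 1]) (use tilt_bounds in auto)
  define E where "E j = measure_pmf.expectation (Bz j) (\<lambda>a. tilt j a *\<^sub>R iexp (\<eta> * Z j a))" for j
  define T where "T j = measure_pmf.expectation (Bz j) (tilt j)" for j
  have ie: "integrable (measure_pmf (Bz j)) (\<lambda>a. tilt j a *\<^sub>R iexp (\<eta> * Z j a))" for j
    by (rule measure_pmf.integrable_const_bound[where B = 1]) (use tilt_bounds in auto)
  have XE: "X d j = 2 * T j + Re (d * E j)" for d j
  proof -
    have "d * E j = measure_pmf.expectation (Bz j) (\<lambda>a. d * (tilt j a *\<^sub>R iexp (\<eta> * Z j a)))"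
      unfolding E_def by (rule integral_mult_right_zero[symmetric])
    then have "Re (d * E j) = Re (measure_pmf.expectation (Bz j) (\<lambda>a. d * (tilt j a *\<^sub>R iexp (\<eta> * Z j a))))"
      by simp
    also have "\<dots> = measure_pmf.expectation (Bz j) (\<lambda>a. Re (d * (tilt j a *\<^sub>R iexp (\<eta> * Z j a))))"
      using ie by (intro integral_Re[symmetric] integrable_mult_right)
    finally have "Re (d * E j) = measure_pmf.expectation (Bz j) (\<lambda>a. Re (d * (tilt j a *\<^sub>R iexp (\<eta> * Z j a))))" .
    moreover have "integrable (measure_pmf (Bz j)) (\<lambda>a. Re (d * (tilt j a *\<^sub>R iexp (\<eta> * Z j a))))"
      using ie by (intro integrable_Re integrable_mult_right)
    moreover have "(2 + Re (d * iexp (\<eta> * Z j a))) * tilt j a = 2 * tilt j a + Re (d * (tilt j a *\<^sub>R iexp (\<eta> * Z j a)))" for a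
      by (simp add: algebra_simps)
    ultimately show ?thesis unfolding X_def T_def using it by simp
  qed
  let ?k = "sqrt (2 * pi) / pi"
  have k: "?k > 0" by simp
  \<comment> \<open>For \<open>d = 0\<close> the weight is the constant 2, which yields the
    normalising expectation.\<close>
  have Tl: "(\<lambda>j. sqrt (V j) * (2 * T j)) \<longlonglongrightarrow> ?k"
    using X[of 0] unfolding XE by simp
  have main: "(\<lambda>j. Re (d * (E j / T j))) \<longlonglongrightarrow> Re (d * \<Psi> \<eta>)" if "norm d \<le> 1" for d
  proof -
    have "(\<lambda>j. (sqrt (V j) * X d j - sqrt (V j) * (2 * T j)) / (sqrt (V j) * (2 * T j))) \<longlonglongrightarrow>
       (?k * (2 + Re (d * \<Psi> \<eta>)) / 2 - ?k) / ?k"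
      using k by (intro tendsto_divide tendsto_diff X that Tl) auto
    also have "(?k * (2 + Re (d * \<Psi> \<eta>)) / 2 - ?k) / ?k = Re (d * \<Psi> \<eta>) / 2"
    proof -
      have "(k * (2 + x) / 2 - k) / k = x / 2" if "k > 0" for k x :: real using that by (simp add: field_simps)
      then show ?thesis using k by blast
    qed
    finally have l: "(\<lambda>j. 2 * ((sqrt (V j) * X d j - sqrt (V j) * (2 * T j)) / (sqrt (V j) * (2 * T j)))) \<longlonglongrightarrow> 2 * (Re (d * \<Psi> \<eta>) / 2)"
      by (intro tendsto_mult tendsto_const)
    have "eventually (\<lambda>j. 2 * ((sqrt (V j) * X d j - sqrt (V j) * (2 * T j)) / (sqrt (V j) * (2 * T j))) = Re (d * (E j / T j))) sequentially"
      using evV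
    proof eventually_elim
      case (elim j)
      have "d * (E j / T j) = d * E j / complex_of_real (T j)" by simp
      then have "Re (d * (E j / T j)) = Re (d * E j) / T j" by (simp only: Re_divide_of_real)
      moreover have "2 * ((r * (2 * T + x) - r * (2 * T)) / (r * (2 * T))) = x / T" if "r > 0" for r T x :: real
        using that by (simp add: distrib_left)
      then have "2 * ((sqrt (V j) * (2 * T j + Re (d * E j)) - sqrt (V j) * (2 * T j)) / (sqrt (V j) * (2 * T j))) = Re (d * E j) / T j"
        using elim by simp
      ultimately show ?case unfolding XE by simp
    qed
    from Lim_transform_eventually[OF l this] have "(\<lambda>j. Re (d * (E j / T j))) \<longlonglongrightarrow> 2 * (Re (d * \<Psi> \<eta>) / 2)" .
    moreover have "2 * (Re (d * \<Psi> \<eta>) / 2) = Re (d * \<Psi> \<eta>)" by linarith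
    ultimately show ?thesis by (simp only:)
  qed
  \<comment> \<open>The values 1 and \<open>- \<i>\<close> of \<open>d\<close> give the real and the
    imaginary part.\<close>
  have "(\<lambda>j. Complex (Re (1 * (E j / T j))) (Re (- \<i> * (E j / T j)))) \<longlonglongrightarrow> Complex (Re (1 * \<Psi> \<eta>)) (Re (- \<i> * \<Psi> \<eta>))"
    by (intro tendsto_Complex main) auto
  moreover have "Complex (Re (1 * z)) (Re (- \<i> * z)) = z" for z by (simp add: complex_eq_iff)
  ultimately show ?thesis unfolding E_def[symmetric] T_def[symmetric] by (simp only:)
qed

end

section \<open>From the Boltzmann model to the multiplicative monoid\<close>

context real_lucas_pair
begin

lemma phi_gt_1: "\<phi> > 1"
proof -
  have D: "real_of_int (P ^ 2 - 4 * Q) = (\<phi> - \<psi>) ^ 2" by (rule discriminant)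
  have two: "2 * \<phi> = of_int P + (\<phi> - \<psi>)" using sum_eq by simp
  from discriminant_cases show ?thesis
  proof
    assume "5 \<le> P ^ 2 - 4 * Q"
    then have "real_of_int 5 \<le> real_of_int (P ^ 2 - 4 * Q)" by (simp only: of_int_le_iff)
    then have "1 ^ 2 < (\<phi> - \<psi>) ^ 2" unfolding D by simp
    then have "1 < \<phi> - \<psi>" using diff_pos by (intro power_less_imp_less_base[of 1 2]) auto
    then show ?thesis using two P_pos by linarith
  next
    assume "3 \<le> P \<and> 1 \<le> P ^ 2 - 4 * Q"
    then show ?thesis using two diff_pos by linarith
  qed
qed

text \<open>For \<open>Q > 0\<close> both roots are positive and the closed forms compare directly;
  otherwise the recurrence with \<open>P >= 1\<close> only adds nonnegative terms.\<close>

lemma v_le_Suc: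
  assumes "n \<ge> 1"
  shows "v n \<le> v (Suc n)"
proof (cases "Q > 0")
  case True
  have "\<phi> * \<psi> > 0" using True prod_eq by simp
  then have psi: "\<psi> > 0" using phi_gt_1 by (simp add: zero_less_mult_iff)
  have lt: "\<psi> < \<phi>" using dominant by linarith
  have "\<psi> ^ n * (\<psi> - 1) \<le> \<phi> ^ n * (\<phi> - 1)"
  proof (cases "\<psi> \<le> 1")
    case True
    have "\<psi> ^ n * (\<psi> - 1) \<le> 0" using True psi by (simp add: mult_nonneg_nonpos)
    also have "0 \<le> \<phi> ^ n * (\<phi> - 1)" using phi_gt_1 by simp
    finally show ?thesis .
  next
    case False
    then show ?thesis using psi lt by (intro mult_mono power_mono) auto
  qed
  then have "\<phi> ^ n - \<psi> ^ n \<le> \<phi> ^ Suc n - \<psi> ^ Suc n" by (simp add: algebra_simps)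
  then have "real (v n) \<le> real (v (Suc n))" unfolding real_v using diff_pos by (intro divide_right_mono) auto
  then show ?thesis by simp
next
  case False
  then have Q: "Q \<le> 0" by simp
  obtain k where k: "n = Suc k" using assms by (cases n) auto
  have "U (Suc (Suc k)) = P * U (Suc k) - Q * U k" by simp
  moreover have "1 * U (Suc k) \<le> P * U (Suc k)" using P_pos int_v[of "Suc k"] by (intro mult_right_mono) auto
  moreover have "Q * U k \<le> 0" using Q int_v[of k] by (intro mult_nonpos_nonneg) auto
  ultimately have "U (Suc k) \<le> U (Suc (Suc k))" by linarith
  then show ?thesis unfolding k int_v[symmetric] by simp
qed

lemma v_mono:
  assumes "1 \<le> m" "m \<le> n"
  shows "v m \<le> v n"
  using assms(2)
proof (induction n rule: dec_induct)
  case (step k)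
  then show ?case using v_le_Suc[of k] assms(1) by simp
qed simp

definition prim_index :: "nat set" where
  "prim_index = {n. n \<ge> 1 \<and> (\<exists>p. primitive_divisor v n p)}"

lemma F_eq: "\<F> \<phi> \<psi> = v ` prim_index"
  by (auto simp: \<F>_def prim_index_def)

lemma prim_index_ge_1: "n \<in> prim_index \<Longrightarrow> n \<ge> 1"
  by (simp add: prim_index_def)

lemma primitive_not_dvd_smaller:
  assumes "primitive_divisor v n p" "1 \<le> k" "k < n"
  shows "\<not> p dvd v k"
proof
  assume "p dvd v k"
  also have "v k dvd (\<Prod>k = 1..<n. v k)" using assms by (intro dvd_prodI) auto
  finally show False using assms(1) by (simp add: primitive_divisor_def)
qed

text \<open>Monotonicity alone is weak, as \<open>v 1 = v 2\<close> is possible; a primitive divisor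
  of the later term separates the two. Elements of the generating set thus correspond to indices one
  to one and in order.\<close>

lemma v_strict_mono:
  assumes "m \<ge> 1" "n \<in> prim_index" "m < n"
  shows "v m < v n"
proof -
  obtain p where p: "primitive_divisor v n p" using assms by (auto simp: prim_index_def)
  have "v m \<noteq> v n" using primitive_not_dvd_smaller[OF p, of m] p assms by (auto simp: primitive_divisor_def)
  then show ?thesis using v_mono[of m n] assms by simp
qed

lemma v_le_iff:
  assumes "m \<in> prim_index" "n \<in> prim_index"
  shows "v m \<le> v n \<longleftrightarrow> m \<le> n"
  using v_strict_mono[of n m] v_mono[of m n] assms prim_index_ge_1 by (metis linorder_not_le)

lemma inj_on_v: "inj_on v prim_index"
  by (rule inj_onI) (metis antisym v_le_iff order_refl)

lemma v_ge_2:
  assumes "n \<in> prim_index"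
  shows "v n \<ge> 2"
proof -
  obtain p where p: "prime p" "p dvd v n" using assms by (auto simp: prim_index_def primitive_divisor_def)
  then show ?thesis using dvd_imp_le[OF p(2)] v_pos[of n] prime_ge_2_nat[OF p(1)] prim_index_ge_1[OF assms] by linarith
qed

definition lam :: "nat \<Rightarrow> real" where "lam n = ln (real (v n))"

lemma lam_close_ex: "\<exists>C. \<forall>n\<in>prim_index. \<bar>lam n - ln \<phi> * real n\<bar> \<le> C"
proof -
  define r where "r = \<psi> / \<phi>"
  have "\<bar>\<phi>\<bar> = \<phi>" using phi_gt_1 by simp
  then have r: "\<bar>r\<bar> < 1" using dominant phi_gt_1 by (simp add: r_def abs_divide del: abs_of_nonneg)
  have "\<bar>lam n - ln \<phi> * real n\<bar> \<le> ln 2 - ln (1 - \<bar>r\<bar>) + \<bar>ln (\<phi> - \<psi>)\<bar>" if n: "n \<in> prim_index" for n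
  proof -
    have "\<bar>r ^ n\<bar> \<le> \<bar>r\<bar> ^ 1"
      unfolding power_abs using r prim_index_ge_1[OF n] by (intro power_decreasing) auto
    then have rn: "\<bar>r ^ n\<bar> \<le> \<bar>r\<bar>" by simp
    have "real (v n) = \<phi> ^ n * (1 - r ^ n) / (\<phi> - \<psi>)"
      unfolding real_v r_def using phi_gt_1 by (simp add: power_divide right_diff_distrib)
    moreover have "1 - r ^ n > 0" using rn r by linarith
    ultimately have "lam n = real n * ln \<phi> + ln (1 - r ^ n) - ln (\<phi> - \<psi>)"
      unfolding lam_def using phi_gt_1 diff_pos by (simp add: ln_div ln_mult ln_realpow)
    moreover have "ln (1 - \<bar>r\<bar>) \<le> ln (1 - r ^ n)" using rn r by (intro ln_mono) linarith+
    moreover have "ln (1 - r ^ n) \<le> ln 2" using rn r by (intro ln_mono) linarith+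
    moreover have "ln (1 - \<bar>r\<bar>) \<le> 0" "ln (2::real) \<ge> 0" using r by auto
    moreover have "ln (\<phi> - \<psi>) \<le> \<bar>ln (\<phi> - \<psi>)\<bar>" "- ln (\<phi> - \<psi>) \<le> \<bar>ln (\<phi> - \<psi>)\<bar>" by auto
    ultimately show ?thesis unfolding mult.commute[of "ln \<phi>"] by linarith
  qed
  then show ?thesis by blast
qed

text \<open>One fixed constant is selected because the locale takes it as a parameter.\<close>

definition lam_error :: real where
  "lam_error = (SOME C. \<forall>n\<in>prim_index. \<bar>lam n - ln \<phi> * real n\<bar> \<le> C)"

sublocale G: log_growth prim_index lam "ln \<phi>" lam_error
proof
  show "ln \<phi> > 0" using phi_gt_1 by simp
  show "lam n > 0" if "n \<in> prim_index" for n using v_ge_2[OF that] by (simp add: lam_def)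
  show "\<bar>lam n - ln \<phi> * real n\<bar> \<le> lam_error" if "n \<in> prim_index" for n
    using someI_ex[OF lam_close_ex] that unfolding lam_error_def by blast
  show "0 \<notin> prim_index" using prim_index_ge_1 by fastforce
  show "n \<in> prim_index" if "n \<ge> 13" for n
    using primitive_divisor_exists[OF that] that by (simp add: prim_index_def)
qed

lemma F0_eq: "\<F>\<^sub>0 \<phi> \<psi> = v ` G.upto 12"
  unfolding \<F>\<^sub>0_def G.upto_def by (auto simp: prim_index_def)

text \<open>
  The largest element occurring in one of the two multisets has a primitive prime divisor, which
  divides no other element of either; hence it occurs in both and can be cancelled.
\<close>

lemma F_factorisation_unique:
  assumes "set_mset A \<subseteq> \<F> \<phi> \<psi>" "set_mset B \<subseteq> \<F> \<phi> \<psi>" "prod_mset A = prod_mset B"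
  shows "A = B"
  using assms
proof (induction "size A" arbitrary: A B rule: less_induct)
  case less
  show ?case
  proof (cases "A + B = {#}")
    case False
    define m where "m = Max (set_mset (A + B))"
    have m: "m \<in> set_mset (A + B)" unfolding m_def using False by (intro Max_in) auto
    have max: "k \<le> m" if "k \<in># A + B" for k unfolding m_def using that by (intro Max_ge) auto
    have sub: "k \<in> \<F> \<phi> \<psi>" if "k \<in># A + B" for k using that less.prems by auto
    obtain n where n: "n \<in> prim_index" "m = v n" using sub[OF m] unfolding F_eq by auto
    obtain p where p: "primitive_divisor v n p" using n by (auto simp: prim_index_def)
    have pp: "prime p" "p dvd m" using p n by (auto simp: primitive_divisor_def)
    have only: "k = m" if k: "k \<in># A + B" "p dvd k" for k
    proof -
      obtain i where i: "i \<in> prim_index" "k = v i" using sub[OF k(1)] unfolding F_eq by auto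
      then have "i \<le> n" using max[OF k(1)] v_le_iff n by simp
      moreover have "\<not> i < n" using primitive_not_dvd_smaller[OF p, of i] prim_index_ge_1[OF i(1)] k i by auto
      ultimately show ?thesis using i n by simp
    qed
    have iff: "p dvd prod_mset D \<longleftrightarrow> m \<in># D" if "D \<subseteq># A + B" for D
      using that only pp by (auto simp: prime_dvd_prod_mset_iff dest: mset_subset_eqD)
    have mem: "m \<in># A" "m \<in># B" using iff[of A] iff[of B] m less.prems(3) by auto
    have "m > 0" using v_ge_2[OF n(1)] n by simp
    then have "prod_mset (A - {#m#}) = prod_mset (B - {#m#})"
      using less.prems(3) insert_DiffM[OF mem(1)] insert_DiffM[OF mem(2)] by (metis prod_mset.add_mset mult_left_cancel less_numeral_extra(3))
    moreover have "size (A - {#m#}) < size A" using mem(1) by (rule size_Diff1_less)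
    ultimately have "A - {#m#} = B - {#m#}"
      using less.prems by (intro less.hyps) (auto dest: in_diffD)
    then show ?thesis using insert_DiffM[OF mem(1)] insert_DiffM[OF mem(2)] by metis
  qed simp
qed

lemma Omega_prod_mset:
  assumes "set_mset A \<subseteq> \<F> \<phi> \<psi>"
  shows "Omega (\<F> \<phi> \<psi>) (prod_mset A) = size A"
proof -
  have "factorisation (\<F> \<phi> \<psi>) (prod_mset A) = A"
    unfolding factorisation_def using assms F_factorisation_unique by (intro the_equality) auto
  then show ?thesis by (simp add: Omega_def)
qed

section \<open>Exponent vectors and elements of the monoid\<close>

definition mset_of_exps :: "nat set \<Rightarrow> (nat \<Rightarrow> nat) \<Rightarrow> nat multiset" where
  "mset_of_exps J a = (\<Sum>n\<in>J. replicate_mset (a n) (v n))"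

lemma mset_of_exps:
  assumes "finite J" "J \<subseteq> prim_index"
  shows "set_mset (mset_of_exps J a) \<subseteq> \<F> \<phi> \<psi>" "size (mset_of_exps J a) = (\<Sum>n\<in>J. a n)"
    and "prod_mset (mset_of_exps J a) = (\<Prod>n\<in>J. v n ^ a n)"
    and "n \<in> J \<Longrightarrow> count (mset_of_exps J a) (v n) = a n"
proof -
  show "set_mset (mset_of_exps J a) \<subseteq> \<F> \<phi> \<psi>"
    using assms unfolding mset_of_exps_def F_eq by (auto simp: set_mset_sum)
  show "size (mset_of_exps J a) = (\<Sum>n\<in>J. a n)"
    unfolding mset_of_exps_def by (simp add: size_multiset_sum)
  show "prod_mset (mset_of_exps J a) = (\<Prod>n\<in>J. v n ^ a n)"
    unfolding mset_of_exps_def using assms(1) by (induction J) auto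
  assume n: "n \<in> J"
  have "count (mset_of_exps J a) (v n) = (\<Sum>m\<in>J. if v m = v n then a m else 0)"
    unfolding mset_of_exps_def count_sum by (intro sum.cong refl) auto
  also have "\<dots> = (\<Sum>m\<in>J. if m = n then a m else 0)"
    using assms(2) n inj_on_v by (intro sum.cong refl) (metis inj_onD subsetD)
  also have "\<dots> = a n" using assms(1) n by simp
  finally show "count (mset_of_exps J a) (v n) = a n" .
qed

text \<open>Vanishing outside \<open>J\<close> makes the vector unique, and it matches the default
  value 0 of the product law \<open>Pi_pmf\<close>.\<close>

definition small_exps :: "nat set \<Rightarrow> real \<Rightarrow> (nat \<Rightarrow> nat) set" where
  "small_exps J L = {a. (\<forall>n. n \<notin> J \<longrightarrow> a n = 0) \<and> (\<Sum>n\<in>J. lam n * real (a n)) \<le> L}"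

text \<open>Injectivity is unique factorisation. For surjectivity, every factor of an integer up to
  \<open>x\<close> is at most \<open>x\<close>, so \<open>J\<close> has room for it; a larger
  \<open>J\<close> does no harm, since the size constraint is imposed on the vector.\<close>

lemma bij_betw_small_exps:
  assumes J: "finite J" "J \<subseteq> prim_index" and x: "x \<ge> 1" and J_large: "\<And>n. n \<in> prim_index \<Longrightarrow> real (v n) \<le> x \<Longrightarrow> n \<in> J"
  shows "bij_betw (\<lambda>a. \<Prod>n\<in>J. v n ^ a n) (small_exps J (ln x)) {n \<in> mult_monoid (\<F> \<phi> \<psi>). 1 \<le> n \<and> real n \<le> x}"
proof (rule bij_betw_imageI)
  note me = mset_of_exps[OF J]
  have pos: "v n > 0" if "n \<in> J" for n using v_ge_2 J that by fastforce
  have ppos: "(\<Prod>n\<in>J. v n ^ a n) > 0" for a using pos by (intro prod_pos) auto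
  have lnp: "ln (real (\<Prod>n\<in>J. v n ^ a n)) = (\<Sum>n\<in>J. lam n * real (a n))" for a
    unfolding of_nat_prod using pos J(1)
    by (subst ln_prod) (auto simp: ln_realpow lam_def mult.commute)
  have le: "real (\<Prod>n\<in>J. v n ^ a n) \<le> x \<longleftrightarrow> (\<Sum>n\<in>J. lam n * real (a n)) \<le> ln x" for a
  proof -
    have "real (\<Prod>n\<in>J. v n ^ a n) > 0" using ppos[of a] by (simp only: of_nat_0_less_iff)
    then show ?thesis unfolding lnp[symmetric] using x by (intro ln_le_cancel_iff[symmetric]) auto
  qed
  show "inj_on (\<lambda>a. \<Prod>n\<in>J. v n ^ a n) (small_exps J (ln x))"
  proof (rule inj_onI)
    fix a b assume ab: "a \<in> small_exps J (ln x)" "b \<in> small_exps J (ln x)" "(\<Prod>n\<in>J. v n ^ a n) = (\<Prod>n\<in>J. v n ^ b n)"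
    then have "mset_of_exps J a = mset_of_exps J b"
      using me(1,3) by (intro F_factorisation_unique) auto
    then have "a n = b n" if "n \<in> J" for n using me(4)[OF that] by metis
    moreover have "a n = b n" if "n \<notin> J" for n using ab that by (simp add: small_exps_def)
    ultimately show "a = b" by (intro ext) blast
  qed
  show "(\<lambda>a. \<Prod>n\<in>J. v n ^ a n) ` small_exps J (ln x) = {n \<in> mult_monoid (\<F> \<phi> \<psi>). 1 \<le> n \<and> real n \<le> x}"
  proof (intro equalityI subsetI)
    fix k assume "k \<in> (\<lambda>a. \<Prod>n\<in>J. v n ^ a n) ` small_exps J (ln x)"
    then obtain a where a: "a \<in> small_exps J (ln x)" "k = (\<Prod>n\<in>J. v n ^ a n)" by auto
    have "k \<in> mult_monoid (\<F> \<phi> \<psi>)" unfolding mult_monoid_def a(2) me(3)[symmetric] using me(1) by blast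
    moreover have "real k \<le> x" using a le by (auto simp: small_exps_def)
    moreover have "k \<ge> 1" using ppos[of a] a(2) by linarith
    ultimately show "k \<in> {n \<in> mult_monoid (\<F> \<phi> \<psi>). 1 \<le> n \<and> real n \<le> x}" by simp
  next
    fix k assume "k \<in> {n \<in> mult_monoid (\<F> \<phi> \<psi>). 1 \<le> n \<and> real n \<le> x}"
    then obtain A where A: "set_mset A \<subseteq> \<F> \<phi> \<psi>" "k = prod_mset A" "k \<ge> 1" "real k \<le> x"
      by (auto simp: mult_monoid_def)
    define a where "a n = (if n \<in> J then count A (v n) else 0)" for n
    have sub: "\<exists>n\<in>J. m = v n" if m: "m \<in># A" for m
    proof -
      have "m \<le> k" using dvd_imp_le[OF dvd_prod_mset[OF m]] A by simp
      then have "real m \<le> x" using A by linarith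
      moreover obtain n where "n \<in> prim_index" "m = v n" using m A unfolding F_eq by auto
      ultimately show ?thesis using J_large by blast
    qed
    have "mset_of_exps J a = A"
    proof (rule multiset_eqI)
      fix m
      show "count (mset_of_exps J a) m = count A m"
      proof (cases "\<exists>n\<in>J. m = v n")
        case True
        then show ?thesis using me(4)[of _ a] by (auto simp: a_def)
      next
        case False
        then have "count A m = 0" using sub by (auto simp: count_eq_zero_iff)
        moreover have "count (mset_of_exps J a) m = 0"
          unfolding mset_of_exps_def using False by (auto simp: count_sum)
        ultimately show ?thesis by simp
      qed
    qed
    then have k: "k = (\<Prod>n\<in>J. v n ^ a n)" using me(3)[of a] A by simp
    then have "a \<in> small_exps J (ln x)" using le[of a] A by (auto simp: small_exps_def a_def)
    then show "k \<in> (\<lambda>a. \<Prod>n\<in>J. v n ^ a n) ` small_exps J (ln x)" using k by blast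
  qed
qed

lemma finite_mult_monoid_upto: "finite {n \<in> S. 1 \<le> n \<and> real n \<le> x}"
  by (rule finite_subset[of _ "{..nat \<lfloor>x\<rfloor>}"]) (auto simp: le_nat_floor)

lemma one_in_mult_monoid: "1 \<in> mult_monoid S"
  unfolding mult_monoid_def by (auto intro!: exI[of _ "{#}"])

lemma expectation_uniform_upto:
  fixes f :: "nat \<Rightarrow> complex"
  assumes J: "finite J" "J \<subseteq> prim_index" and x: "x \<ge> 1" and J_large: "\<And>n. n \<in> prim_index \<Longrightarrow> real (v n) \<le> x \<Longrightarrow> n \<in> J"
  shows "finite (small_exps J (ln x))" "small_exps J (ln x) \<noteq> {}"
    and "measure_pmf.expectation (uniform_upto (\<F> \<phi> \<psi>) x) (\<lambda>n. f (Omega (\<F> \<phi> \<psi>) n)) =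
      (\<Sum>a\<in>small_exps J (ln x). f (\<Sum>n\<in>J. a n)) / card (small_exps J (ln x))"
proof -
  let ?S = "{n \<in> mult_monoid (\<F> \<phi> \<psi>). 1 \<le> n \<and> real n \<le> x}"
  have bij: "bij_betw (\<lambda>a. \<Prod>n\<in>J. v n ^ a n) (small_exps J (ln x)) ?S"
    by (rule bij_betw_small_exps[OF J x]) (rule J_large)
  have fin: "finite ?S" by (rule finite_mult_monoid_upto)
  have ne: "?S \<noteq> {}" using one_in_mult_monoid[of "\<F> \<phi> \<psi>"] x by auto
  show "finite (small_exps J (ln x))" using bij_betw_finite[OF bij] fin by simp
  show "small_exps J (ln x) \<noteq> {}" using bij_betw_imp_surj_on[OF bij] ne by (metis image_empty)
  have "measure_pmf.expectation (uniform_upto (\<F> \<phi> \<psi>) x) (\<lambda>n. f (Omega (\<F> \<phi> \<psi>) n)) = (\<Sum>n\<in>?S. f (Omega (\<F> \<phi> \<psi>) n)) / card ?S"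
    unfolding uniform_upto_def using fin ne
    by (subst integral_measure_pmf[of ?S]) (auto simp: scaleR_conv_of_real sum_divide_distrib)
  also have "card ?S = card (small_exps J (ln x))" using bij_betw_same_card[OF bij] by simp
  also have "(\<Sum>n\<in>?S. f (Omega (\<F> \<phi> \<psi>) n)) = (\<Sum>a\<in>small_exps J (ln x). f (Omega (\<F> \<phi> \<psi>) (\<Prod>n\<in>J. v n ^ a n)))"
    by (rule sum.reindex_bij_betw[OF bij, symmetric])
  also have "\<dots> = (\<Sum>a\<in>small_exps J (ln x). f (\<Sum>n\<in>J. a n))"
    unfolding mset_of_exps(3)[OF J, symmetric] Omega_prod_mset[OF mset_of_exps(1)[OF J]] mset_of_exps(2)[OF J] ..
  finally show "measure_pmf.expectation (uniform_upto (\<F> \<phi> \<psi>) x) (\<lambda>n. f (Omega (\<F> \<phi> \<psi>) n)) =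
      (\<Sum>a\<in>small_exps J (ln x). f (\<Sum>n\<in>J. a n)) / card (small_exps J (ln x))" .
qed

end

text \<open>Passes from variables labelled by the elements \<open>v n\<close> to variables labelled
  by \<open>n\<close>; injectivity ensures that none of them is repeated.\<close>

lemma (in prob_space) indep_vars_reindex_inj:
  assumes inj: "inj_on f I" and ind: "indep_vars (\<lambda>_. N) X (f ` I)"
  shows "indep_vars (\<lambda>_. N) (\<lambda>i. X (f i)) I"
proof -
  define F where "F k = {X k -` A \<inter> space M | A. A \<in> sets N}" for k
  have rv: "\<forall>i\<in>f ` I. random_variable N (X i)" and sets: "indep_sets F (f ` I)"
    using ind unfolding indep_vars_def2 F_def by auto
  have "indep_sets (\<lambda>i. F (f i)) I"
  proof (rule indep_setsI)
    show "F (f i) \<subseteq> events" if "i \<in> I" for i using sets that by (auto simp: indep_sets_def)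
    fix A J assume J: "J \<noteq> {}" "J \<subseteq> I" "finite J" and A: "\<forall>j\<in>J. A j \<in> F (f j)"
    have injJ: "inj_on f J" using inj J(2) by (rule inj_on_subset)
    define A' where "A' k = A (inv_into J f k)" for k
    have A': "A' (f j) = A j" if "j \<in> J" for j using injJ that by (simp add: A'_def)
    have "prob (\<Inter>k\<in>f ` J. A' k) = (\<Prod>k\<in>f ` J. prob (A' k))"
      using J A A' by (intro indep_setsD[OF sets]) auto
    then show "prob (\<Inter>j\<in>J. A j) = (\<Prod>j\<in>J. prob (A j))"
      using A' by (simp add: prod.reindex[OF injJ])
  qed
  then show ?thesis using rv unfolding indep_vars_def2 F_def by auto
qed

context boltzmann_limit
begin

definition bounded_exps :: "nat \<Rightarrow> (nat \<Rightarrow> nat) set" where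
  "bounded_exps j = {a. (\<forall>n. n \<notin> J j \<longrightarrow> a n = 0) \<and> (\<Sum>n\<in>J j. lam n * real (a n)) \<le> L j}"

text \<open>
  Under the Boltzmann law the weight of \<open>a\<close> is proportional to \<open>exp (- s Y a)\<close>, where \<open>Y a\<close> is the
  logarithm of the integer with exponent vector \<open>a\<close>; the tilt cancels it on \<open>{Y \<le> L}\<close>.
\<close>

lemma tilted_expectation:
  fixes h :: "(nat \<Rightarrow> nat) \<Rightarrow> complex"
  assumes fin: "finite (bounded_exps j)"
  defines "\<kappa> \<equiv> (\<Prod>n\<in>J j. 1 - exp (- (s j * lam n))) * exp (- (s j * L j))"
  shows "measure_pmf.expectation (Bz j) (\<lambda>a. tilt j a *\<^sub>R h a) = complex_of_real \<kappa> * (\<Sum>a\<in>bounded_exps j. h a)"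
proof -
  have t_iff: "t j a \<le> 0 \<longleftrightarrow> (\<Sum>n\<in>J j. lam n * real (a n)) \<le> L j" for a
    using s_pos[of j] by (simp add: t_def mult_le_0_iff)
  have supp: "a \<in> bounded_exps j" if "a \<in> set_pmf (Bz j)" "tilt j a *\<^sub>R h a \<noteq> 0" for a
    using that set_Pi_pmf_subset[of "J j" 0] unfolding Bz_def tilt_def
    by (auto simp: bounded_exps_def t_iff indicator_def split: if_splits)
  have w: "pmf (Bz j) a * tilt j a = \<kappa>" if a: "a \<in> bounded_exps j" for a
  proof -
    have "pmf (Bz j) a = (\<Prod>n\<in>J j. pmf (geometric_pmf (1 - exp (- (s j * lam n)))) (a n))"
      unfolding Bz_def using a by (intro pmf_Pi') (auto simp: bounded_exps_def)
    also have "\<dots> = (\<Prod>n\<in>J j. exp (- (s j * lam n * real (a n))) * (1 - exp (- (s j * lam n))))"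
    proof (rule prod.cong[OF refl])
      fix n assume n: "n \<in> J j"
      have "exp (- (s j * lam n)) ^ a n = exp (- (s j * lam n * real (a n)))"
        by (simp add: exp_of_nat_mult[symmetric] mult.commute)
      then show "pmf (geometric_pmf (1 - exp (- (s j * lam n)))) (a n) = exp (- (s j * lam n * real (a n))) * (1 - exp (- (s j * lam n)))"
        using sl_pos[OF n] by simp
    qed
    also have "\<dots> = exp (- (s j * (\<Sum>n\<in>J j. lam n * real (a n)))) * (\<Prod>n\<in>J j. 1 - exp (- (s j * lam n)))"
      by (simp add: prod.distrib exp_sum[symmetric] sum_negf sum_distrib_left mult.assoc)
    finally have "pmf (Bz j) a = exp (- (s j * (\<Sum>n\<in>J j. lam n * real (a n)))) * (\<Prod>n\<in>J j. 1 - exp (- (s j * lam n)))" .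
    moreover have "tilt j a = exp (s j * ((\<Sum>n\<in>J j. lam n * real (a n)) - L j))"
      using a t_iff[of a] by (simp add: tilt_def bounded_exps_def t_def)
    moreover have "exp (- (s * Y)) * p * exp (s * (Y - l)) = p * exp (- (s * l))" for s Y p l :: real
      by (simp add: right_diff_distrib exp_diff exp_minus divide_inverse)
    ultimately show ?thesis unfolding \<kappa>_def by (simp only:)
  qed
  have "measure_pmf.expectation (Bz j) (\<lambda>a. tilt j a *\<^sub>R h a) = (\<Sum>a\<in>bounded_exps j. pmf (Bz j) a *\<^sub>R (tilt j a *\<^sub>R h a))"
    by (rule integral_measure_pmf[OF fin]) (rule supp)
  also have "\<dots> = (\<Sum>a\<in>bounded_exps j. complex_of_real \<kappa> * h a)"
    by (intro sum.cong refl) (simp only: scaleR_scaleR w, simp only: scaleR_conv_of_real)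
  finally show ?thesis by (simp only: sum_distrib_left)
qed

text \<open>The constant \<open>\<kappa>\<close> is the same for all admissible vectors, so it
  cancels and a plain average remains.\<close>

lemma tilted_ratio:
  assumes fin: "finite (bounded_exps j)"
  shows "measure_pmf.expectation (Bz j) (\<lambda>a. tilt j a *\<^sub>R iexp (\<eta> * Z j a)) / measure_pmf.expectation (Bz j) (tilt j) =
    (\<Sum>a\<in>bounded_exps j. iexp (\<eta> * Z j a)) / card (bounded_exps j)"
proof -
  define \<kappa> where "\<kappa> = (\<Prod>n\<in>J j. 1 - exp (- (s j * lam n))) * exp (- (s j * L j))"
  have "(\<Prod>n\<in>J j. 1 - exp (- (s j * lam n))) > 0" using sl_pos[of _ j] by (intro prod_pos) fastforce
  then have k: "\<kappa> \<noteq> 0" unfolding \<kappa>_def by (intro no_zero_divisors) (simp_all del: prod_zero_iff)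
  have "complex_of_real (measure_pmf.expectation (Bz j) (tilt j)) = measure_pmf.expectation (Bz j) (\<lambda>a. tilt j a *\<^sub>R 1)"
    by (simp add: scaleR_conv_of_real integral_complex_of_real)
  also have "\<dots> = complex_of_real \<kappa> * card (bounded_exps j)"
    unfolding tilted_expectation[OF fin] \<kappa>_def by simp
  finally show ?thesis unfolding tilted_expectation[OF fin] \<kappa>_def[symmetric] using k by simp
qed

end

context real_lucas_pair
begin

text \<open>The inserted 0 serves the case of no admissible index; as 0 is never a primitive index,
  the corresponding set is then empty.\<close>

definition index_upto :: "nat \<Rightarrow> nat" where
  "index_upto K = Max (insert 0 {n \<in> prim_index. v n \<le> K})"

lemma finite_index: "finite {n \<in> prim_index. v n \<le> K}"
proof (rule finite_imageD)
  show "finite (v ` {n \<in> prim_index. v n \<le> K})" by (rule finite_subset[of _ "{..K}"]) auto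
  show "inj_on v {n \<in> prim_index. v n \<le> K}" by (rule inj_on_subset[OF inj_on_v]) auto
qed

lemma upto_index: "G.upto (index_upto K) = {n \<in> prim_index. v n \<le> K}"
proof (intro equalityI subsetI)
  fix n assume n: "n \<in> G.upto (index_upto K)"
  then have nI: "n \<in> prim_index" "n \<le> index_upto K" by (auto simp: G.upto_def)
  have "index_upto K \<in> insert 0 {n \<in> prim_index. v n \<le> K}"
    unfolding index_upto_def using finite_index by (intro Max_in) auto
  moreover have "index_upto K \<noteq> 0" using nI prim_index_ge_1 by fastforce
  ultimately have "index_upto K \<in> prim_index" "v (index_upto K) \<le> K" by auto
  then show "n \<in> {n \<in> prim_index. v n \<le> K}" using nI v_le_iff[of n "index_upto K"] by simp
next
  fix n assume n: "n \<in> {n \<in> prim_index. v n \<le> K}"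
  then have "n \<le> index_upto K" unfolding index_upto_def using finite_index by (intro Max_ge) auto
  then show "n \<in> G.upto (index_upto K)" using n by (simp add: G.upto_def)
qed

lemma index_upto_at_top: "filterlim index_upto at_top sequentially"
  unfolding filterlim_at_top eventually_sequentially
proof (intro allI exI impI)
  fix Z K assume K: "v (Z + 13) \<le> K"
  have "Z + 13 \<in> prim_index" by (rule G.tail_subset) simp
  then have "Z + 13 \<le> index_upto K" unfolding index_upto_def using finite_index K by (intro Max_ge) auto
  then show "Z \<le> index_upto K" by simp
qed

lemma centred_partial_sum_eq:
  "centred_partial_sum (\<F> \<phi> \<psi>) X K \<omega> = (\<Sum>n\<in>G.upto (index_upto K). X (v n) \<omega> - 1 / lam n)"
proof -
  have "{m \<in> \<F> \<phi> \<psi>. m \<le> K} = v ` {n \<in> prim_index. v n \<le> K}" unfolding F_eq by auto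
  moreover have "inj_on v {n \<in> prim_index. v n \<le> K}" by (rule inj_on_subset[OF inj_on_v]) auto
  ultimately show ?thesis
    unfolding centred_partial_sum_def upto_index by (simp add: sum.reindex lam_def)
qed

section \<open>The limiting random series\<close>

context
  fixes M :: "'a measure" and X :: "nat \<Rightarrow> 'a \<Rightarrow> real"
  assumes prob: "prob_space M"
    and ind: "prob_space.indep_vars M (\<lambda>_. borel) X (\<F> \<phi> \<psi>)"
    and dist: "\<And>m. m \<in> \<F> \<phi> \<psi> \<Longrightarrow> distributed M lborel (X m) (exponential_density (ln (real m)))"
begin

interpretation prob_space M by (rule prob)

lemma indep_X: "indep_vars (\<lambda>_. borel) (\<lambda>n. X (v n)) prim_index"
  using indep_vars_reindex_inj[OF inj_on_v] ind unfolding F_eq by blast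

lemma dist_X: "n \<in> prim_index \<Longrightarrow> distributed M lborel (X (v n)) (exponential_density (lam n))"
  using dist unfolding F_eq lam_def by blast

lemma measurable_X: "n \<in> prim_index \<Longrightarrow> X (v n) \<in> borel_measurable M"
  using distributed_measurable[OF dist_X] by simp

definition T :: "nat \<Rightarrow> 'a \<Rightarrow> real" where
  "T N \<omega> = (\<Sum>n\<in>G.upto N. X (v n) \<omega> - 1 / lam n)"

lemma AE_convergent_T: "AE \<omega> in M. convergent (\<lambda>N. T N \<omega>)"
proof -
  obtain c where c: "c > 0" "\<forall>n\<in>prim_index. c * real n \<le> lam n" using G.lam_linear_lower by blast
  show ?thesis unfolding T_def G.upto_def
    by (rule AE_convergent_centred_exponentials[OF c(1) _ G.zero_notin indep_X dist_X]) (use c G.lam_pos in auto)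
qed

lemma centred_partial_sum_T: "centred_partial_sum (\<F> \<phi> \<psi>) X K \<omega> = T (index_upto K) \<omega>"
  unfolding centred_partial_sum_eq T_def ..

text \<open>Summation up to the value \<open>K\<close> is summation up to the index
  \<open>index_upto K\<close>, which tends to infinity; both orders of summation therefore have the
  same limit.\<close>

lemma convergent_centred_partial_sum:
  assumes "convergent (\<lambda>N. T N \<omega>)"
  shows "convergent (\<lambda>K. centred_partial_sum (\<F> \<phi> \<psi>) X K \<omega>)" "(\<lambda>N. T N \<omega>) \<longlonglongrightarrow> centred_sum (\<F> \<phi> \<psi>) X \<omega>"
proof -
  obtain y where y: "(\<lambda>N. T N \<omega>) \<longlonglongrightarrow> y" using assms by (auto simp: convergent_def)
  have "(\<lambda>K. centred_partial_sum (\<F> \<phi> \<psi>) X K \<omega>) \<longlonglongrightarrow> y"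
    unfolding centred_partial_sum_T by (rule filterlim_compose[OF y index_upto_at_top])
  then show "convergent (\<lambda>K. centred_partial_sum (\<F> \<phi> \<psi>) X K \<omega>)" "(\<lambda>N. T N \<omega>) \<longlonglongrightarrow> centred_sum (\<F> \<phi> \<psi>) X \<omega>"
    using y unfolding centred_sum_def by (auto simp: convergent_def limI)
qed

lemma AE_convergent_centred_partial_sum: "AE \<omega> in M. convergent (\<lambda>K. centred_partial_sum (\<F> \<phi> \<psi>) X K \<omega>)"
  using AE_convergent_T by eventually_elim (rule convergent_centred_partial_sum)

lemma measurable_T [measurable]: "T N \<in> borel_measurable M"
  unfolding T_def using measurable_X G.upto_subset
  by (intro borel_measurable_sum borel_measurable_diff) auto

lemma measurable_centred_sum [measurable]: "centred_sum (\<F> \<phi> \<psi>) X \<in> borel_measurable M"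
  unfolding centred_sum_def centred_partial_sum_T by measurable

lemma char_T: "char (distr M borel (T N)) \<eta> = (\<Prod>n\<in>G.upto N. iexp (- \<eta> / lam n) / (1 - \<i> * \<eta> / lam n))"
proof -
  have ind': "indep_vars (\<lambda>_. borel) (\<lambda>n \<omega>. X (v n) \<omega> - 1 / lam n) (G.upto N)"
    by (rule indep_vars_compose2[OF indep_vars_subset[OF indep_X G.upto_subset], where Y = "\<lambda>n x. x - 1 / lam n"]) simp
  have "char (distr M borel (T N)) \<eta> = (\<Prod>n\<in>G.upto N. char (distr M borel (\<lambda>\<omega>. X (v n) \<omega> - 1 / lam n)) \<eta>)"
    unfolding T_def[abs_def] by (rule char_distr_sum[OF ind'])
  also have "\<dots> = (\<Prod>n\<in>G.upto N. iexp (- \<eta> / lam n) / (1 - \<i> * \<eta> / lam n))"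
  proof (rule prod.cong[OF refl])
    fix n assume "n \<in> G.upto N"
    then have n: "n \<in> prim_index" using G.upto_subset by blast
    note [measurable] = measurable_X[OF n]
    have l: "lam n > 0" using G.lam_pos[OF n] .
    have "char (distr M borel (\<lambda>\<omega>. X (v n) \<omega> - 1 / lam n)) \<eta> = (CLINT \<omega>|M. iexp (- \<eta> / lam n) * iexp (\<eta> * X (v n) \<omega>))"
      unfolding char_def by (subst integral_distr) (auto intro!: Bochner_Integration.integral_cong simp: exp_add[symmetric] algebra_simps)
    also have "\<dots> = iexp (- \<eta> / lam n) * (CLINT \<omega>|M. iexp (\<eta> * X (v n) \<omega>))" by (rule integral_mult_right_zero)
    also have "(CLINT \<omega>|M. iexp (\<eta> * X (v n) \<omega>)) = char (distr M lborel (X (v n))) \<eta>"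
      unfolding char_def by (subst integral_distr) auto
    also have "distr M lborel (X (v n)) = density lborel (exponential_density (lam n))"
      by (rule distributed_distr_eq_density[OF dist_X[OF n]])
    also have "char \<dots> \<eta> = lam n / (lam n - \<i> * \<eta>)" by (rule char_exponential[OF l])
    also have "\<dots> = 1 / (1 - \<i> * \<eta> / lam n)" using l by (simp add: divide_simps)
    finally show "char (distr M borel (\<lambda>\<omega>. X (v n) \<omega> - 1 / lam n)) \<eta> = iexp (- \<eta> / lam n) / (1 - \<i> * \<eta> / lam n)" by simp
  qed
  finally show ?thesis .
qed

text \<open>Almost sure convergence of the partial sums gives convergence of their characteristic
  functions by bounded convergence. This supplies the limit \<open>\<Psi>\<close> of the products of
  \<open>exp_char\<close>.\<close>

lemma char_T_tendsto:
  "(\<lambda>N. \<Prod>n\<in>G.upto N. iexp (- \<eta> / lam n) / (1 - \<i> * \<eta> / lam n)) \<longlonglongrightarrow> char (distr M borel (centred_sum (\<F> \<phi> \<psi>) X)) \<eta>"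
proof -
  have c: "char (distr M borel Y) \<eta> = (CLINT \<omega>|M. iexp (\<eta> * Y \<omega>))" if [measurable]: "Y \<in> borel_measurable M" for Y
    unfolding char_def by (subst integral_distr) auto
  have "(\<lambda>N. CLINT \<omega>|M. iexp (\<eta> * T N \<omega>)) \<longlonglongrightarrow> (CLINT \<omega>|M. iexp (\<eta> * centred_sum (\<F> \<phi> \<psi>) X \<omega>))"
  proof (rule integral_dominated_convergence[where w = "\<lambda>_. 1"])
    show "AE \<omega> in M. (\<lambda>N. iexp (\<eta> * T N \<omega>)) \<longlonglongrightarrow> iexp (\<eta> * centred_sum (\<F> \<phi> \<psi>) X \<omega>)"
      using AE_convergent_T by eventually_elim (intro tendsto_intros convergent_centred_partial_sum)
  qed auto
  then show ?thesis unfolding char_T[symmetric] c[OF measurable_T] c[OF measurable_centred_sum] .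
qed

end
end

context log_growth
begin

lemma sum_upto_eq: "(\<Sum>n\<in>upto N. f n) = (\<Sum>n<Suc N. if n \<in> I then f n else 0)"
proof -
  have "upto N = {..<Suc N} \<inter> I" by (auto simp: upto_def)
  then show ?thesis by (simp only: sum.inter_restrict[OF finite_lessThan])
qed

lemma tendsto_partial_mean_size: "s > 0 \<Longrightarrow> (\<lambda>N. \<Sum>n\<in>upto N. s * lam n * geo_mean (s * lam n)) \<longlonglongrightarrow> suminf (mean_size s)"
  unfolding sum_upto_eq mean_size_def[symmetric] using mean_size_sum by (intro LIMSEQ_Suc summable_LIMSEQ) blast

lemma tendsto_partial_mean_count: "s > 0 \<Longrightarrow> (\<lambda>N. \<Sum>n\<in>upto N. s * geo_mean (s * lam n)) \<longlonglongrightarrow> suminf (mean_count s)"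
  unfolding sum_upto_eq mean_count_def[symmetric] by (intro LIMSEQ_Suc summable_LIMSEQ summable_mean_count)

end

section \<open>The scale and the centring\<close>

context real_lucas_pair
begin

text \<open>The positive solution \<open>s\<close> of
  \<open>s * ln x = pi ^ 2 / (6 * s * ln \<phi>)\<close>, which balances the mean of
  \<open>Y\<close> with \<open>ln x\<close>; for \<open>ln x > 0\<close> it is also the reciprocal
  of the normalising factor \<open>b\<^sub>2 \<phi> * sqrt (ln x)\<close>.\<close>

definition scale :: "real \<Rightarrow> real" where "scale x = pi / sqrt (6 * ln \<phi> * ln x)"

definition centre :: "real \<Rightarrow> real" where
  "centre x = scale x * (a\<^sub>1 \<phi> / 2 * sqrt (ln x) * ln (ln x) + b\<^sub>1 \<phi> \<psi> * sqrt (ln x))"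

lemma ln_phi_pos: "ln \<phi> > 0" by (rule G.l_pos)

lemma normalised_Omega_eq:
  assumes "ln x > 0"
  shows "normalised_Omega \<phi> \<psi> x n = scale x * real (Omega (\<F> \<phi> \<psi>) n) - centre x"
proof -
  have "b\<^sub>2 \<phi> * sqrt (ln x) = 1 / scale x" by (simp add: b\<^sub>2_def scale_def real_sqrt_mult)
  then show ?thesis unfolding normalised_Omega_def centre_def
    by (simp add: right_diff_distrib distrib_left mult.commute)
qed

text \<open>The limit in \<open>mean_count_asymptotics\<close> for the present sequence.\<close>

definition limit_constant :: real where
  "limit_constant = (\<Sum>n\<in>G.upto 12. 1 / lam n) + 1 / lam 13
      + (\<Sum>k. 1 / lam (Suc k + 13) - 1 / (real (Suc k) * ln \<phi>)) + (euler_mascheroni - ln (ln \<phi>)) / ln \<phi>"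

text \<open>The logarithm in \<open>b\<^sub>1\<close> is split in two: one part belongs to the
  constant of the mean count, the other is the constant part of
  \<open>- ln (scale x) / ln \<phi>\<close>.\<close>

lemma b1_eq: "b\<^sub>1 \<phi> \<psi> = b\<^sub>2 \<phi> * (limit_constant + ln (6 * ln \<phi> / pi ^ 2) / (2 * ln \<phi>))"
proof -
  define S where "S = (\<Sum>n\<in>G.upto 12. 1 / lam n) + 1 / lam 13 + (\<Sum>k. 1 / lam (Suc k + 13) - 1 / (real (Suc k) * ln \<phi>))"
  have "(\<Sum>m\<in>\<F>\<^sub>0 \<phi> \<psi>. 1 / ln (real m)) = (\<Sum>n\<in>G.upto 12. 1 / lam n)"
    unfolding F0_eq lam_def using inj_on_subset[OF inj_on_v G.upto_subset] by (simp add: sum.reindex)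
  then have "b\<^sub>1 \<phi> \<psi> = b\<^sub>2 \<phi> * ((2 * euler_mascheroni - ln (pi ^ 2 * ln \<phi> / 6)) / (2 * ln \<phi>) + S)"
    unfolding b\<^sub>1_def b\<^sub>2_def S_def lam_def[symmetric] by (simp add: add.assoc)
  moreover have "ln (pi ^ 2 * ln \<phi> / 6) = 2 * ln pi + ln (ln \<phi>) - ln 6" "ln (6 * ln \<phi> / pi ^ 2) = ln 6 + ln (ln \<phi>) - 2 * ln pi"
    using ln_phi_pos by (simp_all add: ln_div ln_mult ln_realpow)
  moreover have "(2 * g - (2 * p + q - r)) / (2 * l) + S = S + (g - q) / l + (r + q - 2 * p) / (2 * l)" if "l > 0" for g p q r l :: real
    using that by (simp add: field_simps)
  ultimately show ?thesis unfolding limit_constant_def S_def[symmetric] using ln_phi_pos by simp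
qed

text \<open>The prescribed centring is exactly the asymptotic mean
  \<open>- ln s / ln \<phi> + limit_constant\<close> of the scaled count at
  \<open>s = scale x\<close>; the term with \<open>ln (ln x)\<close> arises from
  \<open>ln s\<close>.\<close>

lemma centre_eq:
  assumes "ln x > 0"
  shows "centre x = - (ln (scale x) / ln \<phi>) + limit_constant"
proof -
  have sc: "scale x * sqrt (ln x) = 1 / b\<^sub>2 \<phi>" using assms by (simp add: b\<^sub>2_def scale_def real_sqrt_mult)
  have b2: "b\<^sub>2 \<phi> > 0" using ln_phi_pos by (simp add: b\<^sub>2_def)
  have a1: "a\<^sub>1 \<phi> = b\<^sub>2 \<phi> / ln \<phi>"
    using ln_phi_pos by (simp add: a\<^sub>1_def b\<^sub>2_def real_sqrt_mult real_sqrt_divide divide_simps)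
  have "centre x = (scale x * sqrt (ln x)) * (a\<^sub>1 \<phi> / 2 * ln (ln x) + b\<^sub>1 \<phi> \<psi>)"
    by (simp add: centre_def algebra_simps)
  also have "\<dots> = ln (ln x) / (2 * ln \<phi>) + (limit_constant + ln (6 * ln \<phi> / pi ^ 2) / (2 * ln \<phi>))"
    unfolding sc a1 b1_eq using b2 by (simp add: distrib_left)
  finally have c: "centre x = ln (ln x) / (2 * ln \<phi>) + (limit_constant + ln (6 * ln \<phi> / pi ^ 2) / (2 * ln \<phi>))" .
  have e: "ln (6 * ln \<phi> / pi ^ 2) = ln 6 + ln (ln \<phi>) - 2 * ln pi"
    using ln_phi_pos by (simp add: ln_div ln_mult ln_realpow)
  have "ln (scale x) = ln pi - (ln 6 + ln (ln \<phi>) + ln (ln x)) / 2"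
    using assms ln_phi_pos by (simp add: scale_def ln_div ln_sqrt ln_mult)
  moreover have "t / (2 * l) + (B + (r + q - 2 * p) / (2 * l)) = - ((p - (r + q + t) / 2) / l) + B" if "l > 0" for t l B p q r :: real
    using that by (simp add: field_simps)
  ultimately show ?thesis unfolding c e using ln_phi_pos by simp
qed

lemma char_normalised_Omega_tendsto:
  fixes x :: "nat \<Rightarrow> real" and \<Psi> :: "real \<Rightarrow> complex"
  assumes x: "filterlim x at_top sequentially"
    and x_large: "\<And>j. x j \<ge> 1" "\<And>j. ln (x j) > 0" "\<And>j. ln (x j) \<ge> pi ^ 2 / (6 * ln \<phi>)"
    and \<Psi>: "\<And>\<eta>. (\<lambda>N. \<Prod>n\<in>G.upto N. iexp (- \<eta> / lam n) / (1 - \<i> * \<eta> / lam n)) \<longlonglongrightarrow> \<Psi> \<eta>"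
  shows "(\<lambda>j. char (distr (measure_pmf (uniform_upto (\<F> \<phi> \<psi>) (x j))) borel (normalised_Omega \<phi> \<psi> (x j))) \<eta>) \<longlonglongrightarrow> \<Psi> \<eta>"
proof -
  define s where "s j = scale (x j)" for j
  define L where "L j = ln (x j)" for j
  note lp = ln_phi_pos
  have s_pos: "s j > 0" for j using x_large(2)[of j] lp by (simp add: s_def scale_def)
  have s_le: "s j \<le> 1" for j
  proof -
    have "pi ^ 2 \<le> 6 * ln \<phi> * ln (x j)" using x_large(3)[of j] lp by (simp add: field_simps)
    then have "pi \<le> sqrt (6 * ln \<phi> * ln (x j))" by (rule real_le_rsqrt)
    moreover have "6 * ln \<phi> * ln (x j) > 0" using x_large(2)[of j] lp by simp
    ultimately show ?thesis by (simp add: s_def scale_def)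
  qed
  have L_top: "filterlim L at_top sequentially" unfolding L_def by (rule filterlim_compose[OF ln_at_top x])
  have s_lim: "s \<longlonglongrightarrow> 0"
  proof -
    have "((\<lambda>y. pi / sqrt (6 * ln \<phi> * y)) \<longlongrightarrow> 0) at_top" using lp by real_asymp
    from filterlim_compose[OF this L_top] show ?thesis by (simp add: s_def[abs_def] scale_def L_def)
  qed
  have s_right: "filterlim s (at_right 0) sequentially"
    using s_pos s_lim less_imp_neq[OF s_pos, symmetric] by (auto simp: filterlim_at)
  have sL: "s j * L j = pi ^ 2 / 6 / (s j * ln \<phi>)" for j
  proof -
    have "s j ^ 2 = pi ^ 2 / (6 * ln \<phi> * L j)"
      using lp x_large(2)[of j] by (simp add: s_def scale_def L_def power_divide)
    moreover have "s j * L j * (s j * ln \<phi>) = s j ^ 2 * (ln \<phi> * L j)" by (simp add: power2_eq_square)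
    moreover have "p / (6 * l * L) * (l * L) = p / 6" if "l > 0" "L > 0" for p l L :: real using that by simp
    ultimately have "s j * L j * (s j * ln \<phi>) = pi ^ 2 / 6"
      using lp x_large(2)[of j] unfolding L_def by simp
    then show ?thesis using s_pos[of j] lp by (simp add: nonzero_eq_divide_eq)
  qed
  obtain K where K: "\<And>s. s > 0 \<Longrightarrow> \<bar>suminf (G.mean_size s) - pi ^ 2 / 6 / (s * ln \<phi>)\<bar> \<le> K" using G.mean_size_sum by blast
  \<comment> \<open>The truncation is chosen separately for each \<open>j\<close>: it contains every
    index that can occur up to \<open>x j\<close>, and it is so long that the truncated means differ
    from the full series by a bounded amount and by a vanishing amount respectively.\<close>
  define good where "good j N \<longleftrightarrow> 1 / (ln \<phi> * s j) \<le> real N \<and> (\<forall>n\<in>prim_index. real (v n) \<le> x j \<longrightarrow> n \<le> N) \<and>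
     dist (\<Sum>n\<in>G.upto N. s j * lam n * geo_mean (s j * lam n)) (suminf (G.mean_size (s j))) < 1 \<and>
     dist (\<Sum>n\<in>G.upto N. s j * geo_mean (s j * lam n)) (suminf (G.mean_count (s j))) < inverse (real (Suc j))" for j N
  have "\<exists>N. good j N" for j
  proof -
    have "eventually (\<lambda>N. 1 / (ln \<phi> * s j) \<le> real N) sequentially"
      using filterlim_real_sequentially by (simp add: filterlim_at_top)
    moreover have "eventually (\<lambda>N. \<forall>n\<in>prim_index. real (v n) \<le> x j \<longrightarrow> n \<le> N) sequentially"
    proof (rule eventually_sequentiallyI[where c = "index_upto (nat \<lfloor>x j\<rfloor>)"], intro ballI impI)
      fix N n assume N: "index_upto (nat \<lfloor>x j\<rfloor>) \<le> N" and n: "n \<in> prim_index" "real (v n) \<le> x j"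
      then have "n \<in> G.upto (index_upto (nat \<lfloor>x j\<rfloor>))" unfolding upto_index by (simp add: le_nat_floor)
      then show "n \<le> N" using N by (simp add: G.upto_def)
    qed
    moreover note tendstoD[OF G.tendsto_partial_mean_size[OF s_pos[of j]], of 1]
      tendstoD[OF G.tendsto_partial_mean_count[OF s_pos[of j]], of "inverse (real (Suc j))"]
    ultimately have "eventually (good j) sequentially"
      unfolding good_def by (intro eventually_conj) auto
    then show ?thesis by (auto simp: eventually_sequentially)
  qed
  then obtain N where N: "\<And>j. good j (N j)" by metis
  interpret B: boltzmann_seq prim_index lam "ln \<phi>" lam_error s N
    by unfold_locales (use s_pos s_le s_lim N in \<open>auto simp: good_def\<close>)
  interpret BL: boltzmann_limit prim_index lam "ln \<phi>" lam_error s N L "\<lambda>j. centre (x j)" \<Psi> "K + 1"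
  proof
    show "\<bar>(\<Sum>n\<in>B.J j. s j * lam n * geo_mean (s j * lam n)) - s j * L j\<bar> \<le> K + 1" for j
    proof -
      have "\<bar>(\<Sum>n\<in>B.J j. s j * lam n * geo_mean (s j * lam n)) - suminf (G.mean_size (s j))\<bar> < 1"
        using N[of j] by (simp add: good_def dist_real_def)
      then show ?thesis using K[OF s_pos[of j]] unfolding sL by linarith
    qed
    show "(\<lambda>N. \<Prod>n\<in>G.upto N. B.exp_char n \<eta>) \<longlonglongrightarrow> \<Psi> \<eta>" for \<eta>
      unfolding B.exp_char_def by (rule \<Psi>)
    have "(\<lambda>j. (\<Sum>n\<in>B.J j. s j * geo_mean (s j * lam n)) - suminf (G.mean_count (s j))) \<longlonglongrightarrow> 0"
    proof (rule Lim_null_comparison[OF always_eventually LIMSEQ_inverse_real_of_nat], intro allI)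
      show "norm ((\<Sum>n\<in>B.J j. s j * geo_mean (s j * lam n)) - suminf (G.mean_count (s j))) \<le> inverse (real (Suc j))" for j
        using N[of j] by (simp add: good_def dist_real_def)
    qed
    moreover have "(\<lambda>j. suminf (G.mean_count (s j)) + ln (s j) / ln \<phi>) \<longlonglongrightarrow> limit_constant"
      unfolding limit_constant_def by (rule filterlim_compose[OF G.mean_count_asymptotics s_right])
    ultimately have "(\<lambda>j. ((\<Sum>n\<in>B.J j. s j * geo_mean (s j * lam n)) - suminf (G.mean_count (s j)))
         + (suminf (G.mean_count (s j)) + ln (s j) / ln \<phi>) - limit_constant) \<longlonglongrightarrow> 0 + limit_constant - limit_constant"
      by (intro tendsto_diff tendsto_add tendsto_const)
    then show "(\<lambda>j. (\<Sum>n\<in>B.J j. s j * geo_mean (s j * lam n)) - centre (x j)) \<longlonglongrightarrow> 0"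
      unfolding centre_eq[OF x_large(2)] s_def[symmetric] by (simp add: algebra_simps)
  qed
  have eq: "measure_pmf.expectation (BL.Bz j) (\<lambda>a. BL.tilt j a *\<^sub>R iexp (\<eta> * BL.Z j a)) / measure_pmf.expectation (BL.Bz j) (BL.tilt j)
     = char (distr (measure_pmf (uniform_upto (\<F> \<phi> \<psi>) (x j))) borel (normalised_Omega \<phi> \<psi> (x j))) \<eta>" for j
  proof -
    have JI: "finite (B.J j)" "B.J j \<subseteq> prim_index" using G.upto_subset by auto
    have large: "n \<in> B.J j" if "n \<in> prim_index" "real (v n) \<le> x j" for n
      using N[of j] that by (auto simp: good_def G.upto_def)
    have be: "BL.bounded_exps j = small_exps (B.J j) (ln (x j))"
      by (simp add: BL.bounded_exps_def small_exps_def L_def)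
    note ex = expectation_uniform_upto[OF JI x_large(1)[of j]]
    have "char (distr (measure_pmf (uniform_upto (\<F> \<phi> \<psi>) (x j))) borel (normalised_Omega \<phi> \<psi> (x j))) \<eta> =
        measure_pmf.expectation (uniform_upto (\<F> \<phi> \<psi>) (x j)) (\<lambda>n. iexp (\<eta> * normalised_Omega \<phi> \<psi> (x j) n))"
      unfolding char_def by (subst integral_distr) auto
    also have "\<dots> = measure_pmf.expectation (uniform_upto (\<F> \<phi> \<psi>) (x j)) (\<lambda>n. iexp (\<eta> * (s j * real (Omega (\<F> \<phi> \<psi>) n) - centre (x j))))"
      unfolding normalised_Omega_eq[OF x_large(2)] s_def ..
    also have "\<dots> = (\<Sum>a\<in>BL.bounded_exps j. iexp (\<eta> * (s j * real (\<Sum>n\<in>B.J j. a n) - centre (x j)))) / card (BL.bounded_exps j)"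
      unfolding be by (rule ex(3)[where f = "\<lambda>k. iexp (\<eta> * (s j * real k - centre (x j)))"]) (rule large)
    also have "\<dots> = (\<Sum>a\<in>BL.bounded_exps j. iexp (\<eta> * BL.Z j a)) / card (BL.bounded_exps j)"
      by (simp only: BL.Z_def of_nat_sum)
    finally show ?thesis using BL.tilted_ratio[of j \<eta>] ex(1) large unfolding be by simp
  qed
  show ?thesis using BL.tilted_char_tendsto[of \<eta>] unfolding eq .
qed

end

theorem theorem3:
  fixes \<phi> \<psi> :: real and P Q :: int
    and M :: "'a measure" and X :: "nat \<Rightarrow> 'a \<Rightarrow> real"
  assumes "algebraic_int \<phi>" and "algebraic_int \<psi>"
    and "\<phi> + \<psi> = of_int P" and "\<phi> * \<psi> = of_int Q"
    and "P \<noteq> 0" and "Q \<noteq> 0" and "coprime P Q"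
    and "\<phi> > \<bar>\<psi>\<bar>"
    and "prob_space M"
    and "prob_space.indep_vars M (\<lambda>_. borel) X (\<F> \<phi> \<psi>)"
    and "\<And>m. m \<in> \<F> \<phi> \<psi> \<Longrightarrow> distributed M lborel (X m) (exponential_density (ln (real m)))"
  shows "(AE \<omega> in M. convergent (\<lambda>K. centred_partial_sum (\<F> \<phi> \<psi>) X K \<omega>)) \<and>
    weak_conv_along
      (\<lambda>x. distr (measure_pmf (uniform_upto (\<F> \<phi> \<psi>) x)) borel (normalised_Omega \<phi> \<psi> x))
      (distr M borel (centred_sum (\<F> \<phi> \<psi>) X))
      at_top"
proof
  interpret real_lucas_pair \<phi> \<psi> P Q
    by unfold_locales (use assms in auto)
  interpret prob_space M by (rule assms(9))

  show "AE \<omega> in M. convergent (\<lambda>K. centred_partial_sum (\<F> \<phi> \<psi>) X K \<omega>)"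
    by (rule AE_convergent_centred_partial_sum[OF assms(9,10)]) (rule assms(11))
  have mC: "centred_sum (\<F> \<phi> \<psi>) X \<in> borel_measurable M"
    by (rule measurable_centred_sum[OF assms(9,10)]) (rule assms(11))
  have lim: "(\<lambda>N. \<Prod>n\<in>G.upto N. iexp (- \<eta> / lam n) / (1 - \<i> * \<eta> / lam n)) \<longlonglongrightarrow> char (distr M borel (centred_sum (\<F> \<phi> \<psi>) X)) \<eta>" for \<eta>
    by (rule char_T_tendsto[OF assms(9,10)]) (rule assms(11))
  let ?\<mu> = "\<lambda>x. distr (measure_pmf (uniform_upto (\<F> \<phi> \<psi>) x)) borel (normalised_Omega \<phi> \<psi> x)"
  let ?\<nu> = "distr M borel (centred_sum (\<F> \<phi> \<psi>) X)"
  \<comment> \<open>From \<open>x0\<close> on, \<open>ln x\<close> is positive and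
    \<open>scale x\<close> is at most 1.\<close>
  define x0 where "x0 = exp (max 1 (pi ^ 2 / (6 * ln \<phi>)))"
  show "weak_conv_along ?\<mu> ?\<nu> at_top"
    unfolding weak_conv_along_def
  proof (intro allI impI tendsto_at_topI_sequentially)
    fix y :: real and x :: "nat \<Rightarrow> real"
    assume y: "isCont (cdf ?\<nu>) y" and x: "filterlim x at_top sequentially"
    then have "eventually (\<lambda>j. x0 \<le> x j) sequentially" by (simp add: filterlim_at_top)
    then obtain j0 where j0: "\<And>j. j \<ge> j0 \<Longrightarrow> x0 \<le> x j" by (auto simp: eventually_sequentially)
    \<comment> \<open>Dropping an initial segment makes these bounds hold for every member of the
      sequence, and the shift is undone afterwards.\<close>
    define x' where "x' j = x (j + j0)" for j
    have x': "filterlim x' at_top sequentially"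
      unfolding x'_def by (rule filterlim_compose[OF x]) (rule filterlim_add_const_nat_at_top)
    have large: "x' j \<ge> 1" "ln (x' j) > 0" "ln (x' j) \<ge> pi ^ 2 / (6 * ln \<phi>)" for j
    proof -
      have ge: "x0 \<le> x' j" unfolding x'_def by (rule j0) simp
      have "0 < x0" "1 \<le> x0" by (simp_all add: x0_def)
      then have "ln x0 \<le> ln (x' j)" using ge by (intro ln_mono) auto
      then show "ln (x' j) > 0" "ln (x' j) \<ge> pi ^ 2 / (6 * ln \<phi>)" by (auto simp: x0_def)
      show "x' j \<ge> 1" using ge \<open>1 \<le> x0\<close> by linarith
    qed
    have "weak_conv_m (\<lambda>j. ?\<mu> (x' j)) ?\<nu>"
    proof (rule levy_continuity)
      show "real_distribution (?\<mu> (x' j))" for j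
        by (rule prob_space.real_distribution_distr[OF prob_space_measure_pmf]) simp
      show "real_distribution ?\<nu>" using mC by (rule real_distribution_distr)
      show "(\<lambda>j. char (?\<mu> (x' j)) \<eta>) \<longlonglongrightarrow> char ?\<nu> \<eta>" for \<eta>
        by (rule char_normalised_Omega_tendsto[OF x' large lim])
    qed
    then have "(\<lambda>j. cdf (?\<mu> (x' j)) y) \<longlonglongrightarrow> cdf ?\<nu> y"
      using y by (simp add: weak_conv_m_def weak_conv_def)
    then show "(\<lambda>j. cdf (?\<mu> (x j)) y) \<longlonglongrightarrow> cdf ?\<nu> y"
      unfolding x'_def by (rule LIMSEQ_offset)
  qed
qed

end
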